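(* Let $\sigma,b:\mathbb{R}\to\mathbb{R}$ be measurable and bounded. Suppose there is $c_\sigma>0$ with $\sigma(x)\ge c_\sigma$ for every $x\in\mathbb{R}$, and that there exists $h>0$ such that $$|\sigma(x)-\sigma(y)|\le\big|\ln|x-y|\big|^{-(2+h)}\qquad\text{for all }x,y\in\mathbb{R}\text{ with }0<|x-y|<1 .$$ Let $u(t,x)$, $(t,x)\in(0,\infty)\times[0,1]$, be a random field adapted to the filtration generated by a space-time white noise $W$ on $\mathbb{R}_+\times[0,1]$ and satisfying $$u(t,x)=\int_0^1G_t(x,y)u_0(y)dy+\int_0^t\int_0^1G_{t-s}(x,y)\sigma(u(s,y))\,dW(s,y)+\int_0^t\int_0^1G_{t-s}(x,y)b(u(s,y))\,dy\,ds .$$ Then for every $0<x_1<\dots<x_d<1$ and $T>0$, the law of the random vector $U=(u(T,x_1),\dots,u(T,x_d))$ is absolutely continuous with respect to the Lebesgue measure on $\mathbb{R}^d$.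
   Context: $G_t(x,y)$ is the fundamental solution on $[0,1]$ of the heat equation $\partial_tv=\partial_x^2v$ with Neumann boundary conditions $\partial_xv(t,0)=\partial_xv(t,1)=0$; $dW(s,y)$ denotes Walsh's stochastic integral with respect to the white noise; $u_0$ is the (deterministic) initial condition $u(0,x)=u_0(x)$. The equation is the mild form of $\partial_tu=\partial_x^2u+\sigma(u)W+b(u)$ with Neumann boundary conditions. No uniqueness is assumed: $u$ is any adapted random field satisfying the equation. *)

theory Defs
  imports "HOL-Probability.Probability"
begin

text \<open>
  \<open>v\<close> is a classical \<open>C\<^sup>1\<^sup>,\<^sup>2\<close> solution on \<open>(0,\<infinity>) \<times> [0,1]\<close> of the heat equation with Neumann boundary
  conditions; \<open>v1\<close> and \<open>v2\<close> are its first and second space derivatives (one-sided at the end points).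
\<close>

definition neumann_heat_solution :: "(real \<Rightarrow> real \<Rightarrow> real) \<Rightarrow> bool" where
  "neumann_heat_solution v \<longleftrightarrow>
    (\<exists>v1 v2 :: real \<Rightarrow> real \<Rightarrow> real.
      continuous_on ({0<..} \<times> {0..1}) (\<lambda>(t, x). v t x) \<and>
      continuous_on ({0<..} \<times> {0..1}) (\<lambda>(t, x). v1 t x) \<and>
      continuous_on ({0<..} \<times> {0..1}) (\<lambda>(t, x). v2 t x) \<and>
      (\<forall>t>0. \<forall>x\<in>{0..1}.
        ((\<lambda>z. v t z) has_real_derivative v1 t x) (at x within {0..1}) \<and>
        ((\<lambda>z. v1 t z) has_real_derivative v2 t x) (at x within {0..1}) \<and>
        ((\<lambda>s. v s x) has_real_derivative v2 t x) (at t)) \<and>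
      (\<forall>t>0. v1 t 0 = 0 \<and> v1 t 1 = 0))"

text \<open>
  \<open>G t x y\<close> stands for \<open>G\<^sub>t(x,y)\<close>. The fundamental solution with pole \<open>y\<close> starts from the Dirac mass
  at \<open>y\<close>, in the sense of weak convergence of measures. This determines \<open>G t x y\<close> for \<open>t > 0\<close> and
  \<open>x, y \<in> [0,1]\<close>; other values of \<open>G\<close> are irrelevant.
\<close>

definition neumann_heat_kernel :: "(real \<Rightarrow> real \<Rightarrow> real \<Rightarrow> real) \<Rightarrow> bool" where
  "neumann_heat_kernel G \<longleftrightarrow>
    (\<forall>y\<in>{0..1}.
      neumann_heat_solution (\<lambda>t x. G t x y) \<and>
      (\<forall>f. continuous_on {0..1} f \<longrightarrow>
        ((\<lambda>t. LINT x:{0..1}|lborel. G t x y * f x) \<longlongrightarrow> f y) (at_right 0)))"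

text \<open>\<open>X\<close> has law \<open>N(0,v)\<close>, including the degenerate case \<open>v = 0\<close>.\<close>

definition centered_gaussian :: "'a measure \<Rightarrow> ('a \<Rightarrow> real) \<Rightarrow> real \<Rightarrow> bool" where
  "centered_gaussian M X v \<longleftrightarrow>
    X \<in> borel_measurable M \<and>
    (if v = 0 then (AE \<omega> in M. X \<omega> = 0)
     else v > 0 \<and> distributed M lborel X (\<lambda>z. ennreal (normal_density 0 (sqrt v) z)))"

definition noise_sets :: "(real \<times> real) set set" where
  "noise_sets = {A \<in> sets borel. A \<subseteq> {0..} \<times> {0..1} \<and> emeasure lborel A < \<infinity>}"

text \<open>
  Space-time white noise on \<open>\<real>\<^sub>+ \<times> [0,1]\<close>: a centred Gaussian family \<open>W(A)\<close> with covariance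
  \<open>E[W(A) W(B)] = |A \<inter> B|\<close>, joint normality being expressed through linear combinations.
\<close>

definition white_noise :: "'a measure \<Rightarrow> ((real \<times> real) set \<Rightarrow> 'a \<Rightarrow> real) \<Rightarrow> bool" where
  "white_noise M W \<longleftrightarrow>
    (\<forall>(n :: nat) A c. (\<forall>i<n. A i \<in> noise_sets) \<longrightarrow>
      centered_gaussian M (\<lambda>\<omega>. \<Sum>i<n. c i * W (A i) \<omega>)
        (\<Sum>i<n. \<Sum>j<n. c i * c j * measure lborel (A i \<inter> A j)))"

text \<open>The filtration generated by the noise, augmented as usual by the null sets.\<close>

definition noise_filtration ::
    "'a measure \<Rightarrow> ((real \<times> real) set \<Rightarrow> 'a \<Rightarrow> real) \<Rightarrow> real \<Rightarrow> 'a measure" where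
  "noise_filtration M W t =
    sigma (space M)
      ({W A -` B \<inter> space M | A B. A \<in> noise_sets \<and> A \<subseteq> {0..t} \<times> {0..1} \<and> B \<in> sets borel}
        \<union> null_sets M)"

text \<open>
  Walsh's stochastic integral over \<open>[0,t] \<times> [0,1]\<close>. A list of tuples \<open>(r, s, A, X)\<close> encodes the simple
  process \<open>\<Sum> X \<cdot> 1\<^sub>(\<^sub>r\<^sub>,\<^sub>s\<^sub>] \<cdot> 1\<^sub>A\<close>, whose integral is \<open>\<Sum> X \<cdot> W((r,s] \<times> A)\<close>; the integral is then
  extended to all integrands that are \<open>L\<^sup>2(ds dy dP)\<close>-limits of simple processes.
\<close>

definition simple_process ::
    "'a measure \<Rightarrow> ((real \<times> real) set \<Rightarrow> 'a \<Rightarrow> real) \<Rightarrow> real \<Rightarrow>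
     (real \<times> real \<times> real set \<times> ('a \<Rightarrow> real)) list \<Rightarrow> bool" where
  "simple_process M W t ps \<longleftrightarrow>
    (\<forall>(r, s, A, X) \<in> set ps.
      0 \<le> r \<and> r \<le> s \<and> s \<le> t \<and> A \<in> sets borel \<and> A \<subseteq> {0..1} \<and>
      X \<in> borel_measurable (noise_filtration M W r) \<and> bounded (X ` space M))"

definition simple_value ::
    "(real \<times> real \<times> real set \<times> ('a \<Rightarrow> real)) list \<Rightarrow> real \<Rightarrow> real \<Rightarrow> 'a \<Rightarrow> real" where
  "simple_value ps \<tau> y \<omega> =
    (\<Sum>(r, s, A, X) \<leftarrow> ps. X \<omega> * indicator {r<..s} \<tau> * indicator A y)"

definition simple_integral ::
    "((real \<times> real) set \<Rightarrow> 'a \<Rightarrow> real) \<Rightarrow>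
     (real \<times> real \<times> real set \<times> ('a \<Rightarrow> real)) list \<Rightarrow> 'a \<Rightarrow> real" where
  "simple_integral W ps \<omega> = (\<Sum>(r, s, A, X) \<leftarrow> ps. X \<omega> * W ({r<..s} \<times> A) \<omega>)"

text \<open>
  \<open>has_walsh_integral M W t f Z\<close> says that \<open>f\<close> is integrable and that \<open>Z\<close> is a version of
  \<open>\<integral>\<^sub>0\<^sup>t \<integral>\<^sub>0\<^sup>1 f(s,y) dW(s,y)\<close>, which is determined only almost surely.
\<close>

definition has_walsh_integral ::
    "'a measure \<Rightarrow> ((real \<times> real) set \<Rightarrow> 'a \<Rightarrow> real) \<Rightarrow> real \<Rightarrow>
     (real \<Rightarrow> real \<Rightarrow> 'a \<Rightarrow> real) \<Rightarrow> ('a \<Rightarrow> real) \<Rightarrow> bool" where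
  "has_walsh_integral M W t f Z \<longleftrightarrow>
    (\<lambda>((s, y), \<omega>). f s y \<omega>)
      \<in> borel_measurable (restrict_space lborel ({0<..<t} \<times> {0..1}) \<Otimes>\<^sub>M M) \<and>
    Z \<in> borel_measurable M \<and>
    (\<exists>ps. (\<forall>n. simple_process M W t (ps n)) \<and>
      (\<lambda>n. \<integral>\<^sup>+((s, y), \<omega>). ennreal ((simple_value (ps n) s y \<omega> - f s y \<omega>)\<^sup>2)
        \<partial>(restrict_space lborel ({0<..<t} \<times> {0..1}) \<Otimes>\<^sub>M M)) \<longlonglongrightarrow> 0 \<and>
      (\<lambda>n. \<integral>\<^sup>+\<omega>. ennreal ((simple_integral W (ps n) \<omega> - Z \<omega>)\<^sup>2) \<partial>M) \<longlonglongrightarrow> 0)"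

definition adapted_random_field ::
    "'a measure \<Rightarrow> ((real \<times> real) set \<Rightarrow> 'a \<Rightarrow> real) \<Rightarrow>
     (real \<Rightarrow> real \<Rightarrow> 'a \<Rightarrow> real) \<Rightarrow> bool" where
  "adapted_random_field M W u \<longleftrightarrow>
    (\<lambda>((t, x), \<omega>). u t x \<omega>)
      \<in> borel_measurable (restrict_space borel ({0<..} \<times> {0..1}) \<Otimes>\<^sub>M M) \<and>
    (\<forall>t>0. \<forall>x\<in>{0..1}. u t x \<in> borel_measurable (noise_filtration M W t))"

text \<open>
  The mild equation, required almost surely for each \<open>(t,x)\<close>. For bounded measurable \<open>b\<close> the drift
  integral exists without further assumptions.
\<close>

definition mild_solution ::
    "'a measure \<Rightarrow> ((real \<times> real) set \<Rightarrow> 'a \<Rightarrow> real) \<Rightarrow> (real \<Rightarrow> real \<Rightarrow> real \<Rightarrow> real) \<Rightarrow>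
     (real \<Rightarrow> real) \<Rightarrow> (real \<Rightarrow> real) \<Rightarrow> (real \<Rightarrow> real) \<Rightarrow> (real \<Rightarrow> real \<Rightarrow> 'a \<Rightarrow> real) \<Rightarrow> bool" where
  "mild_solution M W G \<sigma> b u0 u \<longleftrightarrow>
    (\<forall>t>0. \<forall>x\<in>{0..1}.
      set_integrable lborel {0..1} (\<lambda>y. G t x y * u0 y) \<and>
      (\<exists>Z. has_walsh_integral M W t (\<lambda>s y \<omega>. G (t - s) x y * \<sigma> (u s y \<omega>)) Z \<and>
        (AE \<omega> in M. u t x \<omega> =
          (LINT y:{0..1}|lborel. G t x y * u0 y) + Z \<omega> +
          (LINT s:{0<..<t}|lborel. LINT y:{0..1}|lborel. G (t - s) x y * b (u s y \<omega>)))))"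

end

theory Submission
  imports Defs
begin

text \<open>
  The law of \<open>U\<close> is absolutely continuous once, at every small scale \<open>\<delta>\<close>, there is a \<open>V\<close> with
  \<open>E|U - V| \<le> C \<delta> |ln \<delta>|\<^sup>-\<^sup>(\<^sup>2\<^sup>+\<^sup>h\<^sup>)\<close> whose law moves in total variation by at most \<open>C |v| / \<delta>\<close> under
  translation by \<open>v\<close>: consecutive dyadic mollifications of the law of \<open>U\<close> then differ by a summable
  amount, uniformly over bounded test functions. For the solution at time \<open>T\<close> one takes
  \<open>\<epsilon> = \<delta>\<^sup>4\<close> and freezes \<open>\<sigma>(u)\<close> on \<open>(T - \<epsilon>, T)\<close> at its value \<open>\<sigma>(u(T - \<epsilon>, x\<^sub>i))\<close>, keeping only the noise near
  \<open>x\<^sub>i\<close>. Given the past, the frozen integrals are then independent Gaussians of variance at least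
  of order \<open>\<surd>\<epsilon> = \<delta>\<^sup>2\<close>, which yields the translation bound. The Hoelder continuity in mean square of \<open>u\<close> and the
  logarithmic modulus of \<open>\<sigma>\<close> make the freezing error at most of order \<open>\<epsilon>\<^sup>1\<^sup>/\<^sup>4 |ln \<epsilon>|\<^sup>-\<^sup>(\<^sup>2\<^sup>+\<^sup>h\<^sup>)\<close>.
  Regularity in space is measured by \<open>|cos (\<pi> x) - cos (\<pi> y)|\<close>, which is compatible with the
  cosine expansion of the kernel up to the boundary.
\<close>

section \<open>Absolute continuity from approximations at all scales\<close>

text \<open>The exponent \<open>2 + h\<close> comes from a balance of two errors. At scale
  \<open>2 ^ -k\<close>, translation costs about \<open>2 ^ -k / \<delta>\<close> and approximation
  about \<open>2 ^ k * \<delta> * k powr -(2 + h)\<close>. As long as \<bar>ln \<delta>\<bar> is of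
  order k, the product of the two is \<open>k powr -(2 + h)\<close> whatever \<delta> is, so both
  can be summable because the exponent exceeds 2. The obstacle is that \<sigma> has neither a
  derivative nor a Hoelder exponent: the solution cannot be differentiated along the noise, and
  freezing gains a mere logarithm over the natural fluctuation \<open>\<epsilon> powr (1/4)\<close>.
  No power may be lost, so the spatial distance to the evaluation point is absorbed by the kernel
  itself, whose norm weighted by that distance gains a full factor \<epsilon>. The Gaussian part is
  then a finite combination of noise values, and conditioning on the past becomes a Fubini
  argument.\<close>

lemma abs_integral_le:
  fixes f g :: "'a \<Rightarrow> real"
  assumes "integrable M f" "integrable M g" "\<And>x. x \<in> space M \<Longrightarrow> \<bar>f x\<bar> \<le> g x"
  shows "\<bar>\<integral>x. f x \<partial>M\<bar> \<le> (\<integral>x. g x \<partial>M)"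
proof -
  have "\<bar>\<integral>x. f x \<partial>M\<bar> \<le> (\<integral>x. \<bar>f x\<bar> \<partial>M)"
    using integral_norm_bound[of M f] by simp
  also have "\<dots> \<le> (\<integral>x. g x \<partial>M)"
    by (rule integral_mono) (use assms in auto)
  finally show ?thesis .
qed

lemma lborel_integral_translate:
  fixes f :: "'b::euclidean_space \<Rightarrow> real"
  assumes [measurable]: "f \<in> borel_measurable borel"
  shows "(LINT z|lborel. f (c + z)) = (LINT z|lborel. f z)"
proof -
  have "(LINT z|lborel. f z) = (LINT z|distr lborel borel ((+) c). f z)"
    by (simp add: lborel_distr_plus)
  also have "\<dots> = (LINT z|lborel. f (c + z))"
    by (subst integral_distr) auto
  finally show ?thesis ..
qed

lemma lborel_integrable_translate:
  fixes f :: "'b::euclidean_space \<Rightarrow> real"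
  assumes "integrable lborel f"
  shows "integrable lborel (\<lambda>z. f (c + z))"
proof -
  have [measurable]: "f \<in> borel_measurable borel" using assms by auto
  have "integrable (distr lborel borel ((+) c)) f" using assms by (simp add: lborel_distr_plus)
  then show ?thesis by (subst (asm) integrable_distr_eq) auto
qed

section \<open>Mollification at a given scale\<close>

text \<open>An explicit bump with the two properties that count: Lipschitz continuity gives the
  linear translation bound in L1, compact support limits the length of the translations that
  occur.\<close>

definition hat :: "'b::euclidean_space \<Rightarrow> real" where
  "hat z = max 0 (1 - norm z)"

definition mollifier :: "'b::euclidean_space \<Rightarrow> real" where
  "mollifier z = hat z / (LINT w|lborel. hat (w :: 'b))"

lemma hat_measurable [measurable]: "hat \<in> borel_measurable borel"
  unfolding hat_def by measurable

lemma mollifier_measurable [measurable]: "mollifier \<in> borel_measurable borel"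
  unfolding mollifier_def by measurable

lemma hat_eq_0: "norm z \<ge> 1 \<Longrightarrow> hat z = 0"
  by (simp add: hat_def)

lemma hat_nonneg: "hat z \<ge> 0"
  by (simp add: hat_def)

lemma integrable_indicator_cball:
  "integrable lborel (indicator (cball (a :: 'b::euclidean_space) r) :: 'b \<Rightarrow> real)"
  by (rule integrable_real_indicator) (use emeasure_lborel_cball_finite[of a r] in auto)

lemma integrable_hat: "integrable lborel (hat :: 'b::euclidean_space \<Rightarrow> real)"
proof (rule Bochner_Integration.integrable_bound[OF integrable_indicator_cball[of 0 1]])
  show "AE x in lborel. norm (hat (x::'b)) \<le> norm (indicator (cball 0 1) x :: real)"
    by (rule AE_I2) (auto simp: indicator_def not_le hat_def)
qed auto

lemma hat_mass_pos: "(LINT w|lborel. hat (w :: 'b::euclidean_space)) > 0"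
proof -
  have "0 < measure lborel (cball (0::'b) (1/2)) * (1/2)"
    by (simp add: content_cball_pos)
  also have "\<dots> = (LINT w|lborel. indicator (cball (0::'b) (1/2)) w * (1/2))"
    by simp
  also have "\<dots> \<le> (LINT w|lborel. hat (w :: 'b))"
  proof (rule integral_mono)
    show "indicator (cball 0 (1/2)) w * (1/2) \<le> hat w" for w :: 'b
      by (auto simp: hat_def indicator_def)
  qed (intro integrable_mult_left integrable_indicator_cball integrable_hat)+
  finally show ?thesis .
qed

lemma mollifier_nonneg: "mollifier z \<ge> 0"
  unfolding mollifier_def by (intro divide_nonneg_pos hat_nonneg hat_mass_pos)

lemma mollifier_eq_0: "norm z \<ge> 1 \<Longrightarrow> mollifier z = 0"
  unfolding mollifier_def by (simp add: hat_eq_0)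

lemma integrable_mollifier: "integrable lborel (mollifier :: 'b::euclidean_space \<Rightarrow> real)"
  unfolding mollifier_def by (simp add: integrable_hat)

lemma integral_mollifier: "(LINT z|lborel. mollifier (z :: 'b::euclidean_space)) = 1"
  unfolding mollifier_def using hat_mass_pos[where 'b='b] by simp

text \<open>For short shifts the integrand is at most \<open>norm w / m\<close>, since the tent is
  1-Lipschitz, and it lives in the ball of radius 2. For \<open>norm w > 1\<close> the two unit
  masses give 2, which the summand 2 in \<open>L\<close> absorbs.\<close>

lemma mollifier_translation_bound:
  "\<exists>L>0. \<forall>w :: 'b::euclidean_space.
    (LINT z|lborel. \<bar>mollifier (z - w) - mollifier z\<bar>) \<le> L * norm w"
proof -
  define m where "m = (LINT w|lborel. hat (w :: 'b))"
  have m: "m > 0" unfolding m_def by (rule hat_mass_pos)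
  define L where "L = measure lborel (cball (0::'b) 2) / m + 2"
  have L: "L > 0" unfolding L_def using m by (simp add: add_nonneg_pos)
  have int_shift: "integrable lborel (\<lambda>z::'b. mollifier (z - w))" for w
    using lborel_integrable_translate[OF integrable_mollifier, of "-w"] by simp
  have "(LINT z|lborel. \<bar>mollifier (z - w) - mollifier z\<bar>) \<le> L * norm w" for w :: 'b
  proof (cases "norm w \<le> 1")
    case True
    have "(LINT z|lborel. \<bar>mollifier (z - w) - mollifier z\<bar>)
        \<le> (LINT z|lborel. indicator (cball (0::'b) 2) z * (norm w / m))"
    proof (rule integral_mono)
      fix z :: 'b
      have hz: "\<bar>hat (z - w) - hat z\<bar> \<le> norm w"
        using norm_triangle_ineq3[of "z - w" z] unfolding hat_def by (auto simp: max_def norm_minus_commute)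
      have "mollifier (z - w) - mollifier z = (hat (z - w) - hat z) / m"
        by (simp add: mollifier_def m_def diff_divide_distrib)
      then have "\<bar>mollifier (z - w) - mollifier z\<bar> \<le> norm w / m"
        using hz m by (simp add: divide_right_mono abs_divide)
      moreover have "mollifier (z - w) = 0 \<and> mollifier z = 0" if "norm z > 2"
        using that True norm_triangle_ineq2[of z w] by (intro conjI mollifier_eq_0) auto
      ultimately show "\<bar>mollifier (z - w) - mollifier z\<bar> \<le> indicator (cball 0 2) z * (norm w / m)"
        by (auto simp: indicator_def)
    qed (auto intro!: Bochner_Integration.integrable_abs Bochner_Integration.integrable_diff int_shift integrable_mollifier integrable_mult_left integrable_indicator_cball)
    also have "\<dots> = measure lborel (cball (0::'b) 2) / m * norm w" by simp
    also have "\<dots> \<le> L * norm w" unfolding L_def by (intro mult_right_mono) auto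
    finally show ?thesis .
  next
    case False
    have "(LINT z|lborel. \<bar>mollifier (z - w) - mollifier z\<bar>)
        \<le> (LINT z|lborel. mollifier (z - w) + mollifier z)"
      by (rule integral_mono) (auto intro!: Bochner_Integration.integrable_abs Bochner_Integration.integrable_diff Bochner_Integration.integrable_add int_shift integrable_mollifier
            simp: abs_le_iff mollifier_nonneg)
    also have "\<dots> = 2"
      using lborel_integral_translate[of "mollifier :: 'b \<Rightarrow> real" "-w"] int_shift[of w]
      by (simp add: integral_mollifier integrable_mollifier)
    also have "\<dots> \<le> L * norm w"
    proof -
      have "2 * 1 \<le> L * norm w" using False m unfolding L_def
        by (intro mult_mono) auto
      then show ?thesis by simp
    qed
    finally show ?thesis .
  qed
  with L show ?thesis by blast
qed

text \<open>Convolution at scale \<eta>, with the integration variable rescaled so that the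
  mollifier does not move with \<eta>. Limits in \<eta> then have the fixed majorant
  \<open>mollifier\<close>.\<close>

definition smooth :: "real \<Rightarrow> ('b::euclidean_space \<Rightarrow> real) \<Rightarrow> 'b \<Rightarrow> real" where
  "smooth \<eta> f x = (LINT z|lborel. f (x + \<eta> *\<^sub>R z) * mollifier z)"

lemma integrable_smooth_integrand:
  fixes f :: "'b::euclidean_space \<Rightarrow> real"
  assumes [measurable]: "f \<in> borel_measurable borel" and "\<And>x. \<bar>f x\<bar> \<le> 1"
  shows "integrable lborel (\<lambda>z. f (x + \<eta> *\<^sub>R z) * mollifier z)"
  by (rule Bochner_Integration.integrable_bound[OF integrable_mollifier])
     (auto simp: abs_mult assms mult_left_le_one_le)

lemma smooth_measurable [measurable]:
  fixes f :: "'b::euclidean_space \<Rightarrow> real"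
  assumes [measurable]: "f \<in> borel_measurable borel"
  shows "smooth \<eta> f \<in> borel_measurable borel"
  unfolding smooth_def by measurable

lemma smooth_bounded:
  fixes f :: "'b::euclidean_space \<Rightarrow> real"
  assumes [measurable]: "f \<in> borel_measurable borel" and "\<And>x. \<bar>f x\<bar> \<le> 1"
  shows "\<bar>smooth \<eta> f x\<bar> \<le> 1"
proof -
  have "\<bar>smooth \<eta> f x\<bar> \<le> (LINT z|lborel. mollifier (z::'b))"
    unfolding smooth_def
    by (rule abs_integral_le[OF integrable_smooth_integrand[OF assms] integrable_mollifier])
       (auto simp: abs_mult assms mollifier_nonneg mult_left_le_one_le)
  then show ?thesis by (simp add: integral_mollifier)
qed

text \<open>A displacement of the point by \<open>\<eta> *\<^sub>R w\<close> becomes a translation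
  of the mollifier by \<open>w\<close>. Boundedness of \<open>f\<close> is therefore enough, and the
  Lipschitz constant grows like 1/\<eta>.\<close>

lemma smooth_lipschitz:
  fixes f :: "'b::euclidean_space \<Rightarrow> real"
  assumes [measurable]: "f \<in> borel_measurable borel" and f: "\<And>x. \<bar>f x\<bar> \<le> 1"
    and L: "\<And>w :: 'b. (LINT z|lborel. \<bar>mollifier (z - w) - mollifier z\<bar>) \<le> L * norm w"
    and "\<eta> > 0"
  shows "\<bar>smooth \<eta> f x - smooth \<eta> f y\<bar> \<le> L / \<eta> * norm (x - y)"
proof -
  define w where "w = (x - y) /\<^sub>R \<eta>"
  have x: "x + \<eta> *\<^sub>R z = y + \<eta> *\<^sub>R (w + z)" for z
    using \<open>\<eta> > 0\<close> by (simp add: w_def algebra_simps)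
  have int_shift: "integrable lborel (\<lambda>z::'b. mollifier (z - w))"
    using lborel_integrable_translate[OF integrable_mollifier, of "-w"] by simp
  have eq: "smooth \<eta> f x = (LINT z|lborel. f (y + \<eta> *\<^sub>R z) * mollifier (z - w))"
    unfolding smooth_def x
    using lborel_integral_translate[of "\<lambda>z. f (y + \<eta> *\<^sub>R z) * mollifier (z - w)" w] by simp
  have i1: "integrable lborel (\<lambda>z. f (y + \<eta> *\<^sub>R z) * mollifier (z - w))"
    by (rule Bochner_Integration.integrable_bound[OF int_shift]) (auto simp: abs_mult f mult_left_le_one_le)
  have "\<bar>smooth \<eta> f x - smooth \<eta> f y\<bar>
      = \<bar>LINT z|lborel. f (y + \<eta> *\<^sub>R z) * (mollifier (z - w) - mollifier z)\<bar>"
    unfolding eq unfolding smooth_def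
    by (subst Bochner_Integration.integral_diff[symmetric])
       (auto simp: i1 integrable_smooth_integrand assms right_diff_distrib)
  also have "\<dots> \<le> (LINT z|lborel. \<bar>mollifier (z - w) - mollifier z\<bar>)"
  proof (rule abs_integral_le)
    show "integrable lborel (\<lambda>z. f (y + \<eta> *\<^sub>R z) * (mollifier (z - w) - mollifier z))"
      using Bochner_Integration.integrable_diff[OF i1 integrable_smooth_integrand[OF assms(1) f, of y \<eta>]]
      by (simp add: right_diff_distrib)
  qed (auto intro!: Bochner_Integration.integrable_abs Bochner_Integration.integrable_diff int_shift integrable_mollifier simp: abs_mult f mult_left_le_one_le)
  also have "\<dots> \<le> L * norm w" by (rule L)
  also have "\<dots> = L / \<eta> * norm (x - y)" using \<open>\<eta> > 0\<close> by (simp add: w_def divide_inverse)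
  finally show ?thesis .
qed

text \<open>By Fubini the smoothed expectation is an average of expectations of \<open>f\<close>
  translated by \<open>\<eta> *\<^sub>R z\<close>, and the mollifier vanishes for
  \<open>norm z \<ge> 1\<close>, so only translations of length below \<eta> matter.\<close>

lemma (in prob_space) expectation_smooth_close:
  fixes f :: "'b::euclidean_space \<Rightarrow> real"
  assumes [measurable]: "f \<in> borel_measurable borel" "V \<in> borel_measurable M"
    and f: "\<And>x. \<bar>f x\<bar> \<le> 1" and "\<eta> > 0" "A \<ge> 0"
    and shift: "\<And>v. \<bar>expectation (\<lambda>\<omega>. f (V \<omega> + v)) - expectation (\<lambda>\<omega>. f (V \<omega>))\<bar> \<le> A * norm v"
  shows "\<bar>expectation (\<lambda>\<omega>. smooth \<eta> f (V \<omega>)) - expectation (\<lambda>\<omega>. f (V \<omega>))\<bar> \<le> A * \<eta>"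
proof -
  interpret pair_sigma_finite M lborel ..
  have int: "integrable (M \<Otimes>\<^sub>M lborel) (\<lambda>(\<omega>, z). f (V \<omega> + \<eta> *\<^sub>R z) * mollifier z)"
  proof (rule Bochner_Integration.integrable_bound[where f = "\<lambda>(\<omega>, z). mollifier z"])
    show "integrable (M \<Otimes>\<^sub>M lborel) (\<lambda>(\<omega>::'a, z::'b). mollifier z)"
      by (rule Fubini_integrable) (auto simp: integrable_mollifier)
  qed (auto simp: abs_mult f mult_left_le_one_le)
  have "expectation (\<lambda>\<omega>. smooth \<eta> f (V \<omega>))
      = (LINT z|lborel. expectation (\<lambda>\<omega>. f (V \<omega> + \<eta> *\<^sub>R z) * mollifier z))"
    unfolding smooth_def using Fubini_integral[OF int] by simp
  also have "\<dots> = (LINT z|lborel. expectation (\<lambda>\<omega>. f (V \<omega> + \<eta> *\<^sub>R z)) * mollifier z)"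
    by simp
  finally have eq: "expectation (\<lambda>\<omega>. smooth \<eta> f (V \<omega>))
      = (LINT z|lborel. expectation (\<lambda>\<omega>. f (V \<omega> + \<eta> *\<^sub>R z)) * mollifier z)" .
  have bd: "\<bar>expectation (\<lambda>\<omega>. f (V \<omega> + v))\<bar> \<le> 1" for v
  proof -
    have "\<bar>expectation (\<lambda>\<omega>. f (V \<omega> + v))\<bar> \<le> expectation (\<lambda>\<omega>. 1)"
      by (rule abs_integral_le) (auto intro!: integrable_const_bound[where B=1] simp: f)
    then show ?thesis by (simp add: prob_space)
  qed
  have i1: "integrable lborel (\<lambda>z. expectation (\<lambda>\<omega>. f (V \<omega> + \<eta> *\<^sub>R z)) * mollifier z)"
    by (rule Bochner_Integration.integrable_bound[OF integrable_mollifier]) (auto simp: abs_mult bd mult_left_le_one_le)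
  have "\<bar>expectation (\<lambda>\<omega>. smooth \<eta> f (V \<omega>)) - expectation (\<lambda>\<omega>. f (V \<omega>))\<bar>
     = \<bar>LINT z|lborel. (expectation (\<lambda>\<omega>. f (V \<omega> + \<eta> *\<^sub>R z)) - expectation (\<lambda>\<omega>. f (V \<omega>))) * mollifier (z::'b)\<bar>"
    unfolding eq left_diff_distrib
    by (subst Bochner_Integration.integral_diff) (auto simp: i1 integrable_mollifier integral_mollifier)
  also have "\<dots> \<le> (LINT z|lborel. A * \<eta> * mollifier (z::'b))"
  proof (rule abs_integral_le)
    show "integrable lborel (\<lambda>z. (expectation (\<lambda>\<omega>. f (V \<omega> + \<eta> *\<^sub>R z)) - expectation (\<lambda>\<omega>. f (V \<omega>))) * mollifier (z::'b))"
      unfolding left_diff_distrib by (intro Bochner_Integration.integrable_diff i1) (auto simp: integrable_mollifier)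
    fix z :: 'b
    show "\<bar>(expectation (\<lambda>\<omega>. f (V \<omega> + \<eta> *\<^sub>R z)) - expectation (\<lambda>\<omega>. f (V \<omega>))) * mollifier z\<bar> \<le> A * \<eta> * mollifier z"
    proof (cases "norm z \<ge> 1")
      case True then show ?thesis by (simp add: mollifier_eq_0)
    next
      case False
      have "\<bar>expectation (\<lambda>\<omega>. f (V \<omega> + \<eta> *\<^sub>R z)) - expectation (\<lambda>\<omega>. f (V \<omega>))\<bar> \<le> A * norm (\<eta> *\<^sub>R z)"
        by (rule shift)
      also have "\<dots> \<le> A * (\<eta> * 1)" using False \<open>\<eta> > 0\<close> \<open>A \<ge> 0\<close>
        by (auto intro!: mult_left_mono)
      finally show ?thesis by (auto simp: abs_mult mollifier_nonneg intro!: mult_right_mono)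
    qed
  qed (auto simp: integrable_mollifier)
  also have "\<dots> = A * \<eta>" by (simp add: integral_mollifier)
  finally show ?thesis .
qed

lemma smooth_tendsto:
  fixes f :: "'b::euclidean_space \<Rightarrow> real"
  assumes cf: "continuous_on UNIV f" and f: "\<And>x. \<bar>f x\<bar> \<le> 1" and \<eta>: "\<eta> \<longlonglongrightarrow> 0"
  shows "(\<lambda>k. smooth (\<eta> k) f x) \<longlonglongrightarrow> f x"
proof -
  have [measurable]: "f \<in> borel_measurable borel" using cf by (rule borel_measurable_continuous_onI)
  have "(\<lambda>k. LINT z|lborel. f (x + \<eta> k *\<^sub>R z) * mollifier z) \<longlonglongrightarrow> (LINT z|lborel. f x * mollifier (z::'b))"
  proof (rule integral_dominated_convergence[OF _ _ integrable_mollifier])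
    show "AE z in lborel. (\<lambda>k. f (x + \<eta> k *\<^sub>R z) * mollifier z) \<longlonglongrightarrow> f x * mollifier (z::'b)"
    proof (rule AE_I2, intro tendsto_mult tendsto_const)
      fix z :: 'b
      have "(\<lambda>k. x + \<eta> k *\<^sub>R z) \<longlonglongrightarrow> x + 0 *\<^sub>R z" by (intro tendsto_intros \<eta>)
      then show "(\<lambda>k. f (x + \<eta> k *\<^sub>R z)) \<longlonglongrightarrow> f x"
        using cf by (auto simp: continuous_on_eq_continuous_at intro: isCont_tendsto_compose)
    qed
  qed (auto simp: abs_mult f mollifier_nonneg mult_left_le_one_le)
  then show ?thesis by (simp add: smooth_def integral_mollifier)
qed

section \<open>From mollification bounds to absolute continuity\<close>

text \<open>A compact Lebesgue-null set becomes invisible after smoothing at any positive scale, so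
  its mass under the law of \<open>U\<close> is at most \<open>r k\<close> for every
  \<open>k\<close>. Uniformity over the test functions allows these to shrink to the indicator of
  the set before \<open>k\<close> grows.\<close>

lemma (in prob_space) absolutely_continuous_by_mollification:
  fixes U :: "'a \<Rightarrow> 'b::euclidean_space"
  assumes U [measurable]: "U \<in> borel_measurable M" and r: "r \<longlonglongrightarrow> 0"
    and bound: "\<And>f k. continuous_on UNIV f \<Longrightarrow> (\<And>x. \<bar>f x\<bar> \<le> 1) \<Longrightarrow>
      \<bar>expectation (\<lambda>\<omega>. f (U \<omega>)) - expectation (\<lambda>\<omega>. smooth ((1/2) ^ k) f (U \<omega>))\<bar> \<le> r k"
  shows "absolutely_continuous lborel (distr M borel U)"
proof -
  interpret D: prob_space "distr M borel U" by (rule prob_space_distr) fact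
  have compact_null: "emeasure (distr M borel U) K = 0" if K: "compact K" "K \<in> null_sets lborel" for K
  proof (cases "K = {}")
    case False
    have [measurable]: "K \<in> sets borel" using K(2) by auto
    \<comment> \<open>Continuous functions that dominate the indicator of \<open>K\<close> and
      decrease to it; the hypothesis \<open>bound\<close> speaks about continuous test
      functions.\<close>
    define f where "f n x = max 0 (1 - real n * infdist x K)" for n x
    have cf: "continuous_on UNIV (f n)" for n
      unfolding f_def by (intro continuous_intros)
    have [measurable]: "f n \<in> borel_measurable borel" for n
      by (rule borel_measurable_continuous_onI[OF cf])
    have f0: "0 \<le> f n x" and f1: "\<bar>f n x\<bar> \<le> 1" and f1': "f n x \<le> 1" for n x
      using infdist_nonneg[of x K] by (auto simp: f_def max_def)
    have fK: "f n x = 1" if "x \<in> K" for n x using that by (simp add: f_def)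
    have f_lim: "(\<lambda>n. f n x) \<longlonglongrightarrow> indicator K x" for x
    proof (cases "x \<in> K")
      case False
      have d: "infdist x K > 0"
        using False K(1) \<open>K \<noteq> {}\<close> by (intro infdist_pos_not_in_closed compact_imp_closed)
      have "eventually (\<lambda>n. f n x = 0) sequentially"
        using eventually_ge_at_top[of "nat \<lceil>1 / infdist x K\<rceil>"]
      proof eventually_elim
        case (elim n)
        then have "1 / infdist x K \<le> real n" by linarith
        then show ?case using d by (simp add: f_def field_simps)
      qed
      then show ?thesis using False by (simp add: tendsto_eventually)
    qed (simp add: fK)
    \<comment> \<open>The map \<open>z \<mapsto> x + \<eta> z\<close> changes Lebesgue measure by a
      constant factor, so the preimage of the null set \<open>K\<close> is null as well.\<close>
    have zero: "AE z in lborel. x + \<eta> *\<^sub>R z \<notin> K" if "\<eta> > 0" for x \<eta>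
    proof -
      have "AE y in lborel. y \<notin> K" using K(2) by (rule AE_not_in)
      then have "AE y in density (distr lborel borel (\<lambda>z. x + \<eta> *\<^sub>R z)) (\<lambda>_. ennreal (\<bar>\<eta>\<bar> ^ DIM('b))). y \<notin> K"
        by (subst lborel_affine[symmetric]) (use that in auto)
      then show ?thesis using that by (simp add: AE_density AE_distr_iff)
    qed
    have smooth_lim: "(\<lambda>n. smooth \<eta> (f n) x) \<longlonglongrightarrow> 0" if "\<eta> > 0" for x \<eta>
    proof -
      have "(\<lambda>n. smooth \<eta> (f n) x) \<longlonglongrightarrow> (LINT z|lborel. indicator K (x + \<eta> *\<^sub>R z) * mollifier z)"
        unfolding smooth_def
        by (rule integral_dominated_convergence[OF _ _ integrable_mollifier])
           (auto intro!: tendsto_intros f_lim simp: abs_mult f1 mollifier_nonneg mult_left_le_one_le)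
      also have "(LINT z|lborel. indicator K (x + \<eta> *\<^sub>R z) * mollifier z) = 0"
        using zero[OF that, of x] by (intro integral_eq_zero_AE) (auto elim!: eventually_mono)
      finally show ?thesis .
    qed
    have le: "measure (distr M borel U) K \<le> r k" for k
    proof -
      have "(\<lambda>n. expectation (\<lambda>\<omega>. smooth ((1/2) ^ k) (f n) (U \<omega>))) \<longlonglongrightarrow> expectation (\<lambda>\<omega>. 0)"
        by (rule integral_dominated_convergence[where w = "\<lambda>_. 1"])
           (auto intro!: smooth_lim smooth_bounded f1)
      then have lim: "(\<lambda>n. expectation (\<lambda>\<omega>. smooth ((1/2) ^ k) (f n) (U \<omega>)) + r k) \<longlonglongrightarrow> 0 + r k"
        by (intro tendsto_intros) simp
      have "measure (distr M borel U) K \<le> expectation (\<lambda>\<omega>. smooth ((1/2) ^ k) (f n) (U \<omega>)) + r k" for n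
      proof -
        have "measure (distr M borel U) K = expectation (\<lambda>\<omega>. indicator K (U \<omega>))"
          using integral_distr[OF U, of "indicator K :: 'b \<Rightarrow> real"] by simp
        also have "\<dots> \<le> expectation (\<lambda>\<omega>. f n (U \<omega>))"
          by (rule integral_mono) (auto intro!: integrable_const_bound[where B=1] simp: f1 f1' f0 fK indicator_def)
        also have "\<dots> \<le> expectation (\<lambda>\<omega>. smooth ((1/2) ^ k) (f n) (U \<omega>)) + r k"
          using bound[OF cf f1, of n k] by linarith
        finally show ?thesis .
      qed
      then have "measure (distr M borel U) K \<le> 0 + r k"
        by (intro LIMSEQ_le_const[OF lim]) blast
      then show ?thesis by simp
    qed
    then have "measure (distr M borel U) K \<le> 0"
      using r by (intro LIMSEQ_le_const) auto
    then show ?thesis by (simp add: D.emeasure_eq_measure measure_le_0_iff)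
  qed simp
  show ?thesis
    unfolding absolutely_continuous_def
  proof
    fix N :: "'b set" assume N: "N \<in> null_sets lborel"
    then have Nb: "N \<in> sets borel" by auto
    \<comment> \<open>Inner regularity of the finite Borel measure reduces an arbitrary null set to
      its compact subsets.\<close>
    have "emeasure (distr M borel U) N = (SUP K \<in> {K. K \<subseteq> N \<and> compact K}. emeasure (distr M borel U) K)"
      by (rule inner_regular) (use Nb in \<open>auto simp: D.emeasure_space_1\<close>)
    also have "\<dots> = (SUP K \<in> {K. K \<subseteq> N \<and> compact K}. 0)"
    proof (rule SUP_cong[OF refl])
      fix K assume "K \<in> {K. K \<subseteq> N \<and> compact K}"
      then have K: "K \<subseteq> N" "compact K" by auto
      then have "K \<in> null_sets lborel"
        using null_sets_subset[OF N, of K] by (auto intro: borel_compact)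
      with K show "emeasure (distr M borel U) K = 0" by (intro compact_null)
    qed
    also have "\<dots> = 0" by (intro antisym SUP_least) auto
    finally show "N \<in> null_sets (distr M borel U)" using Nb by auto
  qed
qed

text \<open>Telescoping from \<open>k\<close> on. The tail is written as total minus partial sum, a
  form whose convergence to 0 is immediate.\<close>

lemma summable_tail_criterion:
  fixes t :: "nat \<Rightarrow> real"
  assumes "summable t" and "\<And>k. t k \<ge> 0" and "k0 \<le> k"
    and step: "\<And>k. k \<ge> k0 \<Longrightarrow> \<bar>s (Suc k) - s k\<bar> \<le> t k" and lim: "s \<longlonglongrightarrow> l"
  shows "\<bar>l - s k\<bar> \<le> suminf t - sum t {..<k}"
proof -
  have bd: "\<bar>s (k + n) - s k\<bar> \<le> sum t {..<k + n} - sum t {..<k}" for n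
  proof (induction n)
    case (Suc n)
    then show ?case using step[of "k + n"] \<open>k0 \<le> k\<close> by simp
  qed simp
  have "\<bar>s (k + n) - s k\<bar> \<le> suminf t - sum t {..<k}" for n
    using bd[of n] sum_le_suminf[OF assms(1), of "{..<k + n}"] assms(2)
    by (meson diff_right_mono finite_lessThan order_trans)
  moreover have "(\<lambda>n. \<bar>s (n + k) - s k\<bar>) \<longlonglongrightarrow> \<bar>l - s k\<bar>"
    by (intro tendsto_intros LIMSEQ_ignore_initial_segment lim)
  ultimately show ?thesis
    by (intro LIMSEQ_le_const2) (auto simp: add.commute)
qed

lemma (in prob_space) expectation_smooth_lipschitz:
  fixes f :: "'b::euclidean_space \<Rightarrow> real"
  assumes [measurable]: "f \<in> borel_measurable borel" "U \<in> borel_measurable M" "V \<in> borel_measurable M"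
    and f: "\<And>x. \<bar>f x\<bar> \<le> 1"
    and L: "\<And>w :: 'b. (LINT z|lborel. \<bar>mollifier (z - w) - mollifier z\<bar>) \<le> L * norm w"
    and "\<eta> > 0" and int: "integrable M (\<lambda>\<omega>. norm (U \<omega> - V \<omega>))"
  shows "\<bar>expectation (\<lambda>\<omega>. smooth \<eta> f (U \<omega>)) - expectation (\<lambda>\<omega>. smooth \<eta> f (V \<omega>))\<bar>
    \<le> L / \<eta> * expectation (\<lambda>\<omega>. norm (U \<omega> - V \<omega>))"
proof -
  have i: "integrable M (\<lambda>\<omega>. smooth \<eta> f (X \<omega>))" if [measurable]: "X \<in> borel_measurable M" for X
    by (rule integrable_const_bound[where B=1]) (auto intro!: AE_I2 smooth_bounded f)
  have "\<bar>expectation (\<lambda>\<omega>. smooth \<eta> f (U \<omega>)) - expectation (\<lambda>\<omega>. smooth \<eta> f (V \<omega>))\<bar>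
      = \<bar>expectation (\<lambda>\<omega>. smooth \<eta> f (U \<omega>) - smooth \<eta> f (V \<omega>))\<bar>"
    by (simp add: i)
  also have "\<dots> \<le> expectation (\<lambda>\<omega>. L / \<eta> * norm (U \<omega> - V \<omega>))"
    by (rule abs_integral_le)
       (auto intro!: Bochner_Integration.integrable_diff i integrable_mult_right int smooth_lipschitz f L \<open>\<eta> > 0\<close>
         simp del: times_divide_eq_left)
  finally show ?thesis by simp
qed

text \<open>At each of two consecutive scales, passing from \<open>U\<close> to \<open>V\<close>
  under the smoothing costs the L1 distance times \<open>L\<close> over the scale, and removing the
  smoothing from \<open>V\<close> costs the scale times \<open>C / \<delta>\<close>. These four
  costs bound the change between consecutive mollifications of the law of \<open>U\<close>.\<close>

lemma (in prob_space) absolutely_continuous_by_scales: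
  fixes U :: "'a \<Rightarrow> 'b::euclidean_space"
  assumes U [measurable]: "U \<in> borel_measurable M" and "h > 0" "C \<ge> 0" "\<delta>\<^sub>0 > 0"
    and approx: "\<And>\<delta>. 0 < \<delta> \<Longrightarrow> \<delta> < \<delta>\<^sub>0 \<Longrightarrow> \<exists>V \<in> borel_measurable M.
      integrable M (\<lambda>\<omega>. norm (U \<omega> - V \<omega>)) \<and>
      expectation (\<lambda>\<omega>. norm (U \<omega> - V \<omega>)) \<le> C * \<delta> * \<bar>ln \<delta>\<bar> powr (- (2 + h)) \<and>
      (\<forall>f \<in> borel_measurable borel. (\<forall>x. \<bar>f x\<bar> \<le> 1) \<longrightarrow>
        (\<forall>v. \<bar>expectation (\<lambda>\<omega>. f (V \<omega> + v)) - expectation (\<lambda>\<omega>. f (V \<omega>))\<bar> \<le> C / \<delta> * norm v))"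
  shows "absolutely_continuous lborel (distr M borel U)"
proof -
  obtain L where L: "L > 0"
    "\<And>w :: 'b. (LINT z|lborel. \<bar>mollifier (z - w) - mollifier z\<bar>) \<le> L * norm w"
    using mollifier_translation_bound by blast
  \<comment> \<open>With \<open>\<delta> k\<close> slightly above the mollification scale \<open>2 ^ -k\<close>, the translation error and the
    \<open>L\<^sup>1\<close> error both become of order \<open>k powr - (1 + h/2)\<close>.\<close>
  define \<delta> where "\<delta> k = (1/2) ^ k * real k powr (1 + h/2)" for k
  have "eventually (\<lambda>k. \<delta> k > 0) sequentially"
    using eventually_gt_at_top[of 0] by eventually_elim (simp add: \<delta>_def)
  moreover have ln_le: "eventually (\<lambda>k. ln (\<delta> k) \<le> - (real k / 8)) sequentially"
  proof -
    have "eventually (\<lambda>k. ln (real k) / real k < 1 / (8 * (1 + h/2))) sequentially"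
      by (rule order_tendstoD(2)[OF lim_ln_over_n]) (use \<open>h > 0\<close> in simp)
    then show ?thesis using eventually_gt_at_top[of 0]
    proof eventually_elim
      case (elim k)
      \<comment> \<open>The rate 1/8 leaves room: \<open>ln 2 \<ge> 2/3\<close> against a
        logarithmic correction of at most \<open>k / 8\<close> still exceeds
        \<open>k / 8\<close>.\<close>
      have "ln (\<delta> k) = (1 + h/2) * ln (real k) - real k * ln 2"
        using elim(2) by (simp add: \<delta>_def ln_mult ln_powr ln_realpow ln_div)
      moreover have "(1 + h/2) * ln (real k) \<le> real k / 8"
        using elim \<open>h > 0\<close> by (simp add: divide_simps split: if_splits) (simp add: algebra_simps)
      moreover have "real k * ln 2 \<ge> real k * (2/3)"
        using ln2_ge_two_thirds by (intro mult_left_mono) auto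
      ultimately show ?case by linarith
    qed
  qed
  moreover have "eventually (\<lambda>k. \<delta> k < \<delta>\<^sub>0) sequentially"
  proof -
    have "filterlim (\<lambda>k. real k * (1/8)) at_top sequentially"
      by (rule filterlim_at_top_mult_tendsto_pos[OF tendsto_const _ filterlim_real_sequentially]) simp
    then have "eventually (\<lambda>k. real k * (1/8) > - ln \<delta>\<^sub>0) sequentially"
      unfolding filterlim_at_top_dense by blast
    with ln_le \<open>eventually (\<lambda>k. \<delta> k > 0) sequentially\<close> show ?thesis
    proof eventually_elim
      case (elim k)
      then have "ln (\<delta> k) < ln \<delta>\<^sub>0" by linarith
      with elim \<open>\<delta>\<^sub>0 > 0\<close> show ?case by simp
    qed
  qed
  moreover have "eventually (\<lambda>k. \<bar>ln (\<delta> k)\<bar> \<ge> real k / 8) sequentially"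
    using ln_le by eventually_elim linarith
  ultimately have "eventually (\<lambda>k. \<delta> k > 0 \<and> \<delta> k < \<delta>\<^sub>0 \<and> \<bar>ln (\<delta> k)\<bar> \<ge> real k / 8 \<and> k > 0) sequentially"
    using eventually_gt_at_top[of 0] by eventually_elim auto
  then obtain k0 where k0: "\<And>k. k \<ge> k0 \<Longrightarrow> \<delta> k > 0 \<and> \<delta> k < \<delta>\<^sub>0 \<and> \<bar>ln (\<delta> k)\<bar> \<ge> real k / 8 \<and> k > 0"
    unfolding eventually_sequentially by blast
  \<comment> \<open>The 3 collects the weights \<open>2 * 2 ^ k\<close> and \<open>2 ^ k\<close> of
    the two L1 errors, the 3/2 the relative scales 1/2 and 1 of the two translation errors;
    \<open>8 powr (2 + h)\<close> stems from
    \<open>\<bar>ln (\<delta> k)\<bar> \<ge> k / 8\<close>.\<close>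
  define B where "B = 3 * L * C * 8 powr (2 + h) + 3/2 * C"
  have B: "B \<ge> 0" using L \<open>C \<ge> 0\<close> by (simp add: B_def)
  define t where "t k = B * real k powr (- (1 + h/2))" for k
  have "summable t" unfolding t_def
    using \<open>h > 0\<close> by (intro summable_mult) (simp add: summable_real_powr_iff)
  have t0: "t k \<ge> 0" for k using B by (simp add: t_def)
  \<comment> \<open>Below \<open>k0\<close> the scale \<open>\<delta> k\<close> need not be
    admissible; there the difference of two expectations of modulus at most 1 is bounded by
    2.\<close>
  define r where "r k = (if k < k0 then 2 else suminf t - sum t {..<k})" for k
  have "(\<lambda>k. suminf t - sum t {..<k}) \<longlonglongrightarrow> suminf t - suminf t"
    by (intro tendsto_intros summable_LIMSEQ \<open>summable t\<close>)
  then have "(\<lambda>k. suminf t - sum t {..<k}) \<longlonglongrightarrow> 0" by simp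
  then have r: "r \<longlonglongrightarrow> 0"
    by (rule Lim_transform_eventually)
       (rule eventually_mono[OF eventually_ge_at_top[of k0]], simp add: r_def)
  have step: "\<bar>expectation (\<lambda>\<omega>. smooth ((1/2) ^ Suc k) f (U \<omega>)) - expectation (\<lambda>\<omega>. smooth ((1/2) ^ k) f (U \<omega>))\<bar> \<le> t k"
    if cf: "continuous_on UNIV f" and f: "\<And>x. \<bar>f x\<bar> \<le> 1" and "k \<ge> k0" for f :: "'b \<Rightarrow> real" and k
  proof -
    have [measurable]: "f \<in> borel_measurable borel" by (rule borel_measurable_continuous_onI[OF cf])
    from k0[OF \<open>k \<ge> k0\<close>] have k: "\<delta> k > 0" "\<delta> k < \<delta>\<^sub>0" "\<bar>ln (\<delta> k)\<bar> \<ge> real k / 8" "k > 0" by auto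
    obtain V where V [measurable]: "V \<in> borel_measurable M"
      and int: "integrable M (\<lambda>\<omega>. norm (U \<omega> - V \<omega>))"
      and e: "expectation (\<lambda>\<omega>. norm (U \<omega> - V \<omega>)) \<le> C * \<delta> k * \<bar>ln (\<delta> k)\<bar> powr (- (2 + h))"
      and sh: "\<And>v. \<bar>expectation (\<lambda>\<omega>. f (V \<omega> + v)) - expectation (\<lambda>\<omega>. f (V \<omega>))\<bar> \<le> C / \<delta> k * norm v"
    proof -
      obtain V where V: "V \<in> borel_measurable M" "integrable M (\<lambda>\<omega>. norm (U \<omega> - V \<omega>))"
        "expectation (\<lambda>\<omega>. norm (U \<omega> - V \<omega>)) \<le> C * \<delta> k * \<bar>ln (\<delta> k)\<bar> powr (- (2 + h))"
        and sh: "\<forall>f \<in> borel_measurable borel. (\<forall>x. \<bar>f x\<bar> \<le> 1) \<longrightarrow>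
          (\<forall>v. \<bar>expectation (\<lambda>\<omega>. f (V \<omega> + v)) - expectation (\<lambda>\<omega>. f (V \<omega>))\<bar> \<le> C / \<delta> k * norm v)"
        using approx[OF k(1,2)] by blast
      have "\<bar>expectation (\<lambda>\<omega>. f (V \<omega> + v)) - expectation (\<lambda>\<omega>. f (V \<omega>))\<bar> \<le> C / \<delta> k * norm v" for v
        by (rule sh[rule_format]) (auto simp: f)
      with V show ?thesis by (rule that)
    qed
    define e where "e = expectation (\<lambda>\<omega>. norm (U \<omega> - V \<omega>))"
    have lip: "\<bar>expectation (\<lambda>\<omega>. smooth \<eta> f (U \<omega>)) - expectation (\<lambda>\<omega>. smooth \<eta> f (V \<omega>))\<bar> \<le> L / \<eta> * e"
      if "\<eta> > 0" for \<eta>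
      unfolding e_def by (intro expectation_smooth_lipschitz f L(2) that int) auto
    have close: "\<bar>expectation (\<lambda>\<omega>. smooth \<eta> f (V \<omega>)) - expectation (\<lambda>\<omega>. f (V \<omega>))\<bar> \<le> C / \<delta> k * \<eta>"
      if "\<eta> > 0" for \<eta>
      using k(1) \<open>C \<ge> 0\<close> by (intro expectation_smooth_close f that sh) auto
    have "\<bar>expectation (\<lambda>\<omega>. smooth ((1/2) ^ Suc k) f (U \<omega>)) - expectation (\<lambda>\<omega>. smooth ((1/2) ^ k) f (U \<omega>))\<bar>
        \<le> L / (1/2) ^ Suc k * e + C / \<delta> k * (1/2) ^ Suc k + C / \<delta> k * (1/2) ^ k + L / (1/2) ^ k * e"
      using lip[of "(1/2) ^ Suc k"] lip[of "(1/2) ^ k"] close[of "(1/2) ^ Suc k"] close[of "(1/2) ^ k"]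
      by simp
    also have "\<dots> = 3 * L * 2 ^ k * e + 3/2 * C * ((1/2) ^ k / \<delta> k)"
      by (simp add: power_one_over field_simps)
    also have "\<dots> \<le> 3 * L * C * 8 powr (2 + h) * real k powr (- (1 + h/2)) + 3/2 * C * real k powr (- (1 + h/2))"
    proof -
      have 2: "2 ^ k * \<delta> k = real k powr (1 + h/2)"
        by (simp add: \<delta>_def power_one_over)
      have 3: "(real k / 8) powr (- (2 + h)) = 8 powr (2 + h) * real k powr (- (2 + h))"
        using \<open>k > 0\<close> by (simp only: powr_divide powr_minus) (simp add: divide_simps)
      have "\<bar>ln (\<delta> k)\<bar> powr (- (2 + h)) \<le> (real k / 8) powr (- (2 + h))"
        using k \<open>h > 0\<close> by (intro powr_mono2') auto
      then have "e \<le> C * \<delta> k * (real k / 8) powr (- (2 + h))"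
        using e k(1) \<open>C \<ge> 0\<close> unfolding e_def
        by (meson mult_left_mono mult_nonneg_nonneg less_imp_le order_trans)
      then have "3 * L * 2 ^ k * e \<le> 3 * L * 2 ^ k * (C * \<delta> k * (real k / 8) powr (- (2 + h)))"
        using L(1) by (intro mult_left_mono) auto
      also have "\<dots> = 3 * L * C * 8 powr (2 + h) * ((2 ^ k * \<delta> k) * real k powr (- (2 + h)))"
        unfolding 3 by (simp only: mult_ac)
      \<comment> \<open>The powers of two cancel and
        \<open>(1 + h/2) - (2 + h) = - (1 + h/2)\<close>, the same exponent as for the translation
        error.\<close>
      also have "(2 ^ k * \<delta> k) * real k powr (- (2 + h)) = real k powr (- (1 + h/2))"
        unfolding 2 powr_add[symmetric] by (rule arg_cong2[where f = "(powr)"]) (auto simp: field_simps)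
      finally have 4: "3 * L * 2 ^ k * e \<le> 3 * L * C * 8 powr (2 + h) * real k powr (- (1 + h/2))" .
      have "(1/2) ^ k / \<delta> k = real k powr (- (1 + h/2))"
        unfolding \<delta>_def powr_minus by (simp add: inverse_eq_divide)
      then show ?thesis using 4 by simp
    qed
    also have "\<dots> = t k" unfolding t_def B_def by (simp only: distrib_right)
    finally show ?thesis .
  qed
  show ?thesis
  proof (rule absolutely_continuous_by_mollification[OF U r])
    fix f :: "'b \<Rightarrow> real" and k
    assume cf: "continuous_on UNIV f" and f: "\<And>x. \<bar>f x\<bar> \<le> 1"
    have [measurable]: "f \<in> borel_measurable borel" by (rule borel_measurable_continuous_onI[OF cf])
    have bd: "\<bar>expectation (\<lambda>\<omega>. g (U \<omega>))\<bar> \<le> 1"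
      if "g \<in> borel_measurable borel" "\<And>x. \<bar>g x\<bar> \<le> 1" for g :: "'b \<Rightarrow> real"
    proof -
      have [measurable]: "g \<in> borel_measurable borel" by fact
      have "\<bar>expectation (\<lambda>\<omega>. g (U \<omega>))\<bar> \<le> expectation (\<lambda>\<omega>. 1)"
        by (rule abs_integral_le) (auto intro!: integrable_const_bound[where B=1] simp: that)
      then show ?thesis by (simp add: prob_space)
    qed
    show "\<bar>expectation (\<lambda>\<omega>. f (U \<omega>)) - expectation (\<lambda>\<omega>. smooth ((1/2) ^ k) f (U \<omega>))\<bar> \<le> r k"
    proof (cases "k < k0")
      case True
      have "\<bar>expectation (\<lambda>\<omega>. f (U \<omega>))\<bar> \<le> 1" "\<bar>expectation (\<lambda>\<omega>. smooth ((1/2) ^ k) f (U \<omega>))\<bar> \<le> 1"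
        by (auto intro!: bd smooth_bounded simp: f)
      then show ?thesis using True by (simp add: r_def)
    next
      case False
      have "(\<lambda>k. expectation (\<lambda>\<omega>. smooth ((1/2) ^ k) f (U \<omega>))) \<longlonglongrightarrow> expectation (\<lambda>\<omega>. f (U \<omega>))"
        by (rule integral_dominated_convergence[where w = "\<lambda>_. 1"])
           (auto intro!: smooth_tendsto smooth_bounded LIMSEQ_realpow_zero simp: f cf)
      with False show ?thesis
        unfolding r_def using summable_tail_criterion[OF \<open>summable t\<close> t0, of k0 k
          "\<lambda>k. expectation (\<lambda>\<omega>. smooth ((1/2) ^ k) f (U \<omega>))"] step[OF cf f] by auto
    qed
  qed
qed

section \<open>Gaussian independence and translation bounds\<close>

text \<open>The phases 0 and -\<pi>/2 give the real and the imaginary part of the characteristic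
  function. Levy uniqueness concerns probability measures, hence the division by the common total
  mass; mass 0 is treated apart.\<close>

lemma finite_measure_eq_by_cos:
  fixes N1 N2 :: "real measure"
  assumes "finite_measure N1" "finite_measure N2" and sets1 [measurable_cong]: "sets N1 = sets borel" and sets2 [measurable_cong]: "sets N2 = sets borel"
    and eq: "\<And>t \<psi>. (LINT x|N1. cos (t * x + \<psi>)) = (LINT x|N2. cos (t * x + \<psi>))"
  shows "N1 = N2"
proof -
  interpret N1: finite_measure N1 by fact
  interpret N2: finite_measure N2 by fact
  have sp: "space N1 = UNIV" "space N2 = UNIV"
    using sets_eq_imp_space_eq[OF sets1] sets_eq_imp_space_eq[OF sets2] by auto
  define m where "m = measure N1 UNIV"
  \<comment> \<open>Frequency 0 with phase 0 compares the total masses.\<close>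
  have m2: "measure N2 UNIV = m" using eq[of 0 0] by (simp add: m_def sp)
  show ?thesis
  proof (cases "m = 0")
    case True
    have "emeasure N1 A = 0" "emeasure N2 A = 0" for A
      using emeasure_space[of N1 A] emeasure_space[of N2 A] True m2
      by (simp_all add: sp m_def N1.emeasure_eq_measure N2.emeasure_eq_measure measure_le_0_iff)
    then show ?thesis by (intro measure_eqI) (auto simp: sets1 sets2)
  next
    case False
    then have m: "m > 0" by (simp add: m_def measure_nonneg less_le)
    have rd: "real_distribution (density N (\<lambda>_. ennreal (1 / m)))"
      if "finite_measure N" "sets N = sets borel" "measure N UNIV = m" for N :: "real measure"
    proof -
      interpret N: finite_measure N by fact
      have "space N = UNIV" using sets_eq_imp_space_eq[OF that(2)] by simp
      then show ?thesis
        using m that by (auto simp: real_distribution_def real_distribution_axioms_def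
            emeasure_density_const N.emeasure_eq_measure ennreal_mult'[symmetric] intro!: prob_spaceI)
    qed
    have ch: "char (density N (\<lambda>_. ennreal (1 / m))) t = (1 / m) *\<^sub>R Complex (LINT x|N. cos (t * x + 0)) (LINT x|N. cos (t * x + (- pi / 2)))"
      if N: "finite_measure N" and [measurable_cong]: "sets N = sets borel" for N :: "real measure" and t
    proof -
      interpret N: finite_measure N by fact
      have i: "integrable N (\<lambda>x. iexp (t * x))"
        by (rule N.integrable_const_bound[where B=1]) auto
      have "char (density N (\<lambda>_. ennreal (1 / m))) t = (1 / m) *\<^sub>R (CLINT x|N. iexp (t * x))"
        unfolding char_def using m by (subst integral_density) auto
      also have "(CLINT x|N. iexp (t * x)) = Complex (LINT x|N. cos (t * x + 0)) (LINT x|N. cos (t * x + (- pi / 2)))"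
        using integral_Re[OF i] integral_Im[OF i] by (simp add: complex_eq_iff Re_exp Im_exp cos_diff)
      finally show ?thesis .
    qed
    have "density N1 (\<lambda>_. ennreal (1 / m)) = density N2 (\<lambda>_. ennreal (1 / m))"
    proof (rule Levy_uniqueness)
      show "char (density N1 (\<lambda>_. ennreal (1 / m))) = char (density N2 (\<lambda>_. ennreal (1 / m)))"
        by (rule ext) (simp only: ch[OF assms(1) sets1] ch[OF assms(2) sets2] eq)
    qed (rule rd[OF assms(1) sets1 m_def[symmetric]], rule rd[OF assms(2) sets2 m2])
    then have "emeasure (density N1 (\<lambda>_. ennreal (1 / m))) A = emeasure (density N2 (\<lambda>_. ennreal (1 / m))) A" for A
      by simp
    then have "ennreal (1 / m) * emeasure N1 A = ennreal (1 / m) * emeasure N2 A" if "A \<in> sets borel" for A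
      using emeasure_density_const[of A N1 "ennreal (1 / m)"] emeasure_density_const[of A N2 "ennreal (1 / m)"] that
      by (simp only: sets1 sets2)
    then have "emeasure N1 A = emeasure N2 A" if "A \<in> sets borel" for A
      using that m by (subst (asm) ennreal_mult_cancel_left) auto
    then show ?thesis
      by (intro measure_eqI) (auto simp: sets1 sets2)
  qed
qed

text \<open>Because of the free phase \<open>\<phi>\<close>, the cosines alone carry the whole characteristic function.\<close>
definition trig_agree :: "'a measure \<Rightarrow> 'a measure \<Rightarrow> ('i \<Rightarrow> 'a \<Rightarrow> real) \<Rightarrow> 'i set \<Rightarrow> bool" where
  "trig_agree P Q X I \<longleftrightarrow> (\<forall>K a \<phi>. finite K \<longrightarrow> K \<subseteq> I \<longrightarrow>
    (LINT \<omega>|P. cos ((\<Sum>k\<in>K. a k * X k \<omega>) + \<phi>)) = (LINT \<omega>|Q. cos ((\<Sum>k\<in>K. a k * X k \<omega>) + \<phi>)))"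

text \<open>The nonnegative weight \<open>1 + cos\<close> makes each side an integral against a
  finite measure on the line, the image under \<open>X i\<close>. The cosine transform of that
  measure expands by the product formula into cosines of linear combinations of the family, on which
  \<open>P\<close> and \<open>Q\<close> agree; one-dimensional uniqueness then admits the
  indicator.\<close>

lemma trig_agree_weighted:
  fixes X :: "'i \<Rightarrow> 'a \<Rightarrow> real"
  assumes P: "finite_measure P" and Q: "finite_measure Q" and sets [measurable_cong]: "sets Q = sets P"
    and X: "\<And>i. i \<in> I \<Longrightarrow> X i \<in> borel_measurable P"
    and ag: "trig_agree P Q X I" and i: "i \<in> I" and B [measurable]: "B \<in> sets borel"
    and K: "finite K" "K \<subseteq> I"
  shows "(LINT \<omega>|P. indicator B (X i \<omega>) * (1 + cos ((\<Sum>k\<in>K. a k * X k \<omega>) + \<phi>)))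
       = (LINT \<omega>|Q. indicator B (X i \<omega>) * (1 + cos ((\<Sum>k\<in>K. a k * X k \<omega>) + \<phi>)))"
proof -
  interpret P: finite_measure P by fact
  interpret Q: finite_measure Q by fact
  define Y where "Y \<omega> = (\<Sum>k\<in>K. a k * X k \<omega>) + \<phi>" for \<omega>
  have [measurable]: "X i \<in> borel_measurable P" using X i .
  have Y [measurable]: "Y \<in> borel_measurable P"
    unfolding Y_def using X K by (intro borel_measurable_add borel_measurable_sum borel_measurable_times) auto
  define N where "N R = distr (density R (\<lambda>\<omega>. ennreal (1 + cos (Y \<omega>)))) borel (X i)" for R
  have nn: "1 + cos y \<ge> 0" for y :: real using cos_ge_minus_one[of y] by linarith
  have fin: "finite_measure (N R)" if R: "finite_measure R" and [measurable_cong]: "sets R = sets P" for R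
  proof -
    interpret R: finite_measure R by fact
    have "(\<integral>\<^sup>+ \<omega>. ennreal (1 + cos (Y \<omega>)) \<partial>R) \<le> (\<integral>\<^sup>+ \<omega>. ennreal 2 \<partial>R)"
      by (intro nn_integral_mono ennreal_leI) (use cos_le_one in \<open>simp add: add.commute\<close>)
    also have "\<dots> < \<infinity>" by (simp add: R.emeasure_eq_measure ennreal_mult_less_top)
    finally have "emeasure (density R (\<lambda>\<omega>. ennreal (1 + cos (Y \<omega>)))) (space R) < \<infinity>"
      by (simp add: emeasure_density cong: nn_integral_cong)
    then have "finite_measure (density R (\<lambda>\<omega>. ennreal (1 + cos (Y \<omega>))))"
      by (intro finite_measureI) auto
    then show ?thesis unfolding N_def by (intro finite_measure.finite_measure_distr) auto
  qed
  have intN: "(LINT x|N R. g x) = (LINT \<omega>|R. (1 + cos (Y \<omega>)) * g (X i \<omega>))"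
    if [measurable_cong]: "sets R = sets P" and [measurable]: "g \<in> borel_measurable borel" for R and g :: "real \<Rightarrow> real"
    unfolding N_def by (subst integral_distr, simp, simp, subst integral_density) (auto simp: nn)
  have trig: "(LINT \<omega>|R. (1 + cos (Y \<omega>)) * cos (t * X i \<omega> + \<psi>))
     = (LINT \<omega>|R. cos ((\<Sum>k\<in>{i}. t * X k \<omega>) + \<psi>))
      + (LINT \<omega>|R. cos ((\<Sum>k\<in>insert i K. ((if k \<in> K then a k else 0) + (if k = i then t else 0)) * X k \<omega>) + (\<phi> + \<psi>))) / 2
      + (LINT \<omega>|R. cos ((\<Sum>k\<in>insert i K. ((if k \<in> K then a k else 0) + (if k = i then - t else 0)) * X k \<omega>) + (\<phi> - \<psi>))) / 2"
    if R: "finite_measure R" and [measurable_cong]: "sets R = sets P" for R t \<psi>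
  proof -
    interpret R: finite_measure R by fact
    \<comment> \<open>The coefficients carry case distinctions because \<open>i\<close> may or may
      not already belong to \<open>K\<close>.\<close>
    have s: "(\<Sum>k\<in>insert i K. ((if k \<in> K then a k else 0) + (if k = i then t else 0)) * X k \<omega>)
        = (\<Sum>k\<in>K. a k * X k \<omega>) + t * X i \<omega>" for t \<omega>
    proof -
      have "(\<Sum>k\<in>insert i K. (if k \<in> K then a k else 0) * X k \<omega>) = (\<Sum>k\<in>K. a k * X k \<omega>)"
        using K by (intro sum.mono_neutral_cong_right) auto
      moreover have "(\<Sum>k\<in>insert i K. (if k = i then t else 0) * X k \<omega>) = (\<Sum>k\<in>{i}. t * X k \<omega>)"
        using K by (intro sum.mono_neutral_cong_right) auto
      ultimately show ?thesis by (simp add: sum.distrib distrib_right)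
    qed
    have p: "(1 + cos (Y \<omega>)) * cos (t * X i \<omega> + \<psi>)
      = cos (t * X i \<omega> + \<psi>) + cos (Y \<omega> + (t * X i \<omega> + \<psi>)) / 2 + cos (Y \<omega> - (t * X i \<omega> + \<psi>)) / 2" for \<omega>
      unfolding distrib_right cos_times_cos by (simp add: field_simps)
    have i: "integrable R (\<lambda>\<omega>. cos (Z \<omega>))" if [measurable]: "Z \<in> borel_measurable R" for Z :: "'a \<Rightarrow> real"
    proof (rule R.integrable_const_bound[where B=1])
      show "AE \<omega> in R. norm (cos (Z \<omega>)) \<le> 1" by (rule AE_I2) simp
    qed measurable
    have "(LINT \<omega>|R. (1 + cos (Y \<omega>)) * cos (t * X i \<omega> + \<psi>))
       = (LINT \<omega>|R. cos (t * X i \<omega> + \<psi>)) + (LINT \<omega>|R. cos (Y \<omega> + (t * X i \<omega> + \<psi>))) / 2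
         + (LINT \<omega>|R. cos (Y \<omega> - (t * X i \<omega> + \<psi>))) / 2"
      unfolding p by (simp add: i)
    also have "\<dots> = (LINT \<omega>|R. cos ((\<Sum>k\<in>{i}. t * X k \<omega>) + \<psi>))
      + (LINT \<omega>|R. cos ((\<Sum>k\<in>insert i K. ((if k \<in> K then a k else 0) + (if k = i then t else 0)) * X k \<omega>) + (\<phi> + \<psi>))) / 2
      + (LINT \<omega>|R. cos ((\<Sum>k\<in>insert i K. ((if k \<in> K then a k else 0) + (if k = i then - t else 0)) * X k \<omega>) + (\<phi> - \<psi>))) / 2"
      unfolding s Y_def by (simp add: algebra_simps)
    finally show ?thesis .
  qed
  have "N P = N Q"
  proof (rule finite_measure_eq_by_cos)
    fix t \<psi>
    have I: "finite (insert i K)" "insert i K \<subseteq> I" "finite {i}" "{i} \<subseteq> I" using K i by auto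
    have A: "(LINT \<omega>|P. cos ((\<Sum>k\<in>L. c k * X k \<omega>) + \<theta>)) = (LINT \<omega>|Q. cos ((\<Sum>k\<in>L. c k * X k \<omega>) + \<theta>))"
      if "finite L" "L \<subseteq> I" for L c \<theta> using ag that unfolding trig_agree_def by blast
    show "(LINT x|N P. cos (t * x + \<psi>)) = (LINT x|N Q. cos (t * x + \<psi>))"
    proof -
      have [measurable]: "(\<lambda>x. cos (t * x + \<psi>)) \<in> borel_measurable borel" by measurable
      show ?thesis
        by (subst intN[OF refl], measurable, subst intN[OF sets], measurable,
            simp only: trig[OF P refl] trig[OF Q sets] A[OF I(1,2)] A[OF I(3,4)])
    qed
  qed (use P Q sets fin in \<open>auto simp: N_def\<close>)
  have "(LINT \<omega>|P. (1 + cos (Y \<omega>)) * indicator B (X i \<omega>)) = (LINT x|N P. (indicator B x :: real))"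
    by (rule intN[OF refl, symmetric]) simp
  also have "\<dots> = (LINT x|N Q. (indicator B x :: real))" by (simp only: \<open>N P = N Q\<close>)
  also have "\<dots> = (LINT \<omega>|Q. (1 + cos (Y \<omega>)) * indicator B (X i \<omega>))"
    by (rule intN[OF sets]) simp
  finally show ?thesis unfolding Y_def by (simp only: mult.commute)
qed

text \<open>The bare cosine is recovered from the weight \<open>1 + cos\<close> by subtracting the
  case of an empty index set with phase \<pi>/2, in which the weight is identically 1.\<close>

lemma trig_agree_restrict:
  fixes X :: "'i \<Rightarrow> 'a \<Rightarrow> real"
  assumes P: "finite_measure P" and Q: "finite_measure Q" and sets [measurable_cong]: "sets Q = sets P"
    and X: "\<And>i. i \<in> I \<Longrightarrow> X i \<in> borel_measurable P"
    and ag: "trig_agree P Q X I" and i: "i \<in> I" and B [measurable]: "B \<in> sets borel"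
  shows "trig_agree (density P (\<lambda>\<omega>. indicator B (X i \<omega>))) (density Q (\<lambda>\<omega>. indicator B (X i \<omega>))) X I"
  unfolding trig_agree_def
proof (intro allI impI)
  fix K :: "'i set" and a \<phi> assume K: "finite K" "K \<subseteq> I"
  define Y where "Y \<omega> = (\<Sum>k\<in>K. a k * X k \<omega>) + \<phi>" for \<omega>
  have [measurable]: "X i \<in> borel_measurable P" using X i .
  have Y [measurable]: "Y \<in> borel_measurable P"
    unfolding Y_def using X K by (intro borel_measurable_add borel_measurable_sum borel_measurable_times) auto
  have d: "(LINT \<omega>|density R (\<lambda>\<omega>. indicator B (X i \<omega>)). cos (Y \<omega>))
      = (LINT \<omega>|R. indicator B (X i \<omega>) * (1 + cos (Y \<omega>))) - (LINT \<omega>|R. indicator B (X i \<omega>) * (1 + cos ((\<Sum>k\<in>{}. a k * X k \<omega>) + pi/2)))"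
    if R: "finite_measure R" and [measurable_cong]: "sets R = sets P" for R
  proof -
    interpret R: finite_measure R by fact
    have i: "integrable R (\<lambda>\<omega>. indicator B (X i \<omega>) :: real)"
      by (rule R.integrable_const_bound[where B=1]) (auto simp: indicator_def)
    have i2: "integrable R (\<lambda>\<omega>. indicator B (X i \<omega>) * cos (Y \<omega>) :: real)"
      by (rule R.integrable_const_bound[where B=1]) (auto simp: indicator_def)
    have "(LINT \<omega>|density R (\<lambda>\<omega>. indicator B (X i \<omega>)). cos (Y \<omega>)) = (LINT \<omega>|R. indicator B (X i \<omega>) * cos (Y \<omega>))"
      using integral_density[of "\<lambda>\<omega>. cos (Y \<omega>)" R "\<lambda>\<omega>. indicator B (X i \<omega>)"] by (simp add: ennreal_indicator)
    then show ?thesis by (simp add: distrib_left i i2)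
  qed
  show "(LINT \<omega>|density P (\<lambda>\<omega>. indicator B (X i \<omega>)). cos ((\<Sum>k\<in>K. a k * X k \<omega>) + \<phi>))
    = (LINT \<omega>|density Q (\<lambda>\<omega>. indicator B (X i \<omega>)). cos ((\<Sum>k\<in>K. a k * X k \<omega>) + \<phi>))"
    unfolding Y_def[symmetric] d[OF P refl] d[OF Q sets]
    unfolding Y_def
    by (intro arg_cong2[where f = "(-)"] trig_agree_weighted[OF P Q sets X ag i B] K) auto
qed

text \<open>One coordinate after another is restricted to \<open>X i \<in> A i\<close>. Agreement on
  cosines survives each restriction, so the induction varies the two measures, and uniqueness on the
  line suffices for joint laws.\<close>

lemma trig_agree_measure:
  fixes X :: "'i \<Rightarrow> 'a \<Rightarrow> real"
  assumes "finite J" "J \<subseteq> I"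
    and "finite_measure P" "finite_measure Q" "sets Q = sets P"
    and X: "\<And>i. i \<in> I \<Longrightarrow> X i \<in> borel_measurable P"
    and "trig_agree P Q X I" and A: "\<And>i. i \<in> J \<Longrightarrow> A i \<in> sets borel"
  shows "emeasure P {\<omega> \<in> space P. \<forall>i\<in>J. X i \<omega> \<in> A i} = emeasure Q {\<omega> \<in> space Q. \<forall>i\<in>J. X i \<omega> \<in> A i}"
  using assms
proof (induction J arbitrary: P Q rule: finite_induct)
  case empty
  interpret P: finite_measure P by fact
  interpret Q: finite_measure Q by fact
  \<comment> \<open>The empty sum with phase 0 compares the total masses.\<close>
  from empty(6)[unfolded trig_agree_def, rule_format, of "{}" undefined 0]
  show ?case by (simp add: P.emeasure_eq_measure Q.emeasure_eq_measure)
next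
  case (insert i J)
  have XJ: "X k \<in> borel_measurable P" if "k \<in> insert i J" for k
    using insert.prems(1) by (intro insert.prems(5)) (use that in blast)
  have [measurable]: "X i \<in> borel_measurable P" "A i \<in> sets borel"
    by (auto intro: XJ insert.prems(7))
  note [measurable_cong] = \<open>sets Q = sets P\<close>
  have [measurable]: "{\<omega> \<in> space P. \<forall>i\<in>J. X i \<omega> \<in> A i} \<in> sets P"
  proof (rule sets.sets_Collect_finite_All[OF _ insert.hyps(1)])
    fix k assume "k \<in> J"
    then have [measurable]: "X k \<in> borel_measurable P" "A k \<in> sets borel"
      by (auto intro: XJ insert.prems(7))
    show "{\<omega> \<in> space P. X k \<omega> \<in> A k} \<in> sets P" by measurable
  qed
  have sp: "space Q = space P" using \<open>sets Q = sets P\<close> by (rule sets_eq_imp_space_eq)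
  have fm: "finite_measure (density R (\<lambda>\<omega>. indicator (A i) (X i \<omega>)))" if R: "finite_measure R" and [measurable_cong]: "sets R = sets P" for R
  proof -
    interpret R: finite_measure R by fact
    have "(\<integral>\<^sup>+ \<omega>. indicator (A i) (X i \<omega>) \<partial>R) \<le> (\<integral>\<^sup>+ \<omega>. 1 \<partial>R)"
      by (intro nn_integral_mono) (auto simp: indicator_def)
    also have "\<dots> < \<infinity>" by (simp add: R.emeasure_eq_measure)
    finally show ?thesis by (intro finite_measureI) (auto simp: emeasure_density cong: nn_integral_cong)
  qed
  have e: "emeasure R {\<omega> \<in> space R. \<forall>k\<in>insert i J. X k \<omega> \<in> A k}
     = emeasure (density R (\<lambda>\<omega>. indicator (A i) (X i \<omega>))) {\<omega> \<in> space R. \<forall>i\<in>J. X i \<omega> \<in> A i}"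
    if [measurable_cong]: "sets R = sets P" for R
  proof -
    have [simp]: "space R = space P" using that by (rule sets_eq_imp_space_eq)
    have "emeasure (density R (\<lambda>\<omega>. indicator (A i) (X i \<omega>))) {\<omega> \<in> space R. \<forall>i\<in>J. X i \<omega> \<in> A i}
      = (\<integral>\<^sup>+ \<omega>. indicator {\<omega> \<in> space P. X i \<omega> \<in> A i \<and> (\<forall>i\<in>J. X i \<omega> \<in> A i)} \<omega> \<partial>R)"
      by (subst emeasure_density, measurable, intro nn_integral_cong) (auto simp: indicator_def)
    also have "\<dots> = emeasure R {\<omega> \<in> space P. X i \<omega> \<in> A i \<and> (\<forall>i\<in>J. X i \<omega> \<in> A i)}"
      by (intro nn_integral_indicator) measurable
    finally show ?thesis by simp
  qed
  have "trig_agree (density P (\<lambda>\<omega>. indicator (A i) (X i \<omega>))) (density Q (\<lambda>\<omega>. indicator (A i) (X i \<omega>))) X I"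
    by (rule trig_agree_restrict) (use insert.prems in \<open>auto\<close>)
  then have "emeasure (density P (\<lambda>\<omega>. indicator (A i) (X i \<omega>))) {\<omega> \<in> space (density P (\<lambda>\<omega>. indicator (A i) (X i \<omega>))). \<forall>i\<in>J. X i \<omega> \<in> A i}
     = emeasure (density Q (\<lambda>\<omega>. indicator (A i) (X i \<omega>))) {\<omega> \<in> space (density Q (\<lambda>\<omega>. indicator (A i) (X i \<omega>))). \<forall>i\<in>J. X i \<omega> \<in> A i}"
    using insert.prems(1,4)
    by (intro insert.IH fm[OF insert.prems(2) refl] fm[OF insert.prems(3,4)]) (auto intro: insert.prems(5,7))
  then have "emeasure (density P (\<lambda>\<omega>. indicator (A i) (X i \<omega>))) {\<omega> \<in> space P. \<forall>i\<in>J. X i \<omega> \<in> A i}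
     = emeasure (density Q (\<lambda>\<omega>. indicator (A i) (X i \<omega>))) {\<omega> \<in> space Q. \<forall>i\<in>J. X i \<omega> \<in> A i}"
    by simp
  then show ?case by (simp only: e[OF refl] e[OF \<open>sets Q = sets P\<close>])
qed

text \<open>Finite measures on a product space are determined by cylinders over finitely many
  coordinates. The index set may thus be uncountable, as it is for the family of all noise sets in a
  region.\<close>

lemma trig_agree_PiM:
  fixes X :: "'i \<Rightarrow> 'a \<Rightarrow> real"
  assumes P: "finite_measure P" and Q: "finite_measure Q" and sets: "sets Q = sets P"
    and X: "\<And>i. i \<in> I \<Longrightarrow> X i \<in> borel_measurable P"
    and ag: "trig_agree P Q X I"
  shows "distr P (PiM I (\<lambda>_. borel)) (\<lambda>\<omega>. \<lambda>i\<in>I. X i \<omega>) = distr Q (PiM I (\<lambda>_. borel)) (\<lambda>\<omega>. \<lambda>i\<in>I. X i \<omega>)"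
proof (rule measure_eqI_PiM_infinite)
  note [measurable_cong] = sets
  have Z [measurable]: "(\<lambda>\<omega>. \<lambda>i\<in>I. X i \<omega>) \<in> measurable P (PiM I (\<lambda>_. borel))"
    by (intro measurable_restrict X)
  show "finite_measure (distr P (PiM I (\<lambda>_. borel)) (\<lambda>\<omega>. \<lambda>i\<in>I. X i \<omega>))"
    by (rule finite_measure.finite_measure_distr[OF P Z])
  fix A J assume J: "finite J" "J \<subseteq> I" and A: "\<And>i. i \<in> J \<Longrightarrow> A i \<in> sets (borel :: real measure)"
  have e: "emeasure (distr R (PiM I (\<lambda>_. borel)) (\<lambda>\<omega>. \<lambda>i\<in>I. X i \<omega>)) (prod_emb I (\<lambda>_. borel) J (Pi\<^sub>E J A))
      = emeasure R {\<omega> \<in> space R. \<forall>i\<in>J. X i \<omega> \<in> A i}" if [measurable_cong]: "sets R = sets P" for R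
  proof -
    have [measurable]: "prod_emb I (\<lambda>_. borel) J (Pi\<^sub>E J A) \<in> sets (PiM I (\<lambda>_. borel :: real measure))"
      using J A by (intro sets_PiM_I) auto
    have "(\<lambda>\<omega>. \<lambda>i\<in>I. X i \<omega>) -` prod_emb I (\<lambda>_. borel) J (Pi\<^sub>E J A) \<inter> space R = {\<omega> \<in> space R. \<forall>i\<in>J. X i \<omega> \<in> A i}"
      using J by (auto simp: prod_emb_def PiE_iff) (metis subsetD)
    then show ?thesis by (subst emeasure_distr) auto
  qed
  show "emeasure (distr P (PiM I (\<lambda>_. borel)) (\<lambda>\<omega>. \<lambda>i\<in>I. X i \<omega>)) (prod_emb I (\<lambda>_. borel) J (Pi\<^sub>E J A))
      = emeasure (distr Q (PiM I (\<lambda>_. borel)) (\<lambda>\<omega>. \<lambda>i\<in>I. X i \<omega>)) (prod_emb I (\<lambda>_. borel) J (Pi\<^sub>E J A))"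
    unfolding e[OF refl] e[OF sets] using trig_agree_measure[OF J P Q sets X ag, of A] A by blast
qed auto

section \<open>Centred Gaussian variables and their translations\<close>

text \<open>The characteristic function is real, so the sine term of the addition formula integrates
  to 0. The degenerate law obeys the same formula with \<open>v = 0\<close>.\<close>

lemma (in prob_space) centered_gaussian_cos:
  assumes "centered_gaussian M X v"
  shows "expectation (\<lambda>\<omega>. cos (X \<omega> + \<phi>)) = exp (- v / 2) * cos \<phi>"
proof (cases "v = 0")
  case True
  with assms have "AE \<omega> in M. X \<omega> = 0" and [measurable]: "X \<in> borel_measurable M"
    by (auto simp: centered_gaussian_def)
  then have "expectation (\<lambda>\<omega>. cos (X \<omega> + \<phi>)) = expectation (\<lambda>\<omega>. cos \<phi>)"
    by (intro integral_cong_AE) (auto elim!: eventually_mono)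
  then show ?thesis using True by (simp add: prob_space)
next
  case False
  with assms have v: "v > 0" and X [measurable]: "X \<in> borel_measurable M"
    and D: "distributed M lborel X (\<lambda>z. ennreal (normal_density 0 (sqrt v) z))"
    by (auto simp: centered_gaussian_def)
  define Z where "Z \<omega> = (X \<omega> - 0) / sqrt v" for \<omega>
  have DZ: "distributed M lborel Z std_normal_density"
    using D v unfolding Z_def by (subst normal_standard_normal_convert[symmetric]) auto
  have XZ: "X \<omega> = sqrt v * Z \<omega>" for \<omega> using v by (simp add: Z_def)
  interpret S: prob_space std_normal_distribution by (rule prob_space_normal_density) simp
  have i: "integrable std_normal_distribution (\<lambda>x. iexp (sqrt v * x))"
    by (rule S.integrable_const_bound[where B=1]) auto
  have ch: "(CLINT x|std_normal_distribution. iexp (sqrt v * x)) = complex_of_real (exp (- v / 2))"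
    using fun_cong[OF char_std_normal_distribution, of "sqrt v"] v by (simp add: char_def)
  have c: "(LINT x|std_normal_distribution. cos (sqrt v * x)) = exp (- v / 2)"
    using integral_Re[OF i] unfolding ch by (simp add: Re_exp)
  have s: "(LINT x|std_normal_distribution. sin (sqrt v * x)) = 0"
    using integral_Im[OF i] unfolding ch by (simp add: Im_exp)
  have ic: "integrable std_normal_distribution (\<lambda>x. cos (sqrt v * x))"
    and isn: "integrable std_normal_distribution (\<lambda>x. sin (sqrt v * x))"
    by (rule S.integrable_const_bound[where B=1]; auto)+
  have "expectation (\<lambda>\<omega>. cos (X \<omega> + \<phi>)) = (LINT x|lborel. std_normal_density x * cos (sqrt v * x + \<phi>))"
    unfolding XZ by (rule distributed_integral[OF DZ, symmetric]) auto
  also have "\<dots> = (LINT x|std_normal_distribution. cos (sqrt v * x + \<phi>))"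
    by (subst integral_density) auto
  also have "\<dots> = (LINT x|std_normal_distribution. cos (sqrt v * x) * cos \<phi> - sin (sqrt v * x) * sin \<phi>)"
    by (simp add: cos_add)
  also have "\<dots> = exp (- v / 2) * cos \<phi>"
    by (subst Bochner_Integration.integral_diff) (use ic isn in \<open>auto simp: c s\<close>)
  finally show ?thesis .
qed

lemma (in prob_space) centered_gaussian_moments:
  assumes "centered_gaussian M X v"
  shows "expectation X = 0" "expectation (\<lambda>\<omega>. (X \<omega>)\<^sup>2) = v"
    "integrable M X" "integrable M (\<lambda>\<omega>. (X \<omega>)\<^sup>2)"
proof -
  have [measurable]: "X \<in> borel_measurable M" using assms by (simp add: centered_gaussian_def)
  have "expectation X = 0 \<and> expectation (\<lambda>\<omega>. (X \<omega>)\<^sup>2) = v \<and> integrable M X \<and> integrable M (\<lambda>\<omega>. (X \<omega>)\<^sup>2)"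
  proof (cases "v = 0")
    case True
    with assms have ae: "AE \<omega> in M. X \<omega> = 0" by (auto simp: centered_gaussian_def)
    then have ae2: "AE \<omega> in M. (X \<omega>)\<^sup>2 = 0" by auto
    have "integrable M X \<longleftrightarrow> integrable M (\<lambda>\<omega>. 0 :: real)" using ae by (intro integrable_cong_AE) auto
    moreover have "integrable M (\<lambda>\<omega>. (X \<omega>)\<^sup>2) \<longleftrightarrow> integrable M (\<lambda>\<omega>. 0 :: real)" using ae2 by (intro integrable_cong_AE) auto
    ultimately show ?thesis using ae ae2 True by (simp add: integral_eq_zero_AE)
  next
    case False
    with assms have v: "v > 0" and D: "distributed M lborel X (\<lambda>z. ennreal (normal_density 0 (sqrt v) z))"
      by (auto simp: centered_gaussian_def)
    have sv: "sqrt v > 0" using v by simp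
    have "expectation X = 0" by (rule normal_distributed_expectation[OF sv D])
    moreover have "expectation (\<lambda>\<omega>. (X \<omega>)\<^sup>2) = v"
      using normal_distributed_variance[OF sv D] \<open>expectation X = 0\<close> v by simp
    moreover have "integrable M X"
      using distributed_integrable[OF D, of "\<lambda>x. x"] integrable_normal_moment_nz_1[OF sv, of 0] by simp
    moreover have "integrable M (\<lambda>\<omega>. (X \<omega>)\<^sup>2)"
      using distributed_integrable[OF D, of "\<lambda>x. x\<^sup>2"] integrable_normal_moment[OF sv, of 0 2] by simp
    ultimately show ?thesis by simp
  qed
  then show "expectation X = 0" "expectation (\<lambda>\<omega>. (X \<omega>)\<^sup>2) = v"
    "integrable M X" "integrable M (\<lambda>\<omega>. (X \<omega>)\<^sup>2)" by auto
qed

text \<open>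
  The \<open>\<chi>\<^sup>2\<close>-distance of two normal densities is explicit, and it controls the \<open>L\<^sup>1\<close>-distance by the
  weighted AM-GM inequality \<open>2 \<bar>d\<bar> \<le> \<lambda> d\<^sup>2 / p + p / \<lambda>\<close>.
\<close>
lemma normal_density_translation_bound:
  assumes "s > 0"
  shows "(LINT x|lborel. \<bar>normal_density a s x - normal_density 0 s x\<bar>) \<le> 2 * \<bar>a\<bar> / s"
proof -
  note int = integrable_normal_density[OF assms] 
  define r where "r = \<bar>a\<bar> / s"
  have r0: "r \<ge> 0" using assms by (simp add: r_def)
  have i: "integrable lborel (\<lambda>x. \<bar>normal_density a s x - normal_density 0 s x\<bar>)"
    by (intro Bochner_Integration.integrable_abs Bochner_Integration.integrable_diff int)
  consider "r = 0" | "r \<ge> 1" | "0 < r" "r < 1" using r0 by linarith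
  then show ?thesis
  proof cases
    case 1
    then have "a = 0" using assms by (simp add: r_def)
    then show ?thesis by simp
  next
    case 2
    have "(LINT x|lborel. \<bar>normal_density a s x - normal_density 0 s x\<bar>)
        \<le> (LINT x|lborel. normal_density a s x + normal_density 0 s x)"
      by (intro integral_mono i Bochner_Integration.integrable_add int)
         (use normal_density_nonneg in \<open>auto simp: abs_le_iff\<close>)
    also have "\<dots> = 2" using assms by (simp add: int)
    finally show ?thesis using 2 by (simp add: r_def)
  next
    case 3
    \<comment> \<open>The \<chi>-square integrand: the square of the shifted density divided by the
      unshifted one is \<open>exp (r\<^sup>2)\<close> times the normal density centred at
      \<open>2 * a\<close>.\<close>
    define q where "q x = exp (r\<^sup>2) * normal_density (2 * a) s x - 2 * normal_density a s x + normal_density 0 s x" for x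
    have q: "q x * normal_density 0 s x = (normal_density a s x - normal_density 0 s x)\<^sup>2" for x
    proof -
      have "exp (r\<^sup>2) * (normal_density (2 * a) s x * normal_density 0 s x) = (normal_density a s x)\<^sup>2"
      proof -
        have e: "r\<^sup>2 + (- (x - 2 * a)\<^sup>2 / (2 * s\<^sup>2) + (- x\<^sup>2 / (2 * s\<^sup>2))) = (- (x - a)\<^sup>2 / (2 * s\<^sup>2)) + (- (x - a)\<^sup>2 / (2 * s\<^sup>2))"
          using assms by (simp add: r_def power_divide divide_simps) (simp add: power2_eq_square algebra_simps)
        have "exp (r\<^sup>2) * (exp (- (x - 2 * a)\<^sup>2 / (2 * s\<^sup>2)) * exp (- x\<^sup>2 / (2 * s\<^sup>2))) = exp (- (x - a)\<^sup>2 / (2 * s\<^sup>2)) * exp (- (x - a)\<^sup>2 / (2 * s\<^sup>2))"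
          unfolding exp_add[symmetric] e ..
        then show ?thesis
          unfolding normal_density_def power2_eq_square[of "1 / sqrt (2 * pi * s\<^sup>2) * exp (- (x - a)\<^sup>2 / (2 * s\<^sup>2))"]
          by (simp add: mult_ac)
      qed
      then show ?thesis by (simp add: q_def power2_eq_square algebra_simps)
    qed
    have iq: "integrable lborel q"
      unfolding q_def by (intro Bochner_Integration.integrable_add Bochner_Integration.integrable_diff integrable_mult_right int)
    have Iq: "(LINT x|lborel. q x) = exp (r\<^sup>2) - 1"
      unfolding q_def using assms by (simp add: int)
    \<comment> \<open>The weight is taken as 1/r, which balances
      \<open>(exp (r\<^sup>2) - 1) / r\<close> against \<open>r\<close>.\<close>
    have le: "\<bar>normal_density a s x - normal_density 0 s x\<bar> \<le> (q x / r + r * normal_density 0 s x) / 2" for x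
    proof -
      define p where "p = normal_density 0 s x"
      define d where "d = \<bar>normal_density a s x - normal_density 0 s x\<bar>"
      have p: "p > 0" unfolding p_def by (rule normal_density_pos[OF assms])
      have qd: "q x = d\<^sup>2 / p" using q[of x] p by (simp add: d_def p_def field_simps)
      have "0 \<le> (d - r * p)\<^sup>2 / (r * p)" using p 3 by simp
      also have "\<dots> = d\<^sup>2 / p / r + r * p - 2 * d"
        using p 3 by (simp add: power2_eq_square field_simps)
      finally have "d \<le> (q x / r + r * p) / 2" unfolding qd by simp
      then show ?thesis by (simp only: d_def p_def)
    qed
    have "(LINT x|lborel. \<bar>normal_density a s x - normal_density 0 s x\<bar>)
        \<le> (LINT x|lborel. (q x / r + r * normal_density 0 s x) / 2)"
      by (intro integral_mono i le integrable_divide Bochner_Integration.integrable_add iq integrable_mult_right int)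
    also have "\<dots> = ((exp (r\<^sup>2) - 1) / r + r) / 2"
      using assms by (simp add: iq int Iq)
    also have "\<dots> \<le> 2 * r"
    proof -
      have "exp (r\<^sup>2) \<le> 1 + r\<^sup>2 + (r\<^sup>2)\<^sup>2"
        using 3 by (intro exp_bound) (auto simp: power_le_one)
      also have "(r\<^sup>2)\<^sup>2 \<le> r\<^sup>2" using 3 by (simp add: power2_eq_square mult_le_one mult_left_le)
      finally have "exp (r\<^sup>2) - 1 \<le> 2 * r * r" by (simp add: power2_eq_square)
      then have "(exp (r\<^sup>2) - 1) / r \<le> 2 * r" using 3 by (simp add: divide_le_eq)
      then show ?thesis using 3 by simp
    qed
    finally show ?thesis by (simp add: r_def)
  qed
qed

text \<open>Shifting the argument by \<open>w\<close> amounts to shifting the Gaussian by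
  \<open>w / s\<close>. After this change of variables \<open>f\<close> appears as a common factor
  of modulus at most 1.\<close>

lemma (in prob_space) gaussian_translation_bound:
  fixes f :: "real \<Rightarrow> real"
  assumes g: "centered_gaussian M N v" and "v > 0" and "s \<noteq> 0"
    and [measurable]: "f \<in> borel_measurable borel" and f: "\<And>x. \<bar>f x\<bar> \<le> 1"
  shows "\<bar>(LINT n|distr M borel N. f (y + w + s * n)) - (LINT n|distr M borel N. f (y + s * n))\<bar>
     \<le> 2 * \<bar>w\<bar> / (\<bar>s\<bar> * sqrt v)"
proof -
  have [measurable]: "N \<in> borel_measurable M" using g by (simp add: centered_gaussian_def)
  have D: "distributed M lborel N (\<lambda>z. ennreal (normal_density 0 (sqrt v) z))"
    using g \<open>v > 0\<close> by (simp add: centered_gaussian_def)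
  have sv: "sqrt v > 0" using \<open>v > 0\<close> by simp
  define a where "a = w / s"
  have i: "integrable lborel (\<lambda>x. normal_density m (sqrt v) x * f (y + s * x))" for m
    by (rule Bochner_Integration.integrable_bound[OF integrable_normal_density[OF sv, of m]])
       (auto simp: abs_mult f mult_left_le)
  have 1: "(LINT n|distr M borel N. f (y + w + s * n)) = (LINT x|lborel. normal_density a (sqrt v) x * f (y + s * x))"
  proof -
    have "(LINT n|distr M borel N. f (y + w + s * n)) = expectation (\<lambda>\<omega>. f (y + w + s * N \<omega>))"
      by (rule integral_distr) auto
    also have "\<dots> = (LINT x|lborel. normal_density 0 (sqrt v) x * f (y + w + s * x))"
      by (rule distributed_integral[OF D, symmetric]) auto
    also have "\<dots> = (LINT x|lborel. normal_density a (sqrt v) (a + x) * f (y + s * (a + x)))"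
      using \<open>s \<noteq> 0\<close> by (simp add: normal_density_def a_def distrib_left add.assoc)
    also have "\<dots> = (LINT x|lborel. normal_density a (sqrt v) x * f (y + s * x))"
      by (rule lborel_integral_translate) simp
    finally show ?thesis .
  qed
  have 2: "(LINT n|distr M borel N. f (y + s * n)) = (LINT x|lborel. normal_density 0 (sqrt v) x * f (y + s * x))"
    by (subst integral_distr, simp, simp, rule distributed_integral[OF D, symmetric]) auto
  have "\<bar>(LINT n|distr M borel N. f (y + w + s * n)) - (LINT n|distr M borel N. f (y + s * n))\<bar>
    = \<bar>LINT x|lborel. normal_density a (sqrt v) x * f (y + s * x) - normal_density 0 (sqrt v) x * f (y + s * x)\<bar>"
    unfolding 1 2 by (simp add: i)
  also have "\<dots> \<le> (LINT x|lborel. \<bar>normal_density a (sqrt v) x - normal_density 0 (sqrt v) x\<bar>)"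
  proof (rule abs_integral_le)
    show "\<bar>normal_density a (sqrt v) x * f (y + s * x) - normal_density 0 (sqrt v) x * f (y + s * x)\<bar>
        \<le> \<bar>normal_density a (sqrt v) x - normal_density 0 (sqrt v) x\<bar>" for x
      unfolding left_diff_distrib[symmetric] by (simp add: abs_mult f mult_left_le)
  qed (intro Bochner_Integration.integrable_abs Bochner_Integration.integrable_diff i integrable_normal_density[OF sv])+
  also have "\<dots> \<le> 2 * \<bar>a\<bar> / sqrt v" by (rule normal_density_translation_bound[OF sv])
  also have "\<dots> = 2 * \<bar>w\<bar> / (\<bar>s\<bar> * sqrt v)" by (simp add: a_def abs_divide)
  finally show ?thesis .
qed

section \<open>White noise\<close>

text \<open>Indexed by regions rather than times: for one coordinate of the final vector the
  independent information is the past together with the noise near all other points, which no time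
  interval describes.\<close>

definition noise_sigma :: "'a measure \<Rightarrow> ((real \<times> real) set \<Rightarrow> 'a \<Rightarrow> real) \<Rightarrow> (real \<times> real) set \<Rightarrow> 'a measure" where
  "noise_sigma M W S = sigma (space M)
    ({W A -` B \<inter> space M | A B. A \<in> noise_sets \<and> A \<subseteq> S \<and> B \<in> sets borel} \<union> null_sets M)"

lemma noise_filtration_eq: "noise_filtration M W t = noise_sigma M W ({0..t} \<times> {0..1})"
  by (simp add: noise_filtration_def noise_sigma_def)

locale noise_space = prob_space M for M :: "'a measure" +
  fixes W :: "(real \<times> real) set \<Rightarrow> 'a \<Rightarrow> real"
  assumes wn: "white_noise M W"
begin

lemma gaussian_sum:
  assumes "finite J" and "\<And>j. j \<in> J \<Longrightarrow> A j \<in> noise_sets"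
  shows "centered_gaussian M (\<lambda>\<omega>. \<Sum>j\<in>J. c j * W (A j) \<omega>)
    (\<Sum>i\<in>J. \<Sum>j\<in>J. c i * c j * measure lborel (A i \<inter> A j))"
proof -
  obtain p where p: "bij_betw p {..<card J} J"
    using ex_bij_betw_nat_finite[OF assms(1)] by (auto simp: atLeast0LessThan)
  have "centered_gaussian M (\<lambda>\<omega>. \<Sum>i<card J. c (p i) * W (A (p i)) \<omega>)
        (\<Sum>i<card J. \<Sum>j<card J. c (p i) * c (p j) * measure lborel (A (p i) \<inter> A (p j)))"
    using wn assms(2) p unfolding white_noise_def by (auto dest: bij_betwE)
  moreover have "(\<Sum>i<card J. c (p i) * W (A (p i)) \<omega>) = (\<Sum>j\<in>J. c j * W (A j) \<omega>)" for \<omega>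
    by (rule sum.reindex_bij_betw[OF p])
  moreover have "(\<Sum>i<card J. \<Sum>j<card J. c (p i) * c (p j) * measure lborel (A (p i) \<inter> A (p j)))
     = (\<Sum>i\<in>J. \<Sum>j\<in>J. c i * c j * measure lborel (A i \<inter> A j))"
  proof -
    have "(\<Sum>i<card J. \<Sum>j<card J. c (p i) * c (p j) * measure lborel (A (p i) \<inter> A (p j)))
       = (\<Sum>i<card J. \<Sum>j\<in>J. c (p i) * c j * measure lborel (A (p i) \<inter> A j))"
      by (intro sum.cong refl sum.reindex_bij_betw[OF p])
    also have "\<dots> = (\<Sum>i\<in>J. \<Sum>j\<in>J. c i * c j * measure lborel (A i \<inter> A j))"
      by (rule sum.reindex_bij_betw[OF p])
    finally show ?thesis .
  qed
  ultimately show ?thesis by simp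
qed

lemma gaussian_W: "A \<in> noise_sets \<Longrightarrow> centered_gaussian M (W A) (measure lborel A)"
  using gaussian_sum[of "{()}" "\<lambda>_. A" "\<lambda>_. 1"] by simp

lemma W_measurable: "A \<in> noise_sets \<Longrightarrow> W A \<in> borel_measurable M"
  using gaussian_W by (auto simp: centered_gaussian_def)

lemma noise_generator_subset:
  "{W A -` B \<inter> space M |A B. A \<in> noise_sets \<and> A \<subseteq> S \<and> B \<in> sets borel} \<union> null_sets M \<subseteq> sets M"
  by (auto intro: measurable_sets[OF W_measurable])

lemma noise_generator_Pow:
  "{W A -` B \<inter> space M |A B. A \<in> noise_sets \<and> A \<subseteq> S \<and> B \<in> sets borel} \<union> null_sets M \<subseteq> Pow (space M)"
  using noise_generator_subset sets.space_closed by (rule order_trans)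

lemma space_noise_sigma [simp]: "space (noise_sigma M W S) = space M"
  by (simp add: noise_sigma_def space_measure_of_conv)

lemma sets_noise_sigma: "sets (noise_sigma M W S) = sigma_sets (space M)
    ({W A -` B \<inter> space M |A B. A \<in> noise_sets \<and> A \<subseteq> S \<and> B \<in> sets borel} \<union> null_sets M)"
  unfolding noise_sigma_def by (rule sets_measure_of[OF noise_generator_Pow])

lemma sets_noise_sigma_subset: "sets (noise_sigma M W S) \<subseteq> sets M"
  unfolding sets_noise_sigma by (rule sets.sigma_sets_subset[OF noise_generator_subset])

lemma noise_sigma_subalgebra: "subalgebra M (noise_sigma M W S)"
  by (simp add: subalgebra_def sets_noise_sigma_subset)

lemma W_noise_sigma_measurable:
  assumes "A \<in> noise_sets" "A \<subseteq> S" shows "W A \<in> borel_measurable (noise_sigma M W S)"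
  by (rule measurableI) (use assms in \<open>auto simp: sets_noise_sigma intro!: sigma_sets.Basic\<close>)

lemma noise_sigma_measurable_mono:
  assumes "f \<in> measurable (noise_sigma M W S) N" "S \<subseteq> T"
  shows "f \<in> measurable (noise_sigma M W T) N"
proof -
  have "sets (noise_sigma M W S) \<subseteq> sets (noise_sigma M W T)"
    unfolding sets_noise_sigma by (rule sigma_sets_mono') (use assms(2) in auto)
  then show ?thesis using assms(1) by (auto simp: measurable_def)
qed

lemma noise_sigma_measurable_M: "f \<in> measurable (noise_sigma M W S) N \<Longrightarrow> f \<in> measurable M N"
  by (rule measurable_from_subalg[OF noise_sigma_subalgebra])

section \<open>Independence of the noise on disjoint regions\<close>

text \<open>Disjointness from \<open>S\<close> makes all mixed covariances vanish, so the variance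
  of \<open>Y0 + t * N\<close> is the sum of the variances and the exponential factorises. Products
  of cosines are reduced to this case by the sum formula.\<close>

lemma trig_factor:
  fixes R :: "'j \<Rightarrow> (real \<times> real) set" and c :: "'j \<Rightarrow> real" and a :: "(real \<times> real) set \<Rightarrow> real" and \<phi> :: real
  assumes J: "finite J" "\<And>j. j \<in> J \<Longrightarrow> R j \<in> noise_sets \<and> R j \<inter> S = {}"
    and K: "finite K" "\<And>A. A \<in> K \<Longrightarrow> A \<in> noise_sets \<and> A \<subseteq> S"
  defines "N \<equiv> \<lambda>\<omega>. \<Sum>j\<in>J. c j * W (R j) \<omega>" and "Y \<equiv> \<lambda>\<omega>. (\<Sum>A\<in>K. a A * W A \<omega>) + \<phi>"
  shows "expectation (\<lambda>\<omega>. cos (Y \<omega>) * cos (t * N \<omega> + \<psi>)) = expectation (\<lambda>\<omega>. cos (Y \<omega>)) * expectation (\<lambda>\<omega>. cos (t * N \<omega> + \<psi>))"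
proof -
  define Y0 where "Y0 \<omega> = (\<Sum>A\<in>K. a A * W A \<omega>)" for \<omega>
  define vY where "vY = (\<Sum>A\<in>K. \<Sum>B\<in>K. a A * a B * measure lborel (A \<inter> B))"
  define vN where "vN = (\<Sum>i\<in>J. \<Sum>j\<in>J. c i * c j * measure lborel (R i \<inter> R j))"
  have gY: "centered_gaussian M Y0 vY"
    unfolding Y0_def vY_def by (rule gaussian_sum) (use K in auto)
  have gN: "centered_gaussian M (\<lambda>\<omega>. t * N \<omega>) (t\<^sup>2 * vN)" for t
    using gaussian_sum[OF J(1), of R "\<lambda>j. t * c j"] J(2)
    by (simp add: N_def vN_def sum_distrib_left power2_eq_square mult_ac)
  have gZ: "centered_gaussian M (\<lambda>\<omega>. Y0 \<omega> + t * N \<omega>) (vY + t\<^sup>2 * vN)" for t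
  proof -
    have z: "measure lborel (A \<inter> R j) = 0" "measure lborel (R j \<inter> A) = 0" if "A \<in> K" "j \<in> J" for A j
    proof -
      have "A \<inter> R j = {}" "R j \<inter> A = {}" using J(2)[OF that(2)] K(2)[OF that(1)] by auto
      then show "measure lborel (A \<inter> R j) = 0" "measure lborel (R j \<inter> A) = 0" by simp_all
    qed
    define D where "D = case_sum (\<lambda>A. A) R"
    define e where "e = case_sum a (\<lambda>j. t * c j)"
    have "centered_gaussian M (\<lambda>\<omega>. \<Sum>j\<in>K <+> J. e j * W (D j) \<omega>)
      (\<Sum>i\<in>K <+> J. \<Sum>j\<in>K <+> J. e i * e j * measure lborel (D i \<inter> D j))"
      by (rule gaussian_sum) (use J K in \<open>auto simp: D_def\<close>)
    moreover have "(\<Sum>j\<in>K <+> J. e j * W (D j) \<omega>) = Y0 \<omega> + t * N \<omega>" for \<omega>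
      using J(1) K(1) by (simp add: sum.Plus D_def e_def Y0_def N_def sum_distrib_left mult_ac)
    moreover have "(\<Sum>i\<in>K <+> J. \<Sum>j\<in>K <+> J. e i * e j * measure lborel (D i \<inter> D j)) = vY + t\<^sup>2 * vN"
      using J(1) K(1)
      by (simp add: sum.Plus D_def e_def sum.distrib z vY_def vN_def sum_distrib_left power2_eq_square mult_ac)
    ultimately show ?thesis by simp
  qed
  note cg = centered_gaussian_cos
  have [measurable]: "Y0 \<in> borel_measurable M" "N \<in> borel_measurable M"
    using gY gN[of 1] by (auto simp: centered_gaussian_def)
  have i: "integrable M (\<lambda>\<omega>. cos (Z \<omega>))" if "Z \<in> borel_measurable M" for Z :: "'a \<Rightarrow> real"
    by (rule integrable_const_bound[where B=1]) (use that in auto)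
  have "cos (Y \<omega>) * cos (t * N \<omega> + \<psi>)
      = cos ((Y0 \<omega> + (-t) * N \<omega>) + (\<phi> - \<psi>)) / 2 + cos ((Y0 \<omega> + t * N \<omega>) + (\<phi> + \<psi>)) / 2" for \<omega>
    unfolding cos_times_cos Y_def Y0_def by (simp add: algebra_simps add_divide_distrib)
  then have "expectation (\<lambda>\<omega>. cos (Y \<omega>) * cos (t * N \<omega> + \<psi>))
    = expectation (\<lambda>\<omega>. cos ((Y0 \<omega> + (-t) * N \<omega>) + (\<phi> - \<psi>))) / 2 + expectation (\<lambda>\<omega>. cos ((Y0 \<omega> + t * N \<omega>) + (\<phi> + \<psi>))) / 2"
    by (simp add: i)
  also have "\<dots> = exp (- (vY + t\<^sup>2 * vN) / 2) * ((cos (\<phi> - \<psi>) + cos (\<phi> + \<psi>)) / 2)"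
    unfolding cg[OF gZ] by (simp add: distrib_left add_divide_distrib)
  also have "\<dots> = (exp (- vY / 2) * cos \<phi>) * (exp (- (t\<^sup>2 * vN) / 2) * cos \<psi>)"
  proof -
    have "exp (- (vY + t\<^sup>2 * vN) / 2) = exp (- vY / 2) * exp (- (t\<^sup>2 * vN) / 2)"
      by (simp add: exp_add[symmetric] diff_divide_distrib)
    moreover have "(cos (\<phi> - \<psi>) + cos (\<phi> + \<psi>)) / 2 = cos \<phi> * cos \<psi>"
      using cos_times_cos[of \<phi> \<psi>] by simp
    ultimately show ?thesis by (simp only: mult_ac)
  qed
  also have "\<dots> = expectation (\<lambda>\<omega>. cos (Y0 \<omega> + \<phi>)) * expectation (\<lambda>\<omega>. cos (t * N \<omega> + \<psi>))"
    unfolding cg[OF gY] cg[OF gN] ..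
  finally show ?thesis by (simp add: Y_def Y0_def)
qed

text \<open>With \<open>Y\<close> fixed, the images under \<open>N\<close> of the measures with
  density \<open>1 + cos Y\<close> and with its mean \<open>m\<close> have the same cosine
  transforms and therefore coincide. Testing them on \<open>B\<close> replaces the cosine of
  \<open>N\<close> by an indicator.\<close>

lemma trig_factor_indicator:
  fixes R :: "'j \<Rightarrow> (real \<times> real) set" and c :: "'j \<Rightarrow> real" and a :: "(real \<times> real) set \<Rightarrow> real" and \<phi> :: real
  assumes J: "finite J" "\<And>j. j \<in> J \<Longrightarrow> R j \<in> noise_sets \<and> R j \<inter> S = {}"
    and K: "finite K" "\<And>A. A \<in> K \<Longrightarrow> A \<in> noise_sets \<and> A \<subseteq> S"
    and B: "B \<in> sets borel"
  defines "N \<equiv> \<lambda>\<omega>. \<Sum>j\<in>J. c j * W (R j) \<omega>" and "Y \<equiv> \<lambda>\<omega>. (\<Sum>A\<in>K. a A * W A \<omega>) + \<phi>"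
  shows "expectation (\<lambda>\<omega>. indicator B (N \<omega>) * cos (Y \<omega>)) = expectation (\<lambda>\<omega>. indicator B (N \<omega>)) * expectation (\<lambda>\<omega>. cos (Y \<omega>))"
proof -
  have [measurable]: "N \<in> borel_measurable M" "Y \<in> borel_measurable M" "B \<in> sets borel"
    unfolding N_def Y_def using J K B by (auto intro!: borel_measurable_sum borel_measurable_add borel_measurable_times W_measurable)
  have nn: "1 + cos y \<ge> 0" for y :: real using cos_ge_minus_one[of y] by linarith
  define m where "m = expectation (\<lambda>\<omega>. 1 + cos (Y \<omega>))"
  have m0: "m \<ge> 0" unfolding m_def by (rule Bochner_Integration.integral_nonneg) (rule nn)
  have ic: "integrable M (\<lambda>\<omega>. cos (Z \<omega>))" if "Z \<in> borel_measurable M" for Z :: "'a \<Rightarrow> real"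
    by (rule integrable_const_bound[where B=1]) (use that in auto)
  define D where "D g = distr (density M (\<lambda>\<omega>. ennreal (g \<omega>))) borel N" for g
  have fm: "finite_measure (D g)" if "\<And>\<omega>. g \<omega> \<le> C" and [measurable]: "g \<in> borel_measurable M" for g C
  proof -
    have "(\<integral>\<^sup>+ \<omega>. ennreal (g \<omega>) \<partial>M) \<le> (\<integral>\<^sup>+ \<omega>. ennreal C \<partial>M)"
      by (intro nn_integral_mono ennreal_leI that(1))
    also have "\<dots> < \<infinity>" by (simp add: emeasure_space_1)
    finally have "finite_measure (density M (\<lambda>\<omega>. ennreal (g \<omega>)))"
      by (intro finite_measureI) (simp add: emeasure_density cong: nn_integral_cong)
    then show ?thesis unfolding D_def by (intro finite_measure.finite_measure_distr) auto
  qed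
  have ID: "(LINT x|D g. f x) = expectation (\<lambda>\<omega>. g \<omega> * f (N \<omega>))"
    if "\<And>\<omega>. g \<omega> \<ge> 0" and [measurable]: "g \<in> borel_measurable M" "f \<in> borel_measurable borel" for g and f :: "real \<Rightarrow> real"
    unfolding D_def by (subst integral_distr, simp, simp, subst integral_density) (auto simp: that)
  have "D (\<lambda>\<omega>. 1 + cos (Y \<omega>)) = D (\<lambda>_. m)"
  proof (rule finite_measure_eq_by_cos)
    show "finite_measure (D (\<lambda>\<omega>. 1 + cos (Y \<omega>)))"
      by (rule fm[of _ 2]) (use cos_le_one in \<open>auto simp: add.commute\<close>)
    show "finite_measure (D (\<lambda>_. m))" by (rule fm[of _ m]) auto
    fix t \<psi>
    have i2: "integrable M (\<lambda>\<omega>. cos (Y \<omega>) * cos (t * N \<omega> + \<psi>))"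
      by (rule integrable_const_bound[where B=1]) (auto simp: abs_mult mult_le_one)
    have "(LINT x|D (\<lambda>\<omega>. 1 + cos (Y \<omega>)). cos (t * x + \<psi>)) = expectation (\<lambda>\<omega>. (1 + cos (Y \<omega>)) * cos (t * N \<omega> + \<psi>))"
      by (rule ID) (auto intro: nn)
    also have "\<dots> = m * expectation (\<lambda>\<omega>. cos (t * N \<omega> + \<psi>))"
    proof -
      have "expectation (\<lambda>\<omega>. cos (Y \<omega>) * cos (t * N \<omega> + \<psi>)) = expectation (\<lambda>\<omega>. cos (Y \<omega>)) * expectation (\<lambda>\<omega>. cos (t * N \<omega> + \<psi>))"
        unfolding N_def Y_def by (rule trig_factor[where R = R and S = S, OF J K])
      then show ?thesis
        unfolding distrib_right by (simp add: ic i2 m_def prob_space distrib_right)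
    qed
    also have "\<dots> = (LINT x|D (\<lambda>_. m). cos (t * x + \<psi>))"
      by (subst ID) (auto simp: m0)
    finally show "(LINT x|D (\<lambda>\<omega>. 1 + cos (Y \<omega>)). cos (t * x + \<psi>)) = (LINT x|D (\<lambda>_. m). cos (t * x + \<psi>))" .
  qed (auto simp: D_def)
  then have "(LINT x|D (\<lambda>\<omega>. 1 + cos (Y \<omega>)). (indicator B x :: real)) = (LINT x|D (\<lambda>_. m). indicator B x)" by simp
  then have eq: "expectation (\<lambda>\<omega>. (1 + cos (Y \<omega>)) * indicator B (N \<omega>)) = expectation (\<lambda>\<omega>. m * indicator B (N \<omega>))"
    using ID[of "\<lambda>\<omega>. 1 + cos (Y \<omega>)" "indicator B"] ID[of "\<lambda>_. m" "indicator B"] nn m0 by (simp del: integral_indicator)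
  have iB: "integrable M (\<lambda>\<omega>. indicator B (N \<omega>) :: real)"
    by (rule integrable_const_bound[where B=1]) (auto simp: indicator_def)
  have iBY: "integrable M (\<lambda>\<omega>. cos (Y \<omega>) * indicator B (N \<omega>) :: real)"
    by (rule integrable_const_bound[where B=1]) (auto simp: indicator_def)
  have "expectation (\<lambda>\<omega>. indicator B (N \<omega>)) + expectation (\<lambda>\<omega>. cos (Y \<omega>) * indicator B (N \<omega>))
      = expectation (\<lambda>\<omega>. (1 + cos (Y \<omega>)) * indicator B (N \<omega>))"
    unfolding distrib_right by (subst Bochner_Integration.integral_add) (use iB iBY in auto)
  also have "\<dots> = (1 + expectation (\<lambda>\<omega>. cos (Y \<omega>))) * expectation (\<lambda>\<omega>. indicator B (N \<omega>))"
    unfolding eq by (simp add: m_def ic prob_space del: integral_indicator)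
  finally show ?thesis by (simp add: algebra_simps del: integral_indicator)
qed

text \<open>Induction over the generated sigma-algebra: every event is a measurable condition on the
  whole family of noise values. The equivalence holds almost surely because the generators include
  the null sets.\<close>

lemma noise_sigma_PiM:
  assumes "C \<in> sets (noise_sigma M W S)"
  defines "I \<equiv> {A \<in> noise_sets. A \<subseteq> S}"
  shows "\<exists>D \<in> sets (PiM I (\<lambda>_. borel :: real measure)). AE \<omega> in M. \<omega> \<in> C \<longleftrightarrow> (\<lambda>A\<in>I. W A \<omega>) \<in> D"
  using assms(1) unfolding sets_noise_sigma
proof (induction rule: sigma_sets.induct)
  case (Basic C)
  then consider A B where "C = W A -` B \<inter> space M" "A \<in> I" "B \<in> sets borel" | "C \<in> null_sets M"
    by (auto simp: I_def)
  then show ?case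
  proof cases
    case 1
    then have "(\<lambda>x. x A) -` B \<inter> space (PiM I (\<lambda>_. borel :: real measure)) \<in> sets (PiM I (\<lambda>_. borel :: real measure))"
      by (intro measurable_sets[where A=borel] measurable_component_singleton) auto
    then show ?thesis
      by (rule bexI[rotated]) (use 1 in \<open>auto simp: space_PiM\<close>)
  next
    case 2
    then have "AE \<omega> in M. \<omega> \<notin> C" by (rule AE_not_in)
    then show ?thesis by (intro bexI[of _ "{}"]) auto
  qed
next
  case Empty
  then show ?case by (intro bexI[of _ "{}"]) auto
next
  case (Compl C)
  then obtain D where D: "D \<in> sets (PiM I (\<lambda>_. borel :: real measure))" "AE \<omega> in M. \<omega> \<in> C \<longleftrightarrow> (\<lambda>A\<in>I. W A \<omega>) \<in> D"
    by blast
  have "AE \<omega> in M. \<omega> \<in> space M - C \<longleftrightarrow> (\<lambda>A\<in>I. W A \<omega>) \<in> space (PiM I (\<lambda>_. borel :: real measure)) - D"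
    using D(2) AE_space by eventually_elim (auto simp: space_PiM)
  moreover have "space (PiM I (\<lambda>_. borel :: real measure)) - D \<in> sets (PiM I (\<lambda>_. borel :: real measure))"
    using D(1) by (rule sets.compl_sets)
  ultimately show ?case by blast
next
  case (Union C)
  have "\<exists>D. \<forall>i. D i \<in> sets (PiM I (\<lambda>_. borel :: real measure)) \<and> (AE \<omega> in M. \<omega> \<in> C i \<longleftrightarrow> (\<lambda>A\<in>I. W A \<omega>) \<in> D i)"
    by (rule choice) (use Union.IH in blast)
  then obtain D where D: "\<And>i. D i \<in> sets (PiM I (\<lambda>_. borel :: real measure))"
    "\<And>i. AE \<omega> in M. \<omega> \<in> C i \<longleftrightarrow> (\<lambda>A\<in>I. W A \<omega>) \<in> D i" by blast
  have "AE \<omega> in M. \<forall>i. \<omega> \<in> C i \<longleftrightarrow> (\<lambda>A\<in>I. W A \<omega>) \<in> D i"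
    using D(2) by (simp add: AE_all_countable)
  then have "AE \<omega> in M. \<omega> \<in> (\<Union>i. C i) \<longleftrightarrow> (\<lambda>A\<in>I. W A \<omega>) \<in> (\<Union>i. D i)"
    by eventually_elim auto
  moreover have "(\<Union>i. D i) \<in> sets (PiM I (\<lambda>_. borel :: real measure))"
    using D(1) by (intro sets.countable_UN) blast
  ultimately show ?case by blast
qed

text \<open>The event for \<open>N\<close> is turned into the density of a measure \<open>P\<close>,
  to be compared with the multiple \<open>Q\<close> of \<open>M\<close> by its probability. They
  agree on cosines of noise values in \<open>S\<close> by factorisation, hence on the law of the
  whole family, hence on \<open>C\<close>.\<close>

lemma noise_independent_sets:
  fixes R :: "'j \<Rightarrow> (real \<times> real) set" and c :: "'j \<Rightarrow> real"
  assumes J: "finite J" "\<And>j. j \<in> J \<Longrightarrow> R j \<in> noise_sets \<and> R j \<inter> S = {}"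
    and B [measurable]: "B \<in> sets borel" and C: "C \<in> sets (noise_sigma M W S)"
  defines "N \<equiv> \<lambda>\<omega>. \<Sum>j\<in>J. c j * W (R j) \<omega>"
  shows "prob (C \<inter> (N -` B \<inter> space M)) = prob C * prob (N -` B \<inter> space M)"
proof -
  define I where "I = {A \<in> noise_sets. A \<subseteq> S}"
  define Z where "Z \<omega> = (\<lambda>A\<in>I. W A \<omega>)" for \<omega>
  have [measurable]: "N \<in> borel_measurable M"
    unfolding N_def using J by (auto intro!: borel_measurable_sum borel_measurable_times W_measurable)
  have WI: "\<And>A. A \<in> I \<Longrightarrow> W A \<in> borel_measurable M" by (auto simp: I_def W_measurable)
  have [measurable]: "Z \<in> measurable M (PiM I (\<lambda>_. borel))"
    unfolding Z_def by (intro measurable_restrict WI)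
  have [measurable]: "C \<in> sets M" using C sets_noise_sigma_subset by auto
  define b where "b = prob (N -` B \<inter> space M)"
  have bE: "expectation (\<lambda>\<omega>. indicator B (N \<omega>)) = b"
  proof -
    have "expectation (\<lambda>\<omega>. indicator B (N \<omega>) :: real) = expectation (indicator (N -` B \<inter> space M))"
      by (rule Bochner_Integration.integral_cong) (auto simp: indicator_def)
    then show ?thesis by (simp add: b_def)
  qed
  define P where "P = density M (\<lambda>\<omega>. ennreal (indicator B (N \<omega>)))"
  define Q where "Q = density M (\<lambda>\<omega>. ennreal b)"
  have b: "0 \<le> b" "b \<le> 1" by (auto simp: b_def)
  have fP: "finite_measure P"
  proof (rule finite_measureI)
    have "emeasure P (space P) = (\<integral>\<^sup>+\<omega>. ennreal (indicator B (N \<omega>)) \<partial>M)"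
      unfolding P_def by (simp add: emeasure_density cong: nn_integral_cong)
    also have "\<dots> \<le> (\<integral>\<^sup>+\<omega>. 1 \<partial>M)" by (intro nn_integral_mono) (auto simp: indicator_def)
    also have "\<dots> < \<infinity>" by (simp add: emeasure_space_1)
    finally show "emeasure P (space P) \<noteq> \<infinity>" by simp
  qed
  have fQ: "finite_measure Q"
    by (rule finite_measureI) (simp add: Q_def emeasure_density_const emeasure_space_1)
  have "distr P (PiM I (\<lambda>_. borel)) (\<lambda>\<omega>. \<lambda>A\<in>I. W A \<omega>) = distr Q (PiM I (\<lambda>_. borel)) (\<lambda>\<omega>. \<lambda>A\<in>I. W A \<omega>)"
  proof (rule trig_agree_PiM[OF fP fQ])
    show "trig_agree P Q W I"
      unfolding trig_agree_def
    proof (intro allI impI)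
      fix K :: "(real \<times> real) set set" and a \<phi> assume K: "finite K" "K \<subseteq> I"
      then have K': "\<And>A. A \<in> K \<Longrightarrow> A \<in> noise_sets \<and> A \<subseteq> S" by (auto simp: I_def)
      define Y where "Y \<omega> = (\<Sum>A\<in>K. a A * W A \<omega>) + \<phi>" for \<omega>
      have [measurable]: "Y \<in> borel_measurable M"
        unfolding Y_def using K' by (auto intro!: borel_measurable_sum borel_measurable_add borel_measurable_times W_measurable)
      have "(LINT \<omega>|P. cos (Y \<omega>)) = expectation (\<lambda>\<omega>. indicator B (N \<omega>) * cos (Y \<omega>))"
        unfolding P_def by (subst integral_density) auto
      also have "\<dots> = b * expectation (\<lambda>\<omega>. cos (Y \<omega>))"
        unfolding bE[symmetric] N_def Y_def by (rule trig_factor_indicator[where R = R and S = S, OF J K(1) K' B])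
      also have "\<dots> = (LINT \<omega>|Q. cos (Y \<omega>))"
        unfolding Q_def using b by (subst integral_density) auto
      finally show "(LINT \<omega>|P. cos ((\<Sum>k\<in>K. a k * W k \<omega>) + \<phi>)) = (LINT \<omega>|Q. cos ((\<Sum>k\<in>K. a k * W k \<omega>) + \<phi>))"
        by (simp add: Y_def)
    qed
  qed (auto simp: P_def Q_def WI)
  then have eq: "distr P (PiM I (\<lambda>_. borel)) Z = distr Q (PiM I (\<lambda>_. borel)) Z" by (simp add: Z_def[abs_def])
  obtain D where D [measurable]: "D \<in> sets (PiM I (\<lambda>_. borel :: real measure))" and ae: "AE \<omega> in M. \<omega> \<in> C \<longleftrightarrow> Z \<omega> \<in> D"
    using noise_sigma_PiM[OF C] unfolding Z_def I_def by blast
  have "emeasure (distr P (PiM I (\<lambda>_. borel)) Z) D = emeasure P (Z -` D \<inter> space M)"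
    by (subst emeasure_distr) (auto simp: P_def)
  also have "\<dots> = (\<integral>\<^sup>+\<omega>. ennreal (indicator B (N \<omega>)) * indicator (Z -` D \<inter> space M) \<omega> \<partial>M)"
    unfolding P_def by (rule emeasure_density) auto
  also have "\<dots> = (\<integral>\<^sup>+\<omega>. indicator (C \<inter> (N -` B \<inter> space M)) \<omega> \<partial>M)"
    by (rule nn_integral_cong_AE) (use ae AE_space in \<open>eventually_elim, auto simp: indicator_def\<close>)
  also have "\<dots> = ennreal (prob (C \<inter> (N -` B \<inter> space M)))"
    by (simp add: emeasure_eq_measure)
  finally have 1: "emeasure (distr P (PiM I (\<lambda>_. borel)) Z) D = ennreal (prob (C \<inter> (N -` B \<inter> space M)))" .
  have "emeasure (distr Q (PiM I (\<lambda>_. borel)) Z) D = emeasure Q (Z -` D \<inter> space M)"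
    by (subst emeasure_distr) (auto simp: Q_def)
  also have "\<dots> = ennreal b * emeasure M (Z -` D \<inter> space M)"
    unfolding Q_def by (rule emeasure_density_const) measurable
  also have "emeasure M (Z -` D \<inter> space M) = emeasure M C"
    by (rule emeasure_eq_AE) (use ae AE_space in \<open>eventually_elim, auto\<close>)
  finally have 2: "emeasure (distr Q (PiM I (\<lambda>_. borel)) Z) D = ennreal (b * prob C)"
    using b by (simp add: emeasure_eq_measure ennreal_mult)
  from 1 2 eq have "ennreal (prob (C \<inter> (N -` B \<inter> space M))) = ennreal (b * prob C)" by simp
  then show ?thesis using b by (simp add: b_def mult.commute)
qed

end

context noise_space
begin

lemma Int_stable_vimage: "Int_stable {f -` A \<inter> \<Omega> |A. A \<in> sets N}"
proof (rule Int_stableI)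
  fix a b assume "a \<in> {f -` A \<inter> \<Omega> |A. A \<in> sets N}" "b \<in> {f -` A \<inter> \<Omega> |A. A \<in> sets N}"
  then obtain A B where "A \<in> sets N" "B \<in> sets N" "a = f -` A \<inter> \<Omega>" "b = f -` B \<inter> \<Omega>" by blast
  then have "a \<inter> b = f -` (A \<inter> B) \<inter> \<Omega>" "A \<inter> B \<in> sets N" by auto
  then show "a \<inter> b \<in> {f -` A \<inter> \<Omega> |A. A \<in> sets N}" by blast
qed

lemma noise_independent:
  fixes R :: "'j \<Rightarrow> (real \<times> real) set" and c :: "'j \<Rightarrow> real" and Y :: "'a \<Rightarrow> real"
  assumes J: "finite J" "\<And>j. j \<in> J \<Longrightarrow> R j \<in> noise_sets \<and> R j \<inter> S = {}"
    and Y: "Y \<in> borel_measurable (noise_sigma M W S)"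
  defines "N \<equiv> \<lambda>\<omega>. \<Sum>j\<in>J. c j * W (R j) \<omega>"
  shows "indep_var borel Y borel N"
  unfolding indep_var_eq
proof (intro conjI indep_set_sigma_sets)
  have [measurable]: "N \<in> borel_measurable M"
    unfolding N_def using J by (auto intro!: borel_measurable_sum borel_measurable_times W_measurable)
  have [measurable]: "Y \<in> borel_measurable M" by (rule noise_sigma_measurable_M[OF Y])
  show "N \<in> borel_measurable M" "Y \<in> borel_measurable M" by measurable
  show "Int_stable {Y -` A \<inter> space M |A. A \<in> sets borel}"
    by (rule Int_stable_vimage)
  show "Int_stable {N -` A \<inter> space M |A. A \<in> sets borel}"
    by (rule Int_stable_vimage)
  show "indep_set {Y -` A \<inter> space M |A. A \<in> sets borel} {N -` A \<inter> space M |A. A \<in> sets borel}"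
    unfolding indep_sets2_eq
  proof (intro conjI ballI)
    show "{Y -` A \<inter> space M |A. A \<in> sets borel} \<subseteq> events" "{N -` A \<inter> space M |A. A \<in> sets borel} \<subseteq> events" by auto
    fix C D assume C: "C \<in> {Y -` A \<inter> space M |A. A \<in> sets borel}" and "D \<in> {N -` A \<inter> space M |A. A \<in> sets borel}"
    then obtain B where B: "D = N -` B \<inter> space M" "B \<in> sets borel" by auto
    have "C \<in> sets (noise_sigma M W S)" using C measurable_sets[OF Y] by auto
    then show "prob (C \<inter> D) = prob C * prob D"
      unfolding B(1) N_def using noise_independent_sets[where R = R and c = c, OF J B(2)] by simp
  qed
qed

lemma noise_independent_expectation:
  fixes R :: "'j \<Rightarrow> (real \<times> real) set" and c :: "'j \<Rightarrow> real" and Y :: "'a \<Rightarrow> real" and g :: "real \<Rightarrow> real"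
  assumes J: "finite J" "\<And>j. j \<in> J \<Longrightarrow> R j \<in> noise_sets \<and> R j \<inter> S = {}"
    and Y: "Y \<in> borel_measurable (noise_sigma M W S)" "integrable M Y"
  defines "N \<equiv> \<lambda>\<omega>. \<Sum>j\<in>J. c j * W (R j) \<omega>"
  assumes g: "g \<in> borel_measurable borel" "integrable M (\<lambda>\<omega>. g (N \<omega>))"
  shows "expectation (\<lambda>\<omega>. Y \<omega> * g (N \<omega>)) = expectation Y * expectation (\<lambda>\<omega>. g (N \<omega>))"
    and "integrable M (\<lambda>\<omega>. Y \<omega> * g (N \<omega>))"
proof -
  have "indep_var borel ((\<lambda>x. x) \<circ> Y) borel (g \<circ> N)"
    unfolding N_def by (rule indep_var_compose[OF noise_independent[where R = R and c = c, OF J Y(1)] measurable_ident_sets[OF refl] g(1)])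
  then have i: "indep_var borel Y borel (\<lambda>\<omega>. g (N \<omega>))" by (simp add: comp_def)
  show "expectation (\<lambda>\<omega>. Y \<omega> * g (N \<omega>)) = expectation Y * expectation (\<lambda>\<omega>. g (N \<omega>))"
    by (rule indep_var_lebesgue_integral[OF i Y(2) g(2)])
  show "integrable M (\<lambda>\<omega>. Y \<omega> * g (N \<omega>))"
    by (rule indep_var_integrable[OF i Y(2) g(2)])
qed

text \<open>Keeping the sample point itself as first component turns conditioning on the noise in
  \<open>S\<close> into an iterated integral over a product measure.\<close>

lemma noise_product_distr:
  fixes R :: "'j \<Rightarrow> (real \<times> real) set" and c :: "'j \<Rightarrow> real"
  assumes J: "finite J" "\<And>j. j \<in> J \<Longrightarrow> R j \<in> noise_sets \<and> R j \<inter> S = {}"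
  defines "N \<equiv> \<lambda>\<omega>. \<Sum>j\<in>J. c j * W (R j) \<omega>"
  shows "distr M (noise_sigma M W S) (\<lambda>\<omega>. \<omega>) \<Otimes>\<^sub>M distr M borel N
    = distr M (noise_sigma M W S \<Otimes>\<^sub>M borel) (\<lambda>\<omega>. (\<omega>, N \<omega>))"
proof (rule pair_measure_eqI)
  have NM: "N \<in> borel_measurable M"
    unfolding N_def using J by (auto intro!: borel_measurable_sum borel_measurable_times W_measurable)
  have id [measurable]: "(\<lambda>\<omega>. \<omega>) \<in> measurable M (noise_sigma M W S)"
    by (rule noise_sigma_measurable_M[where S = S]) simp
  show "sigma_finite_measure (distr M (noise_sigma M W S) (\<lambda>\<omega>. \<omega>))"
    by (rule prob_space_imp_sigma_finite) (rule prob_space_distr[OF id])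
  show "sigma_finite_measure (distr M borel N)"
    by (rule prob_space_imp_sigma_finite) (rule prob_space_distr[OF NM])
  show "sets (distr M (noise_sigma M W S) (\<lambda>\<omega>. \<omega>) \<Otimes>\<^sub>M distr M borel N)
      = sets (distr M (noise_sigma M W S \<Otimes>\<^sub>M borel) (\<lambda>\<omega>. (\<omega>, N \<omega>)))"
    by (simp only: sets_distr sets_pair_measure_cong[OF sets_distr sets_distr])
  fix C B assume C: "C \<in> sets (distr M (noise_sigma M W S) (\<lambda>\<omega>. \<omega>))" and B: "B \<in> sets (distr M borel N)"
  then have C': "C \<in> sets (noise_sigma M W S)" and B': "B \<in> sets borel" by (simp_all only: sets_distr)
  have "emeasure (distr M (noise_sigma M W S \<Otimes>\<^sub>M borel) (\<lambda>\<omega>. (\<omega>, N \<omega>))) (C \<times> B)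
      = emeasure M ((\<lambda>\<omega>. (\<omega>, N \<omega>)) -` (C \<times> B) \<inter> space M)"
    by (rule emeasure_distr[OF measurable_Pair[OF id NM] pair_measureI[OF C' B']])
  also have "(\<lambda>\<omega>. (\<omega>, N \<omega>)) -` (C \<times> B) \<inter> space M = C \<inter> (N -` B \<inter> space M)" by auto
  also have "emeasure M \<dots> = ennreal (prob C * prob (N -` B \<inter> space M))"
    unfolding emeasure_eq_measure N_def using noise_independent_sets[where R = R and c = c, OF J B' C'] by simp
  also have "\<dots> = emeasure (distr M (noise_sigma M W S) (\<lambda>\<omega>. \<omega>)) C * emeasure (distr M borel N) B"
  proof -
    have "emeasure (distr M (noise_sigma M W S) (\<lambda>\<omega>. \<omega>)) C = emeasure M ((\<lambda>\<omega>. \<omega>) -` C \<inter> space M)"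
      by (rule emeasure_distr[OF id C'])
    also have "(\<lambda>\<omega>. \<omega>) -` C \<inter> space M = C" using sets.sets_into_space[OF C'] by auto
    finally show ?thesis
      by (simp only: emeasure_distr[OF NM B'] emeasure_eq_measure ennreal_mult[OF measure_nonneg measure_nonneg])
  qed
  finally show "emeasure (distr M (noise_sigma M W S) (\<lambda>\<omega>. \<omega>)) C * emeasure (distr M borel N) B
    = emeasure (distr M (noise_sigma M W S \<Otimes>\<^sub>M borel) (\<lambda>\<omega>. (\<omega>, N \<omega>))) (C \<times> B)" ..
qed

text \<open>Once the first component is fixed, \<open>Y\<close> and \<open>s\<close> are constants
  and a scalar Gaussian moves along \<open>e\<close>. The one-dimensional bound applies at each
  sample point, and \<open>s \<ge> \<kappa>\<close> makes it uniform.\<close>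

lemma noise_translation_bound:
  fixes R :: "'j \<Rightarrow> (real \<times> real) set" and c :: "'j \<Rightarrow> real" and f :: "'b::euclidean_space \<Rightarrow> real"
  assumes J: "finite J" "\<And>j. j \<in> J \<Longrightarrow> R j \<in> noise_sets \<and> R j \<inter> S = {}"
  defines "N \<equiv> \<lambda>\<omega>. \<Sum>j\<in>J. c j * W (R j) \<omega>"
  assumes g: "centered_gaussian M N v" and "v > 0" and "\<kappa> > 0"
    and Y [measurable]: "Y \<in> borel_measurable (noise_sigma M W S)"
    and s [measurable]: "s \<in> borel_measurable (noise_sigma M W S)" and sk: "\<And>\<omega>. s \<omega> \<ge> \<kappa>"
    and f [measurable]: "f \<in> borel_measurable borel" and f1: "\<And>x. \<bar>f x\<bar> \<le> 1"
  shows "\<bar>expectation (\<lambda>\<omega>. f (Y \<omega> + (s \<omega> * N \<omega>) *\<^sub>R e + w *\<^sub>R e)) - expectation (\<lambda>\<omega>. f (Y \<omega> + (s \<omega> * N \<omega>) *\<^sub>R e))\<bar>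
    \<le> 2 * \<bar>w\<bar> / (\<kappa> * sqrt v)"
proof -
  define F where "F = noise_sigma M W S"
  define D where "D = distr M F (\<lambda>\<omega>. \<omega>)"
  have [measurable]: "N \<in> borel_measurable M" using g by (simp add: centered_gaussian_def)
  have id [measurable]: "(\<lambda>\<omega>. \<omega>) \<in> measurable M F" unfolding F_def
    by (rule noise_sigma_measurable_M[where S = S]) simp
  note [measurable] = Y[folded F_def] s[folded F_def]
  interpret D: prob_space D unfolding D_def by (rule prob_space_distr) measurable
  interpret N: prob_space "distr M borel N" by (rule prob_space_distr) measurable
  interpret DN: pair_prob_space D "distr M borel N" ..
  have [measurable_cong]: "sets D = sets F" by (simp add: D_def)
  \<comment> \<open>The summand 0 plays the role of \<open>y\<close> in the one-dimensional
    translation bound.\<close>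
  have E: "expectation (\<lambda>\<omega>. f (Y \<omega> + (s \<omega> * N \<omega>) *\<^sub>R e + w *\<^sub>R e))
     = (LINT \<omega>|D. LINT n|distr M borel N. f (Y \<omega> + (0 + w + s \<omega> * n) *\<^sub>R e))" for w
  proof -
    define g where "g z = f (Y (fst z) + (0 + w + s (fst z) * snd z) *\<^sub>R e)" for z
    have [measurable]: "g \<in> borel_measurable (F \<Otimes>\<^sub>M borel)" unfolding g_def by measurable
    have "Y \<omega> + (s \<omega> * N \<omega>) *\<^sub>R e + w *\<^sub>R e = Y \<omega> + (0 + w + s \<omega> * N \<omega>) *\<^sub>R e" for \<omega>
      by (simp add: scaleR_add_left add_ac)
    then have "expectation (\<lambda>\<omega>. f (Y \<omega> + (s \<omega> * N \<omega>) *\<^sub>R e + w *\<^sub>R e)) = expectation (\<lambda>\<omega>. g (\<omega>, N \<omega>))"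
      by (simp only: g_def fst_conv snd_conv)
    also have "\<dots> = (LINT z|distr M (F \<Otimes>\<^sub>M borel) (\<lambda>\<omega>. (\<omega>, N \<omega>)). g z)"
      by (rule integral_distr[symmetric]) measurable
    also have "distr M (F \<Otimes>\<^sub>M borel) (\<lambda>\<omega>. (\<omega>, N \<omega>)) = D \<Otimes>\<^sub>M distr M borel N"
      unfolding D_def F_def N_def by (rule noise_product_distr[where R = R and c = c, OF J, symmetric])
    also have "(LINT z|(D \<Otimes>\<^sub>M distr M borel N). g z) = (LINT \<omega>|D. LINT n|distr M borel N. g (\<omega>, n))"
    proof (rule DN.integral_fst'[symmetric])
      show "integrable (D \<Otimes>\<^sub>M distr M borel N) g"
      proof (rule DN.integrable_const_bound[where B=1])
        show "AE z in D \<Otimes>\<^sub>M distr M borel N. norm (g z) \<le> 1" by (rule AE_I2) (simp add: g_def f1)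
      qed measurable
    qed
    also have "\<dots> = (LINT \<omega>|D. LINT n|distr M borel N. f (Y \<omega> + (0 + w + s \<omega> * n) *\<^sub>R e))"
      by (simp only: g_def fst_conv snd_conv)
    finally show ?thesis .
  qed
  have bd: "\<bar>(LINT n|distr M borel N. f (Y \<omega> + (0 + w + s \<omega> * n) *\<^sub>R e))\<bar> \<le> 1" for \<omega> w
  proof -
    have "\<bar>(LINT n|distr M borel N. f (Y \<omega> + (0 + w + s \<omega> * n) *\<^sub>R e))\<bar> \<le> (LINT n|distr M borel N. 1)"
      by (rule abs_integral_le) (auto intro!: N.integrable_const_bound[where B=1] simp: f1)
    also have "(LINT n|distr M borel N. 1) = (1 :: real)" using N.prob_space by simp
    finally show ?thesis .
  qed
  have i: "integrable D (\<lambda>\<omega>. LINT n|distr M borel N. f (Y \<omega> + (0 + w + s \<omega> * n) *\<^sub>R e))" for w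
  proof (rule D.integrable_const_bound[where B=1])
    show "AE \<omega> in D. norm (LINT n|distr M borel N. f (Y \<omega> + (0 + w + s \<omega> * n) *\<^sub>R e)) \<le> 1"
      by (rule AE_I2) (simp only: real_norm_def bd)
    show "(\<lambda>\<omega>. LINT n|distr M borel N. f (Y \<omega> + (0 + w + s \<omega> * n) *\<^sub>R e)) \<in> borel_measurable D"
      by measurable
  qed
  have "\<bar>expectation (\<lambda>\<omega>. f (Y \<omega> + (s \<omega> * N \<omega>) *\<^sub>R e + w *\<^sub>R e)) - expectation (\<lambda>\<omega>. f (Y \<omega> + (s \<omega> * N \<omega>) *\<^sub>R e + 0 *\<^sub>R e))\<bar>
    = \<bar>LINT \<omega>|D. (LINT n|distr M borel N. f (Y \<omega> + (0 + w + s \<omega> * n) *\<^sub>R e)) - (LINT n|distr M borel N. f (Y \<omega> + (0 + 0 + s \<omega> * n) *\<^sub>R e))\<bar>"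
    unfolding E by (subst Bochner_Integration.integral_diff[OF i i]) simp
  also have "\<dots> \<le> (LINT \<omega>|D. 2 * \<bar>w\<bar> / (\<kappa> * sqrt v))"
  proof (rule abs_integral_le)
    fix \<omega>
    have [measurable]: "(\<lambda>r. f (Y \<omega> + r *\<^sub>R e)) \<in> borel_measurable borel" by measurable
    have s0: "s \<omega> > 0" using sk[of \<omega>] \<open>\<kappa> > 0\<close> by linarith
    have "\<bar>(LINT n|distr M borel N. f (Y \<omega> + (0 + w + s \<omega> * n) *\<^sub>R e)) - (LINT n|distr M borel N. f (Y \<omega> + (0 + s \<omega> * n) *\<^sub>R e))\<bar>
      \<le> 2 * \<bar>w\<bar> / (\<bar>s \<omega>\<bar> * sqrt v)"
      using s0 by (intro gaussian_translation_bound[OF g \<open>v > 0\<close>, where f = "\<lambda>r. f (Y \<omega> + r *\<^sub>R e)"]) (auto simp: f1)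
    also have "\<dots> \<le> 2 * \<bar>w\<bar> / (\<kappa> * sqrt v)"
      using s0 sk[of \<omega>] \<open>\<kappa> > 0\<close> \<open>v > 0\<close> by (intro divide_left_mono mult_right_mono mult_pos_pos) auto
    finally show "\<bar>(LINT n|distr M borel N. f (Y \<omega> + (0 + w + s \<omega> * n) *\<^sub>R e)) - (LINT n|distr M borel N. f (Y \<omega> + (0 + 0 + s \<omega> * n) *\<^sub>R e))\<bar> \<le> 2 * \<bar>w\<bar> / (\<kappa> * sqrt v)"
      by simp
  qed (rule Bochner_Integration.integrable_diff[OF i i], rule D.integrable_const)
  also have "\<dots> = 2 * \<bar>w\<bar> / (\<kappa> * sqrt v)" using D.prob_space by simp
  finally show ?thesis by (simp only: scaleR_zero_left add_0_right)
qed

end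

lemma noise_sets_measurable: "A \<in> noise_sets \<Longrightarrow> A \<in> sets borel"
  by (simp add: noise_sets_def)

lemma noise_sets_subset: "A \<in> noise_sets \<Longrightarrow> B \<in> sets borel \<Longrightarrow> B \<subseteq> A \<Longrightarrow> B \<in> noise_sets"
  unfolding noise_sets_def using emeasure_mono[of B A lborel] by (auto intro: le_less_trans)

lemma noise_sets_Int: "A \<in> noise_sets \<Longrightarrow> B \<in> sets borel \<Longrightarrow> A \<inter> B \<in> noise_sets"
  by (rule noise_sets_subset[of A]) (auto simp: noise_sets_measurable)

lemma noise_sets_finite: "A \<in> noise_sets \<Longrightarrow> emeasure lborel A < \<infinity>"
  by (simp add: noise_sets_def)

lemma integrable_indicator_noise:
  "A \<in> noise_sets \<Longrightarrow> integrable lborel (indicator A :: real \<times> real \<Rightarrow> real)"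
  by (auto simp: noise_sets_def)

context noise_space
begin

section \<open>The isometry for simple integrals\<close>

text \<open>Additivity is a consequence of the covariance: the defect is a centred Gaussian whose
  variance works out as 0.\<close>

lemma W_split:
  assumes A: "A \<in> noise_sets" and H: "H \<in> sets borel"
  shows "AE \<omega> in M. W A \<omega> = W (A \<inter> H) \<omega> + W (A - H) \<omega>"
proof -
  have s: "A \<inter> H \<in> noise_sets" "A - H \<in> noise_sets"
    using A H by (auto intro!: noise_sets_subset[OF A] simp: noise_sets_measurable)
  define R where "R j = (if j = 0 then A else if j = 1 then A \<inter> H else A - H)" for j :: nat
  define c where "c j = (if j = 0 then 1 else - 1 :: real)" for j :: nat
  have m: "measure lborel A = measure lborel (A \<inter> H) + measure lborel (A - H)"
    using measure_Un2[of A lborel "A \<inter> H"] A noise_sets_measurable[OF A] noise_sets_measurable[OF s(1)] noise_sets_finite[OF A] 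
      measure_Union[of lborel "A \<inter> H" "A - H"] noise_sets_finite[OF s(1)] noise_sets_finite[OF s(2)] noise_sets_measurable[OF s(2)]
    by (auto simp: Int_Diff_Un less_top[symmetric])
  have "centered_gaussian M (\<lambda>\<omega>. \<Sum>j\<in>{0,1,2}. c j * W (R j) \<omega>)
    (\<Sum>i\<in>{0,1,2}. \<Sum>j\<in>{0,1,2}. c i * c j * measure lborel (R i \<inter> R j))"
    by (rule gaussian_sum) (use A s in \<open>auto simp: R_def\<close>)
  moreover have "(\<Sum>i\<in>{0,1,2}. \<Sum>j\<in>{0,1,2}. c i * c j * measure lborel (R i \<inter> R j)) = 0"
  proof -
    have e: "A \<inter> (A \<inter> H) = A \<inter> H" "A \<inter> H \<inter> A = A \<inter> H" "A \<inter> (A - H) = A - H" "(A - H) \<inter> A = A - H"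
      "A \<inter> H \<inter> (A - H) = {}" "(A - H) \<inter> (A \<inter> H) = {}" by auto
    show ?thesis by (simp add: R_def c_def e m)
  qed
  ultimately have "AE \<omega> in M. (\<Sum>j\<in>{0,1,2}. c j * W (R j) \<omega>) = 0"
    by (simp add: centered_gaussian_def)
  then show ?thesis by eventually_elim (simp add: R_def c_def)
qed

text \<open>The support is any noise set after time \<open>r\<close>, not just a rectangle. Level
  sets of a simple function and pieces cut off by a half-plane then qualify as well.\<close>

definition simple_term :: "real \<Rightarrow> (real \<times> real) set \<Rightarrow> ('a \<Rightarrow> real) \<Rightarrow> bool" where
  "simple_term r R X \<longleftrightarrow> 0 \<le> r \<and> R \<in> noise_sets \<and> R \<subseteq> {r<..} \<times> UNIV \<and>
    X \<in> borel_measurable (noise_filtration M W r) \<and> (\<exists>B. \<forall>\<omega>\<in>space M. \<bar>X \<omega>\<bar> \<le> B)"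

lemma simple_term_measurable: "simple_term r R X \<Longrightarrow> X \<in> borel_measurable M"
  unfolding simple_term_def noise_filtration_eq by (auto intro: noise_sigma_measurable_M)

lemma left_half_plane_borel: "{..t :: real} \<times> (UNIV :: real set) \<in> sets borel"
  by (intro borel_closed closed_Times closed_atMost closed_UNIV)

text \<open>The piece after \<open>t\<close> may be regarded as starting at \<open>max r t\<close>,
  because \<open>X\<close> stays measurable for the larger filtration.\<close>

lemma simple_term_split:
  assumes "simple_term r R X" "t \<ge> 0"
  shows "simple_term r (R \<inter> ({..t} \<times> UNIV)) X" "simple_term (max r t) (R - ({..t} \<times> UNIV)) X"
proof -
  have R: "R \<in> noise_sets" "R \<subseteq> {r<..} \<times> UNIV" "0 \<le> r" and bX: "\<exists>B. \<forall>\<omega>\<in>space M. \<bar>X \<omega>\<bar> \<le> B"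
    and XF: "X \<in> borel_measurable (noise_filtration M W r)"
    using assms(1) unfolding simple_term_def by blast+
  have "{0..r} \<times> {0..1 :: real} \<subseteq> {0..max r t} \<times> {0..1}" by auto
  then have X: "X \<in> borel_measurable (noise_filtration M W (max r t))"
    using XF unfolding noise_filtration_eq by (rule noise_sigma_measurable_mono[rotated])
  have 1: "R \<inter> ({..t} \<times> UNIV) \<in> noise_sets" by (rule noise_sets_Int[OF R(1) left_half_plane_borel])
  have 2: "R - ({..t} \<times> UNIV) \<in> noise_sets"
    by (rule noise_sets_subset[OF R(1) sets.Diff[OF noise_sets_measurable[OF R(1)] left_half_plane_borel]]) blast
  have 3: "R \<inter> ({..t} \<times> UNIV) \<subseteq> {r<..} \<times> UNIV" using R(2) by blast
  have 4: "R - ({..t} \<times> UNIV) \<subseteq> {max r t<..} \<times> UNIV" using R(2) by auto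
  show "simple_term r (R \<inter> ({..t} \<times> UNIV)) X"
    unfolding simple_term_def using R(3) 1 3 XF bX by blast
  have "0 \<le> max r t" using R(3) by simp
  then show "simple_term (max r t) (R - ({..t} \<times> UNIV)) X"
    unfolding simple_term_def using 2 4 X bX by blast
qed

text \<open>Only \<open>R\<close> reaches back before the later starting time \<open>r'\<close>. Its
  early part joins the past factors and is orthogonal to \<open>W R'\<close>; its late part and
  \<open>W R'\<close> are jointly Gaussian and independent of the past, and polarisation extracts
  their covariance.\<close>

lemma simple_term_pair:
  assumes 1: "simple_term r R X" and 2: "simple_term r' R' X'" and "r \<le> r'"
  shows "integrable M (\<lambda>\<omega>. (X \<omega> * W R \<omega>) * (X' \<omega> * W R' \<omega>)) \<and>
    expectation (\<lambda>\<omega>. (X \<omega> * W R \<omega>) * (X' \<omega> * W R' \<omega>)) = expectation (\<lambda>\<omega>. X \<omega> * X' \<omega>) * measure lborel (R \<inter> R')"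
proof -
  define S where "S = {0..r'} \<times> {0..1 :: real}"
  define H where "H = {..r'} \<times> (UNIV :: real set)"
  have H: "H \<in> sets borel" unfolding H_def by (rule left_half_plane_borel)
  define R1 where "R1 = R \<inter> H"
  define R2 where "R2 = R - H"
  have ns: "R \<in> noise_sets" "R' \<in> noise_sets" and Rsub: "R' \<subseteq> {r'<..} \<times> UNIV"
    using 1 2 unfolding simple_term_def by blast+
  have R01: "R \<subseteq> {0..} \<times> {0..1}" using ns(1) unfolding noise_sets_def by blast
  have R1: "R1 \<in> noise_sets" "R1 \<subseteq> S"
    using noise_sets_Int[OF ns(1) H] R01 by (simp_all add: R1_def) (auto simp: H_def S_def)
  have R2: "R2 \<in> noise_sets" "R2 \<inter> S = {}"
  proof -
    show "R2 \<in> noise_sets" unfolding R2_def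
      by (rule noise_sets_subset[OF ns(1) sets.Diff[OF noise_sets_measurable[OF ns(1)] H]]) blast
    show "R2 \<inter> S = {}" by (auto simp: R2_def H_def S_def)
  qed
  have R': "R' \<inter> S = {}" using Rsub by (auto simp: S_def)
  have RR: "R2 \<inter> R' = R \<inter> R'" using Rsub by (auto simp: R2_def H_def)
  obtain B where B: "\<And>\<omega>. \<omega> \<in> space M \<Longrightarrow> \<bar>X \<omega>\<bar> \<le> B" using 1 unfolding simple_term_def by blast
  obtain B' where B': "\<And>\<omega>. \<omega> \<in> space M \<Longrightarrow> \<bar>X' \<omega>\<bar> \<le> B'" using 2 unfolding simple_term_def by blast
  have "{0..r} \<times> {0..1 :: real} \<subseteq> S" using \<open>r \<le> r'\<close> by (auto simp: S_def)
  moreover have "X \<in> borel_measurable (noise_sigma M W ({0..r} \<times> {0..1}))"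
    using 1 unfolding simple_term_def noise_filtration_eq by blast
  ultimately have XF: "X \<in> borel_measurable (noise_sigma M W S)"
    by (rule noise_sigma_measurable_mono[rotated])
  have XF': "X' \<in> borel_measurable (noise_sigma M W S)"
    using 2 unfolding simple_term_def noise_filtration_eq S_def by blast
  define Y where "Y \<omega> = X \<omega> * X' \<omega>" for \<omega>
  define Y1 where "Y1 \<omega> = Y \<omega> * W R1 \<omega>" for \<omega>
  have YF [measurable]: "Y \<in> borel_measurable (noise_sigma M W S)" unfolding Y_def using XF XF' by measurable
  have Y1F [measurable]: "Y1 \<in> borel_measurable (noise_sigma M W S)"
    unfolding Y1_def using W_noise_sigma_measurable[OF R1] YF by measurable
  have [measurable]: "Y \<in> borel_measurable M" "Y1 \<in> borel_measurable M" "X \<in> borel_measurable M" "X' \<in> borel_measurable M"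
    by (fact noise_sigma_measurable_M[OF YF] noise_sigma_measurable_M[OF Y1F] noise_sigma_measurable_M[OF XF] noise_sigma_measurable_M[OF XF'])+
  have Yb: "\<bar>Y \<omega>\<bar> \<le> B * B'" if "\<omega> \<in> space M" for \<omega>
    unfolding Y_def abs_mult using B[OF that] B'[OF that] by (intro mult_mono) auto
  have iY: "integrable M Y"
    by (rule integrable_const_bound[where B="B * B'"]) (rule AE_I2, simp only: real_norm_def Yb, measurable)
  note WM [measurable] = W_measurable[OF R1(1)] W_measurable[OF R2(1)] W_measurable[OF ns(1)] W_measurable[OF ns(2)]
  have iY1: "integrable M Y1"
  proof (rule Bochner_Integration.integrable_bound)
    show "integrable M (\<lambda>\<omega>. B * B' * W R1 \<omega>)"
      using centered_gaussian_moments(3)[OF gaussian_W[OF R1(1)]] by simp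
    show "AE \<omega> in M. norm (Y1 \<omega>) \<le> norm (B * B' * W R1 \<omega>)"
    proof (rule AE_I2)
      fix \<omega> assume "\<omega> \<in> space M"
      from Yb[OF this] have "\<bar>Y \<omega>\<bar> \<le> \<bar>B * B'\<bar>" by linarith
      then have "\<bar>Y \<omega>\<bar> * \<bar>W R1 \<omega>\<bar> \<le> \<bar>B * B'\<bar> * \<bar>W R1 \<omega>\<bar>" by (rule mult_right_mono) simp
      then show "norm (Y1 \<omega>) \<le> norm (B * B' * W R1 \<omega>)" by (simp only: Y1_def real_norm_def abs_mult)
    qed
  qed measurable
  have a: "expectation (\<lambda>\<omega>. Y1 \<omega> * W R' \<omega>) = 0" "integrable M (\<lambda>\<omega>. Y1 \<omega> * W R' \<omega>)"
    using noise_independent_expectation[where J = "{()}" and R = "\<lambda>_. R'" and c = "\<lambda>_. 1" and g = "\<lambda>x. x", OF _ _ Y1F iY1]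
      centered_gaussian_moments[OF gaussian_W[OF ns(2)]] ns(2) R' by simp_all
  \<comment> \<open>Variance of \<open>W R2 + e * W R'\<close> for a sign \<open>e\<close>; a
    quarter of the difference between the two signs is the covariance.\<close>
  define \<sigma>2 where "\<sigma>2 e = measure lborel R2 + measure lborel R' + 2 * e * measure lborel (R2 \<inter> R')" for e :: real
  have b: "expectation (\<lambda>\<omega>. Y \<omega> * (W R2 \<omega> + e * W R' \<omega>)\<^sup>2) = expectation Y * \<sigma>2 e \<and>
      integrable M (\<lambda>\<omega>. Y \<omega> * (W R2 \<omega> + e * W R' \<omega>)\<^sup>2)" if e: "e * e = 1" for e
  proof -
    define Q where "Q j = (if j then R2 else R')" for j :: bool
    define c where "c j = (if j then 1 else e)" for j :: bool
    have Q: "Q j \<in> noise_sets \<and> Q j \<inter> S = {}" for j using R2 R' ns(2) by (auto simp: Q_def)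
    have s: "(\<Sum>j\<in>UNIV. c j * W (Q j) \<omega>) = W R2 \<omega> + e * W R' \<omega>" for \<omega>
      by (simp add: UNIV_bool Q_def c_def)
    have "(\<Sum>i\<in>UNIV. \<Sum>j\<in>UNIV. c i * c j * measure lborel (Q i \<inter> Q j)) = \<sigma>2 e"
      using e by (simp add: UNIV_bool Q_def c_def \<sigma>2_def Int_commute)
    then have g: "centered_gaussian M (\<lambda>\<omega>. W R2 \<omega> + e * W R' \<omega>) (\<sigma>2 e)"
      using gaussian_sum[of UNIV Q c] Q by (simp add: s)
    show ?thesis
      using noise_independent_expectation[where J = UNIV and R = Q and c = c and g = "\<lambda>x. x\<^sup>2", OF _ Q YF iY]
        centered_gaussian_moments[OF g] by (simp add: s)
  qed
  have ae: "AE \<omega> in M. (X \<omega> * W R \<omega>) * (X' \<omega> * W R' \<omega>)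
      = Y1 \<omega> * W R' \<omega> + (Y \<omega> * (W R2 \<omega> + 1 * W R' \<omega>)\<^sup>2 - Y \<omega> * (W R2 \<omega> + (-1) * W R' \<omega>)\<^sup>2) / 4"
    using W_split[OF ns(1) H]
  proof eventually_elim
    case (elim \<omega>)
    then show ?case unfolding Y1_def Y_def R1_def[symmetric] R2_def[symmetric]
      by (simp add: power2_eq_square algebra_simps)
  qed
  have i: "integrable M (\<lambda>\<omega>. Y1 \<omega> * W R' \<omega> + (Y \<omega> * (W R2 \<omega> + 1 * W R' \<omega>)\<^sup>2 - Y \<omega> * (W R2 \<omega> + (-1) * W R' \<omega>)\<^sup>2) / 4)"
    using a(2) b[of 1] b[of "-1"] by (intro Bochner_Integration.integrable_add integrable_divide Bochner_Integration.integrable_diff) auto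
  have "integrable M (\<lambda>\<omega>. (X \<omega> * W R \<omega>) * (X' \<omega> * W R' \<omega>))"
    using i ae by (subst integrable_cong_AE[OF _ _ ae]) auto
  moreover have "expectation (\<lambda>\<omega>. (X \<omega> * W R \<omega>) * (X' \<omega> * W R' \<omega>))
     = expectation (\<lambda>\<omega>. Y1 \<omega> * W R' \<omega> + (Y \<omega> * (W R2 \<omega> + 1 * W R' \<omega>)\<^sup>2 - Y \<omega> * (W R2 \<omega> + (-1) * W R' \<omega>)\<^sup>2) / 4)"
    by (rule integral_cong_AE[OF _ _ ae]) measurable
  moreover have "\<dots> = expectation Y * measure lborel (R \<inter> R')"
    using a b[of 1] b[of "-1"] by (simp add: \<sigma>2_def RR algebra_simps)
  moreover have "Y = (\<lambda>\<omega>. X \<omega> * X' \<omega>)" by (rule ext) (rule Y_def)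
  ultimately show ?thesis by simp
qed

lemma simple_term_pair':
  assumes "simple_term r R X" "simple_term r' R' X'"
  shows "integrable M (\<lambda>\<omega>. (X \<omega> * W R \<omega>) * (X' \<omega> * W R' \<omega>))"
    and "expectation (\<lambda>\<omega>. (X \<omega> * W R \<omega>) * (X' \<omega> * W R' \<omega>)) = expectation (\<lambda>\<omega>. X \<omega> * X' \<omega>) * measure lborel (R \<inter> R')"
proof -
  have "integrable M (\<lambda>\<omega>. (X \<omega> * W R \<omega>) * (X' \<omega> * W R' \<omega>)) \<and>
    expectation (\<lambda>\<omega>. (X \<omega> * W R \<omega>) * (X' \<omega> * W R' \<omega>)) = expectation (\<lambda>\<omega>. X \<omega> * X' \<omega>) * measure lborel (R \<inter> R')"
  proof (cases "r \<le> r'")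
    case True
    then show ?thesis using simple_term_pair assms by blast
  next
    case False
    then show ?thesis using simple_term_pair[OF assms(2,1)] by (simp add: mult.commute Int_commute)
  qed
  then show "integrable M (\<lambda>\<omega>. (X \<omega> * W R \<omega>) * (X' \<omega> * W R' \<omega>))"
    and "expectation (\<lambda>\<omega>. (X \<omega> * W R \<omega>) * (X' \<omega> * W R' \<omega>)) = expectation (\<lambda>\<omega>. X \<omega> * X' \<omega>) * measure lborel (R \<inter> R')"
    by auto
qed

text \<open>The terms may overlap and need no order in time: both squares expand into double sums
  whose entries match pair by pair, each carrying the area of
  \<open>R k \<inter> R l\<close>.\<close>

lemma ito_isometry:
  assumes K: "finite K" and st: "\<And>k. k \<in> K \<Longrightarrow> simple_term (r k) (R k) (X k)"
  shows "(\<integral>\<^sup>+\<omega>. ennreal ((\<Sum>k\<in>K. X k \<omega> * W (R k) \<omega>)\<^sup>2) \<partial>M)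
    = (\<integral>\<^sup>+z. ennreal ((\<Sum>k\<in>K. X k (snd z) * indicator (R k) (fst z))\<^sup>2) \<partial>(lborel \<Otimes>\<^sub>M M))"
proof -
  interpret L: pair_sigma_finite "lborel :: (real \<times> real) measure" M ..
  have XM [measurable]: "k \<in> K \<Longrightarrow> X k \<in> borel_measurable M" for k using st simple_term_measurable by blast
  have RM: "k \<in> K \<Longrightarrow> R k \<in> noise_sets" for k using st unfolding simple_term_def by blast
  have RM' [measurable]: "k \<in> K \<Longrightarrow> R k \<in> sets borel" for k using RM noise_sets_measurable by blast
  have iX: "integrable M (\<lambda>\<omega>. X k \<omega> * X l \<omega>)" if kl: "k \<in> K" "l \<in> K" for k l
  proof -
    have [measurable]: "X k \<in> borel_measurable M" "X l \<in> borel_measurable M" using kl by auto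
    obtain B where B: "\<And>\<omega>. \<omega> \<in> space M \<Longrightarrow> \<bar>X k \<omega>\<bar> \<le> B" using st[OF kl(1)] unfolding simple_term_def by blast
    obtain B' where B': "\<And>\<omega>. \<omega> \<in> space M \<Longrightarrow> \<bar>X l \<omega>\<bar> \<le> B'" using st[OF kl(2)] unfolding simple_term_def by blast
    have "\<bar>X k \<omega> * X l \<omega>\<bar> \<le> B * B'" if "\<omega> \<in> space M" for \<omega>
      unfolding abs_mult using B[OF that] B'[OF that] by (intro mult_mono) auto
    then show ?thesis by (intro integrable_const_bound[where B = "B * B'"] AE_I2) (simp_all only: real_norm_def, measurable)
  qed
  have sq: "(\<Sum>k\<in>K. f k :: real)\<^sup>2 = (\<Sum>k\<in>K. \<Sum>l\<in>K. f k * f l)" for f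
    by (simp add: power2_eq_square sum_product)
  have hb: "integrable (lborel \<Otimes>\<^sub>M M) (\<lambda>z. (X k (snd z) * indicator (R k) (fst z)) * (X l (snd z) * indicator (R l) (fst z)))"
    "(LINT z|(lborel \<Otimes>\<^sub>M M). (X k (snd z) * indicator (R k) (fst z)) * (X l (snd z) * indicator (R l) (fst z)))
      = expectation (\<lambda>\<omega>. X k \<omega> * X l \<omega>) * measure lborel (R k \<inter> R l)" if k: "k \<in> K" "l \<in> K" for k l
  proof -
    have [measurable]: "X k \<in> borel_measurable M" "X l \<in> borel_measurable M" "R k \<in> sets borel" "R l \<in> sets borel" using that by auto
    have e: "(X k \<omega> * indicator (R k) p) * (X l \<omega> * indicator (R l) p) = indicator (R k \<inter> R l) p * (X k \<omega> * X l \<omega>)" for \<omega> p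
      by (simp add: indicator_inter_arith mult_ac)
    have iR: "integrable lborel (indicator (R k \<inter> R l) :: real \<times> real \<Rightarrow> real)"
      using RM[OF k(1)] by (intro integrable_indicator_noise noise_sets_Int) auto
    show i: "integrable (lborel \<Otimes>\<^sub>M M) (\<lambda>z. (X k (snd z) * indicator (R k) (fst z)) * (X l (snd z) * indicator (R l) (fst z)))"
      unfolding e
    proof (rule L.Fubini_integrable)
      show "integrable lborel (\<lambda>p. LINT \<omega>|M. norm (indicat_real (R k \<inter> R l) (fst (p, \<omega>)) * (X k (snd (p, \<omega>)) * X l (snd (p, \<omega>)))))"
        using iR by (simp add: abs_mult)
    qed (use iX[OF k] in auto)
    show "(LINT z|(lborel \<Otimes>\<^sub>M M). (X k (snd z) * indicator (R k) (fst z)) * (X l (snd z) * indicator (R l) (fst z)))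
      = expectation (\<lambda>\<omega>. X k \<omega> * X l \<omega>) * measure lborel (R k \<inter> R l)"
      using L.integral_fst'[OF i] unfolding e by (simp add: mult.commute)
  qed
  have p: "integrable M (\<lambda>\<omega>. (X k \<omega> * W (R k) \<omega>) * (X l \<omega> * W (R l) \<omega>))"
      "expectation (\<lambda>\<omega>. (X k \<omega> * W (R k) \<omega>) * (X l \<omega> * W (R l) \<omega>)) = expectation (\<lambda>\<omega>. X k \<omega> * X l \<omega>) * measure lborel (R k \<inter> R l)"
    if kl: "k \<in> K" "l \<in> K" for k l
    by (rule simple_term_pair'[OF st[OF kl(1)] st[OF kl(2)]])+
  have i1: "integrable M (\<lambda>\<omega>. (\<Sum>k\<in>K. X k \<omega> * W (R k) \<omega>)\<^sup>2)"
    unfolding sq by (intro Bochner_Integration.integrable_sum p)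
  have i2: "integrable (lborel \<Otimes>\<^sub>M M) (\<lambda>z. (\<Sum>k\<in>K. X k (snd z) * indicator (R k) (fst z))\<^sup>2)"
    unfolding sq by (intro Bochner_Integration.integrable_sum hb)
  have "expectation (\<lambda>\<omega>. (\<Sum>k\<in>K. X k \<omega> * W (R k) \<omega>)\<^sup>2) = (\<Sum>k\<in>K. \<Sum>l\<in>K. expectation (\<lambda>\<omega>. X k \<omega> * X l \<omega>) * measure lborel (R k \<inter> R l))"
    unfolding sq using p by (simp add: Bochner_Integration.integral_sum Bochner_Integration.integrable_sum)
  also have "\<dots> = (LINT z|(lborel \<Otimes>\<^sub>M M). (\<Sum>k\<in>K. X k (snd z) * indicator (R k) (fst z))\<^sup>2)"
    unfolding sq using hb by (simp add: Bochner_Integration.integral_sum Bochner_Integration.integrable_sum)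
  finally show ?thesis
    using nn_integral_eq_integral[OF i1] nn_integral_eq_integral[OF i2] by simp
qed

end

section \<open>The Neumann heat kernel\<close>

abbreviation unit_measure :: "real measure" where
  "unit_measure \<equiv> restrict_space lborel {0..1}"

lemma unit_measure_integral:
  fixes f :: "real \<Rightarrow> real"
  assumes "continuous_on {0..1} f"
  shows "integrable unit_measure f" "(LINT x|unit_measure. f x) = integral {0..1} f"
proof -
  have s: "set_integrable lborel {0..1} f" by (rule borel_integrable_atLeastAtMost'[OF assms])
  then show "integrable unit_measure f"
    by (subst integrable_restrict_space) (auto simp: set_integrable_def)
  have "(LINT x|unit_measure. f x) = (LINT x:{0..1}|lborel. f x)"
    by (subst integral_restrict_space) (auto simp: set_lebesgue_integral_def)
  then show "(LINT x|unit_measure. f x) = integral {0..1} f"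
    using set_borel_integral_eq_integral(2)[OF s] by simp
qed

lemma prob_space_unit_measure: "prob_space unit_measure"
  by (rule prob_spaceI) (simp add: emeasure_restrict_space space_restrict_space)

lemma space_unit_measure [simp]: "space unit_measure = {0..1}"
  by (simp add: space_restrict_space)

section \<open>The cosine system on the unit interval\<close>

definition cs :: "nat \<Rightarrow> real \<Rightarrow> real" where "cs n x = cos (real n * pi * x)"

text \<open>The reciprocal of the squared norm of \<open>cs n\<close>, as
  \<open>cs_orthogonal\<close> confirms.\<close>

definition wt :: "nat \<Rightarrow> real" where "wt n = (if n = 0 then 1 else 2)"

definition fc :: "(real \<Rightarrow> real) \<Rightarrow> nat \<Rightarrow> real" where "fc f n = (LINT x|unit_measure. f x * cs n x)"

lemma continuous_on_cs [continuous_intros]: "continuous_on A (cs n)"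
  unfolding cs_def by (intro continuous_intros)

lemma cs_measurable [measurable]: "cs n \<in> borel_measurable borel"
  by (rule borel_measurable_continuous_onI) (rule continuous_on_cs)

lemma abs_cs_le: "\<bar>cs n x\<bar> \<le> 1" by (simp add: cs_def)

lemma cs_0 [simp]: "cs 0 x = 1" by (simp add: cs_def)

lemma wt_pos: "wt n > 0" and wt_le: "wt n \<le> 2" and wt_ge: "wt n \<ge> 1" and wt_0 [simp]: "wt 0 = 1" and wt_Suc [simp]: "wt (Suc n) = 2"
  by (auto simp: wt_def)

lemma integral_cos_int:
  "(LINT x|unit_measure. cos (of_int k * pi * x)) = (if k = 0 then 1 else 0)"
proof (cases "k = 0")
  case True
  have c: "continuous_on {0..1 :: real} (\<lambda>x. 1 :: real)" by simp
  show ?thesis using True unit_measure_integral(2)[OF c] by simp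
next
  case False
  have c: "continuous_on {0..1} (\<lambda>x. cos (of_int k * pi * x))" by (intro continuous_intros)
  have "((\<lambda>x. cos (of_int k * pi * x)) has_integral
      (sin (of_int k * pi * 1) / (of_int k * pi) - sin (of_int k * pi * 0) / (of_int k * pi))) {0..1}"
    by (rule fundamental_theorem_of_calculus)
       (use False in \<open>auto intro!: derivative_eq_intros simp: has_real_derivative_iff_has_vector_derivative[symmetric]\<close>)
  moreover have "sin (of_int k * pi * 1) = 0" by (metis mult.right_neutral sin_npi_int mult.commute)
  ultimately have "integral {0..1} (\<lambda>x. cos (of_int k * pi * x)) = 0"
    by (simp add: integral_unique)
  then show ?thesis using False unit_measure_integral(2)[OF c] by simp
qed

lemma cs_times_cs: "cs m x * cs n x = (cos (of_int (int m - int n) * pi * x) + cos (of_int (int m + int n) * pi * x)) / 2"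
  unfolding cs_def cos_times_cos by (simp add: algebra_simps)

lemma cs_orthogonal: "(LINT x|unit_measure. cs m x * cs n x) = (if m = n then 1 / wt n else 0)"
proof -
  have i: "integrable unit_measure (\<lambda>x. cos (of_int k * pi * x))" for k
    by (rule unit_measure_integral(1)) (intro continuous_intros)
  have "(LINT x|unit_measure. cs m x * cs n x)
      = ((LINT x|unit_measure. cos (of_int (int m - int n) * pi * x)) + (LINT x|unit_measure. cos (of_int (int m + int n) * pi * x))) / 2"
    unfolding cs_times_cs by (simp only: integral_divide_zero Bochner_Integration.integral_add[OF i i])
  then show ?thesis unfolding integral_cos_int by (auto simp: wt_def)
qed

text \<open>The product formula removes one power of \<open>cos (pi * x)\<close> at the price of the
  two neighbouring frequencies, hence the induction over all \<open>n\<close> at once. The case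
  \<open>n = 0\<close> makes \<open>f\<close> orthogonal to every polynomial in the cosine.\<close>

lemma fc_zero_imp_cos_power:
  assumes f: "continuous_on {0..1} f" and z: "\<And>n. fc f n = 0"
  shows "(LINT x|unit_measure. f x * cos (pi * x) ^ k * cs n x) = 0"
proof (induction k arbitrary: n)
  case 0
  then show ?case using z[of n] by (simp add: fc_def)
next
  case (Suc k)
  have i: "integrable unit_measure (\<lambda>x. f x * cos (pi * x) ^ k * cs m x)" for m
    by (rule unit_measure_integral(1)) (intro continuous_intros f)
  show ?case
  proof (cases n)
    case 0
    have "f x * cos (pi * x) ^ Suc k * cs n x = f x * cos (pi * x) ^ k * cs 1 x" for x
      using 0 by (simp add: cs_def mult_ac)
    then show ?thesis using Suc[of 1] by (simp only:)
  next
    case n: (Suc n')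
    have "cos (pi * x) * cs n x = (cs (Suc n) x + cs n' x) / 2" for x
      using cs_times_cs[of n x 1] by (simp add: n cs_def algebra_simps)
    then have "f x * cos (pi * x) ^ k * (cos (pi * x) * cs n x) = (f x * cos (pi * x) ^ k * cs (Suc n) x + f x * cos (pi * x) ^ k * cs n' x) / 2" for x
      by (simp only: times_divide_eq_right distrib_left)
    moreover have "f x * cos (pi * x) ^ Suc k * cs n x = f x * cos (pi * x) ^ k * (cos (pi * x) * cs n x)" for x
      by (simp only: power_Suc mult_ac)
    ultimately have "f x * cos (pi * x) ^ Suc k * cs n x = (f x * cos (pi * x) ^ k * cs (Suc n) x + f x * cos (pi * x) ^ k * cs n' x) / 2" for x
      by (simp only:)
    then have "(LINT x|unit_measure. f x * cos (pi * x) ^ Suc k * cs n x)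
       = ((LINT x|unit_measure. f x * cos (pi * x) ^ k * cs (Suc n) x) + (LINT x|unit_measure. f x * cos (pi * x) ^ k * cs n' x)) / 2"
      by (simp only: integral_divide_zero Bochner_Integration.integral_add[OF i i])
    then show ?thesis by (simp add: Suc)
  qed
qed

text \<open>Completeness. In the variable u = cos(\<pi> x) the function is continuous on [-1,1],
  where polynomials are uniformly dense. Orthogonality to all of them bounds the integral of the
  square by \<open>e * A\<close> for every \<open>e > 0\<close>.\<close>

lemma fc_zero_imp_zero:
  assumes f: "continuous_on {0..1} f" and z: "\<And>n. fc f n = 0" and x: "x \<in> {0..1}"
  shows "f x = 0"
proof -
  define g where "g u = f (arccos u / pi)" for u
  have "continuous_on {-1..1} g"
    unfolding g_def
    by (rule continuous_on_compose2[OF f]) (auto intro!: continuous_intros simp: arccos_ubound arccos_lbound)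
  define A where "A = (LINT x|unit_measure. \<bar>f x\<bar>)"
  have if2: "integrable unit_measure (\<lambda>x. (f x)\<^sup>2)" "integrable unit_measure (\<lambda>x. \<bar>f x\<bar>)"
    by (rule unit_measure_integral(1), intro continuous_intros f)+
  have bound: "(LINT x|unit_measure. (f x)\<^sup>2) \<le> e * A" if e: "e > 0" for e
  proof -
    obtain p where p: "real_polynomial_function p" "\<And>u. u \<in> {-1..1} \<Longrightarrow> \<bar>g u - p u\<bar> < e"
      using Stone_Weierstrass_real_polynomial_function[OF compact_Icc \<open>continuous_on {-1..1} g\<close> e] by blast
    obtain a n where a: "p = (\<lambda>u. \<Sum>i\<le>n. a i * u ^ i)"
      using p(1) unfolding real_polynomial_function_iff_sum by blast
    have i: "integrable unit_measure (\<lambda>x. a i * (f x * cos (pi * x) ^ i * cs 0 x))" for i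
      by (rule unit_measure_integral(1)) (intro continuous_intros f)
    have "f x * p (cos (pi * x)) = (\<Sum>i\<le>n. a i * (f x * cos (pi * x) ^ i * cs 0 x))" for x
      by (simp add: a sum_distrib_left mult_ac)
    then have z1: "(LINT x|unit_measure. f x * p (cos (pi * x))) = 0" and i1: "integrable unit_measure (\<lambda>x. f x * p (cos (pi * x)))"
      using fc_zero_imp_cos_power[OF f z] i by (simp_all add: Bochner_Integration.integral_sum Bochner_Integration.integrable_sum del: cs_0)
    have "(LINT x|unit_measure. (f x)\<^sup>2) = (LINT x|unit_measure. (f x)\<^sup>2 - f x * p (cos (pi * x)))"
      by (simp add: if2 i1 z1)
    also have "\<dots> \<le> (LINT x|unit_measure. e * \<bar>f x\<bar>)"
    proof (intro integral_mono Bochner_Integration.integrable_diff if2 i1 integrable_mult_right)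
      fix x :: real assume "x \<in> space unit_measure"
      then have x: "x \<in> {0..1}" by simp
      have "\<bar>g (cos (pi * x)) - p (cos (pi * x))\<bar> < e" by (rule p(2)) simp
      moreover have "g (cos (pi * x)) = f x"
        using x by (simp add: g_def arccos_cos mult_left_le)
      ultimately have "\<bar>f x\<bar> * \<bar>f x - p (cos (pi * x))\<bar> \<le> \<bar>f x\<bar> * e"
        by (intro mult_left_mono) auto
      then have "f x * (f x - p (cos (pi * x))) \<le> \<bar>f x\<bar> * e"
        unfolding abs_mult[symmetric] by linarith
      then show "(f x)\<^sup>2 - f x * p (cos (pi * x)) \<le> e * \<bar>f x\<bar>"
        by (simp add: power2_eq_square algebra_simps)
    qed
    also have "\<dots> = e * A" by (simp add: A_def)
    finally show ?thesis .
  qed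
  have A: "A \<ge> 0" unfolding A_def by (rule Bochner_Integration.integral_nonneg) simp
  have "(LINT x|unit_measure. (f x)\<^sup>2) \<le> 0"
  proof (rule field_le_epsilon)
    fix e :: real assume "e > 0"
    have "(LINT x|unit_measure. (f x)\<^sup>2) \<le> e / (A + 1) * A" using A \<open>e > 0\<close> by (intro bound) simp
    also have "\<dots> \<le> 0 + e" using A \<open>e > 0\<close> by (simp add: field_simps)
    finally show "(LINT x|unit_measure. (f x)\<^sup>2) \<le> 0 + e" .
  qed
  moreover have "(LINT x|unit_measure. (f x)\<^sup>2) \<ge> 0" by (rule Bochner_Integration.integral_nonneg) simp
  moreover have c2: "continuous_on {0..1} (\<lambda>x. (f x)\<^sup>2)" by (intro continuous_intros f)
  ultimately have "integral {0..1} (\<lambda>x. (f x)\<^sup>2) = 0" using unit_measure_integral(2)[OF c2] by simp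
  then have "(f x)\<^sup>2 = 0" using integral_eq_0_iff[OF c2] x by simp
  then show ?thesis by simp
qed

lemma integral_cos_series:
  assumes f: "continuous_on {0..1} f" and b: "summable (\<lambda>n. \<bar>b n\<bar>)"
  shows "(\<lambda>n. b n * (LINT x|unit_measure. f x * cs n x)) sums (LINT x|unit_measure. f x * (\<Sum>n. b n * cs n x))"
proof -
  have "bounded (f ` {0..1})" by (rule compact_imp_bounded[OF compact_continuous_image[OF f compact_Icc]])
  then obtain B where "\<forall>z\<in>f ` {0..1}. norm z \<le> B" unfolding bounded_iff by blast
  then have B: "\<bar>f x\<bar> \<le> B" if "x \<in> {0..1}" for x using that by simp
  have i: "integrable unit_measure (\<lambda>x. b n * (f x * cs n x))" for n
    by (rule unit_measure_integral(1)) (intro continuous_intros f)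
  have le: "\<bar>b n * (f x * cs n x)\<bar> \<le> \<bar>b n\<bar> * B" if "x \<in> {0..1}" for n x
  proof -
    have "\<bar>f x\<bar> * \<bar>cs n x\<bar> \<le> B * 1" using B[OF that] abs_cs_le[of n x] by (intro mult_mono) auto
    then show ?thesis by (simp add: abs_mult mult_left_mono)
  qed
  have sB: "summable (\<lambda>n. \<bar>b n\<bar> * B)" using b by (rule summable_mult2)
  have "(\<lambda>n. LINT x|unit_measure. b n * (f x * cs n x)) sums (LINT x|unit_measure. (\<Sum>n. b n * (f x * cs n x)))"
  proof (rule sums_integral[OF i])
    show "AE x in unit_measure. summable (\<lambda>n. norm (b n * (f x * cs n x)))"
      by (rule AE_I2, rule summable_comparison_test[OF _ sB]) (use le in auto)
    show "summable (\<lambda>n. LINT x|unit_measure. norm (b n * (f x * cs n x)))"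
    proof (rule summable_comparison_test[OF _ sB], intro exI allI impI)
      fix n
      have "(LINT x|unit_measure. norm (b n * (f x * cs n x))) \<le> (LINT x|unit_measure. \<bar>b n\<bar> * B)"
        using i[of n] le prob_space.finite_measure[OF prob_space_unit_measure]
        by (intro integral_mono integrable_norm) (auto intro!: finite_measure.integrable_const)
      also have "\<dots> = \<bar>b n\<bar> * B" using prob_space.prob_space[OF prob_space_unit_measure] by simp
      finally show "norm (LINT x|unit_measure. norm (b n * (f x * cs n x))) \<le> \<bar>b n\<bar> * B" by simp
    qed
  qed
  moreover have "(\<Sum>n. b n * (f x * cs n x)) = f x * (\<Sum>n. b n * cs n x)" for x
  proof -
    have "summable (\<lambda>n. b n * cs n x)"
      by (rule summable_comparison_test[OF _ b]) (auto simp: abs_mult abs_cs_le mult_left_le)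
    then show ?thesis by (subst suminf_mult[symmetric]) (auto simp: mult_ac)
  qed
  ultimately show ?thesis by simp
qed

lemma cos_series:
  assumes b: "summable (\<lambda>n. \<bar>b n\<bar>)"
  shows "continuous_on A (\<lambda>x. \<Sum>n. b n * cs n x)" and "fc (\<lambda>x. \<Sum>n. b n * cs n x) m = b m / wt m"
proof -
  show "continuous_on A (\<lambda>x. \<Sum>n. b n * cs n x)"
  proof (rule uniform_limit_theorem[OF _ Weierstrass_m_test[OF _ b]])
    show "\<forall>\<^sub>F n in sequentially. continuous_on A (\<lambda>x. \<Sum>i<n. b i * cs i x)"
      by (intro always_eventually allI continuous_intros)
  qed (auto simp: abs_mult abs_cs_le mult_left_le)
  have "(\<lambda>n. b n * (LINT x|unit_measure. cs m x * cs n x)) sums (LINT x|unit_measure. cs m x * (\<Sum>n. b n * cs n x))"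
    by (rule integral_cos_series[OF continuous_on_cs b])
  moreover have "(\<lambda>n. b n * (LINT x|unit_measure. cs m x * cs n x)) = (\<lambda>n. if n = m then b m / wt m else 0)"
    by (intro ext) (simp add: cs_orthogonal)
  ultimately have "(\<lambda>n. if n = m then b m / wt m else 0) sums (LINT x|unit_measure. cs m x * (\<Sum>n. b n * cs n x))"
    by (simp only:)
  then have "(LINT x|unit_measure. cs m x * (\<Sum>n. b n * cs n x)) = b m / wt m"
    by (rule sums_unique2[OF _ sums_single[of m "\<lambda>_. b m / wt m"]])
  then show "fc (\<lambda>x. \<Sum>n. b n * cs n x) m = b m / wt m" unfolding fc_def by (simp only: mult.commute)
qed

text \<open>The absolutely convergent series is a continuous function with the same coefficients, so
  completeness identifies it with \<open>f\<close>. Integrating \<open>f\<close> against its own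
  series gives Parseval.\<close>

lemma cosine_expansion:
  assumes f: "continuous_on {0..1} f" and s: "summable (\<lambda>n. \<bar>fc f n\<bar>)"
  shows "x \<in> {0..1} \<Longrightarrow> f x = (\<Sum>n. wt n * fc f n * cs n x)"
    and "(\<lambda>n. wt n * (fc f n)\<^sup>2) sums (LINT x|unit_measure. (f x)\<^sup>2)"
proof -
  define b where "b n = wt n * fc f n" for n
  define F where "F x = (\<Sum>n. b n * cs n x)" for x
  have b: "summable (\<lambda>n. \<bar>b n\<bar>)"
    by (rule summable_comparison_test[OF _ summable_mult[OF s, of 2]])
       (auto simp: b_def abs_mult wt_def)
  have F: "continuous_on {0..1} F" unfolding F_def by (rule cos_series(1)[OF b])
  have fF: "fc F m = fc f m" for m
    using cos_series(2)[OF b, of m] wt_pos[of m] unfolding F_def b_def by simp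
  have eq: "f x = F x" if "x \<in> {0..1}" for x
  proof -
    have i: "integrable unit_measure (\<lambda>x. f x * cs n x)" "integrable unit_measure (\<lambda>x. F x * cs n x)" for n
      by (rule unit_measure_integral(1), intro continuous_intros f F)+
    have "f x - F x = 0"
    proof (rule fc_zero_imp_zero[OF continuous_on_diff[OF f F] _ that])
      fix n
      have "fc (\<lambda>x. f x - F x) n = fc f n - fc F n"
        unfolding fc_def left_diff_distrib by (rule Bochner_Integration.integral_diff[OF i])
      then show "fc (\<lambda>x. f x - F x) n = 0" by (simp add: fF)
    qed
    then show ?thesis by simp
  qed
  then show "x \<in> {0..1} \<Longrightarrow> f x = (\<Sum>n. wt n * fc f n * cs n x)" by (simp add: F_def b_def)
  have "(\<lambda>n. b n * fc f n) sums (LINT x|unit_measure. f x * F x)"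
    using integral_cos_series[OF f b] unfolding F_def fc_def .
  moreover have "(LINT x|unit_measure. f x * F x) = (LINT x|unit_measure. (f x)\<^sup>2)"
    by (rule Bochner_Integration.integral_cong) (auto simp: eq power2_eq_square)
  ultimately show "(\<lambda>n. wt n * (fc f n)\<^sup>2) sums (LINT x|unit_measure. (f x)\<^sup>2)"
    by (simp add: b_def power2_eq_square mult_ac)
qed

section \<open>Cosine expansion of the Neumann kernel\<close>

text \<open>The eigenvalue of minus the second derivative for the Neumann eigenfunction
  \<open>cs n\<close>.\<close>

definition ev :: "nat \<Rightarrow> real" where "ev n = (real n * pi)\<^sup>2"

text \<open>The coefficient solves a' = -ev n * a: differentiate under the integral, insert the
  equation and integrate by parts twice, where the boundary terms vanish by the Neumann condition
  and by sin(n \<pi>) = 0. The Dirac initial condition, tested with \<open>cs n\<close>, fixes the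
  constant.\<close>

lemma fc_heat:
  assumes G: "neumann_heat_kernel G" and y: "y \<in> {0..1}" and t: "t > 0"
  shows "fc (\<lambda>x. G t x y) n = exp (- ev n * t) * cs n y"
proof -
  have "neumann_heat_solution (\<lambda>t x. G t x y)" using G y unfolding neumann_heat_kernel_def by blast
  then obtain v1 v2 :: "real \<Rightarrow> real \<Rightarrow> real" where v:
      "continuous_on ({0<..} \<times> {0..1}) (\<lambda>(t, x). G t x y) \<and>
      continuous_on ({0<..} \<times> {0..1}) (\<lambda>(t, x). v1 t x) \<and>
      continuous_on ({0<..} \<times> {0..1}) (\<lambda>(t, x). v2 t x) \<and>
      (\<forall>t>0. \<forall>x\<in>{0..1}.
        ((\<lambda>z. G t z y) has_real_derivative v1 t x) (at x within {0..1}) \<and>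
        ((\<lambda>z. v1 t z) has_real_derivative v2 t x) (at x within {0..1}) \<and>
        ((\<lambda>s. G s x y) has_real_derivative v2 t x) (at t)) \<and>
      (\<forall>t>0. v1 t 0 = 0 \<and> v1 t 1 = 0)"
    unfolding neumann_heat_solution_def by (elim exE)
  note c0 = v[THEN conjunct1] and c1 = v[THEN conjunct2, THEN conjunct1]
    and c2 = v[THEN conjunct2, THEN conjunct2, THEN conjunct1]
  note v' = v[THEN conjunct2, THEN conjunct2, THEN conjunct2]
  have d: "((\<lambda>z. G t z y) has_real_derivative v1 t x) (at x within {0..1})"
       "((\<lambda>z. v1 t z) has_real_derivative v2 t x) (at x within {0..1})"
       "((\<lambda>s. G s x y) has_real_derivative v2 t x) (at t)" if "t > 0" "x \<in> {0..1}" for t x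
    using v'[THEN conjunct1, rule_format, OF that] by blast+
  have bc: "v1 t 0 = 0" "v1 t 1 = 0" if "t > 0" for t
    using v'[THEN conjunct2, rule_format, OF that] by blast+
  have slice: "continuous_on {0..1} (\<lambda>x. w t x)"
    if "continuous_on ({0<..} \<times> {0..1}) (\<lambda>(t, x). w t x)" "t > 0" for w :: "real \<Rightarrow> real \<Rightarrow> real" and t
  proof -
    have "continuous_on {0..1} ((\<lambda>(t, x). w t x) \<circ> (\<lambda>x. (t, x)))"
      by (rule continuous_on_compose) (use that in \<open>auto intro!: continuous_intros intro: continuous_on_subset\<close>)
    then show ?thesis by (simp add: comp_def)
  qed
  have sG: "continuous_on {0..1} (\<lambda>x. G t x y)" and sv2: "continuous_on {0..1} (\<lambda>x. v2 t x)" if "t > 0" for t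
    using slice[OF c0 that] slice[OF c2 that] by simp_all
  define a where "a t = fc (\<lambda>x. G t x y) n" for t
  have aHK: "a t = integral (cbox 0 1) (\<lambda>x. G t x y * cs n x)" if "t > 0" for t
    unfolding a_def fc_def using that
    by (subst unit_measure_integral(2)) (auto intro!: continuous_intros sG)
  have da: "(a has_real_derivative - ev n * a t) (at t)" if t: "t > 0" for t
  proof -
    have "((\<lambda>t. integral (cbox 0 1) (\<lambda>x. G t x y * cs n x)) has_field_derivative integral (cbox 0 1) (\<lambda>x. v2 t x * cs n x)) (at t within {0<..})"
    proof (rule leibniz_rule_field_derivative)
      show "((\<lambda>t. G t x y * cs n x) has_field_derivative v2 s x * cs n x) (at s within {0<..})" if "s \<in> {0<..}" "x \<in> cbox 0 1" for s x
        using DERIV_mult[OF d(3)[of s x] DERIV_const[of "cs n x"]] that by (auto intro: has_field_derivative_at_within)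
      show "(\<lambda>x. G s x y * cs n x) integrable_on cbox 0 1" if "s \<in> {0<..}" for s
        using that by (intro integrable_continuous) (auto intro!: continuous_intros sG)
      have "continuous_on ({0<..} \<times> {0..1}) (\<lambda>z. (case z of (t, x) \<Rightarrow> v2 t x) * cs n (snd z))"
        unfolding cs_def by (intro continuous_intros c2)
      then show "continuous_on ({0<..} \<times> cbox 0 1) (\<lambda>(s, x). v2 s x * cs n x)"
        by (simp add: case_prod_beta)
    qed (use t in auto)
    then have "((\<lambda>t. integral (cbox 0 1) (\<lambda>x. G t x y * cs n x)) has_real_derivative integral (cbox 0 1) (\<lambda>x. v2 t x * cs n x)) (at t)"
      using t by (simp add: at_within_open[of t "{0<..}"])
    then have 1: "(a has_real_derivative integral (cbox 0 1) (\<lambda>x. v2 t x * cs n x)) (at t)"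
      by (rule DERIV_cong_ev[THEN iffD1, rotated -1]) (use t aHK eventually_nhds_in_open[of "{0<..}" t] in \<open>auto elim!: eventually_mono\<close>)
    \<comment> \<open>The primitive is \<open>v1 * cs n\<close> plus the sine term, so one
      application of the fundamental theorem performs both integrations by parts.\<close>
    have "((\<lambda>x. v2 t x * cs n x + ev n * (G t x y * cs n x)) has_integral
       ((v1 t 1 * cs n 1 + real n * pi * G t 1 y * sin (real n * pi * 1)) - (v1 t 0 * cs n 0 + real n * pi * G t 0 y * sin (real n * pi * 0)))) {0..1}"
    proof (rule fundamental_theorem_of_calculus)
      fix x :: real assume x: "x \<in> {0..1}"
      have dc: "(cs n has_real_derivative - (real n * pi * sin (real n * pi * x))) (at x within {0..1})"
        unfolding cs_def[abs_def] by (auto intro!: derivative_eq_intros)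
      have ds: "((\<lambda>x. sin (real n * pi * x)) has_real_derivative (real n * pi * cs n x)) (at x within {0..1})"
        unfolding cs_def by (auto intro!: derivative_eq_intros)
      have "((\<lambda>x. v1 t x * cs n x + real n * pi * (G t x y * sin (real n * pi * x))) has_real_derivative
        (v2 t x * cs n x + (- (real n * pi * sin (real n * pi * x))) * v1 t x + real n * pi * (v1 t x * sin (real n * pi * x) + (real n * pi * cs n x) * G t x y))) (at x within {0..1})"
        by (intro DERIV_add DERIV_cmult DERIV_mult d t x dc ds)
      then show "((\<lambda>x. v1 t x * cs n x + real n * pi * G t x y * sin (real n * pi * x)) has_vector_derivative (v2 t x * cs n x + ev n * (G t x y * cs n x))) (at x within {0..1})"
        unfolding has_real_derivative_iff_has_vector_derivative[symmetric]
        by (simp add: ev_def power2_eq_square algebra_simps)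
    qed simp
    then have "((\<lambda>x. v2 t x * cs n x + ev n * (G t x y * cs n x)) has_integral 0) {0..1}"
      using bc t sin_npi[of n] by simp
    then have "integral {0..1} (\<lambda>x. v2 t x * cs n x + ev n * (G t x y * cs n x)) = 0" by (rule integral_unique)
    moreover have "integral {0..1} (\<lambda>x. v2 t x * cs n x + ev n * (G t x y * cs n x)) = integral {0..1} (\<lambda>x. v2 t x * cs n x) + ev n * a t"
      unfolding aHK[OF t] using t
      by (subst Henstock_Kurzweil_Integration.integral_add)
         (auto intro!: integrable_continuous_interval continuous_intros sG sv2)
    ultimately have "integral (cbox 0 1) (\<lambda>x. v2 t x * cs n x) = - ev n * a t" by simp
    with 1 show ?thesis by simp
  qed
  \<comment> \<open>The integrating factor makes \<open>g\<close> constant on positive times, and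
    its limit at 0 is \<open>cs n y\<close>.\<close>
  define g where "g t = exp (ev n * t) * a t" for t
  have dg: "(g has_real_derivative 0) (at t)" if "t > 0" for t
  proof -
    have "((\<lambda>t. exp (ev n * t)) has_real_derivative (ev n * exp (ev n * t))) (at t)"
      by (auto intro!: derivative_eq_intros)
    from DERIV_mult[OF this da[OF that]] show ?thesis
      unfolding g_def[abs_def] by (simp add: algebra_simps)
  qed
  have gc: "g s = g t" if "s > 0" for s
  proof -
    have "\<exists>c. \<forall>x\<in>{0<..}. g x = c"
    proof (rule has_field_derivative_zero_constant)
      show "(g has_field_derivative 0) (at x within {0<..})" if "x \<in> {0<..}" for x
        using dg[of x] that by (auto intro: has_field_derivative_at_within)
    qed auto
    then show ?thesis using that t by auto
  qed
  have lim: "(a \<longlongrightarrow> cs n y) (at_right 0)"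
  proof -
    have "((\<lambda>t. LINT x:{0..1}|lborel. G t x y * cs n x) \<longlongrightarrow> cs n y) (at_right 0)"
      using G y continuous_on_cs unfolding neumann_heat_kernel_def by blast
    moreover have "(LINT x:{0..1}|lborel. G t x y * cs n x) = a t" for t
      unfolding a_def fc_def by (subst integral_restrict_space) (auto simp: set_lebesgue_integral_def)
    ultimately show ?thesis by simp
  qed
  have "((\<lambda>t. exp (ev n * t)) \<longlongrightarrow> exp (ev n * 0)) (at_right 0)"
    by (intro tendsto_intros)
  from tendsto_mult[OF this lim] have "(g \<longlongrightarrow> cs n y) (at_right 0)"
    by (simp add: g_def[abs_def])
  moreover have "eventually (\<lambda>s. g s = g t) (at_right 0)"
    using gc by (auto simp: eventually_at_filter intro!: always_eventually)
  then have "(g \<longlongrightarrow> g t) (at_right 0)" by (rule tendsto_eventually)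
  ultimately have "cs n y = g t" by (rule tendsto_unique[OF trivial_limit_at_right_real])
  then have "g t = cs n y" by simp
  then have "exp (- ev n * t) * (exp (ev n * t) * a t) = exp (- ev n * t) * cs n y" by (simp add: g_def)
  then show ?thesis by (simp add: a_def mult.assoc[symmetric] exp_add[symmetric])
qed

lemma summable_abs_le:
  fixes f g :: "nat \<Rightarrow> real"
  assumes "\<And>n. \<bar>f n\<bar> \<le> g n" "summable g" shows "summable (\<lambda>n. \<bar>f n\<bar>)"
  by (rule summable_comparison_test'[OF assms(2), of 0]) (simp add: assms(1))

lemma exp_minus_le: "z > 0 \<Longrightarrow> exp (- z) \<le> 2 / z\<^sup>2" for z :: real
proof -
  assume z: "z > 0"
  have "z\<^sup>2 / 2 \<le> exp z" using exp_lower_Taylor_quadratic[of z] z by simp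
  then show ?thesis using z by (simp add: exp_minus divide_simps mult.commute)
qed

lemma ev_ge: "ev n \<ge> (real n)\<^sup>2"
  using pi_ge_two by (simp add: ev_def power_mult_distrib) (simp add: mult_le_cancel_left1 one_le_power)

lemma ev_nonneg: "ev n \<ge> 0" by (simp add: ev_def)

lemma ev_mono: "m \<le> n \<Longrightarrow> ev m \<le> ev n"
  unfolding ev_def by (intro power_mono mult_right_mono) auto

lemma summable_ev_exp:
  assumes "t > 0" shows "summable (\<lambda>n. ev n * exp (- ev n * t))" "summable (\<lambda>n. exp (- ev n * t))"
proof -
  have le: "ev n * exp (- ev n * t) \<le> 2 / t\<^sup>2 * (1 / (real n)\<^sup>2)" if "n \<ge> 1" for n
  proof -
    have e: "ev n > 0" using that by (simp add: ev_def)
    have n: "(real n)\<^sup>2 > 0" using that by simp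
    have "ev n * exp (- (ev n * t)) \<le> ev n * (2 / (ev n * t)\<^sup>2)"
      using e assms by (intro mult_left_mono exp_minus_le) auto
    also have "\<dots> = 2 / t\<^sup>2 * (1 / ev n)" using e assms by (simp add: power2_eq_square field_simps)
    also have "\<dots> \<le> 2 / t\<^sup>2 * (1 / (real n)\<^sup>2)"
      using ev_ge[of n] n e assms by (intro mult_left_mono divide_left_mono mult_pos_pos) auto
    finally show ?thesis by simp
  qed
  have s: "summable (\<lambda>n. 2 / t\<^sup>2 * (1 / (real n)\<^sup>2))"
    by (intro summable_mult inverse_power_summable[of 2, unfolded inverse_eq_divide]) simp
  show 1: "summable (\<lambda>n. ev n * exp (- ev n * t))"
    by (rule summable_comparison_test'[OF s, of 1]) (use le ev_nonneg in auto)
  have "exp (- ev n * t) \<le> ev n * exp (- ev n * t)" if "n \<ge> 1" for n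
  proof -
    have "1 \<le> (real n)\<^sup>2" using that by simp
    then have "1 \<le> ev n" using ev_ge[of n] by linarith
    then show ?thesis by simp
  qed
  then show "summable (\<lambda>n. exp (- ev n * t))"
    by (intro summable_comparison_test'[OF 1, of 1]) auto
qed

text \<open>By \<open>heat_kernel_eq_hk\<close> this series is the Neumann heat kernel for \<open>t > 0\<close> and \<open>x, y \<in> [0,1]\<close>.\<close>
definition hk :: "real \<Rightarrow> real \<Rightarrow> real \<Rightarrow> real" where
  "hk t x y = (\<Sum>n. wt n * (exp (- ev n * t) * cs n x) * cs n y)"

lemma hk_measurable [measurable]:
  assumes [measurable]: "f \<in> borel_measurable N" "g \<in> borel_measurable N" "h \<in> borel_measurable N"
  shows "(\<lambda>z. hk (f z) (g z) (h z)) \<in> borel_measurable N"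
  unfolding hk_def by measurable

text \<open>The coefficients found in \<open>fc_heat\<close> are absolutely summable for positive
  times, so the continuous function of \<open>x\<close> equals its cosine series.\<close>

lemma heat_kernel_eq_hk:
  assumes G: "neumann_heat_kernel G" and t: "t > 0" and x: "x \<in> {0..1}" and y: "y \<in> {0..1}"
  shows "G t x y = hk t x y"
proof -
  have "neumann_heat_solution (\<lambda>t x. G t x y)" using G y unfolding neumann_heat_kernel_def by blast
  then have "continuous_on ({0<..} \<times> {0..1}) (\<lambda>(t, x). G t x y)" unfolding neumann_heat_solution_def by blast
  then have "continuous_on {0..1} ((\<lambda>(t, x). G t x y) \<circ> (\<lambda>x. (t, x)))"
    by (intro continuous_on_compose) (use t in \<open>auto intro!: continuous_intros intro: continuous_on_subset\<close>)
  then have c: "continuous_on {0..1} (\<lambda>x. G t x y)" by (simp add: comp_def)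
  have "summable (\<lambda>n. \<bar>fc (\<lambda>x. G t x y) n\<bar>)"
    unfolding fc_heat[OF G y t]
    by (rule summable_comparison_test[OF _ summable_ev_exp(2)[OF t]]) (auto simp: abs_mult abs_cs_le mult_left_le)
  from cosine_expansion(1)[OF c this x] show ?thesis
    unfolding fc_heat[OF G y t] hk_def by (simp add: mult_ac)
qed

lemma cos_series_L2:
  assumes a: "summable (\<lambda>n. \<bar>a n\<bar>)"
  shows "(\<integral>\<^sup>+y. ennreal ((\<Sum>n. wt n * a n * cs n y)\<^sup>2) \<partial>unit_measure) = (\<Sum>n. ennreal (wt n * (a n)\<^sup>2))"
proof -
  have b: "summable (\<lambda>n. \<bar>wt n * a n\<bar>)"
    by (rule summable_comparison_test[OF _ summable_mult[OF a, of 2]])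
       (auto simp: abs_mult wt_def)
  define F where "F y = (\<Sum>n. wt n * a n * cs n y)" for y
  have F: "continuous_on {0..1} F" unfolding F_def by (rule cos_series(1)[OF b])
  have fF: "fc F m = a m" for m
    using cos_series(2)[OF b, of m] wt_pos[of m] unfolding F_def by simp
  have s: "(\<lambda>n. wt n * (a n)\<^sup>2) sums (LINT y|unit_measure. (F y)\<^sup>2)"
    using cosine_expansion(2)[OF F] a by (simp add: fF)
  have "(\<integral>\<^sup>+y. ennreal ((F y)\<^sup>2) \<partial>unit_measure) = ennreal (LINT y|unit_measure. (F y)\<^sup>2)"
    by (rule nn_integral_eq_integral) (auto intro!: unit_measure_integral(1) continuous_intros F)
  also have "\<dots> = (\<Sum>n. ennreal (wt n * (a n)\<^sup>2))"
    using s wt_pos by (intro suminf_ennreal_eq[symmetric]) (auto simp: wt_def)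
  finally show ?thesis by (simp add: F_def)
qed

lemma summable_heat_coeff: "t > 0 \<Longrightarrow> summable (\<lambda>n. \<bar>exp (- ev n * t) * cs n x\<bar>)"
  by (rule summable_comparison_test[OF _ summable_ev_exp(2)[of t]]) (auto simp: abs_mult abs_cs_le mult_left_le)

lemma summable_wt: "summable (\<lambda>n. \<bar>a n\<bar>) \<Longrightarrow> summable (\<lambda>n. \<bar>wt n * a n\<bar>)"
  by (rule summable_comparison_test[OF _ summable_mult[of _ 2]]) (auto simp: abs_mult wt_def)

section \<open>Space-time L2 norms of the kernel\<close>

definition nnexp :: "real \<Rightarrow> real \<Rightarrow> ennreal" where
  "nnexp a L = (\<integral>\<^sup>+\<theta>. ennreal (exp (- a * \<theta>)) * indicator {0<..<L} \<theta> \<partial>lborel)"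

lemma nnexp_le_inverse:
  assumes "a > 0" shows "nnexp a L \<le> ennreal (1 / a)"
proof -
  have "nnexp a L \<le> (\<integral>\<^sup>+\<theta>. ennreal (exp (- a * \<theta>)) * indicator {0..} \<theta> \<partial>lborel)"
    unfolding nnexp_def by (intro nn_integral_mono) (auto simp: indicator_def)
  also have "\<dots> = ennreal (0 - (- exp (- a * 0) / a))"
  proof (rule nn_integral_FTC_atLeast)
    show "((\<lambda>\<theta>. - exp (- a * \<theta>) / a) has_real_derivative exp (- a * x)) (at x)" for x
      using assms by (auto intro!: derivative_eq_intros)
    have "((\<lambda>\<theta>. exp (- a * \<theta>)) \<longlongrightarrow> 0) at_top"
      using assms by (intro filterlim_compose[OF exp_at_bot] filterlim_tendsto_neg_mult_at_bot[OF tendsto_const]) (auto simp: filterlim_ident)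
    then have "((\<lambda>\<theta>. - exp (- a * \<theta>) / a) \<longlongrightarrow> - 0 / a) at_top"
      by (intro tendsto_intros) (use assms in auto)
    then show "((\<lambda>\<theta>. - exp (- a * \<theta>) / a) \<longlongrightarrow> 0) at_top" by simp
  qed auto
  finally show ?thesis by simp
qed

lemma nnexp_le_length:
  assumes "a \<ge> 0" "L \<ge> 0" shows "nnexp a L \<le> ennreal L"
proof -
  have "nnexp a L \<le> (\<integral>\<^sup>+\<theta>. indicator {0<..<L} \<theta> \<partial>lborel)"
    unfolding nnexp_def using assms by (intro nn_integral_mono) (auto simp: indicator_def)
  also have "\<dots> = ennreal L" using assms by simp
  finally show ?thesis .
qed

lemma nnexp_ge:
  assumes "a \<ge> 0" "L \<ge> 0" shows "ennreal (L * exp (- a * L)) \<le> nnexp a L"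
proof -
  have "ennreal (L * exp (- a * L)) = (\<integral>\<^sup>+\<theta>. ennreal (exp (- a * L)) * indicator {0<..<L} \<theta> \<partial>lborel)"
    using assms by (subst nn_integral_cmult_indicator) (auto simp: ennreal_mult[symmetric] mult.commute)
  also have "\<dots> \<le> nnexp a L"
    unfolding nnexp_def using assms by (intro nn_integral_mono) (auto simp: indicator_def mult_left_mono)
  finally show ?thesis .
qed

text \<open>The two elementary bounds, \<open>L\<close> and \<open>1 / a\<close>, are merged into
  one expression comparable to their minimum and of a shape that the arctangent can sum.\<close>

lemma nnexp_le:
  assumes "a \<ge> n\<^sup>2" "L > 0" "n > 0" shows "nnexp a L \<le> ennreal (2 * (L / (1 + L * n\<^sup>2)))"
proof -
  have a: "a > 0" using assms by (meson less_le_trans zero_less_power)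
  have n2: "n\<^sup>2 > 0" using assms by simp
  show ?thesis
  proof (cases "L * n\<^sup>2 \<le> 1")
    case True
    have "L * (1 + L * n\<^sup>2) \<le> L * 2" using True assms by (intro mult_left_mono) auto
    moreover have "0 < 1 + L * n\<^sup>2" using assms n2 by (simp add: add_pos_pos)
    ultimately have "L \<le> 2 * (L / (1 + L * n\<^sup>2))"
      by (simp add: pos_le_divide_eq mult.commute)
    then show ?thesis using nnexp_le_length[of a L] a assms by (meson ennreal_leI less_imp_le order_trans)
  next
    case False
    have "0 < 1 + L * n\<^sup>2" using assms n2 by (simp add: add_pos_pos)
    have "1 / a \<le> 1 / n\<^sup>2" by (rule divide_left_mono[OF assms(1) _ mult_pos_pos[OF a n2]]) simp
    also have "\<dots> \<le> 2 * (L / (1 + L * n\<^sup>2))"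
      using False n2 \<open>0 < 1 + L * n\<^sup>2\<close> by (simp add: divide_simps)
    finally show ?thesis using nnexp_le_inverse[OF a, of L] by (meson ennreal_leI order_trans)
  qed
qed

text \<open>Each summand is \<open>sqrt L\<close> times a right-endpoint Riemann term of
  \<open>1 / (1 + z\<^sup>2)\<close> with mesh \<open>sqrt L\<close>. This function decreases, so
  increments of arctan dominate the terms; they telescope to less than \<pi>/2 < 2.\<close>

lemma sum_arctan_bound:
  assumes "L > 0" shows "(\<Sum>n<N. L / (1 + L * (real (Suc n))\<^sup>2)) \<le> 2 * sqrt L"
proof -
  have step: "L / (1 + L * (real (Suc n))\<^sup>2) \<le> sqrt L * (arctan (sqrt L * real (Suc n)) - arctan (sqrt L * real n))" for n
  proof -
    define a where "a = sqrt L * real n"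
    define b where "b = sqrt L * real (Suc n)"
    have ab: "a < b" "0 \<le> a" "b - a = sqrt L" using assms by (auto simp: a_def b_def algebra_simps)
    obtain z where z: "a < z" "z < b" "arctan b - arctan a = (b - a) * inverse (1 + z\<^sup>2)"
      using MVT2[OF ab(1), of arctan "\<lambda>z. inverse (1 + z\<^sup>2)"] DERIV_arctan by blast
    have "z\<^sup>2 \<le> b\<^sup>2" using z ab by (intro power_mono) auto
    then have "sqrt L * (1 / (1 + b\<^sup>2)) \<le> sqrt L * (1 / (1 + z\<^sup>2))"
      using assms by (intro mult_left_mono divide_left_mono) (auto simp: add_pos_nonneg)
    also have "\<dots> = arctan b - arctan a" using z ab by (simp add: inverse_eq_divide)
    finally have "sqrt L * (sqrt L * (1 / (1 + b\<^sup>2))) \<le> sqrt L * (arctan b - arctan a)"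
      using assms by (intro mult_left_mono) auto
    moreover have "b\<^sup>2 = L * (real (Suc n))\<^sup>2" using assms by (simp add: b_def power_mult_distrib)
    ultimately show ?thesis using assms by (simp add: a_def b_def mult.assoc[symmetric])
  qed
  have "(\<Sum>n<N. L / (1 + L * (real (Suc n))\<^sup>2)) \<le> (\<Sum>n<N. sqrt L * (arctan (sqrt L * real (Suc n)) - arctan (sqrt L * real n)))"
    by (intro sum_mono step)
  also have "\<dots> = sqrt L * arctan (sqrt L * real N)"
    unfolding sum_distrib_left[symmetric]
    using sum_lessThan_telescope[of "\<lambda>n. arctan (sqrt L * real n)" N] by simp
  also have "\<dots> \<le> sqrt L * 2"
    using arctan_ubound[of "sqrt L * real N"] pi_less_4 assms by (intro mult_left_mono) auto
  finally show ?thesis by (simp add: mult.commute)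
qed

lemma suminf_ennreal_le:
  assumes "\<And>n. f n \<le> ennreal (b n)" "\<And>n. 0 \<le> b n" "\<And>N. (\<Sum>n<N. b n) \<le> B"
  shows "(\<Sum>n. f n) \<le> ennreal B"
  unfolding suminf_eq_SUP
proof (rule SUP_least)
  fix N
  have "(\<Sum>n<N. f n) \<le> (\<Sum>n<N. ennreal (b n))" by (intro sum_mono assms)
  also have "\<dots> = ennreal (\<Sum>n<N. b n)" using assms by (intro sum_ennreal) auto
  also have "\<dots> \<le> ennreal B" by (intro ennreal_leI assms)
  finally show "(\<Sum>n<N. f n) \<le> ennreal B" .
qed

text \<open>The bound \<open>L + 4 \<Sum> L / (1 + L n\<^sup>2)\<close> is what all upper estimates of kernel norms reduce to.\<close>
lemma suminf_nnexp_le: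
  assumes "0 < L" "c \<ge> 0"
    and f: "\<And>n. f n \<le> ennreal c * nnexp (ev n) L"
  shows "(\<Sum>n. f n) \<le> ennreal (c * (L + 4 * sqrt L))"
proof (rule suminf_ennreal_le)
  \<comment> \<open>The zero eigenvalue brings no decay and is bounded by the length
    \<open>L\<close>; the factor 2 for the other modes is that of \<open>nnexp_le\<close>.\<close>
  define b where "b n = (if n = 0 then c * L else 2 * c * (L / (1 + L * (real n)\<^sup>2)))" for n
  show "f n \<le> ennreal (b n)" for n
  proof (cases "n = 0")
    case True
    have "nnexp (ev n) L \<le> ennreal L" using assms ev_nonneg by (intro nnexp_le_length) auto
    then have "ennreal c * nnexp (ev n) L \<le> ennreal c * ennreal L" by (rule mult_left_mono) simp
    also have "\<dots> = ennreal (b n)" using True assms by (simp add: b_def ennreal_mult[symmetric])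
    finally show ?thesis using f[of n] by order
  next
    case False
    have "nnexp (ev n) L \<le> ennreal (2 * (L / (1 + L * (real n)\<^sup>2)))"
      using False assms ev_ge by (intro nnexp_le) auto
    then have "ennreal c * nnexp (ev n) L \<le> ennreal c * ennreal (2 * (L / (1 + L * (real n)\<^sup>2)))" by (rule mult_left_mono) simp
    also have "\<dots> = ennreal (b n)" using False assms by (simp add: b_def ennreal_mult[symmetric] mult_ac)
    finally show ?thesis using f[of n] by order
  qed
  show "0 \<le> b n" for n using assms by (simp add: b_def)
  show "(\<Sum>n<N. b n) \<le> c * (L + 4 * sqrt L)" for N
  proof (cases N)
    case 0 then show ?thesis using assms by simp
  next
    case (Suc N')
    have "(\<Sum>n<N. b n) = c * L + (\<Sum>n<N'. 2 * c * (L / (1 + L * (real (Suc n))\<^sup>2)))"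
      unfolding Suc sum.lessThan_Suc_shift by (simp add: b_def)
    also have "\<dots> \<le> c * L + 2 * c * (2 * sqrt L)"
      unfolding sum_distrib_left[symmetric]
      using assms by (intro add_mono mult_left_mono sum_arctan_bound) auto
    finally show ?thesis by (simp add: algebra_simps)
  qed
qed

lemma nn_integral_suminf_time:
  assumes [measurable]: "\<And>n. g n \<in> borel_measurable borel"
  shows "(\<integral>\<^sup>+\<theta>. (\<Sum>n. ennreal (g n \<theta>)) * indicator {0<..<L} \<theta> \<partial>lborel)
    = (\<Sum>n. \<integral>\<^sup>+\<theta>. ennreal (g n \<theta>) * indicator {0<..<L :: real} \<theta> \<partial>lborel)"
  by (subst nn_integral_suminf[symmetric]) (auto simp: ennreal_suminf_multc)

text \<open>A squared norm in which \<theta> is the time still to go, so that (0,L) stands for the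
  last stretch of length \<open>L\<close> before the final time.\<close>

definition kernel_norm :: "real \<Rightarrow> (real \<Rightarrow> real \<Rightarrow> real) \<Rightarrow> ennreal" where
  "kernel_norm L f = (\<integral>\<^sup>+\<theta>. (\<integral>\<^sup>+y. ennreal ((f \<theta> y)\<^sup>2) \<partial>unit_measure) * indicator {0<..<L} \<theta> \<partial>lborel)"

lemma kernel_norm_series:
  assumes "\<And>\<theta>. \<theta> > 0 \<Longrightarrow> summable (\<lambda>n. \<bar>a n \<theta>\<bar>)" and [measurable]: "\<And>n. a n \<in> borel_measurable borel"
    and "\<And>\<theta> y. \<theta> > 0 \<Longrightarrow> y \<in> {0..1} \<Longrightarrow> f \<theta> y = (\<Sum>n. wt n * a n \<theta> * cs n y)"
  shows "kernel_norm L f = (\<Sum>n. \<integral>\<^sup>+\<theta>. ennreal (wt n * (a n \<theta>)\<^sup>2) * indicator {0<..<L} \<theta> \<partial>lborel)"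
proof -
  have "kernel_norm L f = (\<integral>\<^sup>+\<theta>. (\<Sum>n. ennreal (wt n * (a n \<theta>)\<^sup>2)) * indicator {0<..<L} \<theta> \<partial>lborel)"
    unfolding kernel_norm_def
  proof (rule nn_integral_cong)
    fix \<theta> :: real
    show "(\<integral>\<^sup>+y. ennreal ((f \<theta> y)\<^sup>2) \<partial>unit_measure) * indicator {0<..<L} \<theta> = (\<Sum>n. ennreal (wt n * (a n \<theta>)\<^sup>2)) * indicator {0<..<L} \<theta>"
    proof (cases "\<theta> \<in> {0<..<L}")
      case True
      then have "\<theta> > 0" by simp
      have "(\<integral>\<^sup>+y. ennreal ((f \<theta> y)\<^sup>2) \<partial>unit_measure) = (\<integral>\<^sup>+y. ennreal ((\<Sum>n. wt n * a n \<theta> * cs n y)\<^sup>2) \<partial>unit_measure)"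
        by (rule nn_integral_cong) (simp add: assms(3)[OF \<open>\<theta> > 0\<close>])
      then show ?thesis by (simp only: cos_series_L2[OF assms(1)[OF \<open>\<theta> > 0\<close>]])
    qed simp
  qed
  also have "\<dots> = (\<Sum>n. \<integral>\<^sup>+\<theta>. ennreal (wt n * (a n \<theta>)\<^sup>2) * indicator {0<..<L} \<theta> \<partial>lborel)"
    by (rule nn_integral_suminf_time) measurable
  finally show ?thesis .
qed

lemma kernel_norm_hk:
  "kernel_norm L (\<lambda>\<theta>. hk \<theta> x) = (\<Sum>n. ennreal (wt n * (cs n x)\<^sup>2) * nnexp (2 * ev n) L)"
proof -
  have "kernel_norm L (\<lambda>\<theta>. hk \<theta> x) = (\<Sum>n. \<integral>\<^sup>+\<theta>. ennreal (wt n * (exp (- ev n * \<theta>) * cs n x)\<^sup>2) * indicator {0<..<L} \<theta> \<partial>lborel)"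
    by (rule kernel_norm_series) (auto simp: hk_def intro!: summable_heat_coeff[simplified])
  also have "(\<lambda>n. \<integral>\<^sup>+\<theta>. ennreal (wt n * (exp (- ev n * \<theta>) * cs n x)\<^sup>2) * indicator {0<..<L} \<theta> \<partial>lborel)
     = (\<lambda>n. ennreal (wt n * (cs n x)\<^sup>2) * nnexp (2 * ev n) L)"
  proof
    fix n
    have "(exp (- ev n * \<theta>))\<^sup>2 = exp (- (2 * ev n) * \<theta>)" for \<theta>
      by (simp add: power2_eq_square exp_add[symmetric])
    then have "ennreal (wt n * (exp (- ev n * \<theta>) * cs n x)\<^sup>2) = ennreal (wt n * (cs n x)\<^sup>2) * ennreal (exp (- (2 * ev n) * \<theta>))" for \<theta>
      using wt_pos[of n] by (simp only: power_mult_distrib) (simp add: ennreal_mult[symmetric] mult_ac)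
    then show "(\<integral>\<^sup>+\<theta>. ennreal (wt n * (exp (- ev n * \<theta>) * cs n x)\<^sup>2) * indicator {0<..<L} \<theta> \<partial>lborel) = ennreal (wt n * (cs n x)\<^sup>2) * nnexp (2 * ev n) L"
      unfolding nnexp_def by (simp only: mult.assoc) (rule nn_integral_cmult, measurable)
  qed
  finally show ?thesis .
qed

lemma nnexp_antimono: "a \<le> b \<Longrightarrow> nnexp b L \<le> nnexp a L"
  unfolding nnexp_def by (intro nn_integral_mono) (auto simp: indicator_def mult_right_mono)

lemma le_sqrt_of_le_1: "0 \<le> L \<Longrightarrow> L \<le> 1 \<Longrightarrow> L \<le> sqrt L"
  by (intro real_le_rsqrt) (simp add: power2_eq_square mult_left_le)

lemma kernel_norm_hk_le:
  assumes "0 < L"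
  shows "kernel_norm L (\<lambda>\<theta>. hk \<theta> x) \<le> ennreal (2 * (L + 4 * sqrt L))"
proof -
  have "(\<Sum>n. ennreal (wt n * (cs n x)\<^sup>2) * nnexp (2 * ev n) L) \<le> ennreal (2 * (L + 4 * sqrt L))"
  proof (rule suminf_nnexp_le[OF assms])
    fix n
    have "(cs n x)\<^sup>2 \<le> 1" using abs_cs_le[of n x] by (simp add: abs_le_square_iff[of _ 1, simplified])
    then have "wt n * (cs n x)\<^sup>2 \<le> 2 * 1" using wt_le[of n] wt_pos[of n] by (intro mult_mono) auto
    then show "ennreal (wt n * (cs n x)\<^sup>2) * nnexp (2 * ev n) L \<le> ennreal 2 * nnexp (ev n) L"
      using ev_nonneg[of n] by (intro mult_mono ennreal_leI nnexp_antimono) auto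
  qed simp
  then show ?thesis by (simp add: kernel_norm_hk)
qed

text \<open>About \<open>1 / sqrt L\<close> modes keep an exponential factor of order 1 throughout
  (0,L), and each contributes up to order \<open>L\<close>. Neighbouring modes cannot both be small
  at an interior point: their squares add up to at least
  \<open>1 - \<bar>cos (pi * x)\<bar>\<close>.\<close>

lemma kernel_norm_hk_ge:
  assumes "0 < L" "L \<le> 1/16"
  shows "ennreal ((1 - \<bar>cos (pi * x)\<bar>) * exp (- 2 * pi\<^sup>2) / 4 * sqrt L) \<le> kernel_norm L (\<lambda>\<theta>. hk \<theta> x)"
proof -
  define \<kappa> where "\<kappa> = 1 - \<bar>cos (pi * x)\<bar>"
  have \<kappa>: "\<kappa> \<ge> 0" by (simp add: \<kappa>_def)
  \<comment> \<open>Modes up to \<open>2 * m\<close> satisfy \<open>n * sqrt L \<le> 1\<close>,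
    hence \<open>ev n * L \<le> pi\<^sup>2\<close>. The condition \<open>L \<le> 1/16\<close> keeps
    the loss from rounding down below one half.\<close>
  define m where "m = nat \<lfloor>1 / (2 * sqrt L)\<rfloor>"
  have sL: "0 < sqrt L" "sqrt L \<le> 1/4" using assms real_sqrt_le_mono[OF assms(2)] by (auto simp: real_sqrt_divide)
  have m1: "real m \<le> 1 / (2 * sqrt L)" unfolding m_def using sL by simp
  have m2: "real m \<ge> 1 / (4 * sqrt L)"
  proof -
    have "1 / (2 * sqrt L) - 1 \<le> real m" unfolding m_def using sL by linarith
    moreover have "1 \<le> 1 / (4 * sqrt L)" using sL by simp
    moreover have "1 / (2 * sqrt L) = 1 / (4 * sqrt L) + 1 / (4 * sqrt L)" by simp
    ultimately show ?thesis by linarith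
  qed
  have pair: "\<kappa> \<le> (cs n x)\<^sup>2 + (cs (Suc n) x)\<^sup>2" for n
  proof -
    define a where "a = real n * pi * x"
    have "cs (Suc n) x = cos (a + pi * x)" by (simp add: cs_def a_def algebra_simps)
    then have "(cs n x)\<^sup>2 + (cs (Suc n) x)\<^sup>2 = (cos a)\<^sup>2 + (cos (a + pi * x))\<^sup>2" by (simp add: cs_def a_def)
    also have "\<dots> = 1 + cos (2 * a + pi * x) * cos (pi * x)"
    proof -
      have "(cos a)\<^sup>2 = (1 + cos (2 * a)) / 2" using cos_double_cos[of a] by simp
      moreover have "(cos (a + pi * x))\<^sup>2 = (1 + cos (2 * (a + pi * x))) / 2" using cos_double_cos[of "a + pi * x"] by simp
      moreover have "cos (2 * a + pi * x) * cos (pi * x) = (cos (2 * a) + cos (2 * (a + pi * x))) / 2"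
        unfolding cos_times_cos by (simp add: algebra_simps)
      ultimately show ?thesis by (simp add: add_divide_distrib)
    qed
    also have "\<dots> \<ge> \<kappa>"
    proof -
      have "\<bar>cos (2 * a + pi * x)\<bar> * \<bar>cos (pi * x)\<bar> \<le> 1 * \<bar>cos (pi * x)\<bar>" by (intro mult_right_mono) auto
      then show ?thesis unfolding \<kappa>_def abs_mult[symmetric] by linarith
    qed
    finally show ?thesis .
  qed
  \<comment> \<open>Mode 0 stays unpaired, which explains the \<open>+ 1\<close>; the other modes
    are paired as (2j+1, 2j+2).\<close>
  have sum: "real k * \<kappa> \<le> (\<Sum>n<2 * k + 1. (cs n x)\<^sup>2)" for k
  proof (induction k)
    case 0 then show ?case by simp
  next
    case (Suc k)
    have "(\<Sum>n<2 * Suc k + 1. (cs n x)\<^sup>2) = (\<Sum>n<2 * k + 1. (cs n x)\<^sup>2) + ((cs (2 * k + 1) x)\<^sup>2 + (cs (Suc (2 * k + 1)) x)\<^sup>2)"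
      by simp
    then show ?case using Suc pair[of "2 * k + 1"] by (simp add: algebra_simps)
  qed
  have tm: "ennreal (L * exp (- 2 * pi\<^sup>2) * (cs n x)\<^sup>2) \<le> ennreal (wt n * (cs n x)\<^sup>2) * nnexp (2 * ev n) L" if "n < 2 * m + 1" for n
  proof -
    have "real n \<le> 2 * real m" using that by linarith
    also have "\<dots> \<le> 1 / sqrt L" using m1 by simp
    finally have "real n * sqrt L \<le> 1" using sL by (simp add: pos_le_divide_eq)
    then have "(real n * sqrt L)\<^sup>2 \<le> 1\<^sup>2" using sL by (intro power_mono) auto
    then have "(real n)\<^sup>2 * L \<le> 1" using assms by (simp add: power_mult_distrib)
    then have "pi\<^sup>2 * ((real n)\<^sup>2 * L) \<le> pi\<^sup>2 * 1" by (intro mult_left_mono) auto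
    then have "exp (- 2 * pi\<^sup>2) \<le> exp (- (2 * ev n) * L)" by (simp add: ev_def power_mult_distrib mult_ac)
    then have "L * exp (- 2 * pi\<^sup>2) \<le> L * exp (- (2 * ev n) * L)" using assms by (intro mult_left_mono) auto
    then have "ennreal (L * exp (- 2 * pi\<^sup>2)) \<le> nnexp (2 * ev n) L"
      using nnexp_ge[of "2 * ev n" L] ev_nonneg[of n] assms by (meson ennreal_leI less_imp_le mult_nonneg_nonneg order_trans zero_le_numeral)
    moreover have "ennreal ((cs n x)\<^sup>2) \<le> ennreal (wt n * (cs n x)\<^sup>2)"
      using wt_ge[of n] by (intro ennreal_leI) (simp add: mult_le_cancel_right1)
    ultimately have "ennreal ((cs n x)\<^sup>2) * ennreal (L * exp (- 2 * pi\<^sup>2)) \<le> ennreal (wt n * (cs n x)\<^sup>2) * nnexp (2 * ev n) L"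
      by (intro mult_mono) auto
    then show ?thesis using assms by (simp add: ennreal_mult[symmetric] mult_ac)
  qed
  have "\<kappa> * exp (- 2 * pi\<^sup>2) / 4 * sqrt L = L * exp (- 2 * pi\<^sup>2) * (1 / (4 * sqrt L) * \<kappa>)"
    using sL assms by (simp add: field_simps)
  also have "\<dots> \<le> L * exp (- 2 * pi\<^sup>2) * (real m * \<kappa>)"
    using assms m2 \<kappa> by (intro mult_left_mono mult_right_mono) auto
  also have "\<dots> \<le> L * exp (- 2 * pi\<^sup>2) * (\<Sum>n<2 * m + 1. (cs n x)\<^sup>2)"
    using assms sum[of m] by (intro mult_left_mono) auto
  finally have "ennreal (\<kappa> * exp (- 2 * pi\<^sup>2) / 4 * sqrt L) \<le> ennreal (\<Sum>n<2 * m + 1. L * exp (- 2 * pi\<^sup>2) * (cs n x)\<^sup>2)"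
    unfolding sum_distrib_left by (rule ennreal_leI)
  also have "\<dots> = (\<Sum>n<2 * m + 1. ennreal (L * exp (- 2 * pi\<^sup>2) * (cs n x)\<^sup>2))"
    using assms by (intro sum_ennreal[symmetric]) auto
  also have "\<dots> \<le> (\<Sum>n<2 * m + 1. ennreal (wt n * (cs n x)\<^sup>2) * nnexp (2 * ev n) L)"
    by (intro sum_mono tm) auto
  also have "\<dots> \<le> (\<Sum>n. ennreal (wt n * (cs n x)\<^sup>2) * nnexp (2 * ev n) L)"
    by (rule sum_le_suminf) auto
  finally show ?thesis by (simp add: kernel_norm_hk \<kappa>_def)
qed

section \<open>Localisation of the kernel near its pole\<close>

lemma exp_diff_le:
  fixes a b t :: real
  assumes "a \<le> b" "t \<ge> 0" shows "\<bar>exp (- a * t) - exp (- b * t)\<bar> \<le> (b - a) * t * exp (- a * t)"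
proof -
  have "1 - exp (- ((b - a) * t)) \<le> (b - a) * t" using exp_ge_add_one_self[of "- ((b - a) * t)"] by linarith
  then have "exp (- a * t) * (1 - exp (- ((b - a) * t))) \<le> exp (- a * t) * ((b - a) * t)" by (intro mult_left_mono) auto
  moreover have "exp (- a * t) * exp (- ((b - a) * t)) = exp (- b * t)" by (simp add: exp_add[symmetric] algebra_simps)
  moreover have "exp (- b * t) \<le> exp (- a * t)" using assms by (simp add: mult_right_mono)
  ultimately show ?thesis by (simp add: algebra_simps)
qed

text \<open>Multiplication by \<open>cos (\<pi> y)\<close> shifts the cosine coefficients, so only differences of neighbouring
  exponentials survive in the coefficients of \<open>(cos (\<pi> y) - cos (\<pi> x)) hk \<theta> x y\<close>.\<close>
lemma fc_weighted_hk:
  fixes x :: real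
  assumes \<theta>: "\<theta> > 0"
  defines "f \<equiv> \<lambda>y. (cs 1 y - cs 1 x) * hk \<theta> x y"
    and "dd \<equiv> \<lambda>m. \<bar>exp (- ev m * \<theta>) - exp (- ev (Suc m) * \<theta>)\<bar>"
  shows "continuous_on {0..1} f" and "\<bar>fc f 0\<bar> \<le> dd 0" and "\<bar>fc f (Suc m)\<bar> \<le> (dd (Suc m) + dd m) / 2"
proof -
  define c where "c n = exp (- ev n * \<theta>) * cs n x" for n
  have sc: "summable (\<lambda>n. \<bar>wt n * c n\<bar>)" unfolding c_def by (intro summable_wt summable_heat_coeff \<theta>)
  have h: "hk \<theta> x = (\<lambda>y. \<Sum>n. wt n * c n * cs n y)" by (rule ext) (simp add: hk_def c_def)
  have hc: "continuous_on {0..1} (hk \<theta> x)" unfolding h by (rule cos_series(1)[OF sc])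
  have fh: "(LINT y|unit_measure. hk \<theta> x y * cs n y) = c n" for n
    using cos_series(2)[OF sc, of n] wt_pos[of n] unfolding h fc_def by simp
  show "continuous_on {0..1} f" unfolding f_def by (intro continuous_intros hc)
  have i: "integrable unit_measure (\<lambda>y. hk \<theta> x y * cs n y)" for n
    by (rule unit_measure_integral(1)) (intro continuous_intros hc)
  have "fc f 0 = (LINT y|unit_measure. hk \<theta> x y * cs 1 y - cs 1 x * (hk \<theta> x y * cs 0 y))"
    unfolding fc_def f_def by (simp add: algebra_simps)
  also have "\<dots> = c 1 - cs 1 x * c 0"
    by (subst Bochner_Integration.integral_diff) (auto intro!: i integrable_mult_right simp del: cs_0 simp: fh)
  also have "\<dots> = - (exp (- ev 0 * \<theta>) - exp (- ev (Suc 0) * \<theta>)) * cs 1 x" by (simp add: c_def ev_def algebra_simps)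
  finally have "\<bar>fc f 0\<bar> = dd 0 * \<bar>cs 1 x\<bar>" by (simp only: dd_def abs_mult abs_minus_cancel)
  then show "\<bar>fc f 0\<bar> \<le> dd 0" using abs_cs_le[of 1 x] by (simp add: dd_def mult_left_le)
  have prod: "cs 1 y * cs (Suc m) y = (cs (Suc (Suc m)) y + cs m y) / 2" for y
    using cs_times_cs[of "Suc m" y 1] by (simp add: cs_def algebra_simps)
  have "fc f (Suc m) = (LINT y|unit_measure. (hk \<theta> x y * cs (Suc (Suc m)) y + hk \<theta> x y * cs m y) / 2 - cs 1 x * (hk \<theta> x y * cs (Suc m) y))"
    unfolding fc_def f_def
  proof (rule Bochner_Integration.integral_cong)
    fix y
    have "(cs 1 y - cs 1 x) * hk \<theta> x y * cs (Suc m) y = hk \<theta> x y * (cs 1 y * cs (Suc m) y) - cs 1 x * (hk \<theta> x y * cs (Suc m) y)"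
      by (simp add: algebra_simps)
    then show "(cs 1 y - cs 1 x) * hk \<theta> x y * cs (Suc m) y = (hk \<theta> x y * cs (Suc (Suc m)) y + hk \<theta> x y * cs m y) / 2 - cs 1 x * (hk \<theta> x y * cs (Suc m) y)"
      unfolding prod by (simp only: times_divide_eq_right distrib_left)
  qed simp
  also have "\<dots> = (c (Suc (Suc m)) + c m) / 2 - cs 1 x * c (Suc m)"
    by (subst Bochner_Integration.integral_diff)
       (auto intro!: i integrable_mult_right integrable_divide Bochner_Integration.integrable_add simp: fh i)
  \<comment> \<open>The product formula is applied in \<open>x\<close> as well; the halves then pair
    with \<open>c (Suc (Suc m))\<close> and \<open>c m\<close> into differences of neighbouring
    exponentials.\<close>
  also have "cs 1 x * c (Suc m) = exp (- ev (Suc m) * \<theta>) * ((cs (Suc (Suc m)) x + cs m x) / 2)"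
    unfolding c_def prod[symmetric] by (simp add: mult_ac)
  finally have e: "fc f (Suc m) = (- (exp (- ev (Suc m) * \<theta>) - exp (- ev (Suc (Suc m)) * \<theta>)) * cs (Suc (Suc m)) x
      + (exp (- ev m * \<theta>) - exp (- ev (Suc m) * \<theta>)) * cs m x) / 2"
    by (simp add: c_def field_simps)
  have "\<bar>- (exp (- ev (Suc m) * \<theta>) - exp (- ev (Suc (Suc m)) * \<theta>)) * cs (Suc (Suc m)) x\<bar> \<le> dd (Suc m)"
    using abs_cs_le[of "Suc (Suc m)" x] unfolding abs_mult abs_minus_cancel dd_def by (simp add: mult_left_le)
  moreover have "\<bar>(exp (- ev m * \<theta>) - exp (- ev (Suc m) * \<theta>)) * cs m x\<bar> \<le> dd m"
    using abs_cs_le[of m x] unfolding abs_mult dd_def by (simp add: mult_left_le)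
  moreover have "\<bar>(p + q) / 2\<bar> \<le> (P + Q) / 2" if "\<bar>p\<bar> \<le> P" "\<bar>q\<bar> \<le> Q" for p q P Q :: real
    using that unfolding abs_le_iff by (simp add: field_simps)
  ultimately show "\<bar>fc f (Suc m)\<bar> \<le> (dd (Suc m) + dd m) / 2"
    unfolding e by blast
qed

text \<open>The gap between neighbouring eigenvalues is (2m+1)\<pi>^2, so the square carries
  \<theta>^2 (2m+1)^2 and two exponentials. For positive \<open>m\<close>, one \<theta> and one
  exponential absorb (2m+1)^2 because \<open>z * exp (- z) \<le> 1\<close>, and one \<theta>
  survives. The 9 comes from 2m+1 \<le> 3m.\<close>

lemma neighbour_exp_diff_sq:
  assumes "0 < \<theta>" "\<theta> \<le> 1"
  shows "(exp (- ev m * \<theta>) - exp (- ev (Suc m) * \<theta>))\<^sup>2 \<le> 9 * pi ^ 4 * \<theta> * exp (- ev m * \<theta>)"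
proof -
  have p2: "pi\<^sup>2 \<ge> 1" using pi_ge_two by (simp add: one_le_power)
  have d: "ev (Suc m) - ev m = (2 * real m + 1) * pi\<^sup>2" by (simp add: ev_def power2_eq_square algebra_simps)
  have d0: "0 \<le> (ev (Suc m) - ev m) * \<theta> * exp (- ev m * \<theta>)" using ev_mono[of m "Suc m"] assms by simp
  have "(exp (- ev m * \<theta>) - exp (- ev (Suc m) * \<theta>))\<^sup>2 \<le> ((ev (Suc m) - ev m) * \<theta> * exp (- ev m * \<theta>))\<^sup>2"
    using exp_diff_le[of "ev m" "ev (Suc m)" \<theta>] ev_mono[of m "Suc m"] assms d0
    by (intro abs_le_square_iff[THEN iffD1]) (simp only: abs_of_nonneg le_add_same_cancel1 lessI less_imp_le)
  also have "\<dots> = ((2 * real m + 1)\<^sup>2 * pi ^ 4 * \<theta> * (\<theta> * exp (- ev m * \<theta>))) * exp (- ev m * \<theta>)"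
    unfolding d by (simp add: power2_eq_square power4_eq_xxxx mult_ac)
  also have "\<dots> \<le> (9 * pi ^ 4 * \<theta>) * exp (- ev m * \<theta>)"
  proof (rule mult_right_mono)
    show "(2 * real m + 1)\<^sup>2 * pi ^ 4 * \<theta> * (\<theta> * exp (- ev m * \<theta>)) \<le> 9 * pi ^ 4 * \<theta>"
    proof (cases "m = 0")
      case True
      then show ?thesis using assms by (simp add: ev_def mult_le_one)
    next
      case False
      then have m: "real m \<ge> 1" by simp
      define z where "z = ev m * \<theta>"
      have "z \<le> exp z" using exp_ge_add_one_self[of z] by linarith
      then have "z * exp (- z) \<le> 1" by (simp add: exp_minus field_simps)
      moreover have "(2 * real m + 1)\<^sup>2 \<le> (3 * real m)\<^sup>2" using m by (intro power_mono) auto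
      then have "(2 * real m + 1)\<^sup>2 \<le> 9 * ev m" using ev_ge[of m] by (simp add: power_mult_distrib)
      then have "(2 * real m + 1)\<^sup>2 * (\<theta> * exp (- z)) \<le> 9 * ev m * (\<theta> * exp (- z))" using assms by (intro mult_right_mono) auto
      ultimately have "(2 * real m + 1)\<^sup>2 * (\<theta> * exp (- z)) \<le> 9" by (simp add: z_def mult_ac)
      then have "pi ^ 4 * \<theta> * ((2 * real m + 1)\<^sup>2 * (\<theta> * exp (- z))) \<le> pi ^ 4 * \<theta> * 9" using assms by (intro mult_left_mono) auto
      then show ?thesis by (simp add: z_def mult_ac)
    qed
  qed simp
  finally show ?thesis .
qed

text \<open>Against the unweighted norm of order \<open>sqrt L\<close> the weight gains a full
  factor \<open>L\<close>, since at times below \<open>L\<close> the kernel concentrates at distance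
  about \<open>sqrt L\<close> from \<open>x\<close>. In Fourier terms the gain is the factor
  \<theta> in \<open>neighbour_exp_diff_sq\<close>.\<close>

lemma kernel_norm_weighted_hk_le:
  assumes "0 < L" "L \<le> 1"
  shows "kernel_norm L (\<lambda>\<theta> y. (cs 1 y - cs 1 x) * hk \<theta> x y) \<le> ennreal (90 * pi ^ 4 * L * sqrt L)"
proof -
  define dd where "dd \<theta> m = \<bar>exp (- ev m * \<theta>) - exp (- ev (Suc m) * \<theta>)\<bar>" for \<theta> m
  define D where "D m = (\<integral>\<^sup>+\<theta>. ennreal ((dd \<theta> m)\<^sup>2) * indicator {0<..<L} \<theta> \<partial>lborel)" for m
  define a where "a n \<theta> = fc (\<lambda>y. (cs 1 y - cs 1 x) * hk \<theta> x y) n" for n \<theta>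
  have dd0: "dd \<theta> m \<ge> 0" for \<theta> m by (simp add: dd_def)
  have [measurable]: "(\<lambda>\<theta>. dd \<theta> m) \<in> borel_measurable borel" for m unfolding dd_def by measurable
  have a_le: "\<bar>a n \<theta>\<bar> \<le> dd \<theta> n + (if n = 0 then 0 else dd \<theta> (n - 1))"
    and a_sq: "wt n * (a n \<theta>)\<^sup>2 \<le> (dd \<theta> n)\<^sup>2 + (if n = 0 then 0 else (dd \<theta> (n - 1))\<^sup>2)" if \<theta>: "\<theta> > 0" for n \<theta>
  proof -
    have "\<bar>a n \<theta>\<bar> \<le> dd \<theta> n + (if n = 0 then 0 else dd \<theta> (n - 1)) \<and> wt n * (a n \<theta>)\<^sup>2 \<le> (dd \<theta> n)\<^sup>2 + (if n = 0 then 0 else (dd \<theta> (n - 1))\<^sup>2)"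
    proof (cases n)
      case 0
      have "\<bar>a 0 \<theta>\<bar> \<le> dd \<theta> 0" unfolding a_def dd_def using fc_weighted_hk(2)[OF \<theta>, of x] by simp
      then have "\<bar>a 0 \<theta>\<bar>\<^sup>2 \<le> (dd \<theta> 0)\<^sup>2" by (intro power_mono) auto
      then show ?thesis using 0 \<open>\<bar>a 0 \<theta>\<bar> \<le> dd \<theta> 0\<close> by simp
    next
      case (Suc m)
      have "\<bar>a (Suc m) \<theta>\<bar> \<le> (dd \<theta> (Suc m) + dd \<theta> m) / 2" unfolding a_def dd_def using fc_weighted_hk(3)[OF \<theta>, of x m] by simp
      moreover from this have "\<bar>a (Suc m) \<theta>\<bar>\<^sup>2 \<le> ((dd \<theta> (Suc m) + dd \<theta> m) / 2)\<^sup>2" by (intro power_mono) auto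
      \<comment> \<open>The weight 2 of the nonconstant modes is matched by convexity of the square,
        so no constant is lost.\<close>
      moreover have "2 * ((dd \<theta> (Suc m) + dd \<theta> m) / 2)\<^sup>2 \<le> (dd \<theta> (Suc m))\<^sup>2 + (dd \<theta> m)\<^sup>2"
        using zero_le_power2[of "dd \<theta> (Suc m) - dd \<theta> m"] by (simp add: power2_eq_square field_simps)
      ultimately show ?thesis using Suc dd0[of \<theta> m] dd0[of \<theta> "Suc m"] by simp
    qed
    then show "\<bar>a n \<theta>\<bar> \<le> dd \<theta> n + (if n = 0 then 0 else dd \<theta> (n - 1))"
      "wt n * (a n \<theta>)\<^sup>2 \<le> (dd \<theta> n)\<^sup>2 + (if n = 0 then 0 else (dd \<theta> (n - 1))\<^sup>2)" by auto
  qed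
  have sdd: "summable (dd \<theta>)" if "\<theta> > 0" for \<theta>
  proof (rule summable_comparison_test[OF _ summable_add[OF summable_ev_exp(2)[OF that] summable_ev_exp(2)[OF that, THEN summable_ignore_initial_segment[of _ 1]]]])
    show "\<exists>N. \<forall>n\<ge>N. norm (dd \<theta> n) \<le> exp (- ev n * \<theta>) + exp (- ev (n + 1) * \<theta>)"
      by (rule exI[of _ 0]) (auto simp: dd_def abs_le_iff)
  qed
  have sa: "summable (\<lambda>n. \<bar>a n \<theta>\<bar>)" if "\<theta> > 0" for \<theta>
  proof (rule summable_comparison_test)
    show "\<exists>N. \<forall>n\<ge>N. norm \<bar>a n \<theta>\<bar> \<le> dd \<theta> n + (if n = 0 then 0 else dd \<theta> (n - 1))"
      using a_le[OF that] by auto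
    have "summable (\<lambda>n. if n = 0 then 0 else dd \<theta> (n - 1))"
      by (subst summable_Suc_iff[symmetric]) (use sdd[OF that] in simp)
    then show "summable (\<lambda>n. dd \<theta> n + (if n = 0 then 0 else dd \<theta> (n - 1)))"
      by (intro summable_add sdd that)
  qed
  have D_le: "D m \<le> ennreal (9 * pi ^ 4 * L) * nnexp (ev m) L" for m
  proof -
    have "D m \<le> (\<integral>\<^sup>+\<theta>. ennreal (9 * pi ^ 4 * L) * (ennreal (exp (- ev m * \<theta>)) * indicator {0<..<L} \<theta>) \<partial>lborel)"
      unfolding D_def
    proof (rule nn_integral_mono)
      fix \<theta> :: real
      show "ennreal ((dd \<theta> m)\<^sup>2) * indicator {0<..<L} \<theta> \<le> ennreal (9 * pi ^ 4 * L) * (ennreal (exp (- ev m * \<theta>)) * indicator {0<..<L} \<theta>)"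
      proof (cases "\<theta> \<in> {0<..<L}")
        case True
        then have "(dd \<theta> m)\<^sup>2 \<le> 9 * pi ^ 4 * \<theta> * exp (- ev m * \<theta>)"
          unfolding dd_def power2_abs using assms by (intro neighbour_exp_diff_sq) auto
        also have "\<dots> \<le> 9 * pi ^ 4 * L * exp (- ev m * \<theta>)"
          using True by (intro mult_right_mono mult_left_mono) auto
        finally show ?thesis using True assms by (simp add: ennreal_mult[symmetric] ennreal_leI)
      qed simp
    qed
    also have "\<dots> = ennreal (9 * pi ^ 4 * L) * nnexp (ev m) L"
      unfolding nnexp_def by (rule nn_integral_cmult) measurable
    finally show ?thesis .
  qed
  \<comment> \<open>The 5 is 1 + 4 after \<open>L \<le> sqrt L\<close>. Each squared difference
    serves two neighbouring coefficients, which doubles 45 to the final 90.\<close>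
  have sD: "(\<Sum>m. D m) \<le> ennreal (5 * (9 * pi ^ 4 * L) * sqrt L)"
  proof -
    have "(\<Sum>m. D m) \<le> ennreal (9 * pi ^ 4 * L * (L + 4 * sqrt L))"
      using assms by (intro suminf_nnexp_le D_le) auto
    also have "\<dots> \<le> ennreal (9 * pi ^ 4 * L * (sqrt L + 4 * sqrt L))"
      using assms by (intro ennreal_leI mult_left_mono add_right_mono le_sqrt_of_le_1) auto
    finally show ?thesis by (simp add: mult_ac)
  qed
  have "kernel_norm L (\<lambda>\<theta> y. (cs 1 y - cs 1 x) * hk \<theta> x y) \<le> (\<integral>\<^sup>+\<theta>. (\<Sum>n. ennreal ((dd \<theta> n)\<^sup>2 + (if n = 0 then 0 else (dd \<theta> (n - 1))\<^sup>2))) * indicator {0<..<L} \<theta> \<partial>lborel)"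
    unfolding kernel_norm_def
  proof (rule nn_integral_mono)
    fix \<theta> :: real
    show "(\<integral>\<^sup>+y. ennreal (((cs 1 y - cs 1 x) * hk \<theta> x y)\<^sup>2) \<partial>unit_measure) * indicator {0<..<L} \<theta>
        \<le> (\<Sum>n. ennreal ((dd \<theta> n)\<^sup>2 + (if n = 0 then 0 else (dd \<theta> (n - 1))\<^sup>2))) * indicator {0<..<L} \<theta>"
    proof (cases "\<theta> \<in> {0<..<L}")
      case True
      then have \<theta>: "\<theta> > 0" by simp
      note c = fc_weighted_hk(1)[OF \<theta>, of x]
      have "(\<integral>\<^sup>+y. ennreal (((cs 1 y - cs 1 x) * hk \<theta> x y)\<^sup>2) \<partial>unit_measure)
          = (\<integral>\<^sup>+y. ennreal ((\<Sum>n. wt n * a n \<theta> * cs n y)\<^sup>2) \<partial>unit_measure)"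
      proof (rule nn_integral_cong)
        fix y assume "y \<in> space unit_measure"
        then have "(cs 1 y - cs 1 x) * hk \<theta> x y = (\<Sum>n. wt n * a n \<theta> * cs n y)"
          unfolding a_def by (intro cosine_expansion(1)[OF c sa[OF \<theta>, unfolded a_def]]) simp
        then show "ennreal (((cs 1 y - cs 1 x) * hk \<theta> x y)\<^sup>2) = ennreal ((\<Sum>n. wt n * a n \<theta> * cs n y)\<^sup>2)"
          by (simp only:)
      qed
      also have "\<dots> = (\<Sum>n. ennreal (wt n * (a n \<theta>)\<^sup>2))" by (rule cos_series_L2[OF sa[OF \<theta>]])
      also have "\<dots> \<le> (\<Sum>n. ennreal ((dd \<theta> n)\<^sup>2 + (if n = 0 then 0 else (dd \<theta> (n - 1))\<^sup>2)))"
        by (intro suminf_le ennreal_leI a_sq \<theta>) auto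
      finally show ?thesis using True by simp
    qed simp
  qed
  also have "\<dots> = (\<Sum>n. \<integral>\<^sup>+\<theta>. ennreal ((dd \<theta> n)\<^sup>2 + (if n = 0 then 0 else (dd \<theta> (n - 1))\<^sup>2)) * indicator {0<..<L} \<theta> \<partial>lborel)"
    by (rule nn_integral_suminf_time) measurable
  also have "\<dots> = (\<Sum>n. D n + (if n = 0 then 0 else D (n - 1)))"
  proof (rule suminf_cong)
    fix n
    show "(\<integral>\<^sup>+\<theta>. ennreal ((dd \<theta> n)\<^sup>2 + (if n = 0 then 0 else (dd \<theta> (n - 1))\<^sup>2)) * indicator {0<..<L} \<theta> \<partial>lborel) = D n + (if n = 0 then 0 else D (n - 1))"
      unfolding D_def by (cases "n = 0") (simp_all add: distrib_right nn_integral_add)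
  qed
  also have "\<dots> = (\<Sum>n. D n) + (\<Sum>n. if n = 0 then 0 else D (n - 1))"
    by (rule suminf_add[symmetric]) auto
  also have "(\<Sum>n. if n = 0 then 0 else D (n - 1)) = (\<Sum>n. D n)"
  proof -
    have "(\<lambda>n. if Suc n = 0 then 0 else D (Suc n - 1)) sums (\<Sum>n. D n)" by (simp add: summable_sums)
    from sums_Suc[OF this] show ?thesis by (simp add: sums_iff)
  qed
  also have "(\<Sum>n. D n) + (\<Sum>n. D n) \<le> ennreal (5 * (9 * pi ^ 4 * L) * sqrt L) + ennreal (5 * (9 * pi ^ 4 * L) * sqrt L)"
    by (intro add_mono sD)
  also have "\<dots> = ennreal (90 * pi ^ 4 * L * sqrt L)" using assms by (simp add: ennreal_plus[symmetric] del: ennreal_plus)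
  finally show ?thesis .
qed

section \<open>Kernel increments in time and space\<close>

lemma abs_sin_mult_le: "\<bar>sin (real n * a)\<bar> \<le> real n * \<bar>sin a\<bar>"
proof (induction n)
  case (Suc n)
  have "sin (real (Suc n) * a) = sin (real n * a) * cos a + cos (real n * a) * sin a"
    by (simp add: distrib_right sin_add add.commute)
  also have "\<bar>\<dots>\<bar> \<le> \<bar>sin (real n * a)\<bar> * 1 + 1 * \<bar>sin a\<bar>"
    by (intro order_trans[OF abs_triangle_ineq] add_mono) (auto simp: abs_mult intro!: mult_left_le mult_left_le_one_le)
  finally show ?case using Suc by (simp add: algebra_simps)
qed simp

text \<open>In the variable cos(\<pi> x), \<open>cs n\<close> is the n-th Chebyshev polynomial,
  whose Lipschitz constant on [-1,1] is n^2. The sum-to-product formula shows it: both sine factors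
  grow at most linearly in \<open>n\<close>.\<close>

lemma cs_diff_le: "\<bar>cs n x - cs n y\<bar> \<le> (real n)\<^sup>2 * \<bar>cs 1 x - cs 1 y\<bar>"
proof -
  define a where "a = pi * (x + y) / 2"
  define b where "b = pi * (y - x) / 2"
  have e: "cs n x - cs n y = 2 * sin (real n * a) * sin (real n * b)" for n
    unfolding cs_def a_def b_def cos_diff_cos by (simp add: algebra_simps)
  have "\<bar>sin (real n * a)\<bar> * \<bar>sin (real n * b)\<bar> \<le> (real n * \<bar>sin a\<bar>) * (real n * \<bar>sin b\<bar>)"
    by (intro mult_mono abs_sin_mult_le) auto
  then show ?thesis unfolding e by (simp add: abs_mult power2_eq_square mult_ac)
qed

lemma summable_powr_32: "summable (\<lambda>n. (real n) powr (- 3 / 2))"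
  by (subst summable_real_powr_iff) simp

text \<open>Sixteen times the zeta value at 3/2: the exponent is that of
  \<open>ev n powr (1/4) / ev n\<close>, and the term for 0 is 0 because \<open>0 powr _\<close> is
  0.\<close>

definition kernel_const :: real where "kernel_const = 16 * (\<Sum>n. (real n) powr (- 3 / 2))"

lemma kernel_const_nonneg: "kernel_const \<ge> 0"
  unfolding kernel_const_def by (intro mult_nonneg_nonneg suminf_nonneg summable_powr_32) auto

text \<open>The squared Fourier multiplier is at most \<open>min 4 \<rho>\<^sup>2 \<le> 4 \<rho> powr (1/4)\<close>, which leaves a summable series.\<close>
lemma kernel_norm_increment_le:
  assumes "\<eta> \<ge> 0"
  shows "kernel_norm L (\<lambda>\<theta> y. hk (\<theta> + \<eta>) x y - hk \<theta> x' y) \<le> ennreal (kernel_const * (\<eta> + \<bar>cs 1 x - cs 1 x'\<bar>) powr (1/4))"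
proof -
  define d where "d = \<eta> + \<bar>cs 1 x - cs 1 x'\<bar>"
  have d: "d \<ge> 0" using assms by (simp add: d_def)
  define q where "q n = exp (- ev n * \<eta>) * cs n x - cs n x'" for n
  have qs: "summable (\<lambda>n. \<bar>exp (- ev n * \<theta>) * q n\<bar>)" if "\<theta> > 0" for \<theta>
  proof (rule summable_comparison_test[OF _ summable_mult[OF summable_ev_exp(2)[OF that], of 2]])
    show "\<exists>N. \<forall>n\<ge>N. norm \<bar>exp (- ev n * \<theta>) * q n\<bar> \<le> 2 * exp (- ev n * \<theta>)"
    proof (intro exI allI impI)
      fix n
      have "\<bar>exp (- ev n * \<eta>) * cs n x\<bar> \<le> 1 * 1"
        unfolding abs_mult using ev_nonneg[of n] assms abs_cs_le[of n x] by (intro mult_mono) auto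
      then have "\<bar>q n\<bar> \<le> 2" using abs_cs_le[of n x'] unfolding q_def by linarith
      then show "norm \<bar>exp (- ev n * \<theta>) * q n\<bar> \<le> 2 * exp (- ev n * \<theta>)"
        by (simp add: abs_mult)
    qed
  qed
  have k: "kernel_norm L (\<lambda>\<theta> y. hk (\<theta> + \<eta>) x y - hk \<theta> x' y) = (\<Sum>n. \<integral>\<^sup>+\<theta>. ennreal (wt n * (exp (- ev n * \<theta>) * q n)\<^sup>2) * indicator {0<..<L} \<theta> \<partial>lborel)"
  proof (rule kernel_norm_series[OF qs])
    fix \<theta> y :: real assume "\<theta> > 0"
    have s: "summable (\<lambda>n. wt n * (exp (- ev n * t) * cs n z) * cs n y)" if "t > 0" for t z
      by (rule summable_comparison_test[OF _ summable_wt[OF summable_heat_coeff[OF that, of z]]])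
         (auto simp: abs_mult abs_cs_le mult_left_le intro!: exI[of _ 0])
    have "hk (\<theta> + \<eta>) x y - hk \<theta> x' y = (\<Sum>n. wt n * (exp (- ev n * (\<theta> + \<eta>)) * cs n x) * cs n y - wt n * (exp (- ev n * \<theta>) * cs n x') * cs n y)"
      unfolding hk_def using \<open>\<theta> > 0\<close> assms by (intro suminf_diff s) auto
    also have "\<dots> = (\<Sum>n. wt n * (exp (- ev n * \<theta>) * q n) * cs n y)"
    proof (rule suminf_cong)
      fix n
      have "exp (- ev n * (\<theta> + \<eta>)) = exp (- ev n * \<theta>) * exp (- ev n * \<eta>)" by (simp add: exp_add[symmetric] algebra_simps)
      then show "wt n * (exp (- ev n * (\<theta> + \<eta>)) * cs n x) * cs n y - wt n * (exp (- ev n * \<theta>) * cs n x') * cs n y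
          = wt n * (exp (- ev n * \<theta>) * q n) * cs n y"
        unfolding q_def by (simp only:) (simp only: right_diff_distrib left_diff_distrib mult_ac)
    qed
    finally show "hk (\<theta> + \<eta>) x y - hk \<theta> x' y = (\<Sum>n. wt n * (exp (- ev n * \<theta>) * q n) * cs n y)" .
  qed measurable
  have q2: "\<bar>q n\<bar> \<le> 2" and q\<rho>: "\<bar>q n\<bar> \<le> ev n * d" for n
  proof -
    have e1: "exp (- ev n * \<eta>) \<le> 1" using ev_nonneg[of n] assms by simp
    have "\<bar>exp (- ev n * \<eta>) * cs n x\<bar> \<le> 1 * 1"
      unfolding abs_mult using e1 abs_cs_le[of n x] by (intro mult_mono) auto
    then show "\<bar>q n\<bar> \<le> 2" using abs_cs_le[of n x'] unfolding q_def by linarith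
    have "q n = (cs n x - cs n x') - (1 - exp (- ev n * \<eta>)) * cs n x" by (simp add: q_def algebra_simps)
    moreover have "\<bar>(1 - exp (- ev n * \<eta>)) * cs n x\<bar> \<le> ev n * \<eta>"
    proof -
      have "1 - exp (- ev n * \<eta>) \<le> ev n * \<eta>" using exp_ge_add_one_self[of "- ev n * \<eta>"] by linarith
      then have "\<bar>1 - exp (- ev n * \<eta>)\<bar> * \<bar>cs n x\<bar> \<le> ev n * \<eta> * 1"
        using e1 abs_cs_le[of n x] by (intro mult_mono) auto
      then show ?thesis by (simp add: abs_mult)
    qed
    moreover have "\<bar>cs n x - cs n x'\<bar> \<le> ev n * \<bar>cs 1 x - cs 1 x'\<bar>"
      using cs_diff_le[of n x x'] ev_ge[of n] by (meson abs_ge_zero mult_right_mono order_trans)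
    ultimately show "\<bar>q n\<bar> \<le> ev n * d" unfolding d_def distrib_left by linarith
  qed
  have q4: "(q n)\<^sup>2 \<le> 4 * (ev n * d) powr (1/4)" for n
  proof (cases "ev n * d \<ge> 1")
    case True
    have "\<bar>q n\<bar>\<^sup>2 \<le> 2\<^sup>2" using q2[of n] by (intro power_mono) auto
    moreover have "1 \<le> (ev n * d) powr (1/4)" using True by (intro ge_one_powr_ge_zero) auto
    ultimately show ?thesis by simp
  next
    case False
    show ?thesis
    proof (cases "ev n * d = 0")
      case True
      have "\<bar>q n\<bar> \<le> 0" using q\<rho>[of n] by (simp only: True)
      then show ?thesis by simp
    next
      case nz: False
      then have pos: "ev n * d > 0" using ev_nonneg[of n] d by (simp add: less_le)
      have "\<bar>q n\<bar>\<^sup>2 \<le> (ev n * d)\<^sup>2" using q\<rho>[of n] by (intro power_mono) auto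
      also have "\<dots> = (ev n * d) powr 2" using pos by simp
      also have "\<dots> \<le> (ev n * d) powr (1/4)" using pos False by (intro powr_mono') auto
      also have "\<dots> \<le> 4 * (ev n * d) powr (1/4)" by simp
      finally show ?thesis by simp
    qed
  qed
  define B where "B n = 16 * d powr (1/4) * (real n) powr (- 3 / 2)" for n
  have B0: "B n \<ge> 0" for n by (simp add: B_def)
  have "kernel_norm L (\<lambda>\<theta> y. hk (\<theta> + \<eta>) x y - hk \<theta> x' y) \<le> ennreal (suminf B)"
    unfolding k
  proof (rule suminf_ennreal_le[where b = B])
    fix n
    have ex: "(exp (- ev n * \<theta>))\<^sup>2 = exp (- (2 * ev n) * \<theta>)" for \<theta>
      by (simp add: power2_eq_square exp_add[symmetric])
    have eq: "(\<integral>\<^sup>+\<theta>. ennreal (wt n * (exp (- ev n * \<theta>) * q n)\<^sup>2) * indicator {0<..<L} \<theta> \<partial>lborel) = ennreal (wt n * (q n)\<^sup>2) * nnexp (2 * ev n) L"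
    proof -
      have "ennreal (wt n * (exp (- ev n * \<theta>) * q n)\<^sup>2) = ennreal (wt n * (q n)\<^sup>2) * ennreal (exp (- (2 * ev n) * \<theta>))" for \<theta>
        using wt_pos[of n] by (simp only: power_mult_distrib ex) (simp add: ennreal_mult[symmetric] mult_ac)
      then show ?thesis
        unfolding nnexp_def by (simp only: mult.assoc) (rule nn_integral_cmult, measurable)
    qed
    show "(\<integral>\<^sup>+\<theta>. ennreal (wt n * (exp (- ev n * \<theta>) * q n)\<^sup>2) * indicator {0<..<L} \<theta> \<partial>lborel) \<le> ennreal (B n)"
    proof (cases "n = 0")
      case True
      \<comment> \<open>The constant mode does not see increments. This is matched by
        \<open>B 0 = 0\<close>, which rests on the convention that \<open>0 powr _\<close> is
        0.\<close>
      have "q n = 0" using True q\<rho>[of n] by (simp add: ev_def)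
      then show ?thesis unfolding eq by simp
    next
      case False
      then have n: "real n > 0" by simp
      have e: "ev n > 0" using False by (simp add: ev_def)
      have "ennreal (wt n * (q n)\<^sup>2) * nnexp (2 * ev n) L \<le> ennreal (2 * (4 * (ev n * d) powr (1/4))) * ennreal (1 / (2 * ev n))"
        using wt_le[of n] wt_pos[of n] q4[of n] e by (intro mult_mono ennreal_leI nnexp_le_inverse) auto
      also have "\<dots> = ennreal (4 * (ev n powr (1/4) * d powr (1/4)) / ev n)"
        using e d by (simp add: ennreal_mult[symmetric] powr_mult)
      also have "\<dots> \<le> ennreal (B n)"
      proof (rule ennreal_leI)
        have "ev n powr (1/4) / ev n = ev n powr (- 3/4)"
          using e powr_diff[of "ev n" "1/4" 1] by simp
        also have "\<dots> \<le> ((real n)\<^sup>2) powr (- 3/4)"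
          using n ev_ge[of n] by (intro powr_mono2') auto
        also have "\<dots> = (real n powr 2) powr (- 3/4)" using n by simp
        also have "\<dots> = real n powr (- 3/2)" unfolding powr_powr by simp
        finally have "d powr (1/4) * (ev n powr (1/4) / ev n) \<le> d powr (1/4) * real n powr (- 3/2)"
          by (rule mult_left_mono) simp
        moreover have "d powr (1/4) * real n powr (- 3/2) \<ge> 0" by simp
        ultimately have "4 * (d powr (1/4) * (ev n powr (1/4) / ev n)) \<le> 16 * (d powr (1/4) * real n powr (- 3/2))" by linarith
        then show "4 * (ev n powr (1/4) * d powr (1/4)) / ev n \<le> B n" by (simp add: B_def mult_ac)
      qed
      finally show ?thesis unfolding eq .
    qed
    show "B n \<ge> 0" by (rule B0)
  next
    fix N
    have "summable B" unfolding B_def by (intro summable_mult summable_powr_32)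
    then show "(\<Sum>n<N. B n) \<le> suminf B" using B0 by (intro sum_le_suminf) auto
  qed
  also have "suminf B = kernel_const * d powr (1/4)"
    unfolding B_def kernel_const_def using suminf_mult[OF summable_powr_32] by simp
  finally show ?thesis by (simp add: d_def)
qed

section \<open>Pointwise bounds at positive times\<close>

text \<open>Termwise estimates: from time \<open>t0\<close> on, increments in time and in the cosine
  distance share the summable majorant \<open>ev n * exp (- ev n * t0)\<close>. The bound is uniform
  in \<open>y\<close>, as an initial condition that is merely integrable requires.\<close>

lemma hk_diff_le:
  assumes "0 < t0" "t0 \<le> t" "t0 \<le> t'"
  shows "\<bar>hk t x y - hk t' x' y\<bar> \<le> 2 * (\<Sum>n. ev n * exp (- ev n * t0)) * (\<bar>t - t'\<bar> + \<bar>cs 1 x - cs 1 x'\<bar>)"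
    and "\<bar>hk t x y\<bar> \<le> 2 * (\<Sum>n. exp (- ev n * t0))"
proof -
  define d where "d = \<bar>t - t'\<bar> + \<bar>cs 1 x - cs 1 x'\<bar>"
  have s: "summable (\<lambda>n. wt n * (exp (- ev n * t) * cs n z) * cs n y)" if "t > 0" for t z
    by (rule summable_comparison_test[OF _ summable_wt[OF summable_heat_coeff[OF that, of z]]])
       (auto simp: abs_mult abs_cs_le mult_left_le intro!: exI[of _ 0])
  have e: "exp (- ev n * t) \<le> exp (- ev n * t0)" if "t0 \<le> t" for n t
    using that ev_nonneg[of n] by (simp add: mult_left_mono)
  have te: "\<bar>wt n * (exp (- ev n * t) * cs n x) * cs n y\<bar> \<le> 2 * exp (- ev n * t0)" for n
  proof -
    have "\<bar>wt n\<bar> * (\<bar>exp (- ev n * t)\<bar> * \<bar>cs n x\<bar>) * \<bar>cs n y\<bar> \<le> 2 * (exp (- ev n * t0) * 1) * 1"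
      using e[OF assms(2), of n] abs_cs_le[of n] wt_le[of n] wt_pos[of n] by (intro mult_mono) auto
    then show ?thesis by (simp add: abs_mult)
  qed
  have se: "summable (\<lambda>n. 2 * exp (- ev n * t0))" using summable_ev_exp(2)[OF assms(1)] by (rule summable_mult)
  have "\<bar>hk t x y\<bar> \<le> (\<Sum>n. \<bar>wt n * (exp (- ev n * t) * cs n x) * cs n y\<bar>)"
    unfolding hk_def by (rule summable_rabs) (rule summable_abs_le[OF te se])
  also have "\<dots> \<le> (\<Sum>n. 2 * exp (- ev n * t0))"
    by (rule suminf_le[OF te _ se]) (rule summable_abs_le[OF te se])
  also have "\<dots> = 2 * (\<Sum>n. exp (- ev n * t0))" by (rule suminf_mult[OF summable_ev_exp(2)[OF assms(1)]])
  finally show "\<bar>hk t x y\<bar> \<le> 2 * (\<Sum>n. exp (- ev n * t0))" .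
  have ed: "\<bar>exp (- ev n * t) - exp (- ev n * t')\<bar> \<le> ev n * exp (- ev n * t0) * \<bar>t - t'\<bar>" for n
  proof -
    have "\<bar>exp (- ev n * a) - exp (- ev n * b)\<bar> \<le> ev n * exp (- ev n * t0) * (b - a)" if "t0 \<le> a" "a \<le> b" for a b
    proof -
      have "1 - exp (- ev n * (b - a)) \<le> ev n * (b - a)" using exp_ge_add_one_self[of "- ev n * (b - a)"] by linarith
      then have "exp (- ev n * a) * (1 - exp (- ev n * (b - a))) \<le> exp (- ev n * t0) * (ev n * (b - a))"
        using e[OF that(1), of n] ev_nonneg[of n] that by (intro mult_mono) auto
      moreover have "exp (- ev n * a) * exp (- ev n * (b - a)) = exp (- ev n * b)" by (simp add: exp_add[symmetric] algebra_simps)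
      moreover have "exp (- ev n * b) \<le> exp (- ev n * a)" using ev_nonneg[of n] that by (simp add: mult_left_mono)
      ultimately show ?thesis by (simp add: algebra_simps)
    qed
    from this[of t t'] this[of t' t] show ?thesis using assms by (cases "t \<le> t'") (auto simp: abs_minus_commute)
  qed
  have td: "\<bar>wt n * (exp (- ev n * t) * cs n x) * cs n y - wt n * (exp (- ev n * t') * cs n x') * cs n y\<bar> \<le> 2 * d * (ev n * exp (- ev n * t0))" for n
  proof -
    have "exp (- ev n * t) * cs n x - exp (- ev n * t') * cs n x' = (exp (- ev n * t) - exp (- ev n * t')) * cs n x + exp (- ev n * t') * (cs n x - cs n x')"
      by (simp add: algebra_simps)
    moreover have "\<bar>(exp (- ev n * t) - exp (- ev n * t')) * cs n x\<bar> \<le> (ev n * exp (- ev n * t0) * \<bar>t - t'\<bar>) * 1"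
      unfolding abs_mult by (intro mult_mono ed abs_cs_le mult_nonneg_nonneg ev_nonneg) auto
    moreover have "\<bar>exp (- ev n * t') * (cs n x - cs n x')\<bar> \<le> exp (- ev n * t0) * (ev n * \<bar>cs 1 x - cs 1 x'\<bar>)"
    proof -
      have "\<bar>cs n x - cs n x'\<bar> \<le> ev n * \<bar>cs 1 x - cs 1 x'\<bar>"
        using cs_diff_le[of n x x'] ev_ge[of n] by (meson abs_ge_zero mult_right_mono order_trans)
      then show ?thesis
        unfolding abs_mult abs_exp_cancel using e[OF assms(3), of n] by (intro mult_mono) auto
    qed
    ultimately have "\<bar>exp (- ev n * t) * cs n x - exp (- ev n * t') * cs n x'\<bar> \<le> ev n * exp (- ev n * t0) * d"
      unfolding d_def by (simp only: distrib_left mult_1_right mult_ac)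
    then have "\<bar>wt n\<bar> * \<bar>exp (- ev n * t) * cs n x - exp (- ev n * t') * cs n x'\<bar> * \<bar>cs n y\<bar> \<le> 2 * (ev n * exp (- ev n * t0) * d) * 1"
      using abs_cs_le[of n y] wt_le[of n] wt_pos[of n] ev_nonneg[of n] by (intro mult_mono) (auto simp: d_def)
    then show ?thesis
      unfolding abs_mult[symmetric] by (simp add: algebra_simps)
  qed
  have sd: "summable (\<lambda>n. 2 * d * (ev n * exp (- ev n * t0)))" using summable_ev_exp(1)[OF assms(1)] by (rule summable_mult)
  have eq: "hk t x y - hk t' x' y = (\<Sum>n. wt n * (exp (- ev n * t) * cs n x) * cs n y - wt n * (exp (- ev n * t') * cs n x') * cs n y)"
    unfolding hk_def using assms by (intro suminf_diff s) auto
  have "\<bar>hk t x y - hk t' x' y\<bar> \<le> (\<Sum>n. \<bar>wt n * (exp (- ev n * t) * cs n x) * cs n y - wt n * (exp (- ev n * t') * cs n x') * cs n y\<bar>)"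
    unfolding eq by (rule summable_rabs) (rule summable_abs_le[OF td sd])
  also have "\<dots> \<le> (\<Sum>n. 2 * d * (ev n * exp (- ev n * t0)))"
    by (rule suminf_le[OF td _ sd]) (rule summable_abs_le[OF td sd])
  also have "\<dots> = 2 * (\<Sum>n. ev n * exp (- ev n * t0)) * d" by (subst suminf_mult[OF summable_ev_exp(1)[OF assms(1)]]) (simp add: mult_ac)
  finally show "\<bar>hk t x y - hk t' x' y\<bar> \<le> 2 * (\<Sum>n. ev n * exp (- ev n * t0)) * (\<bar>t - t'\<bar> + \<bar>cs 1 x - cs 1 x'\<bar>)"
    by (simp add: d_def)
qed

text \<open>The constant mode contributes 1 and the sum of all others decays exponentially. The
  lower bound serves to pass from integrability of \<open>G t 0 y * u0 y\<close> to that of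
  \<open>u0\<close>.\<close>

lemma hk_large_time: "\<exists>t>0. \<forall>x y. hk t x y \<ge> 1/2"
proof -
  define A where "A = (\<Sum>n. exp (- ev (Suc n) * 1))"
  have sA: "summable (\<lambda>n. exp (- ev (Suc n) * 1))"
    using summable_ev_exp(2)[of 1] by (subst summable_Suc_iff) simp
  have A: "A \<ge> 0" unfolding A_def by (rule suminf_nonneg[OF sA]) simp
  have "((\<lambda>t. 2 * A * exp (- t)) \<longlongrightarrow> 2 * A * 0) at_top"
    by (intro tendsto_intros filterlim_compose[OF exp_at_bot] filterlim_uminus_at_bot_at_top)
  then have "eventually (\<lambda>t. 2 * A * exp (- t) < 1/2) at_top"
    by (rule order_tendstoD) simp
  then obtain r where r: "2 * A * exp (- r) < 1/2" "r \<ge> 1"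
  proof -
    obtain N where "\<forall>t\<ge>N. 2 * A * exp (- t) < 1/2"
      using \<open>eventually (\<lambda>t. 2 * A * exp (- t) < 1/2) at_top\<close> unfolding eventually_at_top_linorder by blast
    then show ?thesis using that[of "max N 1"] by simp
  qed
  \<comment> \<open>One unit of time secures summability of the modes, the remaining
    \<open>r\<close> supplies the small factor \<open>exp (- r)\<close>.\<close>
  define t where "t = r + 1"
  have "hk t x y \<ge> 1/2" for x y
  proof -
    define f where "f n = wt n * (exp (- ev n * t) * cs n x) * cs n y" for n
    have sf: "summable f"
      unfolding f_def using r by (intro summable_comparison_test[OF _ summable_wt[OF summable_heat_coeff[of t x]]])
       (auto simp: abs_mult abs_cs_le mult_left_le t_def intro!: exI[of _ 0])
    have le: "\<bar>f (Suc n)\<bar> \<le> 2 * exp (- r) * exp (- ev (Suc n) * 1)" for n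
    proof -
      have "1 \<le> (real (Suc n))\<^sup>2" by simp
      then have e1: "ev (Suc n) \<ge> 1" using ev_ge[of "Suc n"] by linarith
      have "r * 1 \<le> r * ev (Suc n)" using e1 r by (intro mult_left_mono) auto
      then have "exp (- ev (Suc n) * t) \<le> exp (- r) * exp (- ev (Suc n) * 1)"
        unfolding exp_add[symmetric] t_def by (simp add: algebra_simps)
      then have "\<bar>wt (Suc n)\<bar> * (\<bar>exp (- ev (Suc n) * t)\<bar> * \<bar>cs (Suc n) x\<bar>) * \<bar>cs (Suc n) y\<bar> \<le> 2 * ((exp (- r) * exp (- ev (Suc n) * 1)) * 1) * 1"
        using abs_cs_le[of "Suc n"] by (intro mult_mono) auto
      then show ?thesis by (simp add: f_def abs_mult mult_ac)
    qed
    have sb: "summable (\<lambda>n. 2 * exp (- r) * exp (- ev (Suc n) * 1))" by (rule summable_mult[OF sA])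
    have "\<bar>\<Sum>n. f (Suc n)\<bar> \<le> (\<Sum>n. \<bar>f (Suc n)\<bar>)"
      by (rule summable_rabs) (rule summable_abs_le[OF le sb])
    also have "\<dots> \<le> (\<Sum>n. 2 * exp (- r) * exp (- ev (Suc n) * 1))"
      by (rule suminf_le[OF le _ sb]) (rule summable_abs_le[OF le sb])
    also have "\<dots> = 2 * A * exp (- r)" unfolding A_def by (subst suminf_mult[OF sA]) (simp add: mult_ac)
    finally have "\<bar>\<Sum>n. f (Suc n)\<bar> < 1/2" using r by simp
    moreover have "hk t x y = f 0 + (\<Sum>n. f (Suc n))"
      unfolding hk_def f_def[symmetric] using suminf_split_head[OF sf] by simp
    moreover have "f 0 = 1" by (simp add: f_def ev_def)
    ultimately show ?thesis by linarith
  qed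
  moreover have "t > 0" using r by (simp add: t_def)
  ultimately show ?thesis by blast
qed

section \<open>Stochastic convolution and regularity of the solution\<close>

text \<open>The kernel for terminal time \<open>t\<close> as a function on the plane, zero outside
  the domain of integration, so that kernels for different terminal times can be subtracted.\<close>

definition kap :: "real \<Rightarrow> real \<Rightarrow> real \<times> real \<Rightarrow> real" where
  "kap t x p = indicator ({0<..<t} \<times> {0..1}) p * hk (t - fst p) x (snd p)"

lemma fst_borel [measurable]: "(fst :: real \<times> real \<Rightarrow> real) \<in> borel_measurable borel"
  and snd_borel [measurable]: "(snd :: real \<times> real \<Rightarrow> real) \<in> borel_measurable borel"
  by (intro borel_measurable_continuous_onI continuous_intros)+

lemma right_half_plane_borel [measurable]: "{a :: real<..} \<times> (UNIV :: real set) \<in> sets borel"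
  by (intro borel_open open_Times open_greaterThan open_UNIV)

lemma rect_borel [measurable]: "{a<..<b :: real} \<times> {0..1 :: real} \<in> sets borel"
  by (simp add: borel_Times)

lemma kap_measurable [measurable]: "kap t x \<in> borel_measurable borel"
  unfolding kap_def by measurable

lemma AE_lborel_fst_neq: "AE p in lborel. fst (p :: real \<times> real) \<noteq> t"
proof (rule AE_I)
  show "{p \<in> space lborel. \<not> fst p \<noteq> t} \<subseteq> {t} \<times> (UNIV :: real set)" by auto
  show "emeasure lborel ({t} \<times> (UNIV :: real set)) = 0"
    by (subst lborel_prod[symmetric], subst lborel.emeasure_pair_measure_Times) auto
  show "{t} \<times> (UNIV :: real set) \<in> sets lborel" by (simp add: borel_Times)
qed

lemma nn_integral_time_reversal:
  fixes f :: "real \<Rightarrow> real \<Rightarrow> ennreal"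
  assumes [measurable]: "(\<lambda>p. f (fst p) (snd p)) \<in> borel_measurable borel"
  shows "(\<integral>\<^sup>+p. f (t - fst p) (snd p) * indicator ({t - L<..<t} \<times> {0..1}) p \<partial>lborel)
    = (\<integral>\<^sup>+\<theta>. (\<integral>\<^sup>+y. f \<theta> y \<partial>unit_measure) * indicator {0<..<L} \<theta> \<partial>lborel)"
proof -
  have [measurable]: "(\<lambda>p. f (t - fst p) (snd p)) \<in> borel_measurable borel"
  proof -
    have "(\<lambda>p :: real \<times> real. (t - fst p, snd p)) \<in> measurable borel borel"
      by (intro borel_measurable_continuous_onI continuous_intros)
    from measurable_compose[OF this assms] show ?thesis by simp
  qed
  have slice: "f \<theta> \<in> borel_measurable borel" for \<theta>
  proof -
    have "(\<lambda>y :: real. (\<theta>, y)) \<in> measurable borel borel"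
      by (intro borel_measurable_continuous_onI continuous_intros)
    from measurable_compose[OF this assms] show ?thesis by simp
  qed
  have [measurable]: "(\<lambda>p. f (t - fst p) (snd p) * indicator ({t - L<..<t} \<times> {0..1}) p) \<in> borel_measurable (lborel \<Otimes>\<^sub>M lborel)"
    unfolding lborel_prod by measurable
  have [measurable]: "(\<lambda>(\<theta>, y). f \<theta> y * indicator {0..1} y) \<in> borel_measurable (lborel \<Otimes>\<^sub>M lborel)"
    unfolding lborel_prod using assms by (simp add: case_prod_beta)
  have [measurable]: "(\<lambda>\<theta>. \<integral>\<^sup>+y. f \<theta> y * indicator {0..1} y \<partial>lborel) \<in> borel_measurable borel"
    using lborel.borel_measurable_nn_integral[of "\<lambda>\<theta> y. f \<theta> y * indicator {0..1} y" lborel] by simp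
  have "(\<integral>\<^sup>+p. f (t - fst p) (snd p) * indicator ({t - L<..<t} \<times> {0..1}) p \<partial>lborel)
    = (\<integral>\<^sup>+\<tau>. \<integral>\<^sup>+y. f (t - \<tau>) y * indicator ({t - L<..<t} \<times> {0..1}) (\<tau>, y) \<partial>lborel \<partial>lborel)"
    by (subst lborel_prod[symmetric], subst lborel.nn_integral_fst[symmetric]) auto
  also have "\<dots> = (\<integral>\<^sup>+\<tau>. (\<integral>\<^sup>+y. f (t - \<tau>) y * indicator {0..1} y \<partial>lborel) * indicator {t - L<..<t} \<tau> \<partial>lborel)"
  proof (rule nn_integral_cong)
    fix \<tau> :: real
    have "f (t - \<tau>) y * indicator ({t - L<..<t} \<times> {0..1}) (\<tau>, y) = (f (t - \<tau>) y * indicator {0..1} y) * indicator {t - L<..<t} \<tau>" for y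
      by (auto simp: indicator_def)
    then show "(\<integral>\<^sup>+y. f (t - \<tau>) y * indicator ({t - L<..<t} \<times> {0..1}) (\<tau>, y) \<partial>lborel)
       = (\<integral>\<^sup>+y. f (t - \<tau>) y * indicator {0..1} y \<partial>lborel) * indicator {t - L<..<t} \<tau>"
      using slice[of "t - \<tau>"] by (simp add: nn_integral_multc)
  qed
  also have "\<dots> = (\<integral>\<^sup>+\<theta>. (\<integral>\<^sup>+y. f (t - (t + (-1) * \<theta>)) y * indicator {0..1} y \<partial>lborel) * indicator {t - L<..<t} (t + (-1) * \<theta>) \<partial>lborel)"
  proof (subst nn_integral_real_affine[where c = "-1" and t = t])
    have "(\<lambda>\<tau>. t - \<tau>) \<in> measurable borel (borel :: real measure)" by measurable
    from measurable_compose[OF this, of "\<lambda>\<theta>. \<integral>\<^sup>+y. f \<theta> y * indicator {0..1} y \<partial>lborel"]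
    show "(\<lambda>\<tau>. (\<integral>\<^sup>+y. f (t - \<tau>) y * indicator {0..1} y \<partial>lborel) * indicator {t - L<..<t} \<tau>) \<in> borel_measurable borel"
      by simp
  qed auto
  also have "\<dots> = (\<integral>\<^sup>+\<theta>. (\<integral>\<^sup>+y. f \<theta> y \<partial>unit_measure) * indicator {0<..<L} \<theta> \<partial>lborel)"
    by (rule nn_integral_cong) (auto simp: nn_integral_restrict_space indicator_def)
  finally show ?thesis .
qed

lemma kap_norm_weighted:
  assumes [measurable]: "w \<in> borel_measurable borel" and "0 < \<epsilon>" "\<epsilon> \<le> t"
  shows "(\<integral>\<^sup>+p. ennreal ((w (snd p) * kap t x p)\<^sup>2) * indicator ({t - \<epsilon><..} \<times> UNIV) p \<partial>lborel)
    = kernel_norm \<epsilon> (\<lambda>\<theta> y. w y * hk \<theta> x y)"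
proof -
  have "(\<integral>\<^sup>+p. ennreal ((w (snd p) * kap t x p)\<^sup>2) * indicator ({t - \<epsilon><..} \<times> UNIV) p \<partial>lborel)
    = (\<integral>\<^sup>+p. ennreal ((w (snd p) * hk (t - fst p) x (snd p))\<^sup>2) * indicator ({t - \<epsilon><..<t} \<times> {0..1}) p \<partial>lborel)"
    by (rule nn_integral_cong) (use assms in \<open>auto simp: kap_def indicator_def\<close>)
  also have "\<dots> = kernel_norm \<epsilon> (\<lambda>\<theta> y. w y * hk \<theta> x y)"
    unfolding kernel_norm_def
    by (rule nn_integral_time_reversal[where f = "\<lambda>\<theta> y. ennreal ((w y * hk \<theta> x y)\<^sup>2)"]) measurable
  finally show ?thesis .
qed

lemma kap_norm_part:
  assumes "0 < \<epsilon>" "\<epsilon> \<le> t"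
  shows "(\<integral>\<^sup>+p. ennreal ((kap t x p)\<^sup>2) * indicator ({t - \<epsilon><..} \<times> UNIV) p \<partial>lborel) = kernel_norm \<epsilon> (\<lambda>\<theta>. hk \<theta> x)"
  using kap_norm_weighted[of "\<lambda>_. 1" \<epsilon> t x] assms by simp

lemma kap_norm:
  assumes "0 < t"
  shows "(\<integral>\<^sup>+p. ennreal ((kap t x p)\<^sup>2) \<partial>lborel) = kernel_norm t (\<lambda>\<theta>. hk \<theta> x)"
proof -
  have "(\<integral>\<^sup>+p. ennreal ((kap t x p)\<^sup>2) \<partial>lborel) = (\<integral>\<^sup>+p. ennreal ((kap t x p)\<^sup>2) * indicator ({t - t<..} \<times> UNIV) p \<partial>lborel)"
    by (rule nn_integral_cong) (auto simp: kap_def indicator_def)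
  then show ?thesis using kap_norm_part[of t t x] assms by simp
qed

lemma kap_norm_finite:
  assumes "0 < t" shows "(\<integral>\<^sup>+p. ennreal ((kap t x p)\<^sup>2) \<partial>lborel) < \<infinity>"
  using kernel_norm_hk_le[OF assms, of x] unfolding kap_norm[OF assms] by (auto intro: le_less_trans)

text \<open>Off the null line at time \<open>r\<close> the square splits: before \<open>r\<close>
  both kernels are present and form a kernel increment, after \<open>r\<close> only the kernel for
  \<open>s\<close> is left, over a time of length \<open>s - r\<close>.\<close>

lemma kap_increment_norm:
  assumes "0 < r" "r \<le> s" "s \<le> r + 1"
  shows "(\<integral>\<^sup>+p. ennreal ((kap s x p - kap r x' p)\<^sup>2) \<partial>lborel)
    \<le> ennreal ((kernel_const + 10) * (s - r + \<bar>cs 1 x - cs 1 x'\<bar>) powr (1/4))"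
proof -
  define \<eta> where "\<eta> = s - r"
  define d where "d = \<eta> + \<bar>cs 1 x - cs 1 x'\<bar>"
  have \<eta>: "0 \<le> \<eta>" "\<eta> \<le> 1" "\<eta> \<le> d" using assms by (auto simp: \<eta>_def d_def)
  have "(\<integral>\<^sup>+p. ennreal ((kap s x p - kap r x' p)\<^sup>2) \<partial>lborel)
     = (\<integral>\<^sup>+p. ennreal ((hk (r - fst p + \<eta>) x (snd p) - hk (r - fst p) x' (snd p))\<^sup>2) * indicator ({r - r<..<r} \<times> {0..1}) p
        + ennreal ((kap s x p)\<^sup>2) * indicator ({s - \<eta><..} \<times> UNIV) p \<partial>lborel)"
  proof (rule nn_integral_cong_AE)
    show "AE p in lborel. ennreal ((kap s x p - kap r x' p)\<^sup>2)
      = ennreal ((hk (r - fst p + \<eta>) x (snd p) - hk (r - fst p) x' (snd p))\<^sup>2) * indicator ({r - r<..<r} \<times> {0..1}) p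
        + ennreal ((kap s x p)\<^sup>2) * indicator ({s - \<eta><..} \<times> UNIV) p"
      using AE_lborel_fst_neq[of r]
    proof eventually_elim
      case (elim p)
      have "r - fst p + \<eta> = s - fst p" "s - \<eta> = r" by (simp_all add: \<eta>_def)
      with elim assms show ?case
        by (cases "fst p < r") (auto simp: kap_def indicator_def)
    qed
  qed
  also have "\<dots> = (\<integral>\<^sup>+p. ennreal ((hk (r - fst p + \<eta>) x (snd p) - hk (r - fst p) x' (snd p))\<^sup>2) * indicator ({r - r<..<r} \<times> {0..1}) p \<partial>lborel)
      + (\<integral>\<^sup>+p. ennreal ((kap s x p)\<^sup>2) * indicator ({s - \<eta><..} \<times> UNIV) p \<partial>lborel)"
    by (rule nn_integral_add) measurable
  also have "(\<integral>\<^sup>+p. ennreal ((hk (r - fst p + \<eta>) x (snd p) - hk (r - fst p) x' (snd p))\<^sup>2) * indicator ({r - r<..<r} \<times> {0..1}) p \<partial>lborel)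
      = kernel_norm r (\<lambda>\<theta> y. hk (\<theta> + \<eta>) x y - hk \<theta> x' y)"
    unfolding kernel_norm_def
    by (rule nn_integral_time_reversal[where f = "\<lambda>\<theta> y. ennreal ((hk (\<theta> + \<eta>) x y - hk \<theta> x' y)\<^sup>2)"]) measurable
  also have "\<dots> \<le> ennreal (kernel_const * d powr (1/4))"
    unfolding d_def by (rule kernel_norm_increment_le[OF \<eta>(1)])
  \<comment> \<open>The 10 is 2 * (1 + 4) after \<open>\<eta> \<le> sqrt \<eta>\<close>; the square
    root is then weakened to the power 1/4 to match the increment term.\<close>
  also have "(\<integral>\<^sup>+p. ennreal ((kap s x p)\<^sup>2) * indicator ({s - \<eta><..} \<times> UNIV) p \<partial>lborel) \<le> ennreal (10 * d powr (1/4))"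
  proof (cases "\<eta> = 0")
    case True
    have "(\<integral>\<^sup>+p. ennreal ((kap s x p)\<^sup>2) * indicator ({s - \<eta><..} \<times> UNIV) p \<partial>lborel) = (\<integral>\<^sup>+p. 0 \<partial>(lborel :: (real \<times> real) measure))"
      by (rule nn_integral_cong) (auto simp: kap_def True indicator_def)
    then show ?thesis by simp
  next
    case False
    then have pos: "\<eta> > 0" using \<eta> by simp
    have "kernel_norm \<eta> (\<lambda>\<theta>. hk \<theta> x) \<le> ennreal (2 * (\<eta> + 4 * sqrt \<eta>))" by (rule kernel_norm_hk_le[OF pos])
    also have "\<dots> \<le> ennreal (10 * d powr (1/4))"
    proof (rule ennreal_leI)
      have "sqrt \<eta> = \<eta> powr (1/2)" using pos by (simp add: powr_half_sqrt)
      also have "\<dots> \<le> \<eta> powr (1/4)" using pos \<eta> by (intro powr_mono') auto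
      also have "\<dots> \<le> d powr (1/4)" using pos \<eta> by (intro powr_mono2) auto
      finally have "sqrt \<eta> \<le> d powr (1/4)" .
      show "2 * (\<eta> + 4 * sqrt \<eta>) \<le> 10 * d powr (1/4)"
      proof -
        have "2 * (\<eta> + 4 * sqrt \<eta>) \<le> 2 * (sqrt \<eta> + 4 * sqrt \<eta>)" using le_sqrt_of_le_1[OF \<eta>(1,2)] by simp
        also have "\<dots> = 10 * sqrt \<eta>" by simp
        also have "\<dots> \<le> 10 * d powr (1/4)" using \<open>sqrt \<eta> \<le> d powr (1/4)\<close> by (rule mult_left_mono) simp
        finally show ?thesis .
      qed
    qed
    finally show ?thesis using kap_norm_part[OF pos, of s x] assms by (simp add: \<eta>_def)
  qed
  finally show ?thesis
    using kernel_const_nonneg by (simp add: ennreal_plus[symmetric] distrib_right d_def \<eta>_def add_left_mono add_right_mono del: ennreal_plus)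
qed

section \<open>Walsh integrals through simple approximants\<close>

lemma sum_list_case4:
  "(\<Sum>(r, s, A, X) \<leftarrow> l. g r s A X)
    = (\<Sum>k<length l. g (fst (l ! k)) (fst (snd (l ! k))) (fst (snd (snd (l ! k)))) (snd (snd (snd (l ! k)))))"
  by (simp add: sum_list_sum_nth atLeast0LessThan case_prod_beta)

lemma ennreal_sq_triangle3:
  "ennreal ((a - b)\<^sup>2) \<le> 3 * ennreal ((a - c)\<^sup>2) + 3 * ennreal ((c - d)\<^sup>2) + 3 * ennreal ((d - b)\<^sup>2)"
proof -
  have "((a - c) + (c - d) + (d - b))\<^sup>2 \<le> 3 * (a - c)\<^sup>2 + 3 * (c - d)\<^sup>2 + 3 * (d - b)\<^sup>2"
  proof -
    have "(x + y + z)\<^sup>2 \<le> 3 * x\<^sup>2 + 3 * y\<^sup>2 + 3 * z\<^sup>2" for x y z :: real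
      using zero_le_power2[of "x - y"] zero_le_power2[of "y - z"] zero_le_power2[of "x - z"]
      by (simp add: power2_eq_square algebra_simps)
    then show ?thesis .
  qed
  then have "ennreal ((a - b)\<^sup>2) \<le> ennreal (3 * (a - c)\<^sup>2 + 3 * (c - d)\<^sup>2 + 3 * (d - b)\<^sup>2)"
    by (intro ennreal_leI) simp
  also have "\<dots> = 3 * ennreal ((a - c)\<^sup>2) + 3 * ennreal ((c - d)\<^sup>2) + 3 * ennreal ((d - b)\<^sup>2)"
    by (simp add: ennreal_mult)
  finally show ?thesis .
qed

lemma nn_integral_sq_triangle3:
  assumes [measurable]: "a \<in> borel_measurable N" "b \<in> borel_measurable N" "c \<in> borel_measurable N" "d \<in> borel_measurable N"
  shows "(\<integral>\<^sup>+z. ennreal ((a z - b z)\<^sup>2) \<partial>N)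
    \<le> 3 * (\<integral>\<^sup>+z. ennreal ((a z - c z)\<^sup>2) \<partial>N) + 3 * (\<integral>\<^sup>+z. ennreal ((c z - d z)\<^sup>2) \<partial>N) + 3 * (\<integral>\<^sup>+z. ennreal ((d z - b z)\<^sup>2) \<partial>N)"
proof -
  have "(\<integral>\<^sup>+z. ennreal ((a z - b z)\<^sup>2) \<partial>N)
    \<le> (\<integral>\<^sup>+z. 3 * ennreal ((a z - c z)\<^sup>2) + 3 * ennreal ((c z - d z)\<^sup>2) + 3 * ennreal ((d z - b z)\<^sup>2) \<partial>N)"
    by (intro nn_integral_mono ennreal_sq_triangle3)
  also have "\<dots> = 3 * (\<integral>\<^sup>+z. ennreal ((a z - c z)\<^sup>2) \<partial>N) + 3 * (\<integral>\<^sup>+z. ennreal ((c z - d z)\<^sup>2) \<partial>N) + 3 * (\<integral>\<^sup>+z. ennreal ((d z - b z)\<^sup>2) \<partial>N)"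
    by (simp add: nn_integral_add nn_integral_cmult)
  finally show ?thesis .
qed

context noise_space
begin

definition simple_sum :: "nat \<Rightarrow> (nat \<Rightarrow> (real \<times> real) set) \<Rightarrow> (nat \<Rightarrow> 'a \<Rightarrow> real) \<Rightarrow> (real \<times> real) \<times> 'a \<Rightarrow> real" where
  "simple_sum n R X z = (\<Sum>k<n. X k (snd z) * indicator (R k) (fst z))"

definition simple_int :: "nat \<Rightarrow> (nat \<Rightarrow> (real \<times> real) set) \<Rightarrow> (nat \<Rightarrow> 'a \<Rightarrow> real) \<Rightarrow> 'a \<Rightarrow> real" where
  "simple_int n R X \<omega> = (\<Sum>k<n. X k \<omega> * W (R k) \<omega>)"

definition simple_terms :: "nat \<Rightarrow> (nat \<Rightarrow> real) \<Rightarrow> (nat \<Rightarrow> (real \<times> real) set) \<Rightarrow> (nat \<Rightarrow> 'a \<Rightarrow> real) \<Rightarrow> bool" where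
  "simple_terms n r R X \<longleftrightarrow> (\<forall>k<n. simple_term (r k) (R k) (X k))"

lemma simple_term_noise_set: "simple_term r R X \<Longrightarrow> R \<in> noise_sets"
  unfolding simple_term_def by blast

lemma simple_sum_measurable:
  assumes "simple_terms n r R X" shows "simple_sum n R X \<in> borel_measurable (lborel \<Otimes>\<^sub>M M)"
  unfolding simple_sum_def
proof (rule borel_measurable_sum)
  fix k assume "k \<in> {..<n}"
  then have "simple_term (r k) (R k) (X k)" using assms by (simp add: simple_terms_def)
  then have [measurable]: "X k \<in> borel_measurable M" "R k \<in> sets borel"
    by (auto intro: simple_term_measurable noise_sets_measurable simple_term_noise_set)
  show "(\<lambda>z. X k (snd z) * indicator (R k) (fst z)) \<in> borel_measurable (lborel \<Otimes>\<^sub>M M)" by measurable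
qed

lemma simple_int_measurable:
  assumes "simple_terms n r R X" shows "simple_int n R X \<in> borel_measurable M"
  unfolding simple_int_def
proof (rule borel_measurable_sum)
  fix k assume "k \<in> {..<n}"
  then have "simple_term (r k) (R k) (X k)" using assms by (simp add: simple_terms_def)
  then have [measurable]: "X k \<in> borel_measurable M" "W (R k) \<in> borel_measurable M"
    by (auto intro: simple_term_measurable W_measurable simple_term_noise_set)
  show "(\<lambda>\<omega>. X k \<omega> * W (R k) \<omega>) \<in> borel_measurable M" by measurable
qed

lemma simple_term_uminus: "simple_term r R X \<Longrightarrow> simple_term r R (\<lambda>\<omega>. - X \<omega>)"
  unfolding simple_term_def by auto

text \<open>The difference of two simple processes is again one simple process, over the disjoint
  sum of the index sets.\<close>

lemma ito_isometry_diff: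
  assumes "simple_terms n r R X" "simple_terms n' r' R' X'"
  shows "(\<integral>\<^sup>+\<omega>. ennreal ((simple_int n R X \<omega> - simple_int n' R' X' \<omega>)\<^sup>2) \<partial>M)
    = (\<integral>\<^sup>+z. ennreal ((simple_sum n R X z - simple_sum n' R' X' z)\<^sup>2) \<partial>(lborel \<Otimes>\<^sub>M M))"
proof -
  define K where "K = {..<n} <+> {..<n'}"
  define r2 where "r2 = case_sum r r'"
  define R2 where "R2 = case_sum R R'"
  define X2 where "X2 = case_sum X (\<lambda>k \<omega>. - X' k \<omega>)"
  have st: "simple_term (r2 k) (R2 k) (X2 k)" if "k \<in> K" for k
    using that assms unfolding K_def r2_def R2_def X2_def simple_terms_def by (auto intro!: simple_term_uminus)
  have K: "finite K" by (simp add: K_def)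
  have 1: "(\<Sum>k\<in>K. X2 k \<omega> * W (R2 k) \<omega>) = simple_int n R X \<omega> - simple_int n' R' X' \<omega>" for \<omega>
    unfolding K_def simple_int_def by (simp add: sum.Plus X2_def R2_def sum_negf)
  have 2: "(\<Sum>k\<in>K. X2 k (snd z) * indicator (R2 k) (fst z)) = simple_sum n R X z - simple_sum n' R' X' z" for z
    unfolding K_def simple_sum_def
    by (simp only: sum.Plus[OF finite_lessThan finite_lessThan] X2_def R2_def sum.case comp_def mult_minus_left sum_negf diff_conv_add_uminus)
  show ?thesis using ito_isometry[where r = r2 and R = R2 and X = X2, OF K st] unfolding 1 2 .
qed

text \<open>Moves the approximation from lists and a restricted measure to indexed terms on the
  whole plane, where integrals with different terminal times become comparable.\<close>

lemma walsh_approximation: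
  assumes I: "has_walsh_integral M W t f Z" and e: "e > 0"
    and F [measurable]: "F \<in> borel_measurable (lborel \<Otimes>\<^sub>M M)"
    and Ff: "\<And>p \<omega>. \<omega> \<in> space M \<Longrightarrow> F (p, \<omega>) = indicator ({0<..<t} \<times> {0..1}) p * f (fst p) (snd p) \<omega>"
  shows "\<exists>n r R X. simple_terms n r R X \<and>
    (\<integral>\<^sup>+z. ennreal ((simple_sum n R X z - F z)\<^sup>2) \<partial>(lborel \<Otimes>\<^sub>M M)) \<le> ennreal e \<and>
    (\<integral>\<^sup>+\<omega>. ennreal ((simple_int n R X \<omega> - Z \<omega>)\<^sup>2) \<partial>M) \<le> ennreal e"
proof -
  define D where "D = {0<..<t} \<times> {0..1 :: real}"
  have D [measurable]: "D \<in> sets borel" unfolding D_def by (rule rect_borel)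
  define P where "P = restrict_space (lborel :: (real \<times> real) measure) D"
  from I obtain ps where ps: "\<And>n. simple_process M W t (ps n)"
    and l1: "(\<lambda>n. \<integral>\<^sup>+((s, y), \<omega>). ennreal ((simple_value (ps n) s y \<omega> - f s y \<omega>)\<^sup>2) \<partial>(P \<Otimes>\<^sub>M M)) \<longlonglongrightarrow> 0"
    and l2: "(\<lambda>n. \<integral>\<^sup>+\<omega>. ennreal ((simple_integral W (ps n) \<omega> - Z \<omega>)\<^sup>2) \<partial>M) \<longlonglongrightarrow> 0"
    unfolding has_walsh_integral_def P_def D_def by blast
  have e': "0 < ennreal e" using e by simp
  have "eventually (\<lambda>n. (\<integral>\<^sup>+((s, y), \<omega>). ennreal ((simple_value (ps n) s y \<omega> - f s y \<omega>)\<^sup>2) \<partial>(P \<Otimes>\<^sub>M M)) < ennreal e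
     \<and> (\<integral>\<^sup>+\<omega>. ennreal ((simple_integral W (ps n) \<omega> - Z \<omega>)\<^sup>2) \<partial>M) < ennreal e) sequentially"
    by (intro eventually_conj order_tendstoD(2)[OF l1 e'] order_tendstoD(2)[OF l2 e'])
  then obtain m where m1: "(\<integral>\<^sup>+((s, y), \<omega>). ennreal ((simple_value (ps m) s y \<omega> - f s y \<omega>)\<^sup>2) \<partial>(P \<Otimes>\<^sub>M M)) < ennreal e"
    and m2: "(\<integral>\<^sup>+\<omega>. ennreal ((simple_integral W (ps m) \<omega> - Z \<omega>)\<^sup>2) \<partial>M) < ennreal e"
    unfolding eventually_sequentially by blast
  define l where "l = ps m"
  define r where "r k = fst (l ! k)" for k
  define s where "s k = fst (snd (l ! k))" for k
  define A where "A k = fst (snd (snd (l ! k)))" for k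
  define X where "X k = snd (snd (snd (l ! k)))" for k
  define R where "R k = {r k<..s k} \<times> A k" for k
  define n where "n = length l"
  have pr: "0 \<le> r k" "r k \<le> s k" "s k \<le> t" "A k \<in> sets borel" "A k \<subseteq> {0..1}"
      "X k \<in> borel_measurable (noise_filtration M W (r k))" "bounded (X k ` space M)" if "k < n" for k
  proof -
    have "l ! k \<in> set l" using that by (simp add: n_def)
    with ps[of m] show "0 \<le> r k" "r k \<le> s k" "s k \<le> t" "A k \<in> sets borel" "A k \<subseteq> {0..1}"
      "X k \<in> borel_measurable (noise_filtration M W (r k))" "bounded (X k ` space M)"
      unfolding simple_process_def l_def[symmetric] r_def s_def A_def X_def by (auto simp: case_prod_beta)
  qed
  have st: "simple_terms n r R X"
    unfolding simple_terms_def
  proof (intro allI impI)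
    fix k assume k: "k < n"
    have Rb: "R k \<in> sets borel" unfolding R_def using pr(4)[OF k] by (simp add: borel_Times)
    have sub: "R k \<subseteq> {0..t} \<times> {0..1}" using pr[OF k] unfolding R_def by auto
    have "emeasure lborel (R k) \<le> emeasure lborel ({0..t} \<times> {0..1 :: real})"
      by (rule emeasure_mono[OF sub]) (simp add: borel_Times)
    also have "\<dots> < \<infinity>" by (intro emeasure_compact_finite compact_Times compact_Icc)
    finally have "R k \<in> noise_sets" using Rb sub unfolding noise_sets_def by auto
    moreover have "\<exists>B. \<forall>\<omega>\<in>space M. \<bar>X k \<omega>\<bar> \<le> B" using pr(7)[OF k] unfolding bounded_iff by auto
    moreover have "R k \<subseteq> {r k<..} \<times> UNIV" unfolding R_def by auto
    ultimately show "simple_term (r k) (R k) (X k)"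
      using pr(1,6)[OF k] unfolding simple_term_def by blast
  qed
  have I1: "simple_int n R X \<omega> = simple_integral W l \<omega>" for \<omega>
    unfolding simple_int_def simple_integral_def sum_list_case4 R_def r_def s_def A_def X_def n_def ..
  have V1: "simple_sum n R X (p, \<omega>) = simple_value l (fst p) (snd p) \<omega>" for p \<omega>
  proof -
    have "indicator ({a<..b} \<times> C) p = indicator {a<..b} (fst p) * (indicator C (snd p) :: real)" for a b and C :: "real set"
      by (cases p) (simp add: indicator_times)
    then show ?thesis
      unfolding simple_sum_def simple_value_def sum_list_case4 R_def r_def s_def A_def X_def n_def
      by (simp add: mult.assoc)
  qed
  note [measurable] = simple_sum_measurable[OF st]
  define g where "g z = ennreal ((simple_sum n R X z - F z)\<^sup>2)" for z
  have g [measurable]: "g \<in> borel_measurable (lborel \<Otimes>\<^sub>M M)" unfolding g_def by measurable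
  have gP [measurable]: "g \<in> borel_measurable (P \<Otimes>\<^sub>M M)"
  proof (rule measurable_compose[OF _ g])
    have "(\<lambda>z. (fst z, snd z)) \<in> measurable (P \<Otimes>\<^sub>M M) (lborel \<Otimes>\<^sub>M M)"
      unfolding P_def by (intro measurable_Pair measurable_snd measurable_compose[OF measurable_fst] measurable_restrict_space1) simp
    then show "(\<lambda>z. z) \<in> measurable (P \<Otimes>\<^sub>M M) (lborel \<Otimes>\<^sub>M M)" by simp
  qed
  have "(\<integral>\<^sup>+z. g z \<partial>(lborel \<Otimes>\<^sub>M M)) = (\<integral>\<^sup>+p. (\<integral>\<^sup>+\<omega>. g (p, \<omega>) \<partial>M) \<partial>lborel)"
    by (rule nn_integral_fst[OF g, symmetric])
  \<comment> \<open>Simple processes use time intervals closed on the right, whereas the domain is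
    open at \<open>t\<close>. The two differ on the line \<open>fst p = t\<close>, which is
    null.\<close>
  also have "\<dots> = (\<integral>\<^sup>+p. (\<integral>\<^sup>+\<omega>. g (p, \<omega>) \<partial>M) * indicator D p \<partial>lborel)"
  proof (rule nn_integral_cong_AE)
    show "AE p in lborel. (\<integral>\<^sup>+\<omega>. g (p, \<omega>) \<partial>M) = (\<integral>\<^sup>+\<omega>. g (p, \<omega>) \<partial>M) * indicator D p"
      using AE_lborel_fst_neq[of t]
    proof eventually_elim
      case (elim p)
      show ?case
      proof (cases "p \<in> D")
        case False
        have "g (p, \<omega>) = 0" if "\<omega> \<in> space M" for \<omega>
        proof -
          have "indicator (R k) p = (0 :: real)" if "k < n" for k
            using pr(1,3,5)[OF that] False elim unfolding R_def D_def by (cases p) (auto simp: indicator_def)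
          then have "simple_sum n R X (p, \<omega>) = 0" unfolding simple_sum_def by simp
          moreover have "F (p, \<omega>) = 0" using False Ff[OF that, of p] unfolding D_def by simp
          ultimately show ?thesis by (simp add: g_def)
        qed
        then have "(\<integral>\<^sup>+\<omega>. g (p, \<omega>) \<partial>M) = (\<integral>\<^sup>+\<omega>. 0 \<partial>M)" by (intro nn_integral_cong) simp
        then show ?thesis by simp
      qed simp
    qed
  qed
  also have "\<dots> = (\<integral>\<^sup>+p. (\<integral>\<^sup>+\<omega>. g (p, \<omega>) \<partial>M) \<partial>P)"
    unfolding P_def by (subst nn_integral_restrict_space) auto
  also have "\<dots> = (\<integral>\<^sup>+z. g z \<partial>(P \<Otimes>\<^sub>M M))"
    by (rule nn_integral_fst[OF gP])
  also have "\<dots> = (\<integral>\<^sup>+((s, y), \<omega>). ennreal ((simple_value (ps m) s y \<omega> - f s y \<omega>)\<^sup>2) \<partial>(P \<Otimes>\<^sub>M M))"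
  proof (rule nn_integral_cong)
    fix z assume "z \<in> space (P \<Otimes>\<^sub>M M)"
    then obtain s y \<omega> where z: "z = ((s, y), \<omega>)" "(s, y) \<in> D" "\<omega> \<in> space M"
      by (cases z) (auto simp: space_pair_measure P_def space_restrict_space)
    then show "g z = (\<lambda>((s, y), \<omega>). ennreal ((simple_value (ps m) s y \<omega> - f s y \<omega>)\<^sup>2)) z"
      using Ff[OF z(3), of "(s, y)"] V1[of "(s, y)" \<omega>] unfolding g_def D_def l_def by simp
  qed
  also note m1
  finally have "(\<integral>\<^sup>+z. ennreal ((simple_sum n R X z - F z)\<^sup>2) \<partial>(lborel \<Otimes>\<^sub>M M)) < ennreal e"
    unfolding g_def .
  moreover have "(\<integral>\<^sup>+\<omega>. ennreal ((simple_int n R X \<omega> - Z \<omega>)\<^sup>2) \<partial>M) < ennreal e"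
    unfolding I1 using m2 by (simp add: l_def)
  ultimately show ?thesis using st by (intro exI conjI) (auto intro: less_imp_le)
qed

end

text \<open>Cauchy-Schwarz against the indicator of a set that contains the support.\<close>

lemma integral_abs_sq_le:
  fixes q :: "'a \<Rightarrow> real"
  assumes q: "integrable N q" and D [measurable]: "D \<in> sets N" and supp: "\<And>p. p \<in> space N \<Longrightarrow> p \<notin> D \<Longrightarrow> q p = 0"
    and s: "emeasure N D \<le> ennreal s"
  shows "ennreal ((LINT p|N. \<bar>q p\<bar>)\<^sup>2) \<le> ennreal s * (\<integral>\<^sup>+p. ennreal ((q p)\<^sup>2) \<partial>N)"
proof -
  have [measurable]: "q \<in> borel_measurable N" using q by auto
  have i0: "(LINT p|N. \<bar>q p\<bar>) \<ge> 0" by (rule Bochner_Integration.integral_nonneg) simp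
  have "ennreal (LINT p|N. \<bar>q p\<bar>) = (\<integral>\<^sup>+p. ennreal \<bar>q p\<bar> \<partial>N)"
    by (rule nn_integral_eq_integral[symmetric]) (use q in auto)
  also have "\<dots> = (\<integral>\<^sup>+p. ennreal \<bar>q p\<bar> * indicator D p \<partial>N)"
    by (rule nn_integral_cong) (use supp in \<open>auto simp: indicator_def\<close>)
  finally have "ennreal ((LINT p|N. \<bar>q p\<bar>)\<^sup>2) = (\<integral>\<^sup>+p. ennreal \<bar>q p\<bar> * indicator D p \<partial>N)\<^sup>2"
    using i0 by (simp add: power2_eq_square ennreal_mult)
  also have "\<dots> \<le> (\<integral>\<^sup>+p. (ennreal \<bar>q p\<bar>)\<^sup>2 \<partial>N) * (\<integral>\<^sup>+p. (indicator D p)\<^sup>2 \<partial>N)"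
    by (rule Cauchy_Schwarz_nn_integral) measurable
  also have "(\<integral>\<^sup>+p. (indicator D p)\<^sup>2 \<partial>N) = (\<integral>\<^sup>+p. indicator D p \<partial>N)"
    by (rule nn_integral_cong) (simp add: indicator_def)
  also have "\<dots> = emeasure N D" by simp
  also have "(\<integral>\<^sup>+p. (ennreal \<bar>q p\<bar>)\<^sup>2 \<partial>N) = (\<integral>\<^sup>+p. ennreal ((q p)\<^sup>2) \<partial>N)"
    by (rule nn_integral_cong) (simp add: ennreal_power)
  also have "(\<integral>\<^sup>+p. ennreal ((q p)\<^sup>2) \<partial>N) * emeasure N D \<le> (\<integral>\<^sup>+p. ennreal ((q p)\<^sup>2) \<partial>N) * ennreal s"
    by (rule mult_left_mono[OF s]) simp
  finally show ?thesis by (simp add: mult.commute)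
qed

lemma integrable_kap_sq: "t > 0 \<Longrightarrow> integrable lborel (\<lambda>p. (kap t x p)\<^sup>2)"
  using kap_norm_finite[of t x] by (intro integrableI_bounded) auto

lemma emeasure_rect: "emeasure lborel ({0<..<t} \<times> {0..1 :: real}) = ennreal t"
  by (subst lborel_prod[symmetric], subst lborel.emeasure_pair_measure_Times) (cases "t \<ge> 0"; auto simp: ennreal_neg)+

lemma kap_eq_0: "p \<notin> {0<..<t} \<times> {0..1} \<Longrightarrow> kap t x p = 0"
  by (simp add: kap_def)

lemma integrable_kap: assumes "t > 0" shows "integrable lborel (kap t x)"
proof (rule Bochner_Integration.integrable_bound)
  show "integrable lborel (\<lambda>p. (kap t x p)\<^sup>2 + indicator ({0<..<t} \<times> {0..1}) p)"
    by (intro Bochner_Integration.integrable_add integrable_kap_sq assms integrable_real_indicator)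
       (auto simp: emeasure_rect)
  show "AE p in lborel. norm (kap t x p) \<le> norm ((kap t x p)\<^sup>2 + indicator ({0<..<t} \<times> {0..1}) p)"
  proof (rule AE_I2)
    fix p :: "real \<times> real"
    have le: "\<bar>a\<bar> \<le> a\<^sup>2 + 1" for a :: real
      using zero_le_power2[of "\<bar>a\<bar> - 1"] by (simp add: power2_eq_square algebra_simps)
    show "norm (kap t x p) \<le> norm ((kap t x p)\<^sup>2 + indicator ({0<..<t} \<times> {0..1}) p)"
      using le[of "kap t x p"] by (cases "p \<in> {0<..<t} \<times> {0..1}") (auto simp: kap_eq_0)
  qed
qed measurable

context noise_space
begin

text \<open>The same simple terms approximate the integrand and the value. The terminal time has
  disappeared into \<open>F\<close>, which lives on the whole plane.\<close>

definition walsh_version :: "((real \<times> real) \<times> 'a \<Rightarrow> real) \<Rightarrow> ('a \<Rightarrow> real) \<Rightarrow> bool" where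
  "walsh_version F Z \<longleftrightarrow> F \<in> borel_measurable (lborel \<Otimes>\<^sub>M M) \<and> Z \<in> borel_measurable M \<and>
    (\<forall>e>0. \<exists>n r R X. simple_terms n r R X \<and>
      (\<integral>\<^sup>+z. ennreal ((simple_sum n R X z - F z)\<^sup>2) \<partial>(lborel \<Otimes>\<^sub>M M)) \<le> ennreal e \<and>
      (\<integral>\<^sup>+\<omega>. ennreal ((simple_int n R X \<omega> - Z \<omega>)\<^sup>2) \<partial>M) \<le> ennreal e)"

text \<open>The approximants satisfy the exact isometry; two applications of the three-term
  inequality for squares carry it over with the constant 9 = 3 * 3.\<close>

lemma walsh_version_diff:
  assumes 1: "walsh_version F Z" and 2: "walsh_version F' Z'"
  shows "(\<integral>\<^sup>+\<omega>. ennreal ((Z \<omega> - Z' \<omega>)\<^sup>2) \<partial>M) \<le> 9 * (\<integral>\<^sup>+z. ennreal ((F z - F' z)\<^sup>2) \<partial>(lborel \<Otimes>\<^sub>M M))"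
proof (rule ennreal_le_epsilon)
  fix e :: real assume "e > 0"
  \<comment> \<open>The approximation errors enter with weights 3, 9, 9 and 3, in total 24.\<close>
  define e' where "e' = e / 24"
  have e': "e' > 0" using \<open>e > 0\<close> by (simp add: e'_def)
  have [measurable]: "F \<in> borel_measurable (lborel \<Otimes>\<^sub>M M)" "F' \<in> borel_measurable (lborel \<Otimes>\<^sub>M M)"
    "Z \<in> borel_measurable M" "Z' \<in> borel_measurable M" using 1 2 by (auto simp: walsh_version_def)
  obtain n r R X where a: "simple_terms n r R X"
      "(\<integral>\<^sup>+z. ennreal ((simple_sum n R X z - F z)\<^sup>2) \<partial>(lborel \<Otimes>\<^sub>M M)) \<le> ennreal e'"
      "(\<integral>\<^sup>+\<omega>. ennreal ((simple_int n R X \<omega> - Z \<omega>)\<^sup>2) \<partial>M) \<le> ennreal e'"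
    using 1 e' unfolding walsh_version_def by blast
  obtain n' r' R' X' where b: "simple_terms n' r' R' X'"
      "(\<integral>\<^sup>+z. ennreal ((simple_sum n' R' X' z - F' z)\<^sup>2) \<partial>(lborel \<Otimes>\<^sub>M M)) \<le> ennreal e'"
      "(\<integral>\<^sup>+\<omega>. ennreal ((simple_int n' R' X' \<omega> - Z' \<omega>)\<^sup>2) \<partial>M) \<le> ennreal e'"
    using 2 e' unfolding walsh_version_def by blast
  note [measurable] = simple_sum_measurable[OF a(1)] simple_sum_measurable[OF b(1)] simple_int_measurable[OF a(1)] simple_int_measurable[OF b(1)]
  define Q where "Q = (\<integral>\<^sup>+z. ennreal ((F z - F' z)\<^sup>2) \<partial>(lborel \<Otimes>\<^sub>M M))"
  have "(\<integral>\<^sup>+\<omega>. ennreal ((Z \<omega> - Z' \<omega>)\<^sup>2) \<partial>M)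
    \<le> 3 * (\<integral>\<^sup>+\<omega>. ennreal ((Z \<omega> - simple_int n R X \<omega>)\<^sup>2) \<partial>M) + 3 * (\<integral>\<^sup>+\<omega>. ennreal ((simple_int n R X \<omega> - simple_int n' R' X' \<omega>)\<^sup>2) \<partial>M)
      + 3 * (\<integral>\<^sup>+\<omega>. ennreal ((simple_int n' R' X' \<omega> - Z' \<omega>)\<^sup>2) \<partial>M)"
    by (rule nn_integral_sq_triangle3) measurable
  also have "\<dots> \<le> 3 * ennreal e' + 3 * (3 * ennreal e' + 3 * Q + 3 * ennreal e') + 3 * ennreal e'"
  proof (intro add_mono mult_left_mono)
    show "(\<integral>\<^sup>+\<omega>. ennreal ((Z \<omega> - simple_int n R X \<omega>)\<^sup>2) \<partial>M) \<le> ennreal e'"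
      using a(3) by (simp add: power2_commute)
    have "(\<integral>\<^sup>+\<omega>. ennreal ((simple_int n R X \<omega> - simple_int n' R' X' \<omega>)\<^sup>2) \<partial>M)
       \<le> 3 * (\<integral>\<^sup>+z. ennreal ((simple_sum n R X z - F z)\<^sup>2) \<partial>(lborel \<Otimes>\<^sub>M M)) + 3 * Q
         + 3 * (\<integral>\<^sup>+z. ennreal ((F' z - simple_sum n' R' X' z)\<^sup>2) \<partial>(lborel \<Otimes>\<^sub>M M))"
      unfolding ito_isometry_diff[OF a(1) b(1)] Q_def by (rule nn_integral_sq_triangle3) measurable
    also have "\<dots> \<le> 3 * ennreal e' + 3 * Q + 3 * ennreal e'"
    proof (intro add_mono mult_left_mono a(2) order_refl)
      show "(\<integral>\<^sup>+z. ennreal ((F' z - simple_sum n' R' X' z)\<^sup>2) \<partial>(lborel \<Otimes>\<^sub>M M)) \<le> ennreal e'"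
        using b(2) by (simp add: power2_commute)
    qed auto
    finally show "(\<integral>\<^sup>+\<omega>. ennreal ((simple_int n R X \<omega> - simple_int n' R' X' \<omega>)\<^sup>2) \<partial>M) \<le> 3 * ennreal e' + 3 * Q + 3 * ennreal e'" .
    show "(\<integral>\<^sup>+\<omega>. ennreal ((simple_int n' R' X' \<omega> - Z' \<omega>)\<^sup>2) \<partial>M) \<le> ennreal e'" by (rule b(3))
  qed auto
  also have "\<dots> = 9 * Q + (24 * ennreal e')"
    by (simp add: distrib_left mult.assoc[symmetric] add_ac) (simp add: distrib_right[symmetric] add.assoc[symmetric])
  also have "24 * ennreal e' = ennreal (24 * e')" using e' by (simp add: ennreal_mult)
  also have "24 * e' = e" by (simp add: e'_def)
  finally show "(\<integral>\<^sup>+\<omega>. ennreal ((Z \<omega> - Z' \<omega>)\<^sup>2) \<partial>M) \<le> 9 * (\<integral>\<^sup>+z. ennreal ((F z - F' z)\<^sup>2) \<partial>(lborel \<Otimes>\<^sub>M M)) + ennreal e"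
    unfolding Q_def .
qed

end

section \<open>Decomposition and mean-square regularity of the solution\<close>

locale spde_solution = noise_space M W for M :: "'a measure" and W +
  fixes G :: "real \<Rightarrow> real \<Rightarrow> real \<Rightarrow> real" and \<sigma> b u0 :: "real \<Rightarrow> real"
    and u :: "real \<Rightarrow> real \<Rightarrow> 'a \<Rightarrow> real" and K :: real
  assumes G: "neumann_heat_kernel G"
    and \<sigma>_measurable [measurable]: "\<sigma> \<in> borel_measurable borel" and \<sigma>_le: "\<And>v. \<bar>\<sigma> v\<bar> \<le> K"
    and b_measurable [measurable]: "b \<in> borel_measurable borel" and b_le: "\<And>v. \<bar>b v\<bar> \<le> K"
    and adapted: "adapted_random_field M W u"
    and mild: "mild_solution M W G \<sigma> b u0 u"
begin

lemma K_nonneg: "K \<ge> 0" using \<sigma>_le[of 0] by linarith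

text \<open>The field extended by zero, which turns measurability on a restricted space into joint
  measurability on the full product.\<close>

definition uu :: "(real \<times> real) \<times> 'a \<Rightarrow> real" where
  "uu z = (if z \<in> ({0<..} \<times> {0..1}) \<times> UNIV then u (fst (fst z)) (snd (fst z)) (snd z) else 0)"

lemma uu_eq: "s > 0 \<Longrightarrow> y \<in> {0..1} \<Longrightarrow> uu ((s, y), \<omega>) = u s y \<omega>"
  by (simp add: uu_def)

lemma u_measurable: "t > 0 \<Longrightarrow> x \<in> {0..1} \<Longrightarrow> u t x \<in> borel_measurable M"
  using adapted unfolding adapted_random_field_def noise_filtration_eq
  by (blast intro: noise_sigma_measurable_M)

lemma uu_measurable [measurable]: "uu \<in> borel_measurable (lborel \<Otimes>\<^sub>M M)"
proof -
  define D where "D = {0 :: real<..} \<times> {0..1 :: real}"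
  have D: "D \<in> sets borel" unfolding D_def by (simp add: borel_Times)
  have \<Omega>: "(D \<times> UNIV) \<inter> space (lborel \<Otimes>\<^sub>M M) \<in> sets (lborel \<Otimes>\<^sub>M M)"
  proof -
    have "(D \<times> UNIV) \<inter> space (lborel \<Otimes>\<^sub>M M) = D \<times> space M" by (auto simp: space_pair_measure)
    then show ?thesis using D by simp
  qed
  have um: "(\<lambda>((t, x), \<omega>). u t x \<omega>) \<in> borel_measurable (restrict_space borel D \<Otimes>\<^sub>M M)"
    using adapted unfolding adapted_random_field_def D_def by blast
  have "(\<lambda>z. (fst z, snd z)) \<in> measurable (restrict_space (lborel \<Otimes>\<^sub>M M) (D \<times> UNIV)) (restrict_space borel D \<Otimes>\<^sub>M M)"
  proof (rule measurable_Pair)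
    show "fst \<in> measurable (restrict_space (lborel \<Otimes>\<^sub>M M) (D \<times> UNIV)) (restrict_space borel D)"
    proof (rule measurable_restrict_space2)
      have "fst \<in> measurable (lborel \<Otimes>\<^sub>M M) lborel" by simp
      then have "fst \<in> measurable (lborel \<Otimes>\<^sub>M M) borel" by simp
      then show "fst \<in> measurable (restrict_space (lborel \<Otimes>\<^sub>M M) (D \<times> UNIV)) borel" by (rule measurable_restrict_space1)
    qed (auto simp: space_restrict_space)
    show "snd \<in> measurable (restrict_space (lborel \<Otimes>\<^sub>M M) (D \<times> UNIV)) M"
      by (rule measurable_restrict_space1) simp
  qed
  from measurable_compose[OF this um]
  have "(\<lambda>z. u (fst (fst z)) (snd (fst z)) (snd z)) \<in> borel_measurable (restrict_space (lborel \<Otimes>\<^sub>M M) (D \<times> UNIV))"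
    by (simp add: case_prod_beta)
  then have "(\<lambda>z. if z \<in> D \<times> UNIV then u (fst (fst z)) (snd (fst z)) (snd z) else 0) \<in> borel_measurable (lborel \<Otimes>\<^sub>M M)"
    by (subst (asm) measurable_restrict_space_iff[where c = 0, OF \<Omega>]) auto
  then show ?thesis unfolding uu_def[abs_def] D_def .
qed

lemma uu_slice: "\<omega> \<in> space M \<Longrightarrow> (\<lambda>p. uu (p, \<omega>)) \<in> borel_measurable lborel"
  using measurable_Pair1[OF uu_measurable] by blast

definition SF :: "real \<Rightarrow> real \<Rightarrow> (real \<times> real) \<times> 'a \<Rightarrow> real" where
  "SF t x z = kap t x (fst z) * \<sigma> (uu z)"

text \<open>One integral over the plane in place of the iterated one, with the same kernel as the
  stochastic part; \<open>drift_iterated\<close> relates the two.\<close>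

definition drift :: "real \<Rightarrow> real \<Rightarrow> 'a \<Rightarrow> real" where
  "drift t x \<omega> = (LINT p|lborel. kap t x p * b (uu (p, \<omega>)))"

definition init :: "real \<Rightarrow> real \<Rightarrow> real" where
  "init t x = (LINT y:{0..1}|lborel. G t x y * u0 y)"

lemma kap_M [measurable]: "(\<lambda>z. kap t x (fst z)) \<in> borel_measurable (lborel \<Otimes>\<^sub>M M)"
  by (rule measurable_compose[OF measurable_fst]) simp

lemma SF_measurable [measurable]: "SF t x \<in> borel_measurable (lborel \<Otimes>\<^sub>M M)"
  unfolding SF_def by measurable

lemma kap_G:
  assumes "x \<in> {0..1}" "0 < s" "s < t" "y \<in> {0..1}"
  shows "kap t x (s, y) = G (t - s) x y"
  using assms heat_kernel_eq_hk[OF G, of "t - s" x y] by (simp add: kap_def)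

lemma integrable_kap_b:
  assumes "t > 0" "\<omega> \<in> space M" shows "integrable lborel (\<lambda>p. kap t x p * b (uu (p, \<omega>)))"
proof (rule Bochner_Integration.integrable_bound)
  show "integrable lborel (\<lambda>p. K * kap t x p)" using integrable_kap[OF assms(1)] by simp
  have [measurable]: "(\<lambda>p. uu (p, \<omega>)) \<in> borel_measurable borel" using uu_slice[OF assms(2)] by simp
  show "(\<lambda>p. kap t x p * b (uu (p, \<omega>))) \<in> borel_measurable lborel" by measurable
  show "AE p in lborel. norm (kap t x p * b (uu (p, \<omega>))) \<le> norm (K * kap t x p)"
  proof (rule AE_I2)
    fix p
    have "\<bar>b (uu (p, \<omega>))\<bar> * \<bar>kap t x p\<bar> \<le> \<bar>K\<bar> * \<bar>kap t x p\<bar>"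
      using b_le[of "uu (p, \<omega>)"] K_nonneg by (intro mult_right_mono) auto
    then show "norm (kap t x p * b (uu (p, \<omega>))) \<le> norm (K * kap t x p)"
      by (simp add: abs_mult mult.commute)
  qed
qed

lemma drift_iterated:
  assumes "t > 0" "x \<in> {0..1}" "\<omega> \<in> space M"
  shows "(LINT s:{0<..<t}|lborel. LINT y:{0..1}|lborel. G (t - s) x y * b (u s y \<omega>)) = drift t x \<omega>"
proof -
  have i: "integrable (lborel \<Otimes>\<^sub>M lborel) (\<lambda>p. kap t x p * b (uu (p, \<omega>)))"
    unfolding lborel_prod by (rule integrable_kap_b[OF assms(1,3)])
  have "drift t x \<omega> = (LINT p|(lborel \<Otimes>\<^sub>M lborel). kap t x p * b (uu (p, \<omega>)))"
    unfolding drift_def lborel_prod ..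
  also have "\<dots> = (LINT s|lborel. LINT y|lborel. kap t x (s, y) * b (uu ((s, y), \<omega>)))"
    by (rule lborel_pair.integral_fst'[OF i, symmetric])
  also have "\<dots> = (LINT s:{0<..<t}|lborel. LINT y:{0..1}|lborel. G (t - s) x y * b (u s y \<omega>))"
    unfolding set_lebesgue_integral_def
  proof (rule Bochner_Integration.integral_cong[OF refl])
    fix s :: real
    show "(LINT y|lborel. kap t x (s, y) * b (uu ((s, y), \<omega>)))
      = indicat_real {0<..<t} s *\<^sub>R (LINT y|lborel. indicat_real {0..1} y *\<^sub>R (G (t - s) x y * b (u s y \<omega>)))"
    proof (cases "s \<in> {0<..<t}")
      case True
      have "kap t x (s, y) * b (uu ((s, y), \<omega>)) = indicat_real {0..1} y *\<^sub>R (G (t - s) x y * b (u s y \<omega>))" for y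
        using True assms(2) by (cases "y \<in> {0..1}") (auto simp: kap_G uu_eq kap_eq_0)
      then show ?thesis using True by simp
    next
      case False
      have "kap t x (s, y) = 0" for y by (rule kap_eq_0) (use False in auto)
      then show ?thesis using False by simp
    qed
  qed
  finally show ?thesis ..
qed

text \<open>Both \<open>Z\<close> and the exceptional null set depend on \<open>(t, x)\<close>. No
  joint version is chosen: later estimates fix one or two points and argue almost surely
  there.\<close>

lemma mild_decomposition:
  assumes t: "t > 0" and x: "x \<in> {0..1}"
  shows "\<exists>Z. walsh_version (SF t x) Z \<and> (AE \<omega> in M. u t x \<omega> = init t x + Z \<omega> + drift t x \<omega>)"
proof -
  obtain Z where Z: "has_walsh_integral M W t (\<lambda>s y \<omega>. G (t - s) x y * \<sigma> (u s y \<omega>)) Z"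
    and ae: "AE \<omega> in M. u t x \<omega> = (LINT y:{0..1}|lborel. G t x y * u0 y) + Z \<omega> +
          (LINT s:{0<..<t}|lborel. LINT y:{0..1}|lborel. G (t - s) x y * b (u s y \<omega>))"
    using mild[unfolded mild_solution_def, rule_format, OF t x] by (elim conjE exE)
  have SFeq: "SF t x (p, \<omega>) = indicator ({0<..<t} \<times> {0..1}) p * (G (t - fst p) x (snd p) * \<sigma> (u (fst p) (snd p) \<omega>))" for p \<omega>
  proof (cases "p \<in> {0<..<t} \<times> {0..1}")
    case True
    then obtain s y where "p = (s, y)" "0 < s" "s < t" "y \<in> {0..1}" by (cases p) auto
    then show ?thesis using x by (simp add: SF_def kap_G uu_eq)
  qed (simp add: SF_def kap_eq_0)
  have "walsh_version (SF t x) Z"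
    unfolding walsh_version_def
  proof (intro conjI allI impI)
    show "Z \<in> borel_measurable M" using Z by (simp add: has_walsh_integral_def)
    fix e :: real assume "e > 0"
    show "\<exists>n r R X. simple_terms n r R X \<and>
      (\<integral>\<^sup>+z. ennreal ((simple_sum n R X z - SF t x z)\<^sup>2) \<partial>(lborel \<Otimes>\<^sub>M M)) \<le> ennreal e \<and>
      (\<integral>\<^sup>+\<omega>. ennreal ((simple_int n R X \<omega> - Z \<omega>)\<^sup>2) \<partial>M) \<le> ennreal e"
      by (rule walsh_approximation[OF Z \<open>e > 0\<close> SF_measurable SFeq])
  qed measurable
  moreover have "AE \<omega> in M. u t x \<omega> = init t x + Z \<omega> + drift t x \<omega>"
    using ae AE_space by eventually_elim (simp only: drift_iterated[OF t x] init_def)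
  ultimately show ?thesis by blast
qed

lemma SF_diff_norm:
  "(\<integral>\<^sup>+z. ennreal ((SF s x z - SF r x' z)\<^sup>2) \<partial>(lborel \<Otimes>\<^sub>M M)) \<le> ennreal (K\<^sup>2) * (\<integral>\<^sup>+p. ennreal ((kap s x p - kap r x' p)\<^sup>2) \<partial>lborel)"
proof -
  have "(\<integral>\<^sup>+z. ennreal ((SF s x z - SF r x' z)\<^sup>2) \<partial>(lborel \<Otimes>\<^sub>M M))
     \<le> (\<integral>\<^sup>+z. ennreal (K\<^sup>2) * ennreal ((kap s x (fst z) - kap r x' (fst z))\<^sup>2) \<partial>(lborel \<Otimes>\<^sub>M M))"
  proof (rule nn_integral_mono)
    fix z
    have "(\<sigma> (uu z))\<^sup>2 \<le> K\<^sup>2" using \<sigma>_le[of "uu z"] K_nonneg by (simp add: abs_le_square_iff[symmetric])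
    then have "(\<sigma> (uu z))\<^sup>2 * (kap s x (fst z) - kap r x' (fst z))\<^sup>2 \<le> K\<^sup>2 * (kap s x (fst z) - kap r x' (fst z))\<^sup>2"
      by (rule mult_right_mono) simp
    moreover have "(SF s x z - SF r x' z)\<^sup>2 = (\<sigma> (uu z))\<^sup>2 * (kap s x (fst z) - kap r x' (fst z))\<^sup>2"
      unfolding SF_def by (simp add: power2_eq_square algebra_simps)
    ultimately show "ennreal ((SF s x z - SF r x' z)\<^sup>2) \<le> ennreal (K\<^sup>2) * ennreal ((kap s x (fst z) - kap r x' (fst z))\<^sup>2)"
      by (simp add: ennreal_mult[symmetric] ennreal_leI)
  qed
  also have "\<dots> = ennreal (K\<^sup>2) * (\<integral>\<^sup>+z. ennreal ((kap s x (fst z) - kap r x' (fst z))\<^sup>2) \<partial>(lborel \<Otimes>\<^sub>M M))"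
    by (rule nn_integral_cmult) measurable
  also have "(\<integral>\<^sup>+z. ennreal ((kap s x (fst z) - kap r x' (fst z))\<^sup>2) \<partial>(lborel \<Otimes>\<^sub>M M)) = (\<integral>\<^sup>+p. \<integral>\<^sup>+\<omega>. ennreal ((kap s x p - kap r x' p)\<^sup>2) \<partial>M \<partial>lborel)"
    by (subst nn_integral_fst[symmetric]) auto
  also have "\<dots> = (\<integral>\<^sup>+p. ennreal ((kap s x p - kap r x' p)\<^sup>2) \<partial>lborel)" by (simp add: emeasure_space_1)
  finally show ?thesis .
qed

text \<open>Cauchy-Schwarz on a domain of area \<open>s\<close> reduces the drift to the same
  squared kernel distance that governs the stochastic integral.\<close>

lemma drift_diff:
  assumes "0 < r" "r \<le> s" "\<omega> \<in> space M"
  shows "ennreal ((drift s x \<omega> - drift r x' \<omega>)\<^sup>2) \<le> ennreal (K\<^sup>2 * s) * (\<integral>\<^sup>+p. ennreal ((kap s x p - kap r x' p)\<^sup>2) \<partial>lborel)"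
proof -
  define q where "q p = kap s x p - kap r x' p" for p
  have iq: "integrable lborel q" unfolding q_def using assms by (intro Bochner_Integration.integrable_diff integrable_kap) auto
  have s0: "s > 0" using assms by simp
  have i: "integrable lborel (\<lambda>p. kap s x p * b (uu (p, \<omega>)) - kap r x' p * b (uu (p, \<omega>)))"
    by (intro Bochner_Integration.integrable_diff integrable_kap_b assms s0)
  have "\<bar>drift s x \<omega> - drift r x' \<omega>\<bar> = \<bar>LINT p|lborel. kap s x p * b (uu (p, \<omega>)) - kap r x' p * b (uu (p, \<omega>))\<bar>"
    unfolding drift_def using assms s0 by (subst Bochner_Integration.integral_diff) (auto intro: integrable_kap_b)
  also have "\<dots> \<le> (LINT p|lborel. K * \<bar>q p\<bar>)"
  proof (rule abs_integral_le[OF i])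
    show "integrable lborel (\<lambda>p. K * \<bar>q p\<bar>)" using iq by simp
    fix p
    have "\<bar>b (uu (p, \<omega>))\<bar> * \<bar>q p\<bar> \<le> K * \<bar>q p\<bar>" by (rule mult_right_mono[OF b_le]) simp
    then show "\<bar>kap s x p * b (uu (p, \<omega>)) - kap r x' p * b (uu (p, \<omega>))\<bar> \<le> K * \<bar>q p\<bar>"
      unfolding left_diff_distrib[symmetric] abs_mult q_def by (simp add: mult.commute)
  qed
  also have "\<dots> = K * (LINT p|lborel. \<bar>q p\<bar>)" by simp
  finally have "\<bar>drift s x \<omega> - drift r x' \<omega>\<bar>\<^sup>2 \<le> (K * (LINT p|lborel. \<bar>q p\<bar>))\<^sup>2" by (intro power_mono) auto
  then have "ennreal ((drift s x \<omega> - drift r x' \<omega>)\<^sup>2) \<le> ennreal (K\<^sup>2) * ennreal ((LINT p|lborel. \<bar>q p\<bar>)\<^sup>2)"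
    by (simp add: power_mult_distrib ennreal_mult[symmetric] ennreal_leI)
  also have "ennreal ((LINT p|lborel. \<bar>q p\<bar>)\<^sup>2) \<le> ennreal s * (\<integral>\<^sup>+p. ennreal ((q p)\<^sup>2) \<partial>lborel)"
  proof (rule integral_abs_sq_le[OF iq, of "{0<..<s} \<times> {0..1}"])
    show "q p = 0" if "p \<notin> {0<..<s} \<times> {0..1}" for p
      using that assms unfolding q_def by (subst (1 2) kap_eq_0) auto
  qed (auto simp: emeasure_rect)
  finally show ?thesis
    using s0 by (simp add: q_def ennreal_mult mult.assoc mult_left_mono)
qed

text \<open>The mild equation gives integrability of \<open>G t x y * u0 y\<close> only. At a time
  when the kernel is at least 1/2 this passes to \<open>u0\<close> by division.\<close>

lemma u0_integrable: "integrable lborel (\<lambda>y. indicator {0..1} y * u0 y)"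
proof -
  obtain t where t: "t > 0" "\<And>x y. hk t x y \<ge> 1/2" using hk_large_time by blast
  have "set_integrable lborel {0..1} (\<lambda>y. G t 0 y * u0 y)"
    using mild t(1) unfolding mild_solution_def by auto
  then have i: "integrable lborel (\<lambda>y. indicator {0..1} y * (G t 0 y * u0 y))"
    by (simp add: set_integrable_def)
  have eq: "indicator {0..1} y * u0 y = (indicator {0..1} y * (G t 0 y * u0 y)) / hk t 0 y" for y
  proof -
    have "hk t 0 y \<noteq> 0" using t(2)[of 0 y] by linarith
    then show ?thesis using heat_kernel_eq_hk[OF G t(1), of 0 y] by (auto simp: indicator_def)
  qed
  have m: "(\<lambda>y. (indicator {0..1} y * (G t 0 y * u0 y)) / hk t 0 y) \<in> borel_measurable lborel"
    using borel_measurable_integrable[OF i] by measurable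
  show ?thesis
    unfolding eq
  proof (rule Bochner_Integration.integrable_bound[OF _ m])
    show "integrable lborel (\<lambda>y. 2 * (indicator {0..1} y * (G t 0 y * u0 y)))" using i by simp
    show "AE y in lborel. norm (indicator {0..1} y * (G t 0 y * u0 y) / hk t 0 y) \<le> norm (2 * (indicator {0..1} y * (G t 0 y * u0 y)))"
    proof (rule AE_I2)
      fix y
      have h: "hk t 0 y \<ge> 1/2" by (rule t(2))
      have dv: "\<bar>a\<bar> / hk t 0 y \<le> \<bar>a\<bar> * 2" for a :: real
      proof -
        have "\<bar>a\<bar> / hk t 0 y \<le> \<bar>a\<bar> / (1/2)" using h by (intro divide_left_mono) auto
        then show ?thesis by simp
      qed
      have "norm (indicator {0..1} y * (G t 0 y * u0 y) / hk t 0 y) = \<bar>indicator {0..1} y * (G t 0 y * u0 y)\<bar> / hk t 0 y"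
        using h by (simp add: abs_divide)
      also have "\<dots> \<le> \<bar>indicator {0..1} y * (G t 0 y * u0 y)\<bar> * 2" by (rule dv)
      finally show "norm (indicator {0..1} y * (G t 0 y * u0 y) / hk t 0 y) \<le> norm (2 * (indicator {0..1} y * (G t 0 y * u0 y)))"
        by (simp add: abs_mult mult.commute)
    qed
  qed
qed

lemma init_eq:
  assumes "t > 0" "x \<in> {0..1}"
  shows "init t x = (LINT y|lborel. hk t x y * (indicator {0..1} y * u0 y))"
    and "integrable lborel (\<lambda>y. hk t x y * (indicator {0..1} y * u0 y))"
proof -
  have eq: "indicator {0..1} y *\<^sub>R (G t x y * u0 y) = hk t x y * (indicator {0..1} y * u0 y)" for y
    using heat_kernel_eq_hk[OF G assms(1,2), of y] by (auto simp: indicator_def)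
  show "init t x = (LINT y|lborel. hk t x y * (indicator {0..1} y * u0 y))"
    unfolding init_def set_lebesgue_integral_def eq ..
  have "set_integrable lborel {0..1} (\<lambda>y. G t x y * u0 y)"
    using mild assms unfolding mild_solution_def by blast
  then show "integrable lborel (\<lambda>y. hk t x y * (indicator {0..1} y * u0 y))"
    unfolding set_integrable_def eq .
qed

lemma init_diff:
  assumes "0 < t0"
  shows "\<exists>C\<ge>0. \<forall>s r x x'. t0 \<le> s \<longrightarrow> t0 \<le> r \<longrightarrow> x \<in> {0..1} \<longrightarrow> x' \<in> {0..1} \<longrightarrow>
    \<bar>init s x - init r x'\<bar> \<le> C * (\<bar>s - r\<bar> + \<bar>cs 1 x - cs 1 x'\<bar>)"
proof -
  define A where "A = 2 * (\<Sum>n. ev n * exp (- ev n * t0))"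
  define U where "U = (LINT y|lborel. \<bar>indicator {0..1} y * u0 y\<bar>)"
  have U: "U \<ge> 0" unfolding U_def by (rule Bochner_Integration.integral_nonneg) simp
  have A: "A \<ge> 0" unfolding A_def using summable_ev_exp(1)[OF assms] ev_nonneg by (intro mult_nonneg_nonneg suminf_nonneg) auto
  have "\<bar>init s x - init r x'\<bar> \<le> A * U * (\<bar>s - r\<bar> + \<bar>cs 1 x - cs 1 x'\<bar>)"
    if "t0 \<le> s" "t0 \<le> r" "x \<in> {0..1}" "x' \<in> {0..1}" for s r x x'
  proof -
    define d where "d = \<bar>s - r\<bar> + \<bar>cs 1 x - cs 1 x'\<bar>"
    have sr: "s > 0" "r > 0" using that assms by auto
    have i: "integrable lborel (\<lambda>y. hk s x y * (indicator {0..1} y * u0 y) - hk r x' y * (indicator {0..1} y * u0 y))"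
      by (intro Bochner_Integration.integrable_diff init_eq(2) sr that)
    have "\<bar>init s x - init r x'\<bar> = \<bar>LINT y|lborel. hk s x y * (indicator {0..1} y * u0 y) - hk r x' y * (indicator {0..1} y * u0 y)\<bar>"
      unfolding init_eq(1)[OF sr(1) that(3)] init_eq(1)[OF sr(2) that(4)]
      by (subst Bochner_Integration.integral_diff[OF init_eq(2)[OF sr(1) that(3)] init_eq(2)[OF sr(2) that(4)]]) simp
    also have "\<dots> \<le> (LINT y|lborel. A * d * \<bar>indicator {0..1} y * u0 y\<bar>)"
    proof (rule abs_integral_le[OF i])
      show "integrable lborel (\<lambda>y. A * d * \<bar>indicator {0..1} y * u0 y\<bar>)"
        by (intro integrable_mult_right Bochner_Integration.integrable_abs u0_integrable)
      fix y
      have "\<bar>hk s x y - hk r x' y\<bar> \<le> A * d" unfolding A_def d_def by (rule hk_diff_le(1)[OF assms that(1,2)])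
      then show "\<bar>hk s x y * (indicator {0..1} y * u0 y) - hk r x' y * (indicator {0..1} y * u0 y)\<bar> \<le> A * d * \<bar>indicator {0..1} y * u0 y\<bar>"
        unfolding left_diff_distrib[symmetric] abs_mult[of "hk s x y - hk r x' y"] by (rule mult_right_mono) simp
    qed
    also have "\<dots> = A * U * d" unfolding U_def by (subst integral_mult_right_zero) (simp only: mult_ac)
    finally show ?thesis by (simp only: d_def)
  qed
  with A U show ?thesis by (intro exI[of _ "A * U"]) auto
qed

lemma drift_measurable: "drift t x \<in> borel_measurable M"
proof -
  have "(\<lambda>z. kap t x (snd z) * b (uu (snd z, fst z))) \<in> borel_measurable (M \<Otimes>\<^sub>M lborel)"
  proof -
    have [measurable]: "(\<lambda>z. kap t x (snd z)) \<in> borel_measurable (M \<Otimes>\<^sub>M lborel)"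
      by (rule measurable_compose[OF measurable_snd]) simp
    have "(\<lambda>z. (snd z, fst z)) \<in> measurable (M \<Otimes>\<^sub>M lborel) (lborel \<Otimes>\<^sub>M M)" by measurable
    from measurable_compose[OF this uu_measurable] have [measurable]: "(\<lambda>z. uu (snd z, fst z)) \<in> borel_measurable (M \<Otimes>\<^sub>M lborel)" .
    show ?thesis by measurable
  qed
  then show ?thesis
    unfolding drift_def by (intro lborel.borel_measurable_lebesgue_integral) (simp add: case_prod_beta)
qed

text \<open>Initial part, stochastic integral and drift are compared separately, the last two
  through the same kernel increment. Times stay above \<open>t0\<close> because the initial part is
  controlled only away from time 0. The modest power 1/4 comes from the kernel increments; it later
  meets a merely logarithmic modulus.\<close>

lemma solution_regularity:
  assumes "0 < t0" "0 < T"
  shows "\<exists>C\<ge>0. \<forall>r s x x'. t0 \<le> r \<longrightarrow> r \<le> s \<longrightarrow> s \<le> r + 1 \<longrightarrow> s \<le> T \<longrightarrow> x \<in> {0..1} \<longrightarrow> x' \<in> {0..1} \<longrightarrow>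
    (\<integral>\<^sup>+\<omega>. ennreal ((u s x \<omega> - u r x' \<omega>)\<^sup>2) \<partial>M) \<le> ennreal (C * (s - r + \<bar>cs 1 x - cs 1 x'\<bar>) powr (1/4))"
proof -
  obtain C0 where C0: "C0 \<ge> 0" "\<And>s r x x'. t0 \<le> s \<Longrightarrow> t0 \<le> r \<Longrightarrow> x \<in> {0..1} \<Longrightarrow> x' \<in> {0..1} \<Longrightarrow>
    \<bar>init s x - init r x'\<bar> \<le> C0 * (\<bar>s - r\<bar> + \<bar>cs 1 x - cs 1 x'\<bar>)"
    using init_diff[OF assms(1)] by blast
  define A where "A = kernel_const + 10"
  have A: "A \<ge> 0" using kernel_const_nonneg by (simp add: A_def)
  \<comment> \<open>The outer 3 is that of the three-term inequality. The inner 9 comes from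
    \<open>d \<le> 3\<close> in the initial part and from \<open>walsh_version_diff\<close> in the
    stochastic part.\<close>
  define C where "C = 27 * C0\<^sup>2 + 27 * K\<^sup>2 * A + 3 * K\<^sup>2 * T * A"
  have C: "C \<ge> 0" using A assms by (simp add: C_def)
  have "(\<integral>\<^sup>+\<omega>. ennreal ((u s x \<omega> - u r x' \<omega>)\<^sup>2) \<partial>M) \<le> ennreal (C * (s - r + \<bar>cs 1 x - cs 1 x'\<bar>) powr (1/4))"
    if "t0 \<le> r" "r \<le> s" "s \<le> r + 1" "s \<le> T" and x: "x \<in> {0..1}" "x' \<in> {0..1}" for r s x x'
  proof -
    define d where "d = s - r + \<bar>cs 1 x - cs 1 x'\<bar>"
    have d: "0 \<le> d" "d \<le> 3" using that abs_cs_le[of 1 x] abs_cs_le[of 1 x'] by (auto simp: d_def)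
    have rs: "0 < r" "0 < s" using that assms by auto
    obtain Z where Z: "walsh_version (SF s x) Z" and uZ: "AE \<omega> in M. u s x \<omega> = init s x + Z \<omega> + drift s x \<omega>"
      using mild_decomposition[OF rs(2) x(1)] by blast
    obtain Z' where Z': "walsh_version (SF r x') Z'" and uZ': "AE \<omega> in M. u r x' \<omega> = init r x' + Z' \<omega> + drift r x' \<omega>"
      using mild_decomposition[OF rs(1) x(2)] by blast
    have [measurable]: "Z \<in> borel_measurable M" "Z' \<in> borel_measurable M" using Z Z' by (auto simp: walsh_version_def)
    note [measurable] = drift_measurable
    define Q where "Q = (\<integral>\<^sup>+p. ennreal ((kap s x p - kap r x' p)\<^sup>2) \<partial>lborel)"
    define q where "q = d powr (1/4)"
    have q0: "q \<ge> 0" by (simp add: q_def)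
    have Q: "Q \<le> ennreal (A * q)" unfolding Q_def A_def q_def d_def by (rule kap_increment_norm[OF rs(1) that(2,3)])
    have 1: "(\<integral>\<^sup>+\<omega>. ennreal ((Z \<omega> - Z' \<omega>)\<^sup>2) \<partial>M) \<le> ennreal (9 * K\<^sup>2 * A * q)"
    proof -
      have "(\<integral>\<^sup>+\<omega>. ennreal ((Z \<omega> - Z' \<omega>)\<^sup>2) \<partial>M) \<le> 9 * (\<integral>\<^sup>+z. ennreal ((SF s x z - SF r x' z)\<^sup>2) \<partial>(lborel \<Otimes>\<^sub>M M))"
        by (rule walsh_version_diff[OF Z Z'])
      also have "\<dots> \<le> 9 * (ennreal (K\<^sup>2) * ennreal (A * q))"
        by (rule mult_left_mono[OF order_trans[OF SF_diff_norm mult_left_mono[OF Q[unfolded Q_def]]]]) auto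
      also have "\<dots> = ennreal (9 * K\<^sup>2 * A * q)" using A q0 by (simp add: ennreal_mult mult.assoc)
      finally show ?thesis .
    qed
    have 2: "ennreal ((drift s x \<omega> - drift r x' \<omega>)\<^sup>2) \<le> ennreal (K\<^sup>2 * T * A * q)" if "\<omega> \<in> space M" for \<omega>
    proof -
      have "ennreal ((drift s x \<omega> - drift r x' \<omega>)\<^sup>2) \<le> ennreal (K\<^sup>2 * s) * Q"
        unfolding Q_def by (rule drift_diff[OF rs(1) \<open>r \<le> s\<close> that])
      also have "\<dots> \<le> ennreal (K\<^sup>2 * T) * ennreal (A * q)"
        using \<open>s \<le> T\<close> by (intro mult_mono Q ennreal_leI mult_left_mono) auto
      also have "\<dots> = ennreal (K\<^sup>2 * T * A * q)" using A q0 assms by (simp add: ennreal_mult[symmetric] mult.assoc)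
      finally show ?thesis .
    qed
    have 3: "(init s x - init r x')\<^sup>2 \<le> 9 * C0\<^sup>2 * q"
    proof -
      have "\<bar>init s x - init r x'\<bar> \<le> C0 * d" using C0(2)[of s r x x'] that x by (simp add: d_def)
      then have "\<bar>init s x - init r x'\<bar>\<^sup>2 \<le> (C0 * d)\<^sup>2" by (intro power_mono) auto
      also have "\<dots> = C0\<^sup>2 * d\<^sup>2" by (simp add: power_mult_distrib)
      also have "\<dots> \<le> C0\<^sup>2 * (9 * q)"
      proof (rule mult_left_mono)
        show "d\<^sup>2 \<le> 9 * q"
        proof (cases "d = 0")
          case False
          then have d0: "d > 0" using d by simp
          have "d\<^sup>2 = d powr (7/4) * d powr (1/4)" using d0 by (simp add: powr_add[symmetric])
          also have "d powr (7/4) \<le> 3 powr (7/4)" using d0 d by (intro powr_mono2) auto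
          also have "3 powr (7/4) \<le> (3 :: real) powr 2" by (intro powr_mono) auto
          finally show ?thesis by (simp add: q_def mult_right_mono)
        qed (simp add: q_def)
      qed simp
      finally show ?thesis by simp
    qed
    have "(\<integral>\<^sup>+\<omega>. ennreal ((u s x \<omega> - u r x' \<omega>)\<^sup>2) \<partial>M)
       = (\<integral>\<^sup>+\<omega>. ennreal (((init s x + Z \<omega> + drift s x \<omega>) - (init r x' + Z' \<omega> + drift r x' \<omega>))\<^sup>2) \<partial>M)"
      by (rule nn_integral_cong_AE) (use uZ uZ' in \<open>eventually_elim, simp\<close>)
    also have "\<dots> \<le> 3 * (\<integral>\<^sup>+\<omega>. ennreal (((init s x + Z \<omega> + drift s x \<omega>) - (init r x' + Z \<omega> + drift s x \<omega>))\<^sup>2) \<partial>M)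
       + 3 * (\<integral>\<^sup>+\<omega>. ennreal (((init r x' + Z \<omega> + drift s x \<omega>) - (init r x' + Z' \<omega> + drift s x \<omega>))\<^sup>2) \<partial>M)
       + 3 * (\<integral>\<^sup>+\<omega>. ennreal (((init r x' + Z' \<omega> + drift s x \<omega>) - (init r x' + Z' \<omega> + drift r x' \<omega>))\<^sup>2) \<partial>M)"
      by (rule nn_integral_sq_triangle3) measurable
    also have "\<dots> \<le> 3 * ennreal (9 * C0\<^sup>2 * q) + 3 * ennreal (9 * K\<^sup>2 * A * q) + 3 * ennreal (K\<^sup>2 * T * A * q)"
    proof (intro add_mono mult_left_mono)
      show "(\<integral>\<^sup>+\<omega>. ennreal (((init s x + Z \<omega> + drift s x \<omega>) - (init r x' + Z \<omega> + drift s x \<omega>))\<^sup>2) \<partial>M) \<le> ennreal (9 * C0\<^sup>2 * q)"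
        using 3 by (simp add: emeasure_space_1 ennreal_leI)
      show "(\<integral>\<^sup>+\<omega>. ennreal (((init r x' + Z \<omega> + drift s x \<omega>) - (init r x' + Z' \<omega> + drift s x \<omega>))\<^sup>2) \<partial>M) \<le> ennreal (9 * K\<^sup>2 * A * q)"
        using 1 by simp
      have "(\<integral>\<^sup>+\<omega>. ennreal (((init r x' + Z' \<omega> + drift s x \<omega>) - (init r x' + Z' \<omega> + drift r x' \<omega>))\<^sup>2) \<partial>M) \<le> (\<integral>\<^sup>+\<omega>. ennreal (K\<^sup>2 * T * A * q) \<partial>M)"
        by (rule nn_integral_mono) (use 2 in simp)
      then show "(\<integral>\<^sup>+\<omega>. ennreal (((init r x' + Z' \<omega> + drift s x \<omega>) - (init r x' + Z' \<omega> + drift r x' \<omega>))\<^sup>2) \<partial>M) \<le> ennreal (K\<^sup>2 * T * A * q)"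
        by (simp add: emeasure_space_1)
    qed auto
    also have "\<dots> = ennreal (C * q)"
    proof -
      have "3 * ennreal a + 3 * ennreal b + 3 * ennreal c = ennreal (3 * a + 3 * b + 3 * c)" if "a \<ge> 0" "b \<ge> 0" "c \<ge> 0" for a b c
        using that by (simp add: ennreal_mult)
      then have "3 * ennreal (9 * C0\<^sup>2 * q) + 3 * ennreal (9 * K\<^sup>2 * A * q) + 3 * ennreal (K\<^sup>2 * T * A * q)
        = ennreal (3 * (9 * C0\<^sup>2 * q) + 3 * (9 * K\<^sup>2 * A * q) + 3 * (K\<^sup>2 * T * A * q))"
        using A q0 assms by simp
      also have "3 * (9 * C0\<^sup>2 * q) + 3 * (9 * K\<^sup>2 * A * q) + 3 * (K\<^sup>2 * T * A * q) = C * q"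
        by (simp add: C_def algebra_simps)
      finally show ?thesis .
    qed
    finally show ?thesis by (simp add: q_def d_def)
  qed
  with C show ?thesis by blast
qed

end

section \<open>Freezing the diffusion coefficient near the final time\<close>

text \<open>The cut is at \<open>d = \<epsilon> powr (3/8)\<close>. Closer points yield a small
  power of \<epsilon>; farther ones are paid for with \<open>d\<^sup>2\<close>, which is affordable
  since the kernel norm weighted by the squared distance gains a factor \<epsilon> and the price
  \<open>\<epsilon> powr (-3/4)\<close> stays below its inverse.\<close>

lemma quarter_power_split:
  fixes \<epsilon> d :: real
  assumes "0 < \<epsilon>" "\<epsilon> \<le> 1" "0 \<le> d" "d \<le> 2"
  shows "(\<epsilon> + d) powr (1/4) \<le> 2 * \<epsilon> powr (3/32) + 2 * d\<^sup>2 * \<epsilon> powr (-3/4)"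
proof (cases "d \<le> \<epsilon> powr (3/8)")
  case True
  have "\<epsilon> = \<epsilon> powr 1" using assms by simp
  also have "\<dots> \<le> \<epsilon> powr (3/8)" using assms by (intro powr_mono') auto
  finally have "\<epsilon> + d \<le> 2 * \<epsilon> powr (3/8)" using True by simp
  then have "(\<epsilon> + d) powr (1/4) \<le> (2 * \<epsilon> powr (3/8)) powr (1/4)" using assms by (intro powr_mono2) auto
  also have "\<dots> = 2 powr (1/4) * \<epsilon> powr (3/32)" by (simp add: powr_mult powr_powr)
  also have "\<dots> \<le> 2 powr 1 * \<epsilon> powr (3/32)" by (intro mult_right_mono powr_mono) auto
  finally have "(\<epsilon> + d) powr (1/4) \<le> 2 * \<epsilon> powr (3/32)" by simp
  moreover have "0 \<le> 2 * d\<^sup>2 * \<epsilon> powr (-3/4)" by simp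
  ultimately show ?thesis by linarith
next
  case False
  have "(\<epsilon> powr (3/8))\<^sup>2 \<le> d\<^sup>2" using False by (intro power_mono) auto
  then have "(\<epsilon> powr (3/8))\<^sup>2 * \<epsilon> powr (-3/4) \<le> d\<^sup>2 * \<epsilon> powr (-3/4)" by (rule mult_right_mono) simp
  moreover have "(\<epsilon> powr (3/8))\<^sup>2 * \<epsilon> powr (-3/4) = 1"
    using assms by (simp add: power2_eq_square powr_add[symmetric])
  ultimately have 1: "1 \<le> d\<^sup>2 * \<epsilon> powr (-3/4)" by simp
  have "(\<epsilon> + d) powr (1/4) \<le> 16 powr (1/4)" using assms by (intro powr_mono2) auto
  also have "(16 :: real) powr (1/4) = (2 powr 4) powr (1/4)" by simp
  also have "\<dots> = 2" unfolding powr_powr by simp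
  finally have "(\<epsilon> + d) powr (1/4) \<le> 2" .
  moreover have "0 \<le> \<epsilon> powr (3/32)" by simp
  ultimately show ?thesis using 1 by linarith
qed

text \<open>Up to a constant, \<open>lg h \<epsilon>\<close> is the square of the modulus of continuity of \<open>\<sigma>\<close> at any power of \<open>\<epsilon>\<close>.\<close>
definition lg :: "real \<Rightarrow> real \<Rightarrow> real" where "lg h \<epsilon> = (- ln \<epsilon>) powr (- 2 * (2 + h))"

lemma lg_nonneg: "lg h \<epsilon> \<ge> 0" by (simp add: lg_def)

text \<open>Powers beat powers of logarithms. The threshold \<open>1 / (32 * (2 + h))\<close> for
  \<open>ln x / x\<close> at \<open>x = - ln \<epsilon>\<close> is chosen to produce the exponent
  1/16 after multiplication by \<open>2 * (2 + h)\<close>.\<close>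

lemma power_le_lg:
  assumes "h > 0"
  shows "\<exists>\<epsilon>\<^sub>0>0. \<forall>\<epsilon>. 0 < \<epsilon> \<longrightarrow> \<epsilon> < \<epsilon>\<^sub>0 \<longrightarrow> \<epsilon> < 1 \<and> \<epsilon> powr (1/16) \<le> lg h \<epsilon>"
proof -
  have "((\<lambda>x::real. ln x / x) \<longlongrightarrow> 0) at_top" by (rule ln_x_over_x_tendsto_0)
  then have "eventually (\<lambda>x::real. ln x / x < 1 / (32 * (2 + h))) at_top"
    by (rule order_tendstoD) (use assms in simp)
  then obtain L0 where L0: "\<And>x. x \<ge> L0 \<Longrightarrow> ln x / x < 1 / (32 * (2 + h))"
    unfolding eventually_at_top_linorder by blast
  define L where "L = max L0 1"
  have "\<epsilon> < 1 \<and> \<epsilon> powr (1/16) \<le> lg h \<epsilon>" if "0 < \<epsilon>" "\<epsilon> < exp (- L)" for \<epsilon>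
  proof -
    define l where "l = - ln \<epsilon>"
    have "ln \<epsilon> < ln (exp (- L))" using that by (subst ln_less_cancel_iff) auto
    then have l: "l > L" by (simp add: l_def)
    then have l1: "l > 1" "l \<ge> L0" by (auto simp: L_def)
    have e: "\<epsilon> = exp (- l)" using that by (simp add: l_def)
    have "ln l / l * (32 * (2 + h)) < 1" using L0[OF l1(2)] assms by (simp add: field_simps)
    then have "2 * (2 + h) * ln l \<le> l / 16" using l1 by (simp add: field_simps)
    then have "- l / 16 \<le> - 2 * (2 + h) * ln l" by linarith
    then have "exp (- l / 16) \<le> exp (- 2 * (2 + h) * ln l)" by (subst exp_le_cancel_iff)
    moreover have "\<epsilon> powr (1/16) = exp (- l / 16)" unfolding e powr_def by simp
    moreover have "lg h \<epsilon> = exp (- 2 * (2 + h) * ln l)" unfolding lg_def l_def[symmetric] powr_def using l1 by simp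
    moreover have "\<epsilon> < 1" using l1 by (simp add: e)
    ultimately show ?thesis by simp
  qed
  then show ?thesis by (intro exI[of _ "exp (- L)"]) auto
qed

locale elliptic_spde_solution = spde_solution +
  fixes c\<^sub>0 h T :: real
  assumes c0: "c\<^sub>0 > 0" and \<sigma>_ge: "\<And>z. \<sigma> z \<ge> c\<^sub>0" and h: "h > 0" and T: "T > 0"
    and modulus: "\<And>y z. 0 < \<bar>y - z\<bar> \<Longrightarrow> \<bar>y - z\<bar> < 1 \<Longrightarrow> \<bar>\<sigma> y - \<sigma> z\<bar> \<le> \<bar>ln \<bar>y - z\<bar>\<bar> powr (- (2 + h))"
begin

text \<open>The cut is at \<open>\<epsilon> powr (1/64)\<close>. Below it the logarithm is at least
  \<open>- ln \<epsilon> / 64\<close>, so the modulus of continuity loses only a constant. Above it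
  boundedness of \<sigma> is compared with the square of the increment, as in Chebyshev's
  inequality; second moments of the increments of \<open>u\<close> are then all that enters.\<close>

lemma \<sigma>_increment_sq:
  assumes \<epsilon>: "0 < \<epsilon>" "\<epsilon> < 1"
  shows "(\<sigma> y - \<sigma> z)\<^sup>2 \<le> 64 powr (2 * (2 + h)) * lg h \<epsilon> + 4 * K\<^sup>2 * \<epsilon> powr (-1/32) * (y - z)\<^sup>2"
proof (cases "\<bar>y - z\<bar> \<le> \<epsilon> powr (1/64)")
  case True
  have l: "- ln \<epsilon> > 0" using \<epsilon> by simp
  have 2: "0 \<le> 4 * K\<^sup>2 * \<epsilon> powr (-1/32) * (y - z)\<^sup>2" by simp
  have "(\<sigma> y - \<sigma> z)\<^sup>2 \<le> 64 powr (2 * (2 + h)) * lg h \<epsilon>"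
  proof (cases "y = z")
    case False
    then have pos: "0 < \<bar>y - z\<bar>" by simp
    have lt1: "\<epsilon> powr (1/64) < 1" using powr_less_mono2[of "1/64" \<epsilon> 1] \<epsilon> by simp
    then have "\<bar>y - z\<bar> < 1" using True by simp
    have "ln \<bar>y - z\<bar> \<le> ln (\<epsilon> powr (1/64))" using pos True by (intro ln_mono) auto
    also have "\<dots> = ln \<epsilon> / 64" using \<epsilon> by (simp add: ln_powr)
    finally have ge: "(- ln \<epsilon>) / 64 \<le> \<bar>ln \<bar>y - z\<bar>\<bar>" using l by linarith
    have "\<bar>\<sigma> y - \<sigma> z\<bar> \<le> \<bar>ln \<bar>y - z\<bar>\<bar> powr (- (2 + h))" by (rule modulus[OF pos \<open>\<bar>y - z\<bar> < 1\<close>])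
    also have "\<dots> \<le> ((- ln \<epsilon>) / 64) powr (- (2 + h))" using ge l h by (intro powr_mono2') auto
    finally have "\<bar>\<sigma> y - \<sigma> z\<bar>\<^sup>2 \<le> (((- ln \<epsilon>) / 64) powr (- (2 + h)))\<^sup>2" by (intro power_mono) auto
    also have "\<dots> = ((- ln \<epsilon>) / 64) powr (- (2 * (2 + h)))"
      unfolding power2_eq_square powr_add[symmetric] by (rule arg_cong2[where f = "(powr)"]) auto
    also have "\<dots> = 64 powr (2 * (2 + h)) * lg h \<epsilon>"
    proof -
      define q where "q = 2 * (2 + h)"
      have "((- ln \<epsilon>) / 64) powr (- q) = (- ln \<epsilon>) powr (- q) / 64 powr (- q)" by (rule powr_divide)
      also have "\<dots> = (- ln \<epsilon>) powr (- q) / (1 / 64 powr q)" by (simp only: powr_minus_divide[of 64 q])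
      also have "\<dots> = 64 powr q * (- ln \<epsilon>) powr (- q)" by simp
      finally show ?thesis by (simp add: lg_def q_def)
    qed
    finally show ?thesis by simp
  qed (simp add: lg_nonneg)
  with 2 show ?thesis by linarith
next
  case False
  have "(\<epsilon> powr (1/64))\<^sup>2 \<le> \<bar>y - z\<bar>\<^sup>2" using False by (intro power_mono) auto
  then have "\<epsilon> powr (-1/32) * (\<epsilon> powr (1/64))\<^sup>2 \<le> \<epsilon> powr (-1/32) * (y - z)\<^sup>2" by (intro mult_left_mono) auto
  moreover have "\<epsilon> powr (-1/32) * (\<epsilon> powr (1/64))\<^sup>2 = 1"
    using \<epsilon> by (simp add: power2_eq_square powr_add[symmetric])
  ultimately have 1: "1 \<le> \<epsilon> powr (-1/32) * (y - z)\<^sup>2" by simp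
  have "\<bar>\<sigma> y - \<sigma> z\<bar> \<le> 2 * K" using \<sigma>_le[of y] \<sigma>_le[of z] by linarith
  then have "\<bar>\<sigma> y - \<sigma> z\<bar>\<^sup>2 \<le> (2 * K)\<^sup>2" by (intro power_mono) auto
  also have "\<dots> = 4 * K\<^sup>2 * 1" by (simp add: power_mult_distrib)
  also have "\<dots> \<le> 4 * K\<^sup>2 * (\<epsilon> powr (-1/32) * (y - z)\<^sup>2)" by (intro mult_left_mono 1) simp
  finally have "(\<sigma> y - \<sigma> z)\<^sup>2 \<le> 4 * K\<^sup>2 * \<epsilon> powr (-1/32) * (y - z)\<^sup>2" by (simp add: mult.assoc)
  moreover have "0 \<le> 64 powr (2 * (2 + h)) * lg h \<epsilon>" by (simp add: lg_nonneg)
  ultimately show ?thesis by linarith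
qed

definition frozen :: "real \<Rightarrow> real \<Rightarrow> 'a \<Rightarrow> real" where "frozen \<epsilon> x \<omega> = \<sigma> (u (T - \<epsilon>) x \<omega>)"

lemma frozen_measurable:
  assumes "\<epsilon> < T" "x \<in> {0..1}"
  shows "frozen \<epsilon> x \<in> borel_measurable (noise_sigma M W ({0..T - \<epsilon>} \<times> {0..1}))" "frozen \<epsilon> x \<in> borel_measurable M"
proof -
  have "u (T - \<epsilon>) x \<in> borel_measurable (noise_sigma M W ({0..T - \<epsilon>} \<times> {0..1}))"
    using adapted assms unfolding adapted_random_field_def noise_filtration_eq by auto
  from measurable_compose[OF this \<sigma>_measurable]
  show 1: "frozen \<epsilon> x \<in> borel_measurable (noise_sigma M W ({0..T - \<epsilon>} \<times> {0..1}))" unfolding frozen_def .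
  show "frozen \<epsilon> x \<in> borel_measurable M" by (rule noise_sigma_measurable_M[OF 1])
qed

text \<open>The loss \<open>\<epsilon> powr (-1/32)\<close> from the cut in \<sigma> is covered by
  both terms of \<open>quarter_power_split\<close>: 3/32 - 1/32 leaves 1/16, and -3/4 - 1/32 is 7/32
  - 1. The leftover positive powers are below \<open>lg h \<epsilon>\<close>; the factor
  \<open>d\<^sup>2 / \<epsilon>\<close> is kept for the integration in space.\<close>

lemma freezing_increment:
  "\<exists>C\<ge>0. \<forall>\<epsilon> s x y. 0 < \<epsilon> \<longrightarrow> \<epsilon> < 1 \<longrightarrow> \<epsilon> \<le> T/2 \<longrightarrow> \<epsilon> powr (1/16) \<le> lg h \<epsilon> \<longrightarrow> T - \<epsilon> < s \<longrightarrow> s < T \<longrightarrow> x \<in> {0..1} \<longrightarrow> y \<in> {0..1} \<longrightarrow>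
    (\<integral>\<^sup>+\<omega>. ennreal ((\<sigma> (u s y \<omega>) - frozen \<epsilon> x \<omega>)\<^sup>2) \<partial>M) \<le> ennreal (C * lg h \<epsilon> + C * (lg h \<epsilon> / \<epsilon>) * (cs 1 y - cs 1 x)\<^sup>2)"
proof -
  obtain C1 where C1: "C1 \<ge> 0" "\<And>r s x x'. T/2 \<le> r \<Longrightarrow> r \<le> s \<Longrightarrow> s \<le> r + 1 \<Longrightarrow> s \<le> T \<Longrightarrow> x \<in> {0..1} \<Longrightarrow> x' \<in> {0..1} \<Longrightarrow>
    (\<integral>\<^sup>+\<omega>. ennreal ((u s x \<omega> - u r x' \<omega>)\<^sup>2) \<partial>M) \<le> ennreal (C1 * (s - r + \<bar>cs 1 x - cs 1 x'\<bar>) powr (1/4))"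
    using solution_regularity[of "T/2" T] T by auto
  define C where "C = 64 powr (2 * (2 + h)) + 8 * K\<^sup>2 * C1"
  have C: "C \<ge> 0" using C1 by (simp add: C_def)
  have "(\<integral>\<^sup>+\<omega>. ennreal ((\<sigma> (u s y \<omega>) - frozen \<epsilon> x \<omega>)\<^sup>2) \<partial>M) \<le> ennreal (C * lg h \<epsilon> + C * (lg h \<epsilon> / \<epsilon>) * (cs 1 y - cs 1 x)\<^sup>2)"
    if \<epsilon>: "0 < \<epsilon>" "\<epsilon> < 1" "\<epsilon> \<le> T/2" "\<epsilon> powr (1/16) \<le> lg h \<epsilon>" and s: "T - \<epsilon> < s" "s < T" and xy: "x \<in> {0..1}" "y \<in> {0..1}" for \<epsilon> s x y
  proof -
    define d where "d = \<bar>cs 1 y - cs 1 x\<bar>"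
    have d: "0 \<le> d" "d \<le> 2" using abs_cs_le[of 1 y] abs_cs_le[of 1 x] by (auto simp: d_def)
    have pos: "0 < s" "0 < T - \<epsilon>" using s \<epsilon> T by auto
    note [measurable] = u_measurable[OF pos(1) xy(2)] u_measurable[OF pos(2) xy(1)]
    define A where "A = 64 powr (2 * (2 + h)) * lg h \<epsilon>"
    define B where "B = 4 * K\<^sup>2 * \<epsilon> powr (-1/32)"
    have A: "A \<ge> 0" and B: "B \<ge> 0" by (auto simp: A_def B_def lg_nonneg)
    have "(\<integral>\<^sup>+\<omega>. ennreal ((\<sigma> (u s y \<omega>) - frozen \<epsilon> x \<omega>)\<^sup>2) \<partial>M) \<le> (\<integral>\<^sup>+\<omega>. ennreal A + ennreal B * ennreal ((u s y \<omega> - u (T - \<epsilon>) x \<omega>)\<^sup>2) \<partial>M)"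
    proof (rule nn_integral_mono)
      fix \<omega>
      have "(\<sigma> (u s y \<omega>) - frozen \<epsilon> x \<omega>)\<^sup>2 \<le> A + B * (u s y \<omega> - u (T - \<epsilon>) x \<omega>)\<^sup>2"
        unfolding A_def B_def frozen_def by (rule \<sigma>_increment_sq[OF \<epsilon>(1,2)])
      then have "ennreal ((\<sigma> (u s y \<omega>) - frozen \<epsilon> x \<omega>)\<^sup>2) \<le> ennreal (A + B * (u s y \<omega> - u (T - \<epsilon>) x \<omega>)\<^sup>2)" by (rule ennreal_leI)
      then show "ennreal ((\<sigma> (u s y \<omega>) - frozen \<epsilon> x \<omega>)\<^sup>2) \<le> ennreal A + ennreal B * ennreal ((u s y \<omega> - u (T - \<epsilon>) x \<omega>)\<^sup>2)"
        using A B by (simp add: ennreal_mult)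
    qed
    also have "\<dots> = ennreal A + ennreal B * (\<integral>\<^sup>+\<omega>. ennreal ((u s y \<omega> - u (T - \<epsilon>) x \<omega>)\<^sup>2) \<partial>M)"
      by (subst nn_integral_add) (auto simp: nn_integral_cmult emeasure_space_1)
    also have "(\<integral>\<^sup>+\<omega>. ennreal ((u s y \<omega> - u (T - \<epsilon>) x \<omega>)\<^sup>2) \<partial>M) \<le> ennreal (C1 * (s - (T - \<epsilon>) + d) powr (1/4))"
      unfolding d_def by (rule C1(2)) (use s \<epsilon> xy in auto)
    also have "ennreal A + ennreal B * ennreal (C1 * (s - (T - \<epsilon>) + d) powr (1/4)) = ennreal (A + B * (C1 * (s - (T - \<epsilon>) + d) powr (1/4)))"
      using A B C1(1) by (simp add: ennreal_mult)
    also have "\<dots> \<le> ennreal (C * lg h \<epsilon> + C * (lg h \<epsilon> / \<epsilon>) * (cs 1 y - cs 1 x)\<^sup>2)"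
    proof (rule ennreal_leI)
      have "(s - (T - \<epsilon>) + d) powr (1/4) \<le> (\<epsilon> + d) powr (1/4)" using s d by (intro powr_mono2) auto
      also have "\<dots> \<le> 2 * \<epsilon> powr (3/32) + 2 * d\<^sup>2 * \<epsilon> powr (-3/4)" using \<epsilon> d by (intro quarter_power_split) auto
      finally have "B * (C1 * (s - (T - \<epsilon>) + d) powr (1/4)) \<le> B * (C1 * (2 * \<epsilon> powr (3/32) + 2 * d\<^sup>2 * \<epsilon> powr (-3/4)))"
        using B C1(1) by (intro mult_left_mono)
      also have "\<dots> = 8 * K\<^sup>2 * C1 * (\<epsilon> powr (-1/32) * \<epsilon> powr (3/32) + d\<^sup>2 * (\<epsilon> powr (-1/32) * \<epsilon> powr (-3/4)))"
        by (simp add: B_def algebra_simps)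
      also have "\<epsilon> powr (-1/32) * \<epsilon> powr (3/32) = \<epsilon> powr (1/16)" by (simp add: powr_add[symmetric])
      also have "\<epsilon> powr (-1/32) * \<epsilon> powr (-3/4) = \<epsilon> powr (7/32) * \<epsilon> powr (-1)"
        unfolding powr_add[symmetric] by (rule arg_cong[where f = "(powr) \<epsilon>"]) simp
      also have "8 * K\<^sup>2 * C1 * (\<epsilon> powr (1/16) + d\<^sup>2 * (\<epsilon> powr (7/32) * \<epsilon> powr (-1))) \<le> 8 * K\<^sup>2 * C1 * (lg h \<epsilon> + d\<^sup>2 * (lg h \<epsilon> * \<epsilon> powr (-1)))"
      proof -
        have "\<epsilon> powr (7/32) \<le> \<epsilon> powr (1/16)" using \<epsilon> by (intro powr_mono') auto
        then have "\<epsilon> powr (7/32) \<le> lg h \<epsilon>" using \<epsilon>(4) by linarith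
        then show ?thesis using \<epsilon>(4) C1(1) by (intro mult_left_mono add_mono mult_right_mono) auto
      qed
      also have "\<epsilon> powr (-1) = 1 / \<epsilon>" using \<epsilon> by (simp add: powr_minus_divide)
      finally have "A + B * (C1 * (s - (T - \<epsilon>) + d) powr (1/4)) \<le> A + 8 * K\<^sup>2 * C1 * (lg h \<epsilon> + d\<^sup>2 * (lg h \<epsilon> * (1 / \<epsilon>)))" by simp
      also have "\<dots> = C * lg h \<epsilon> + 8 * K\<^sup>2 * C1 * (lg h \<epsilon> / \<epsilon>) * d\<^sup>2"
        by (simp add: A_def C_def algebra_simps)
      also have "\<dots> \<le> C * lg h \<epsilon> + C * (lg h \<epsilon> / \<epsilon>) * d\<^sup>2"
        using \<epsilon> lg_nonneg[of h \<epsilon>] by (intro add_left_mono mult_right_mono) (auto simp: C_def)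
      finally show "A + B * (C1 * (s - (T - \<epsilon>) + d) powr (1/4)) \<le> C * lg h \<epsilon> + C * (lg h \<epsilon> / \<epsilon>) * (cs 1 y - cs 1 x)\<^sup>2"
        by (simp add: d_def)
    qed
    finally show ?thesis by (simp add: add_left_mono mult_left_mono)
  qed
  with C show ?thesis by blast
qed

definition late :: "real \<Rightarrow> real \<times> real \<Rightarrow> real" where "late \<epsilon> p = indicator ({T - \<epsilon><..} \<times> UNIV) p"

lemma late_measurable [measurable]: "late \<epsilon> \<in> borel_measurable borel"
  unfolding late_def by measurable

lemma late_kap_norm:
  assumes "0 < \<epsilon>" "\<epsilon> \<le> 1" "\<epsilon> \<le> T"
  shows "(\<integral>\<^sup>+p. ennreal ((kap T x p * late \<epsilon> p)\<^sup>2) \<partial>lborel) \<le> ennreal (10 * sqrt \<epsilon>)"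
    and "(\<integral>\<^sup>+p. ennreal (((cs 1 (snd p) - cs 1 x) * (kap T x p * late \<epsilon> p))\<^sup>2) \<partial>lborel) \<le> ennreal (90 * pi ^ 4 * \<epsilon> * sqrt \<epsilon>)"
proof -
  have e: "ennreal ((a * (b * late \<epsilon> p))\<^sup>2) = ennreal ((a * b)\<^sup>2) * indicator ({T - \<epsilon><..} \<times> UNIV) p" for a b p
    by (simp add: late_def indicator_def)
  have "(\<integral>\<^sup>+p. ennreal ((1 * (kap T x p * late \<epsilon> p))\<^sup>2) \<partial>lborel) = kernel_norm \<epsilon> (\<lambda>\<theta> y. 1 * hk \<theta> x y)"
    unfolding e by (rule kap_norm_weighted) (use assms in auto)
  also have "\<dots> \<le> ennreal (2 * (\<epsilon> + 4 * sqrt \<epsilon>))" using kernel_norm_hk_le[OF assms(1), of x] by simp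
  also have "\<dots> \<le> ennreal (2 * (sqrt \<epsilon> + 4 * sqrt \<epsilon>))"
    using assms by (intro ennreal_leI mult_left_mono add_right_mono le_sqrt_of_le_1) auto
  finally show "(\<integral>\<^sup>+p. ennreal ((kap T x p * late \<epsilon> p)\<^sup>2) \<partial>lborel) \<le> ennreal (10 * sqrt \<epsilon>)" by simp
  have "(\<integral>\<^sup>+p. ennreal (((cs 1 (snd p) - cs 1 x) * (kap T x p * late \<epsilon> p))\<^sup>2) \<partial>lborel) = kernel_norm \<epsilon> (\<lambda>\<theta> y. (cs 1 y - cs 1 x) * hk \<theta> x y)"
    unfolding e by (rule kap_norm_weighted[where w = "\<lambda>y. cs 1 y - cs 1 x"]) (use assms in auto)
  also have "\<dots> \<le> ennreal (90 * pi ^ 4 * \<epsilon> * sqrt \<epsilon>)" by (rule kernel_norm_weighted_hk_le[OF assms(1,2)])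
  finally show "(\<integral>\<^sup>+p. ennreal (((cs 1 (snd p) - cs 1 x) * (kap T x p * late \<epsilon> p))\<^sup>2) \<partial>lborel) \<le> ennreal (90 * pi ^ 4 * \<epsilon> * sqrt \<epsilon>)" .
qed

lemma late_M [measurable]: "(\<lambda>z. late \<epsilon> (fst z)) \<in> borel_measurable (lborel \<Otimes>\<^sub>M M)"
  by (rule measurable_compose[OF measurable_fst]) simp

text \<open>The second moment of the coefficient error is integrated against the squared kernel. Its
  constant part meets the norm of order \<open>sqrt \<epsilon>\<close>, its part with the factor
  \<open>1 / \<epsilon>\<close> meets the weighted norm of order
  \<open>\<epsilon> * sqrt \<epsilon>\<close>, and both end up at the same size.\<close>

lemma freezing_error:
  "\<exists>C\<ge>0. \<forall>\<epsilon> x. 0 < \<epsilon> \<longrightarrow> \<epsilon> < 1 \<longrightarrow> \<epsilon> \<le> T/2 \<longrightarrow> \<epsilon> powr (1/16) \<le> lg h \<epsilon> \<longrightarrow> x \<in> {0..1} \<longrightarrow>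
    (\<integral>\<^sup>+z. ennreal ((SF T x z * late \<epsilon> (fst z) - frozen \<epsilon> x (snd z) * (kap T x (fst z) * late \<epsilon> (fst z)))\<^sup>2) \<partial>(lborel \<Otimes>\<^sub>M M))
      \<le> ennreal (C * (sqrt \<epsilon> * lg h \<epsilon>))"
proof -
  obtain C where C: "C \<ge> 0" and inc: "\<And>\<epsilon> s x y. 0 < \<epsilon> \<Longrightarrow> \<epsilon> < 1 \<Longrightarrow> \<epsilon> \<le> T/2 \<Longrightarrow> \<epsilon> powr (1/16) \<le> lg h \<epsilon> \<Longrightarrow> T - \<epsilon> < s \<Longrightarrow> s < T \<Longrightarrow> x \<in> {0..1} \<Longrightarrow> y \<in> {0..1} \<Longrightarrow>
    (\<integral>\<^sup>+\<omega>. ennreal ((\<sigma> (u s y \<omega>) - frozen \<epsilon> x \<omega>)\<^sup>2) \<partial>M) \<le> ennreal (C * lg h \<epsilon> + C * (lg h \<epsilon> / \<epsilon>) * (cs 1 y - cs 1 x)\<^sup>2)"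
    using freezing_increment by blast
  define C' where "C' = C * 10 + C * (90 * pi ^ 4)"
  have "(\<integral>\<^sup>+z. ennreal ((SF T x z * late \<epsilon> (fst z) - frozen \<epsilon> x (snd z) * (kap T x (fst z) * late \<epsilon> (fst z)))\<^sup>2) \<partial>(lborel \<Otimes>\<^sub>M M))
      \<le> ennreal (C' * (sqrt \<epsilon> * lg h \<epsilon>))"
    if \<epsilon>: "0 < \<epsilon>" "\<epsilon> < 1" "\<epsilon> \<le> T/2" "\<epsilon> powr (1/16) \<le> lg h \<epsilon>" and x: "x \<in> {0..1}" for \<epsilon> x
  proof -
    have \<epsilon>T: "\<epsilon> < T" "\<epsilon> \<le> T" "\<epsilon> \<le> 1" using \<epsilon> T by auto
    note [measurable] = frozen_measurable(2)[OF \<epsilon>T(1) x]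
    define k where "k p = kap T x p * late \<epsilon> p" for p
    have [measurable]: "k \<in> borel_measurable borel" unfolding k_def by measurable
    define g where "g z = ennreal ((SF T x z * late \<epsilon> (fst z) - frozen \<epsilon> x (snd z) * (kap T x (fst z) * late \<epsilon> (fst z)))\<^sup>2)" for z
    have gm: "g \<in> borel_measurable (lborel \<Otimes>\<^sub>M M)" unfolding g_def by measurable
    have ge: "g (p, \<omega>) = ennreal ((k p)\<^sup>2) * ennreal ((\<sigma> (uu (p, \<omega>)) - frozen \<epsilon> x \<omega>)\<^sup>2)" for p \<omega>
    proof -
      have "SF T x (p, \<omega>) * late \<epsilon> p - frozen \<epsilon> x \<omega> * (kap T x p * late \<epsilon> p) = k p * (\<sigma> (uu (p, \<omega>)) - frozen \<epsilon> x \<omega>)"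
        unfolding SF_def k_def by (simp add: algebra_simps)
      then show ?thesis unfolding g_def by (simp add: power_mult_distrib ennreal_mult)
    qed
    have "(\<integral>\<^sup>+z. g z \<partial>(lborel \<Otimes>\<^sub>M M)) = (\<integral>\<^sup>+p. \<integral>\<^sup>+\<omega>. g (p, \<omega>) \<partial>M \<partial>lborel)"
      by (rule nn_integral_fst[OF gm, symmetric])
    also have "\<dots> \<le> (\<integral>\<^sup>+p. ennreal (C * lg h \<epsilon>) * ennreal ((k p)\<^sup>2) + ennreal (C * (lg h \<epsilon> / \<epsilon>)) * ennreal (((cs 1 (snd p) - cs 1 x) * k p)\<^sup>2) \<partial>lborel)"
    proof (rule nn_integral_mono)
      fix p :: "real \<times> real"
      have l0: "0 \<le> C * lg h \<epsilon>" "0 \<le> C * (lg h \<epsilon> / \<epsilon>)" using C \<epsilon> lg_nonneg[of h \<epsilon>] by auto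
      show "(\<integral>\<^sup>+\<omega>. g (p, \<omega>) \<partial>M) \<le> ennreal (C * lg h \<epsilon>) * ennreal ((k p)\<^sup>2) + ennreal (C * (lg h \<epsilon> / \<epsilon>)) * ennreal (((cs 1 (snd p) - cs 1 x) * k p)\<^sup>2)"
      proof (cases "p \<in> {T - \<epsilon><..<T} \<times> {0..1}")
        case True
        then obtain s y where p: "p = (s, y)" "T - \<epsilon> < s" "s < T" "y \<in> {0..1}" by (cases p) auto
        have s0: "s > 0" using p \<epsilon>T by simp
        have [measurable]: "u s y \<in> borel_measurable M" by (rule u_measurable[OF s0 p(4)])
        have "(\<integral>\<^sup>+\<omega>. g (p, \<omega>) \<partial>M) = (\<integral>\<^sup>+\<omega>. ennreal ((k p)\<^sup>2) * ennreal ((\<sigma> (u s y \<omega>) - frozen \<epsilon> x \<omega>)\<^sup>2) \<partial>M)"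
          unfolding ge p(1) uu_eq[OF s0 p(4)] ..
        also have "\<dots> = ennreal ((k p)\<^sup>2) * (\<integral>\<^sup>+\<omega>. ennreal ((\<sigma> (u s y \<omega>) - frozen \<epsilon> x \<omega>)\<^sup>2) \<partial>M)"
          by (rule nn_integral_cmult) measurable
        also have "\<dots> \<le> ennreal ((k p)\<^sup>2) * ennreal (C * lg h \<epsilon> + C * (lg h \<epsilon> / \<epsilon>) * (cs 1 y - cs 1 x)\<^sup>2)"
          by (intro mult_left_mono inc \<epsilon> p x) simp
        also have "\<dots> = ennreal ((k p)\<^sup>2 * (C * lg h \<epsilon> + C * (lg h \<epsilon> / \<epsilon>) * (cs 1 y - cs 1 x)\<^sup>2))"
          by (rule ennreal_mult[symmetric]) (intro zero_le_power2 add_nonneg_nonneg mult_nonneg_nonneg[OF l0(2)] l0(1))+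
        also have "\<dots> = ennreal (C * lg h \<epsilon> * (k p)\<^sup>2 + C * (lg h \<epsilon> / \<epsilon>) * ((cs 1 (snd p) - cs 1 x) * k p)\<^sup>2)"
          by (rule arg_cong[where f = ennreal]) (simp only: p(1) snd_conv power_mult_distrib distrib_left mult_ac)
        also have "\<dots> = ennreal (C * lg h \<epsilon>) * ennreal ((k p)\<^sup>2) + ennreal (C * (lg h \<epsilon> / \<epsilon>)) * ennreal (((cs 1 (snd p) - cs 1 x) * k p)\<^sup>2)"
          using l0 by (subst ennreal_plus) (auto simp only: ennreal_mult zero_le_power2 mult_nonneg_nonneg)
        finally show ?thesis .
      next
        case False
        then have "k p = 0" by (auto simp: k_def late_def kap_def indicator_def)
        then show ?thesis by (simp add: ge)
      qed
    qed
    also have "\<dots> = ennreal (C * lg h \<epsilon>) * (\<integral>\<^sup>+p. ennreal ((k p)\<^sup>2) \<partial>lborel) + ennreal (C * (lg h \<epsilon> / \<epsilon>)) * (\<integral>\<^sup>+p. ennreal (((cs 1 (snd p) - cs 1 x) * k p)\<^sup>2) \<partial>lborel)"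
      by (subst nn_integral_add) (auto simp: nn_integral_cmult)
    also have "\<dots> \<le> ennreal (C * lg h \<epsilon>) * ennreal (10 * sqrt \<epsilon>) + ennreal (C * (lg h \<epsilon> / \<epsilon>)) * ennreal (90 * pi ^ 4 * \<epsilon> * sqrt \<epsilon>)"
      unfolding k_def using \<epsilon>T \<epsilon> by (intro add_mono mult_left_mono late_kap_norm) auto
    also have "\<dots> = ennreal (C' * (sqrt \<epsilon> * lg h \<epsilon>))"
    proof -
      have l0: "0 \<le> C * lg h \<epsilon>" "0 \<le> C * (lg h \<epsilon> / \<epsilon>)" using C \<epsilon> lg_nonneg[of h \<epsilon>] by auto
      have "C * lg h \<epsilon> * (10 * sqrt \<epsilon>) + C * (lg h \<epsilon> / \<epsilon>) * (90 * pi ^ 4 * \<epsilon> * sqrt \<epsilon>) = C' * (sqrt \<epsilon> * lg h \<epsilon>)"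
        using \<epsilon> by (simp add: C'_def field_simps)
      moreover have "0 \<le> C * lg h \<epsilon> * (10 * sqrt \<epsilon>)" "0 \<le> C * (lg h \<epsilon> / \<epsilon>) * (90 * pi ^ 4 * \<epsilon> * sqrt \<epsilon>)"
        using \<epsilon> by (intro mult_nonneg_nonneg[OF l0(1)] mult_nonneg_nonneg[OF l0(2)]; simp)+
      moreover have "ennreal (C * lg h \<epsilon>) * ennreal (10 * sqrt \<epsilon>) = ennreal (C * lg h \<epsilon> * (10 * sqrt \<epsilon>))"
        using l0 \<epsilon> by (intro ennreal_mult[symmetric]) auto
      moreover have "ennreal (C * (lg h \<epsilon> / \<epsilon>)) * ennreal (90 * pi ^ 4 * \<epsilon> * sqrt \<epsilon>) = ennreal (C * (lg h \<epsilon> / \<epsilon>) * (90 * pi ^ 4 * \<epsilon> * sqrt \<epsilon>))"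
        using l0 \<epsilon> by (intro ennreal_mult[symmetric]) auto
      ultimately show ?thesis by (simp only: ennreal_plus[symmetric])
    qed
    finally show ?thesis unfolding g_def .
  qed
  moreover have "C' \<ge> 0" using C by (simp add: C'_def)
  ultimately show ?thesis by blast
qed

end

section \<open>Simple kernels, Wiener integrals and past versions\<close>

text \<open>The bound by \<open>2 * \<bar>f p\<bar>\<close> preserves the zeros of \<open>f\<close>,
  so a support condition is inherited, and provides the majorant 9 f^2 for dominated
  convergence.\<close>

lemma L2_simple_approximation:
  fixes f :: "'a \<Rightarrow> real"
  assumes f [measurable]: "f \<in> borel_measurable N" and fin: "(\<integral>\<^sup>+p. ennreal ((f p)\<^sup>2) \<partial>N) < \<infinity>" and "e > 0"
  shows "\<exists>g. simple_function N g \<and> (\<forall>p\<in>space N. \<bar>g p\<bar> \<le> 2 * \<bar>f p\<bar>) \<and> (\<integral>\<^sup>+p. ennreal ((f p - g p)\<^sup>2) \<partial>N) \<le> ennreal e"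
proof -
  obtain F where F: "\<And>i. simple_function N (F i)" "\<And>p. p \<in> space N \<Longrightarrow> (\<lambda>i. F i p) \<longlonglongrightarrow> f p"
    and dist: "\<And>i p. p \<in> space N \<Longrightarrow> dist (F i p) 0 \<le> 2 * dist (f p) 0"
    using borel_measurable_implies_sequence_metric[OF f, of 0] by blast
  have le: "\<bar>F i p\<bar> \<le> 2 * \<bar>f p\<bar>" if "p \<in> space N" for i p using dist[OF that, of i] by simp
  have Fm [measurable]: "F i \<in> borel_measurable N" for i by (rule borel_measurable_simple_function[OF F(1)])
  have "(\<lambda>i. \<integral>\<^sup>+p. ennreal ((f p - F i p)\<^sup>2) \<partial>N) \<longlonglongrightarrow> (\<integral>\<^sup>+p. 0 \<partial>N)"
  proof (rule nn_integral_dominated_convergence)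
    show "AE p in N. ennreal ((f p - F i p)\<^sup>2) \<le> 9 * ennreal ((f p)\<^sup>2)" for i
    proof (rule AE_I2)
      fix p assume "p \<in> space N"
      then have "\<bar>f p - F i p\<bar> \<le> 3 * \<bar>f p\<bar>" using le[of p i] by linarith
      then have "\<bar>f p - F i p\<bar>\<^sup>2 \<le> (3 * \<bar>f p\<bar>)\<^sup>2" by (rule power_mono) simp
      then have "(f p - F i p)\<^sup>2 \<le> 9 * (f p)\<^sup>2" by (simp add: power_mult_distrib)
      then have "ennreal ((f p - F i p)\<^sup>2) \<le> ennreal (9 * (f p)\<^sup>2)" by (rule ennreal_leI)
      then show "ennreal ((f p - F i p)\<^sup>2) \<le> 9 * ennreal ((f p)\<^sup>2)" by (simp add: ennreal_mult)
    qed
    show "(\<integral>\<^sup>+p. 9 * ennreal ((f p)\<^sup>2) \<partial>N) < \<infinity>"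
      using fin by (subst nn_integral_cmult) (auto simp: ennreal_mult_less_top)
    show "AE p in N. (\<lambda>i. ennreal ((f p - F i p)\<^sup>2)) \<longlonglongrightarrow> 0"
    proof (rule AE_I2)
      fix p assume "p \<in> space N"
      then have "(\<lambda>i. (f p - F i p)\<^sup>2) \<longlonglongrightarrow> (f p - f p)\<^sup>2" by (intro tendsto_intros F(2))
      then have "(\<lambda>i. ennreal ((f p - F i p)\<^sup>2)) \<longlonglongrightarrow> ennreal ((f p - f p)\<^sup>2)" by (rule tendsto_ennrealI)
      then show "(\<lambda>i. ennreal ((f p - F i p)\<^sup>2)) \<longlonglongrightarrow> 0" by simp
    qed
  qed measurable
  then have "eventually (\<lambda>i. (\<integral>\<^sup>+p. ennreal ((f p - F i p)\<^sup>2) \<partial>N) < ennreal e) sequentially"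
    by (rule order_tendstoD) (use \<open>e > 0\<close> in simp)
  then obtain i where "(\<integral>\<^sup>+p. ennreal ((f p - F i p)\<^sup>2) \<partial>N) < ennreal e"
    unfolding eventually_sequentially by blast
  then show ?thesis using F(1)[of i] le by (intro exI[of _ "F i"]) (simp add: less_imp_le)
qed

text \<open>The inequality \<open>\<bar>z\<bar> \<le> (z\<^sup>2 / a + a) / 2\<close> yields
  integrability and the bound at one stroke.\<close>

lemma (in prob_space) L1_le_L2:
  assumes [measurable]: "Y \<in> borel_measurable M" and "a > 0" and le: "(\<integral>\<^sup>+\<omega>. ennreal ((Y \<omega>)\<^sup>2) \<partial>M) \<le> ennreal (a\<^sup>2)"
  shows "integrable M Y" and "expectation (\<lambda>\<omega>. \<bar>Y \<omega>\<bar>) \<le> a"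
proof -
  have i2: "integrable M (\<lambda>\<omega>. (Y \<omega>)\<^sup>2)"
    using le by (intro integrableI_bounded) (auto intro: le_less_trans)
  have "ennreal (expectation (\<lambda>\<omega>. (Y \<omega>)\<^sup>2)) \<le> ennreal (a\<^sup>2)"
    using le by (subst nn_integral_eq_integral[symmetric]) (use i2 in auto)
  then have e2: "expectation (\<lambda>\<omega>. (Y \<omega>)\<^sup>2) \<le> a\<^sup>2" by (simp add: ennreal_le_iff)
  have pw: "\<bar>z\<bar> \<le> (z\<^sup>2 / a + a) / 2" for z :: real
    using zero_le_power2[of "\<bar>z\<bar> - a"] \<open>a > 0\<close> by (simp add: power2_eq_square field_simps)
  have ib: "integrable M (\<lambda>\<omega>. ((Y \<omega>)\<^sup>2 / a + a) / 2)" using i2 by simp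
  show iY: "integrable M Y"
  proof (rule Bochner_Integration.integrable_bound[OF ib])
    show "AE \<omega> in M. norm (Y \<omega>) \<le> norm (((Y \<omega>)\<^sup>2 / a + a) / 2)"
    proof (rule AE_I2)
      fix \<omega>
      show "norm (Y \<omega>) \<le> norm (((Y \<omega>)\<^sup>2 / a + a) / 2)" using pw[of "Y \<omega>"] unfolding real_norm_def by linarith
    qed
  qed measurable
  have "expectation (\<lambda>\<omega>. \<bar>Y \<omega>\<bar>) \<le> expectation (\<lambda>\<omega>. ((Y \<omega>)\<^sup>2 / a + a) / 2)"
    using iY ib pw by (intro integral_mono) auto
  also have "\<dots> = (expectation (\<lambda>\<omega>. (Y \<omega>)\<^sup>2) / a + a) / 2"
    using i2 by (simp add: prob_space)
  also have "\<dots> \<le> (a\<^sup>2 / a + a) / 2" using e2 \<open>a > 0\<close> by (intro divide_right_mono add_right_mono) auto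
  also have "\<dots> = a" using \<open>a > 0\<close> by (simp add: power2_eq_square)
  finally show "expectation (\<lambda>\<omega>. \<bar>Y \<omega>\<bar>) \<le> a" .
qed

context noise_space
begin

text \<open>The Wiener integral of \<open>g\<close>, formed from its finitely many level sets. The
  value 0 is removed because its level set has infinite measure and is no noise set.\<close>

lemma simple_function_noise:
  fixes g :: "real \<times> real \<Rightarrow> real"
  assumes g: "simple_function lborel g" and D: "D \<in> noise_sets" "\<And>p. p \<notin> D \<Longrightarrow> g p = 0"
  defines "J \<equiv> range g - {0}" and "A \<equiv> \<lambda>c. g -` {c}"
  shows "finite J" and "\<And>c. c \<in> J \<Longrightarrow> A c \<in> noise_sets \<and> A c \<subseteq> D"
    and "\<And>p. (\<Sum>c\<in>J. c * indicator (A c) p) = g p"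
    and "\<exists>v\<ge>0. centered_gaussian M (\<lambda>\<omega>. \<Sum>c\<in>J. c * W (A c) \<omega>) v \<and> ennreal v = (\<integral>\<^sup>+p. ennreal ((g p)\<^sup>2) \<partial>lborel)"
proof -
  show J: "finite J" using g by (simp add: J_def simple_function_def)
  show A: "A c \<in> noise_sets \<and> A c \<subseteq> D" if "c \<in> J" for c
  proof -
    have "A c \<subseteq> D" using that D(2) by (auto simp: A_def J_def)
    moreover have "A c \<in> sets borel" using g that by (auto simp: simple_function_def A_def J_def)
    ultimately show ?thesis using noise_sets_subset[OF D(1)] by blast
  qed
  show gs: "(\<Sum>c\<in>J. c * indicator (A c) p) = g p" for p
  proof -
    have "(\<Sum>c\<in>J. c * indicator (A c) p) = (\<Sum>c\<in>J. if c = g p then c else 0)"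
      by (rule sum.cong) (auto simp: A_def indicator_def)
    also have "\<dots> = g p" using J by (auto simp: sum.delta' J_def)
    finally show ?thesis .
  qed
  define v where "v = (\<Sum>i\<in>J. \<Sum>j\<in>J. i * j * measure lborel (A i \<inter> A j))"
  have cg: "centered_gaussian M (\<lambda>\<omega>. \<Sum>c\<in>J. c * W (A c) \<omega>) v"
    unfolding v_def by (rule gaussian_sum[OF J]) (use A in blast)
  have AI: "A i \<inter> A j \<in> noise_sets" if "i \<in> J" "j \<in> J" for i j
    using A[OF that(1)] A[OF that(2)] noise_sets_measurable noise_sets_Int by blast
  have sq: "(g p)\<^sup>2 = (\<Sum>i\<in>J. \<Sum>j\<in>J. i * j * indicator (A i \<inter> A j) p)" for p
    unfolding gs[symmetric] power2_eq_square sum_product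
    by (intro sum.cong refl) (simp add: indicator_inter_arith mult_ac)
  have ig: "integrable lborel (\<lambda>p. (g p)\<^sup>2)"
    unfolding sq by (intro Bochner_Integration.integrable_sum integrable_mult_right integrable_indicator_noise AI)
  have "(LINT p|lborel. (g p)\<^sup>2) = v"
    unfolding sq v_def
    by (subst Bochner_Integration.integral_sum, force intro!: Bochner_Integration.integrable_sum integrable_mult_right integrable_indicator_noise AI)
       (intro sum.cong refl, subst Bochner_Integration.integral_sum, auto intro!: integrable_mult_right integrable_indicator_noise AI)
  moreover have "(\<integral>\<^sup>+p. ennreal ((g p)\<^sup>2) \<partial>lborel) = ennreal (LINT p|lborel. (g p)\<^sup>2)"
    by (rule nn_integral_eq_integral[OF ig]) simp
  moreover have "(LINT p|lborel. (g p)\<^sup>2) \<ge> 0" by (rule Bochner_Integration.integral_nonneg) simp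
  ultimately show "\<exists>v\<ge>0. centered_gaussian M (\<lambda>\<omega>. \<Sum>c\<in>J. c * W (A c) \<omega>) v \<and> ennreal v = (\<integral>\<^sup>+p. ennreal ((g p)\<^sup>2) \<partial>lborel)"
    using cg by (intro exI[of _ v]) simp
qed

lemma W_empty: "AE \<omega> in M. W {} \<omega> = 0"
proof -
  have "{} \<in> noise_sets" by (simp add: noise_sets_def)
  from W_split[OF this, of "{}"] show ?thesis by simp
qed

text \<open>The conditional expectation replaces the past integral because adaptedness alone, without
  progressive measurability, does not make a Lebesgue integral over the past adapted.\<close>
lemma adapted_integral_version:
  fixes k :: "real \<times> real \<Rightarrow> real" and w :: "(real \<times> real) \<times> 'a \<Rightarrow> real"
  assumes k: "integrable lborel k" and w [measurable]: "w \<in> borel_measurable (lborel \<Otimes>\<^sub>M M)"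
    and wB: "\<And>z. \<bar>w z\<bar> \<le> B"
    and adapted: "\<And>p. k p \<noteq> 0 \<Longrightarrow> (\<lambda>\<omega>. w (p, \<omega>)) \<in> borel_measurable (noise_sigma M W S)"
  defines "D \<equiv> \<lambda>\<omega>. LINT p|lborel. k p * w (p, \<omega>)"
  shows "\<exists>D'\<in>borel_measurable (noise_sigma M W S). AE \<omega> in M. D \<omega> = D' \<omega>"
proof -
  define F where "F = noise_sigma M W S"
  interpret F: sigma_finite_subalgebra M F
    unfolding F_def
    by (intro finite_measure_subalgebra_is_sigma_finite finite_measure_subalgebra.intro
        finite_measure_subalgebra_axioms.intro noise_sigma_subalgebra finite_measure_axioms)
  interpret L: pair_sigma_finite "lborel :: (real \<times> real) measure" M ..
  have km [measurable]: "k \<in> borel_measurable borel" using borel_measurable_integrable[OF k] by simp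
  have kM [measurable]: "(\<lambda>z. k (fst z)) \<in> borel_measurable (lborel \<Otimes>\<^sub>M M)"
    by (rule measurable_compose[OF measurable_fst]) simp
  have ikw: "integrable (lborel \<Otimes>\<^sub>M M) (\<lambda>z. k (fst z) * w z * Q (snd z))"
    if Q: "integrable M Q" for Q
  proof (rule Bochner_Integration.integrable_bound)
    show "integrable (lborel \<Otimes>\<^sub>M M) (\<lambda>z. B * (k (fst z) * Q (snd z)))"
    proof (rule integrable_mult_right)
      have "integrable (lborel \<Otimes>\<^sub>M M) (\<lambda>(p, \<omega>). k p * Q \<omega>)"
      proof (rule L.Fubini_integrable)
        have [measurable]: "Q \<in> borel_measurable M" using Q by auto
        show "(\<lambda>(p, \<omega>). k p * Q \<omega>) \<in> borel_measurable (lborel \<Otimes>\<^sub>M M)" by measurable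
        show "integrable lborel (\<lambda>p. LINT \<omega>|M. norm (case (p, \<omega>) of (p, \<omega>) \<Rightarrow> k p * Q \<omega>))"
          using k by (simp add: abs_mult)
        show "AE p in lborel. integrable M (\<lambda>\<omega>. case (p, \<omega>) of (p, \<omega>) \<Rightarrow> k p * Q \<omega>)"
          using Q by simp
      qed
      then show "integrable (lborel \<Otimes>\<^sub>M M) (\<lambda>z. k (fst z) * Q (snd z))" by (simp add: case_prod_beta')
    qed
    have [measurable]: "Q \<in> borel_measurable M" using Q by auto
    show "(\<lambda>z. k (fst z) * w z * Q (snd z)) \<in> borel_measurable (lborel \<Otimes>\<^sub>M M)" by measurable
    show "AE z in lborel \<Otimes>\<^sub>M M. norm (k (fst z) * w z * Q (snd z)) \<le> norm (B * (k (fst z) * Q (snd z)))"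
    proof (rule AE_I2)
      fix z
      have "\<bar>w z\<bar> * (\<bar>k (fst z)\<bar> * \<bar>Q (snd z)\<bar>) \<le> \<bar>B\<bar> * (\<bar>k (fst z)\<bar> * \<bar>Q (snd z)\<bar>)"
        using wB[of z] by (intro mult_right_mono) auto
      then show "norm (k (fst z) * w z * Q (snd z)) \<le> norm (B * (k (fst z) * Q (snd z)))"
        by (simp add: abs_mult mult_ac)
    qed
  qed
  have fub: "(LINT p|lborel. k p * expectation (\<lambda>\<omega>. w (p, \<omega>) * Q \<omega>)) = expectation (\<lambda>\<omega>. D \<omega> * Q \<omega>)"
    if Q: "integrable M Q" for Q
  proof -
    have i: "integrable (lborel \<Otimes>\<^sub>M M) (\<lambda>(p, \<omega>). k p * w (p, \<omega>) * Q \<omega>)"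
      using ikw[OF Q] by (simp add: case_prod_beta')
    have "(LINT p|lborel. k p * expectation (\<lambda>\<omega>. w (p, \<omega>) * Q \<omega>)) = (LINT p|lborel. expectation (\<lambda>\<omega>. k p * w (p, \<omega>) * Q \<omega>))"
      by (simp add: mult.assoc)
    also have "\<dots> = expectation (\<lambda>\<omega>. LINT p|lborel. k p * w (p, \<omega>) * Q \<omega>)"
      by (rule L.Fubini_integral[OF i, symmetric])
    finally show ?thesis by (simp add: D_def)
  qed
  have Dm [measurable]: "D \<in> borel_measurable M"
  proof -
    have "(\<lambda>(\<omega>, p). k p * w (p, \<omega>)) \<in> borel_measurable (M \<Otimes>\<^sub>M lborel)" by measurable
    from lborel.borel_measurable_lebesgue_integral[OF this] show ?thesis unfolding D_def .
  qed
  define B' where "B' = B * (LINT p|lborel. \<bar>k p\<bar>)"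
  have slice: "(\<lambda>p. w (p, \<omega>)) \<in> borel_measurable borel" if "\<omega> \<in> space M" for \<omega>
    using measurable_Pair1[OF w that] by simp
  have kwi: "integrable lborel (\<lambda>p. k p * w (p, \<omega>))" if "\<omega> \<in> space M" for \<omega>
  proof (rule Bochner_Integration.integrable_bound)
    note [measurable] = slice[OF that]
    show "integrable lborel (\<lambda>p. B * k p)" using k by simp
    show "(\<lambda>p. k p * w (p, \<omega>)) \<in> borel_measurable lborel" by measurable
    show "AE p in lborel. norm (k p * w (p, \<omega>)) \<le> norm (B * k p)"
    proof (rule AE_I2)
      fix p
      have "\<bar>w (p, \<omega>)\<bar> * \<bar>k p\<bar> \<le> \<bar>B\<bar> * \<bar>k p\<bar>" using wB[of "(p, \<omega>)"] by (intro mult_right_mono) auto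
      then show "norm (k p * w (p, \<omega>)) \<le> norm (B * k p)" by (simp add: abs_mult mult.commute)
    qed
  qed
  have DB: "\<bar>D \<omega>\<bar> \<le> B'" if "\<omega> \<in> space M" for \<omega>
  proof -
    have "\<bar>D \<omega>\<bar> \<le> (LINT p|lborel. B * \<bar>k p\<bar>)" unfolding D_def
    proof (rule abs_integral_le[OF kwi[OF that]])
      show "integrable lborel (\<lambda>p. B * \<bar>k p\<bar>)" using k by simp
      fix p
      have "\<bar>w (p, \<omega>)\<bar> * \<bar>k p\<bar> \<le> B * \<bar>k p\<bar>" by (intro mult_right_mono wB) simp
      then show "\<bar>k p * w (p, \<omega>)\<bar> \<le> B * \<bar>k p\<bar>" by (simp add: abs_mult mult.commute)
    qed
    then show ?thesis by (simp add: B'_def)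
  qed
  have iD: "integrable M D"
    by (rule integrable_const_bound[where B = B']) (rule AE_I2, simp only: real_norm_def DB, measurable)
  define E where "E = real_cond_exp M F D"
  have EF [measurable]: "E \<in> borel_measurable F" unfolding E_def by simp
  have EM [measurable]: "E \<in> borel_measurable M" using EF unfolding F_def by (rule noise_sigma_measurable_M)
  have iE: "integrable M E" unfolding E_def by (rule F.real_cond_exp_int(1)[OF iD])
  have Eb: "AE \<omega> in M. \<bar>E \<omega>\<bar> \<le> B'"
  proof -
    have "AE \<omega> in M. E \<omega> \<le> B'" unfolding E_def
      by (rule F.real_cond_exp_le_c[OF iD]) (rule AE_I2, use DB in \<open>simp add: abs_le_iff\<close>)
    moreover have "AE \<omega> in M. E \<omega> \<ge> - B'" unfolding E_def
    proof (rule F.real_cond_exp_ge_c[OF iD], rule AE_I2)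
      fix \<omega> assume "\<omega> \<in> space M"
      then show "D \<omega> \<ge> - B'" using DB[of \<omega>] by linarith
    qed
    ultimately show ?thesis by eventually_elim linarith
  qed
  have bm: "integrable M (\<lambda>\<omega>. f \<omega> * D \<omega>) \<and> integrable M (\<lambda>\<omega>. f \<omega> * E \<omega>)"
    if [measurable]: "f \<in> borel_measurable M" and f: "AE \<omega> in M. \<bar>f \<omega>\<bar> \<le> C" for f C
  proof -
    have "AE \<omega> in M. norm (f \<omega> * D \<omega>) \<le> C * B'"
      using f AE_space
    proof eventually_elim
      case (elim \<omega>) then show ?case unfolding real_norm_def abs_mult using DB[of \<omega>] by (intro mult_mono) auto
    qed
    moreover have "AE \<omega> in M. norm (f \<omega> * E \<omega>) \<le> C * B'"
      using f Eb
    proof eventually_elim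
      case (elim \<omega>) then show ?case unfolding real_norm_def abs_mult by (intro mult_mono) auto
    qed
    ultimately show ?thesis by (auto intro!: integrable_const_bound)
  qed
  have orth: "expectation (\<lambda>\<omega>. f \<omega> * (D \<omega> - E \<omega>)) = 0"
    if fF: "f \<in> borel_measurable F" and f: "AE \<omega> in M. \<bar>f \<omega>\<bar> \<le> C" for f C
  proof -
    have fM: "f \<in> borel_measurable M" using fF unfolding F_def by (rule noise_sigma_measurable_M)
    note i = bm[OF fM f]
    have "expectation (\<lambda>\<omega>. f \<omega> * E \<omega>) = expectation (\<lambda>\<omega>. f \<omega> * D \<omega>)"
      unfolding E_def by (rule F.real_cond_exp_intg(2)) (use i fF in auto)
    then show ?thesis unfolding right_diff_distrib using i by (simp add: Bochner_Integration.integral_diff)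
  qed
  have iQ: "integrable M (\<lambda>\<omega>. D \<omega> - E \<omega>)" using iD iE by simp
  \<comment> \<open>Each slice of \<open>w\<close> that matters is measurable for the noise in
    \<open>S\<close>, hence orthogonal to \<open>D - E\<close>; Fubini integrates this over
    \<open>p\<close>. Together with the orthogonality of \<open>E\<close> itself it forces
    \<open>D = E\<close> almost surely.\<close>
  have 1: "expectation (\<lambda>\<omega>. D \<omega> * (D \<omega> - E \<omega>)) = 0"
  proof -
    have "k p * expectation (\<lambda>\<omega>. w (p, \<omega>) * (D \<omega> - E \<omega>)) = 0" for p
    proof (cases "k p = 0")
      case False
      have "expectation (\<lambda>\<omega>. w (p, \<omega>) * (D \<omega> - E \<omega>)) = 0"
      proof (rule orth)
        show "(\<lambda>\<omega>. w (p, \<omega>)) \<in> borel_measurable F" using adapted[OF False] by (simp add: F_def)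
        show "AE \<omega> in M. \<bar>w (p, \<omega>)\<bar> \<le> B" by (rule AE_I2) (rule wB)
      qed
      then show ?thesis by simp
    qed simp
    then show ?thesis unfolding fub[OF iQ, symmetric] by (simp only: Bochner_Integration.integral_zero)
  qed
  have 2: "expectation (\<lambda>\<omega>. E \<omega> * (D \<omega> - E \<omega>)) = 0" by (rule orth[OF EF Eb])
  have Db: "AE \<omega> in M. \<bar>D \<omega>\<bar> \<le> B'" by (rule AE_I2) (rule DB)
  have i1: "integrable M (\<lambda>\<omega>. D \<omega> * (D \<omega> - E \<omega>))" "integrable M (\<lambda>\<omega>. E \<omega> * (D \<omega> - E \<omega>))"
    unfolding right_diff_distrib using bm[OF Dm Db] bm[OF EM Eb] by auto
  have sq: "(D \<omega> - E \<omega>)\<^sup>2 = D \<omega> * (D \<omega> - E \<omega>) - E \<omega> * (D \<omega> - E \<omega>)" for \<omega>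
    by (simp add: power2_eq_square left_diff_distrib)
  have "expectation (\<lambda>\<omega>. (D \<omega> - E \<omega>)\<^sup>2) = 0" unfolding sq using i1 1 2 by simp
  moreover have "integrable M (\<lambda>\<omega>. (D \<omega> - E \<omega>)\<^sup>2)" unfolding sq using i1 by simp
  ultimately have "AE \<omega> in M. (D \<omega> - E \<omega>)\<^sup>2 = 0"
    by (subst (asm) integral_nonneg_eq_0_iff_AE) auto
  then have "AE \<omega> in M. D \<omega> = E \<omega>" by eventually_elim simp
  then show ?thesis using EF unfolding F_def by blast
qed

lemma nn_integral_sq_mult_le:
  assumes [measurable]: "k \<in> borel_measurable borel" "w \<in> borel_measurable (lborel \<Otimes>\<^sub>M M)" and w: "\<And>z. \<bar>w z\<bar> \<le> B"
  shows "(\<integral>\<^sup>+z. ennreal ((k (fst z) * w z)\<^sup>2) \<partial>(lborel \<Otimes>\<^sub>M M)) \<le> ennreal (B\<^sup>2) * (\<integral>\<^sup>+p. ennreal ((k p)\<^sup>2) \<partial>lborel)"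
proof -
  have [measurable]: "(\<lambda>z. k (fst z)) \<in> borel_measurable (lborel \<Otimes>\<^sub>M M)"
    by (rule measurable_compose[OF measurable_fst]) simp
  have "(\<integral>\<^sup>+z. ennreal ((k (fst z) * w z)\<^sup>2) \<partial>(lborel \<Otimes>\<^sub>M M)) \<le> (\<integral>\<^sup>+z. ennreal (B\<^sup>2) * ennreal ((k (fst z))\<^sup>2) \<partial>(lborel \<Otimes>\<^sub>M M))"
  proof (rule nn_integral_mono)
    fix z
    have "\<bar>w z\<bar>\<^sup>2 \<le> B\<^sup>2" by (rule power_mono[OF w]) simp
    then have "(w z)\<^sup>2 * (k (fst z))\<^sup>2 \<le> B\<^sup>2 * (k (fst z))\<^sup>2" by (intro mult_right_mono) auto
    then show "ennreal ((k (fst z) * w z)\<^sup>2) \<le> ennreal (B\<^sup>2) * ennreal ((k (fst z))\<^sup>2)"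
      by (simp add: ennreal_mult[symmetric] power_mult_distrib mult.commute ennreal_leI)
  qed
  also have "\<dots> = ennreal (B\<^sup>2) * (\<integral>\<^sup>+z. ennreal ((k (fst z))\<^sup>2) \<partial>(lborel \<Otimes>\<^sub>M M))"
    by (rule nn_integral_cmult) measurable
  also have "(\<integral>\<^sup>+z. ennreal ((k (fst z))\<^sup>2) \<partial>(lborel \<Otimes>\<^sub>M M)) = (\<integral>\<^sup>+p. ennreal ((k p)\<^sup>2) \<partial>lborel)"
    by (subst nn_integral_fst[symmetric]) (auto simp: emeasure_space_1)
  finally show ?thesis .
qed

end

context elliptic_spde_solution
begin

section \<open>Conditionally Gaussian approximation of one coordinate\<close>

definition past :: "real \<Rightarrow> (real \<times> real) set" where "past \<epsilon> = {0..T - \<epsilon>} \<times> {0..1}"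

text \<open>Nearness is measured by the cosine distance because that is the weight in
  \<open>kernel_norm_weighted_hk_le\<close>, which directly bounds what the kernel carries outside
  the strip.\<close>

definition strip :: "real \<Rightarrow> real \<Rightarrow> real \<Rightarrow> (real \<times> real) set" where
  "strip \<rho> \<epsilon> x = ({T - \<epsilon><..<T} \<times> {0..1}) \<inter> {p. \<bar>cs 1 (snd p) - cs 1 x\<bar> < \<rho>}"

lemma strip_noise_set:
  assumes "\<epsilon> < T" shows "strip \<rho> \<epsilon> x \<in> noise_sets"
proof (rule noise_sets_subset)
  show "{0<..<T} \<times> {0..1 :: real} \<in> noise_sets"
    by (auto simp: noise_sets_def emeasure_rect)
  show "strip \<rho> \<epsilon> x \<subseteq> {0<..<T} \<times> {0..1}" using assms by (auto simp: strip_def)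
  have "{p \<in> space borel. \<bar>cs 1 (snd p) - cs 1 x\<bar> < \<rho>} \<in> sets (borel :: (real \<times> real) measure)" by measurable
  then show "strip \<rho> \<epsilon> x \<in> sets borel" unfolding strip_def using sets.Int[OF rect_borel] by simp
qed

text \<open>Cutting the kernel to the strip costs order
  \<open>\<epsilon> * sqrt \<epsilon> / \<rho>\<^sup>2\<close> by the weighted norm; then a simple
  function replaces it. Both errors are small against the lower bound of order
  \<open>sqrt \<epsilon>\<close>, so the variance keeps that order.\<close>

lemma noise_of_kernel:
  assumes x: "0 < x" "x < 1" and \<rho>: "\<rho> > 0"
  shows "\<exists>C>0. \<exists>\<epsilon>\<^sub>0>0. \<forall>\<epsilon>. 0 < \<epsilon> \<longrightarrow> \<epsilon> < \<epsilon>\<^sub>0 \<longrightarrow> (\<exists>J A v g. finite J \<and> (\<forall>c\<in>J. A c \<in> noise_sets \<and> A c \<subseteq> strip \<rho> \<epsilon> x) \<and>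
    (\<forall>p. (\<Sum>c\<in>J. c * indicator (A c) p) = g p) \<and> g \<in> borel_measurable borel \<and>
    centered_gaussian M (\<lambda>\<omega>. \<Sum>c\<in>J. c * W (A c) \<omega>) v \<and> sqrt \<epsilon> / C \<le> v \<and>
    (\<integral>\<^sup>+p. ennreal ((kap T x p * late \<epsilon> p - g p)\<^sup>2) \<partial>lborel) \<le> ennreal (C * (sqrt \<epsilon> * lg h \<epsilon>)))"
proof -
  define \<kappa> where "\<kappa> = (1 - \<bar>cos (pi * x)\<bar>) * exp (- 2 * pi\<^sup>2) / 4"
  have \<kappa>: "\<kappa> > 0"
  proof -
    have "cos (pi * x) < cos 0" using x by (intro cos_monotone_0_pi) auto
    moreover have "cos pi < cos (pi * x)" using x by (intro cos_monotone_0_pi) auto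
    ultimately have "\<bar>cos (pi * x)\<bar> < 1" by simp
    then show ?thesis by (simp add: \<kappa>_def)
  qed
  obtain \<epsilon>1 where \<epsilon>1: "\<epsilon>1 > 0" "\<And>\<epsilon>. 0 < \<epsilon> \<Longrightarrow> \<epsilon> < \<epsilon>1 \<Longrightarrow> \<epsilon> < 1 \<and> \<epsilon> powr (1/16) \<le> lg h \<epsilon>"
    using power_le_lg[OF h] by blast
  define C1 where "C1 = 90 * pi ^ 4 / \<rho>\<^sup>2"
  have C1: "C1 > 0" using \<rho> by (simp add: C1_def)
  define C where "C = 3 * C1 + 3 + 6 / \<kappa>"
  have C: "C > 0" using C1 \<kappa> by (simp add: C_def add_pos_pos)
  \<comment> \<open>The entry 1/16 is the range of the lower bound on the kernel norm;
    \<open>\<kappa> / (12 * C1)\<close> makes the cutting error at most a twelfth of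
    \<open>\<kappa> * sqrt \<epsilon>\<close>.\<close>
  define \<epsilon>\<^sub>0 where "\<epsilon>\<^sub>0 = min (min \<epsilon>1 T) (min (1/16) (\<kappa> / (12 * C1)))"
  have \<epsilon>0: "\<epsilon>\<^sub>0 > 0" using \<epsilon>1 T \<kappa> C1 by (simp add: \<epsilon>\<^sub>0_def)
  have "\<exists>J A v g. finite J \<and> (\<forall>c\<in>J. A c \<in> noise_sets \<and> A c \<subseteq> strip \<rho> \<epsilon> x) \<and>
    (\<forall>p. (\<Sum>c\<in>J. c * indicator (A c) p) = g p) \<and> g \<in> borel_measurable borel \<and>
    centered_gaussian M (\<lambda>\<omega>. \<Sum>c\<in>J. c * W (A c) \<omega>) v \<and> sqrt \<epsilon> / C \<le> v \<and>
    (\<integral>\<^sup>+p. ennreal ((kap T x p * late \<epsilon> p - g p)\<^sup>2) \<partial>lborel) \<le> ennreal (C * (sqrt \<epsilon> * lg h \<epsilon>))"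
    if \<epsilon>: "0 < \<epsilon>" "\<epsilon> < \<epsilon>\<^sub>0" for \<epsilon>
  proof -
    have \<epsilon>': "\<epsilon> < \<epsilon>1" "\<epsilon> < T" "\<epsilon> \<le> 1/16" "\<epsilon> \<le> \<kappa> / (12 * C1)" using \<epsilon> by (auto simp: \<epsilon>\<^sub>0_def)
    have \<epsilon>lt: "\<epsilon> < 1" and plg: "\<epsilon> powr (1/16) \<le> lg h \<epsilon>" using \<epsilon>1(2)[OF \<epsilon>(1) \<epsilon>'(1)] by auto
    have lgpos: "lg h \<epsilon> > 0" using plg \<epsilon>(1) by (smt (verit) powr_gt_zero)
    have "\<epsilon> = \<epsilon> powr 1" using \<epsilon> by simp
    also have "\<dots> \<le> \<epsilon> powr (1/16)" using \<epsilon> \<epsilon>lt by (intro powr_mono') auto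
    finally have \<epsilon>lg: "\<epsilon> \<le> lg h \<epsilon>" using plg by linarith
    have sq: "sqrt \<epsilon> > 0" using \<epsilon> by simp
    define k where "k p = kap T x p * late \<epsilon> p" for p
    define S where "S = strip \<rho> \<epsilon> x"
    have S: "S \<in> noise_sets" unfolding S_def by (rule strip_noise_set[OF \<epsilon>'(2)])
    note [measurable] = noise_sets_measurable[OF S]
    define f0 where "f0 p = k p * indicator S p" for p
    have km [measurable]: "k \<in> borel_measurable borel" unfolding k_def by measurable
    have f0m [measurable]: "f0 \<in> borel_measurable borel" unfolding f0_def by measurable
    have kle: "(\<integral>\<^sup>+p. ennreal ((k p)\<^sup>2) \<partial>lborel) \<le> ennreal (10 * sqrt \<epsilon>)"
      and wle: "(\<integral>\<^sup>+p. ennreal (((cs 1 (snd p) - cs 1 x) * k p)\<^sup>2) \<partial>lborel) \<le> ennreal (90 * pi ^ 4 * \<epsilon> * sqrt \<epsilon>)"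
      unfolding k_def using late_kap_norm[of \<epsilon> x] \<epsilon> \<epsilon>lt \<epsilon>' by auto
    have "(\<integral>\<^sup>+p. ennreal ((f0 p)\<^sup>2) \<partial>lborel) \<le> (\<integral>\<^sup>+p. ennreal ((k p)\<^sup>2) \<partial>lborel)"
      by (rule nn_integral_mono) (simp add: f0_def indicator_def)
    also have "\<dots> < \<infinity>" using kle by (rule le_less_trans) simp
    finally have f0fin: "(\<integral>\<^sup>+p. ennreal ((f0 p)\<^sup>2) \<partial>lborel) < \<infinity>" .
    \<comment> \<open>Two demands on the simple function: its error must be small against the
      variance and must not exceed the size of the freezing error.\<close>
    define m where "m = min (\<kappa> / 12) (lg h \<epsilon>)"
    have m: "m > 0" "m \<le> \<kappa> / 12" "m \<le> lg h \<epsilon>" using \<kappa> lgpos by (auto simp: m_def)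
    define e where "e = sqrt \<epsilon> * m"
    have e: "e > 0" "e \<le> sqrt \<epsilon> * (\<kappa> / 12)" "e \<le> sqrt \<epsilon> * lg h \<epsilon>"
      unfolding e_def using m sq by (auto intro: mult_left_mono)
    have f0m': "f0 \<in> borel_measurable lborel" by simp
    obtain g where g: "simple_function lborel g" "\<And>p. \<bar>g p\<bar> \<le> 2 * \<bar>f0 p\<bar>"
      and ge: "(\<integral>\<^sup>+p. ennreal ((f0 p - g p)\<^sup>2) \<partial>lborel) \<le> ennreal e"
      using L2_simple_approximation[OF f0m' f0fin e(1)] by auto
    have gm [measurable]: "g \<in> borel_measurable borel" using borel_measurable_simple_function[OF g(1)] by simp
    have g0: "g p = 0" if "p \<notin> S" for p using g(2)[of p] that by (simp add: f0_def)
    have sfn1: "finite (range g - {0})"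
      by (rule simple_function_noise(1)[OF g(1) S g0])
    have sfn2: "\<And>c. c \<in> range g - {0} \<Longrightarrow> g -` {c} \<in> noise_sets \<and> g -` {c} \<subseteq> S"
      by (rule simple_function_noise(2)[OF g(1) S g0])
    have sfn3: "\<And>p. (\<Sum>c\<in>range g - {0}. c * indicator (g -` {c}) p) = g p"
      by (rule simple_function_noise(3)[OF g(1) S g0])
    have sfn4: "\<exists>v\<ge>0. centered_gaussian M (\<lambda>\<omega>. \<Sum>c\<in>range g - {0}. c * W (g -` {c}) \<omega>) v \<and> ennreal v = (\<integral>\<^sup>+p. ennreal ((g p)\<^sup>2) \<partial>lborel)"
      by (rule simple_function_noise(4)[OF g(1) S g0])
    obtain v where v: "v \<ge> 0" "centered_gaussian M (\<lambda>\<omega>. \<Sum>c\<in>range g - {0}. c * W (g -` {c}) \<omega>) v"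
      "ennreal v = (\<integral>\<^sup>+p. ennreal ((g p)\<^sup>2) \<partial>lborel)"
      using sfn4 by blast
    define b1 where "b1 = C1 * (\<epsilon> * sqrt \<epsilon>)"
    have b1: "b1 \<ge> 0" using C1 \<epsilon> by (simp add: b1_def)
    have kf0: "(\<integral>\<^sup>+p. ennreal ((k p - f0 p)\<^sup>2) \<partial>lborel) \<le> ennreal b1"
    proof -
      have "(\<integral>\<^sup>+p. ennreal ((k p - f0 p)\<^sup>2) \<partial>lborel) \<le> (\<integral>\<^sup>+p. ennreal (1 / \<rho>\<^sup>2) * ennreal (((cs 1 (snd p) - cs 1 x) * k p)\<^sup>2) \<partial>lborel)"
      proof (rule nn_integral_mono)
        fix p
        have "(k p - f0 p)\<^sup>2 \<le> 1 / \<rho>\<^sup>2 * ((cs 1 (snd p) - cs 1 x) * k p)\<^sup>2"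
        proof (cases "p \<in> S \<or> k p = 0")
          case False
          then have "\<bar>cs 1 (snd p) - cs 1 x\<bar> \<ge> \<rho>"
            by (auto simp: S_def strip_def k_def kap_def late_def indicator_def split: if_splits)
          then have "\<rho>\<^sup>2 \<le> (cs 1 (snd p) - cs 1 x)\<^sup>2" using \<rho> by (subst abs_le_square_iff[symmetric]) simp
          then have "1 \<le> (cs 1 (snd p) - cs 1 x)\<^sup>2 / \<rho>\<^sup>2" using \<rho> by (simp add: field_simps)
          then have "1 * (k p)\<^sup>2 \<le> (cs 1 (snd p) - cs 1 x)\<^sup>2 / \<rho>\<^sup>2 * (k p)\<^sup>2" by (rule mult_right_mono) simp
          moreover have "f0 p = 0" using False by (simp add: f0_def)
          ultimately show ?thesis by (simp add: power_mult_distrib)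
        qed (auto simp: f0_def)
        then have "ennreal ((k p - f0 p)\<^sup>2) \<le> ennreal (1 / \<rho>\<^sup>2 * ((cs 1 (snd p) - cs 1 x) * k p)\<^sup>2)" by (rule ennreal_leI)
        then show "ennreal ((k p - f0 p)\<^sup>2) \<le> ennreal (1 / \<rho>\<^sup>2) * ennreal (((cs 1 (snd p) - cs 1 x) * k p)\<^sup>2)"
          by (subst ennreal_mult[symmetric]) auto
      qed
      also have "\<dots> = ennreal (1 / \<rho>\<^sup>2) * (\<integral>\<^sup>+p. ennreal (((cs 1 (snd p) - cs 1 x) * k p)\<^sup>2) \<partial>lborel)"
        by (rule nn_integral_cmult) measurable
      also have "\<dots> \<le> ennreal (1 / \<rho>\<^sup>2) * ennreal (90 * pi ^ 4 * \<epsilon> * sqrt \<epsilon>)" by (rule mult_left_mono[OF wle]) simp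
      also have "\<dots> = ennreal b1" using \<epsilon> by (subst ennreal_mult[symmetric]) (auto simp: b1_def C1_def)
      finally show ?thesis .
    qed
    have "(\<integral>\<^sup>+p. ennreal ((k p - g p)\<^sup>2) \<partial>lborel)
      \<le> 3 * (\<integral>\<^sup>+p. ennreal ((k p - f0 p)\<^sup>2) \<partial>lborel) + 3 * (\<integral>\<^sup>+p. ennreal ((f0 p - g p)\<^sup>2) \<partial>lborel) + 3 * (\<integral>\<^sup>+p. ennreal ((g p - g p)\<^sup>2) \<partial>lborel)"
      by (rule nn_integral_sq_triangle3) auto
    also have "\<dots> \<le> 3 * ennreal b1 + 3 * ennreal e + 0"
      by (intro add_mono mult_left_mono kf0 ge) auto
    also have "\<dots> = ennreal (3 * b1 + 3 * e)" using b1 e by (simp add: ennreal_mult)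
    also have "\<dots> \<le> ennreal (C * (sqrt \<epsilon> * lg h \<epsilon>))"
    proof (rule ennreal_leI)
      have "b1 \<le> C1 * (sqrt \<epsilon> * lg h \<epsilon>)"
        unfolding b1_def using C1 sq \<epsilon>lg by (subst mult.commute[of \<epsilon>]) (intro mult_left_mono, auto)
      then have "3 * b1 + 3 * e \<le> (3 * C1 + 3) * (sqrt \<epsilon> * lg h \<epsilon>)" using e(3) by (simp add: distrib_right)
      also have "\<dots> \<le> C * (sqrt \<epsilon> * lg h \<epsilon>)"
        using \<kappa> sq lgpos by (intro mult_right_mono) (auto simp: C_def)
      finally show "3 * b1 + 3 * e \<le> C * (sqrt \<epsilon> * lg h \<epsilon>)" .
    qed
    finally have kg: "(\<integral>\<^sup>+p. ennreal ((k p - g p)\<^sup>2) \<partial>lborel) \<le> ennreal (C * (sqrt \<epsilon> * lg h \<epsilon>))" .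
    have "ennreal (\<kappa> * sqrt \<epsilon>) \<le> kernel_norm \<epsilon> (\<lambda>\<theta>. hk \<theta> x)"
      unfolding \<kappa>_def by (rule kernel_norm_hk_ge[OF \<epsilon>(1) \<epsilon>'(3)])
    also have "\<dots> = (\<integral>\<^sup>+p. ennreal ((kap T x p)\<^sup>2) * indicator ({T - \<epsilon><..} \<times> UNIV) p \<partial>lborel)"
      by (rule kap_norm_part[symmetric]) (use \<epsilon> \<epsilon>' in auto)
    also have "\<dots> = (\<integral>\<^sup>+p. ennreal ((k p - 0)\<^sup>2) \<partial>lborel)"
      by (rule nn_integral_cong) (simp add: k_def late_def indicator_def)
    also have "\<dots> \<le> 3 * (\<integral>\<^sup>+p. ennreal ((k p - f0 p)\<^sup>2) \<partial>lborel) + 3 * (\<integral>\<^sup>+p. ennreal ((f0 p - g p)\<^sup>2) \<partial>lborel) + 3 * (\<integral>\<^sup>+p. ennreal ((g p - 0)\<^sup>2) \<partial>lborel)"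
      by (rule nn_integral_sq_triangle3[where b = "\<lambda>_. 0"]) auto
    also have "\<dots> \<le> 3 * ennreal b1 + 3 * ennreal e + 3 * ennreal v"
      by (intro add_mono mult_left_mono kf0 ge) (auto simp: v(3))
    also have "\<dots> = ennreal (3 * b1 + 3 * e + 3 * v)" using b1 e v by (simp add: ennreal_mult)
    finally have "\<kappa> * sqrt \<epsilon> \<le> 3 * b1 + 3 * e + 3 * v" using b1 e v by (subst (asm) ennreal_le_iff) auto
    moreover have "b1 \<le> \<kappa> * sqrt \<epsilon> / 12"
    proof -
      have "C1 * \<epsilon> \<le> \<kappa> / 12" using \<epsilon>'(4) C1 by (simp add: field_simps)
      then have "C1 * \<epsilon> * sqrt \<epsilon> \<le> \<kappa> / 12 * sqrt \<epsilon>" using sq by (intro mult_right_mono) auto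
      then show ?thesis by (simp add: b1_def mult.assoc)
    qed
    moreover have "e \<le> \<kappa> * sqrt \<epsilon> / 12" using e(2) by (simp add: mult.commute)
    \<comment> \<open>Three times two twelfths use up half of
      \<open>\<kappa> * sqrt \<epsilon>\<close>; the other half is at most
      \<open>3 * v\<close>.\<close>
    ultimately have "\<kappa> * sqrt \<epsilon> / 6 \<le> v" by linarith
    moreover have "sqrt \<epsilon> / C \<le> \<kappa> * sqrt \<epsilon> / 6"
    proof -
      have "sqrt \<epsilon> / C \<le> sqrt \<epsilon> / (6 / \<kappa>)"
        using \<kappa> C1 sq C by (intro divide_left_mono) (auto simp: C_def)
      then show ?thesis by (simp add: mult.commute)
    qed
    ultimately have vge: "sqrt \<epsilon> / C \<le> v" by linarith
    show ?thesis
    proof (intro exI conjI ballI allI)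
      show "finite (range g - {0})" by (rule sfn1)
      show "g -` {c} \<in> noise_sets" "g -` {c} \<subseteq> strip \<rho> \<epsilon> x" if "c \<in> range g - {0}" for c
        using sfn2[OF that] by (auto simp: S_def)
      show "(\<Sum>c\<in>range g - {0}. c * indicator (g -` {c}) p) = g p" for p by (rule sfn3)
      show "g \<in> borel_measurable borel" by (rule gm)
      show "centered_gaussian M (\<lambda>\<omega>. \<Sum>c\<in>range g - {0}. c * W (g -` {c}) \<omega>) v" by (rule v(2))
      show "sqrt \<epsilon> / C \<le> v" by (rule vge)
      show "(\<integral>\<^sup>+p. ennreal ((kap T x p * late \<epsilon> p - g p)\<^sup>2) \<partial>lborel) \<le> ennreal (C * (sqrt \<epsilon> * lg h \<epsilon>))"
        using kg by (simp add: k_def)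
    qed
  qed
  note main = this
  show ?thesis
    by (rule exI[of _ C], rule conjI[OF C], rule exI[of _ \<epsilon>\<^sub>0], rule conjI[OF \<epsilon>0], intro allI impI, rule main)
qed

lemma stochastic_part_split:
  assumes Z: "walsh_version (SF T x) Z" and x: "x \<in> {0..1}" and \<epsilon>: "0 < \<epsilon>" "\<epsilon> < T"
    and J: "finite J" and A: "\<And>c. c \<in> J \<Longrightarrow> A c \<in> noise_sets \<and> A c \<subseteq> strip \<rho> \<epsilon> x"
    and g: "\<And>p. (\<Sum>c\<in>J. c * indicator (A c) p) = g p" and gm [measurable]: "g \<in> borel_measurable borel"
    and pos: "0 < e" "0 \<le> a" "0 \<le> b1"
    and freeze: "(\<integral>\<^sup>+z. ennreal ((SF T x z * late \<epsilon> (fst z) - frozen \<epsilon> x (snd z) * (kap T x (fst z) * late \<epsilon> (fst z)))\<^sup>2) \<partial>(lborel \<Otimes>\<^sub>M M)) \<le> ennreal a"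
    and ker: "(\<integral>\<^sup>+p. ennreal ((kap T x p * late \<epsilon> p - g p)\<^sup>2) \<partial>lborel) \<le> ennreal b1"
  shows "\<exists>I\<in>borel_measurable (noise_sigma M W (past \<epsilon>)).
    (\<integral>\<^sup>+\<omega>. ennreal ((Z \<omega> - (I \<omega> + frozen \<epsilon> x \<omega> * (\<Sum>c\<in>J. c * W (A c) \<omega>)))\<^sup>2) \<partial>M) \<le> ennreal (12 * e + 9 * a + 9 * K\<^sup>2 * b1)"
proof -
  define t0 where "t0 = T - \<epsilon>"
  have t0: "t0 > 0" using \<epsilon> by (simp add: t0_def)
  define H where "H = {..t0} \<times> (UNIV :: real set)"
  have H: "H \<in> sets borel" unfolding H_def by (rule left_half_plane_borel)
  define s where "s = frozen \<epsilon> x"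
  have sF: "s \<in> borel_measurable (noise_sigma M W (past \<epsilon>))" and sM [measurable]: "s \<in> borel_measurable M"
    unfolding s_def past_def using frozen_measurable[OF \<epsilon>(2) x] by auto
  have sK: "\<bar>s \<omega>\<bar> \<le> K" for \<omega> unfolding s_def frozen_def by (rule \<sigma>_le)
  define N where "N \<omega> = (\<Sum>c\<in>J. c * W (A c) \<omega>)" for \<omega>
  have NM [measurable]: "N \<in> borel_measurable M"
    unfolding N_def by (intro borel_measurable_sum borel_measurable_times borel_measurable_const W_measurable) (use A in blast)
  have ZM [measurable]: "Z \<in> borel_measurable M" using Z by (simp add: walsh_version_def)
  obtain n r R X where st: "simple_terms n r R X"
      and 1: "(\<integral>\<^sup>+z. ennreal ((simple_sum n R X z - SF T x z)\<^sup>2) \<partial>(lborel \<Otimes>\<^sub>M M)) \<le> ennreal e"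
      and 2: "(\<integral>\<^sup>+\<omega>. ennreal ((simple_int n R X \<omega> - Z \<omega>)\<^sup>2) \<partial>M) \<le> ennreal e"
    using Z pos(1) unfolding walsh_version_def by blast
  have stk: "simple_term (r k) (R k) (X k)" if "k < n" for k using st that by (simp add: simple_terms_def)
  note [measurable] = simple_sum_measurable[OF st] simple_int_measurable[OF st]
  \<comment> \<open>For a term starting after T - \<epsilon> the factor \<open>X k\<close> is
    unknown to the past, but its early piece is empty, and the noise of the empty set is almost
    surely 0; hence the default 0.\<close>
  define I where "I \<omega> = (\<Sum>k<n. X k \<omega> * (if r k \<le> t0 then W (R k \<inter> H) \<omega> else 0))" for \<omega>
  define I2 where "I2 \<omega> = (\<Sum>k<n. X k \<omega> * W (R k - H) \<omega>)" for \<omega>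
  have RH: "R k \<inter> H \<in> noise_sets" "R k - H \<in> noise_sets" "R k \<inter> H \<subseteq> past \<epsilon>" if "k < n" for k
  proof -
    have Rk: "R k \<in> noise_sets" by (rule simple_term_noise_set[OF stk[OF that]])
    show "R k \<inter> H \<in> noise_sets" by (rule noise_sets_Int[OF Rk H])
    show "R k - H \<in> noise_sets" by (rule noise_sets_subset[OF Rk sets.Diff[OF noise_sets_measurable[OF Rk] H]]) blast
    have "R k \<subseteq> {0..} \<times> {0..1}" using Rk by (simp add: noise_sets_def)
    then show "R k \<inter> H \<subseteq> past \<epsilon>" by (auto simp: H_def past_def t0_def)
  qed
  have IF: "I \<in> borel_measurable (noise_sigma M W (past \<epsilon>))"
    unfolding I_def
  proof (rule borel_measurable_sum)
    fix k assume "k \<in> {..<n}"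
    then have k: "k < n" by simp
    show "(\<lambda>\<omega>. X k \<omega> * (if r k \<le> t0 then W (R k \<inter> H) \<omega> else 0)) \<in> borel_measurable (noise_sigma M W (past \<epsilon>))"
    proof (cases "r k \<le> t0")
      case True
      have "X k \<in> borel_measurable (noise_sigma M W ({0..r k} \<times> {0..1}))"
        using stk[OF k] unfolding simple_term_def noise_filtration_eq by blast
      moreover have "{0..r k} \<times> {0..1 :: real} \<subseteq> past \<epsilon>" using True by (auto simp: past_def t0_def)
      ultimately have [measurable]: "X k \<in> borel_measurable (noise_sigma M W (past \<epsilon>))"
        by (rule noise_sigma_measurable_mono)
      have [measurable]: "W (R k \<inter> H) \<in> borel_measurable (noise_sigma M W (past \<epsilon>))"
        by (rule W_noise_sigma_measurable[OF RH(1)[OF k] RH(3)[OF k]])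
      show ?thesis by measurable
    qed simp
  qed
  then have IM [measurable]: "I \<in> borel_measurable M" by (rule noise_sigma_measurable_M)
  have I2M [measurable]: "I2 \<in> borel_measurable M"
    unfolding I2_def
    by (intro borel_measurable_sum borel_measurable_times W_measurable) (auto intro: RH simple_term_measurable[OF stk])
  have split: "AE \<omega> in M. simple_int n R X \<omega> = I \<omega> + I2 \<omega>"
  proof -
    have "AE \<omega> in M. \<forall>k\<in>{..<n}. X k \<omega> * W (R k) \<omega> = X k \<omega> * (if r k \<le> t0 then W (R k \<inter> H) \<omega> else 0) + X k \<omega> * W (R k - H) \<omega>"
    proof (rule AE_finite_allI[OF finite_lessThan])
      fix k assume "k \<in> {..<n}"
      then have k: "k < n" by simp
      note ws = W_split[OF simple_term_noise_set[OF stk[OF k]] H]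
      show "AE \<omega> in M. X k \<omega> * W (R k) \<omega> = X k \<omega> * (if r k \<le> t0 then W (R k \<inter> H) \<omega> else 0) + X k \<omega> * W (R k - H) \<omega>"
      proof (cases "r k \<le> t0")
        case True
        show ?thesis using ws by eventually_elim (simp only: True if_True distrib_left)
      next
        case False
        have "R k \<subseteq> {r k<..} \<times> UNIV" using stk[OF k] unfolding simple_term_def by blast
        then have "R k \<inter> H = {}" using False by (auto simp: H_def)
        with False have eq: "(if r k \<le> t0 then W (R k \<inter> H) \<omega> else 0) = 0" "W (R k \<inter> H) \<omega> = W {} \<omega>" for \<omega> by simp_all
        show ?thesis using ws W_empty
        proof eventually_elim
          case (elim \<omega>)
          show ?case unfolding elim(1) eq elim(2) by simp
        qed
      qed
    qed
    then show ?thesis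
      unfolding simple_int_def I_def I2_def sum.distrib[symmetric]
      by eventually_elim (rule sum.cong, auto)
  qed
  have late_H: "indicator (B - H) p = (indicator B p * late \<epsilon> p :: real)" for B p
    by (cases p) (auto simp: H_def late_def t0_def indicator_def)
  define Q where "Q z = simple_sum n R X z * late \<epsilon> (fst z) - s (snd z) * g (fst z)" for z
  have gM [measurable]: "(\<lambda>z. g (fst z)) \<in> borel_measurable (lborel \<Otimes>\<^sub>M M)"
    by (rule measurable_compose[OF measurable_fst]) simp
  have "(\<integral>\<^sup>+\<omega>. ennreal ((I2 \<omega> - s \<omega> * N \<omega>)\<^sup>2) \<partial>M) = (\<integral>\<^sup>+z. ennreal ((Q z)\<^sup>2) \<partial>(lborel \<Otimes>\<^sub>M M))"
  proof -
    define L where "L = {..<n} <+> J"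
    define r2 where "r2 = case_sum (\<lambda>k. max (r k) t0) (\<lambda>_ :: real. t0)"
    define R2 where "R2 = case_sum (\<lambda>k. R k - H) A"
    define X2 where "X2 = case_sum X (\<lambda>c \<omega>. - (s \<omega> * c))"
    have L: "finite L" using J by (simp add: L_def)
    have st2: "simple_term (r2 j) (R2 j) (X2 j)" if "j \<in> L" for j
    proof (cases j)
      case (Inl k)
      then have "k < n" using that by (auto simp: L_def)
      from simple_term_split(2)[OF stk[OF this], of t0] t0 show ?thesis
        by (simp add: Inl r2_def R2_def X2_def H_def)
    next
      case (Inr c)
      then have c: "c \<in> J" using that by (auto simp: L_def)
      have "A c \<subseteq> {t0<..} \<times> UNIV" using A[OF c] by (auto simp: strip_def t0_def)
      moreover have "(\<lambda>\<omega>. - (s \<omega> * c)) \<in> borel_measurable (noise_filtration M W t0)"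
        unfolding noise_filtration_eq t0_def using sF unfolding past_def by measurable
      moreover have "\<bar>- (s \<omega> * c)\<bar> \<le> K * \<bar>c\<bar>" for \<omega>
        unfolding abs_minus abs_mult by (rule mult_right_mono[OF sK]) simp
      ultimately show ?thesis
        using A[OF c] t0 unfolding simple_term_def Inr r2_def R2_def X2_def sum.case by (intro conjI exI[of _ "K * \<bar>c\<bar>"]) auto
    qed
    have e1: "(\<Sum>j\<in>L. X2 j \<omega> * W (R2 j) \<omega>) = I2 \<omega> - s \<omega> * N \<omega>" for \<omega>
      unfolding L_def I2_def N_def
      by (simp only: sum.Plus[OF finite_lessThan J] X2_def R2_def sum.case comp_def mult_minus_left sum_negf diff_conv_add_uminus sum_distrib_left mult.assoc)
    have e2: "(\<Sum>j\<in>L. X2 j (snd z) * indicator (R2 j) (fst z)) = Q z" for z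
    proof -
      have "(\<Sum>j\<in>L. X2 j (snd z) * indicator (R2 j) (fst z))
        = (\<Sum>k<n. X k (snd z) * indicator (R k - H) (fst z)) + - (\<Sum>c\<in>J. s (snd z) * c * indicator (A c) (fst z))"
        unfolding L_def by (simp only: sum.Plus[OF finite_lessThan J] X2_def R2_def sum.case comp_def mult_minus_left sum_negf)
      also have "(\<Sum>k<n. X k (snd z) * indicator (R k - H) (fst z)) = simple_sum n R X z * late \<epsilon> (fst z)"
        unfolding simple_sum_def sum_distrib_right late_H by (simp only: mult.assoc)
      also have "(\<Sum>c\<in>J. s (snd z) * c * indicator (A c) (fst z)) = s (snd z) * g (fst z)"
        unfolding g[symmetric] sum_distrib_left by (simp only: mult.assoc)
      finally show ?thesis by (simp add: Q_def)
    qed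
    show ?thesis using ito_isometry[where r = r2 and R = R2 and X = X2, OF L st2] unfolding e1 e2 .
  qed
  also have "(\<integral>\<^sup>+z. ennreal ((Q z)\<^sup>2) \<partial>(lborel \<Otimes>\<^sub>M M)) \<le> ennreal (3 * e + 3 * a + 3 * (K\<^sup>2 * b1))"
  proof -
    define k where "k p = kap T x p * late \<epsilon> p" for p
    have km [measurable]: "k \<in> borel_measurable borel" unfolding k_def by measurable
    have kM [measurable]: "(\<lambda>z. k (fst z)) \<in> borel_measurable (lborel \<Otimes>\<^sub>M M)"
      by (rule measurable_compose[OF measurable_fst]) simp
    have sM' [measurable]: "(\<lambda>z. s (snd z)) \<in> borel_measurable (lborel \<Otimes>\<^sub>M M)" by measurable
    have "(\<integral>\<^sup>+z. ennreal ((Q z)\<^sup>2) \<partial>(lborel \<Otimes>\<^sub>M M))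
      \<le> 3 * (\<integral>\<^sup>+z. ennreal ((simple_sum n R X z * late \<epsilon> (fst z) - SF T x z * late \<epsilon> (fst z))\<^sup>2) \<partial>(lborel \<Otimes>\<^sub>M M))
       + 3 * (\<integral>\<^sup>+z. ennreal ((SF T x z * late \<epsilon> (fst z) - s (snd z) * k (fst z))\<^sup>2) \<partial>(lborel \<Otimes>\<^sub>M M))
       + 3 * (\<integral>\<^sup>+z. ennreal ((s (snd z) * k (fst z) - s (snd z) * g (fst z))\<^sup>2) \<partial>(lborel \<Otimes>\<^sub>M M))"
      unfolding Q_def by (rule nn_integral_sq_triangle3) measurable
    also have "\<dots> \<le> 3 * ennreal e + 3 * ennreal a + 3 * (ennreal (K\<^sup>2) * ennreal b1)"
    proof (intro add_mono mult_left_mono)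
      have "(\<integral>\<^sup>+z. ennreal ((simple_sum n R X z * late \<epsilon> (fst z) - SF T x z * late \<epsilon> (fst z))\<^sup>2) \<partial>(lborel \<Otimes>\<^sub>M M))
        \<le> (\<integral>\<^sup>+z. ennreal ((simple_sum n R X z - SF T x z)\<^sup>2) \<partial>(lborel \<Otimes>\<^sub>M M))"
        by (rule nn_integral_mono) (simp add: late_def indicator_def)
      then show "(\<integral>\<^sup>+z. ennreal ((simple_sum n R X z * late \<epsilon> (fst z) - SF T x z * late \<epsilon> (fst z))\<^sup>2) \<partial>(lborel \<Otimes>\<^sub>M M)) \<le> ennreal e"
        using 1 by (rule order_trans)
      show "(\<integral>\<^sup>+z. ennreal ((SF T x z * late \<epsilon> (fst z) - s (snd z) * k (fst z))\<^sup>2) \<partial>(lborel \<Otimes>\<^sub>M M)) \<le> ennreal a"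
        using freeze unfolding s_def k_def .
      have "(\<integral>\<^sup>+z. ennreal ((s (snd z) * k (fst z) - s (snd z) * g (fst z))\<^sup>2) \<partial>(lborel \<Otimes>\<^sub>M M))
        = (\<integral>\<^sup>+z. ennreal (((\<lambda>p. k p - g p) (fst z) * s (snd z))\<^sup>2) \<partial>(lborel \<Otimes>\<^sub>M M))"
        by (simp only: left_diff_distrib mult.commute[of "s _"])
      also have "\<dots> \<le> ennreal (K\<^sup>2) * (\<integral>\<^sup>+p. ennreal ((k p - g p)\<^sup>2) \<partial>lborel)"
        by (rule nn_integral_sq_mult_le) (measurable, rule sK)
      also have "\<dots> \<le> ennreal (K\<^sup>2) * ennreal b1" using ker unfolding k_def by (rule mult_left_mono) simp
      finally show "(\<integral>\<^sup>+z. ennreal ((s (snd z) * k (fst z) - s (snd z) * g (fst z))\<^sup>2) \<partial>(lborel \<Otimes>\<^sub>M M)) \<le> ennreal (K\<^sup>2) * ennreal b1" .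
    qed auto
    also have "\<dots> = ennreal (3 * e + 3 * a + 3 * (K\<^sup>2 * b1))" using pos by (simp add: ennreal_mult)
    finally show ?thesis .
  qed
  finally have I2N: "(\<integral>\<^sup>+\<omega>. ennreal ((I2 \<omega> - s \<omega> * N \<omega>)\<^sup>2) \<partial>M) \<le> ennreal (3 * e + 3 * a + 3 * (K\<^sup>2 * b1))" .
  have "(\<integral>\<^sup>+\<omega>. ennreal ((Z \<omega> - (I \<omega> + s \<omega> * N \<omega>))\<^sup>2) \<partial>M)
    \<le> 3 * (\<integral>\<^sup>+\<omega>. ennreal ((Z \<omega> - simple_int n R X \<omega>)\<^sup>2) \<partial>M) + 3 * (\<integral>\<^sup>+\<omega>. ennreal ((simple_int n R X \<omega> - (I \<omega> + I2 \<omega>))\<^sup>2) \<partial>M)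
      + 3 * (\<integral>\<^sup>+\<omega>. ennreal ((I \<omega> + I2 \<omega> - (I \<omega> + s \<omega> * N \<omega>))\<^sup>2) \<partial>M)"
    by (rule nn_integral_sq_triangle3) measurable
  also have "\<dots> \<le> 3 * ennreal e + 3 * 0 + 3 * ennreal (3 * e + 3 * a + 3 * (K\<^sup>2 * b1))"
  proof (intro add_mono mult_left_mono)
    show "(\<integral>\<^sup>+\<omega>. ennreal ((Z \<omega> - simple_int n R X \<omega>)\<^sup>2) \<partial>M) \<le> ennreal e" using 2 by (simp add: power2_commute)
    have "(\<integral>\<^sup>+\<omega>. ennreal ((simple_int n R X \<omega> - (I \<omega> + I2 \<omega>))\<^sup>2) \<partial>M) = (\<integral>\<^sup>+\<omega>. 0 \<partial>M)"
      by (rule nn_integral_cong_AE) (use split in eventually_elim, simp)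
    then show "(\<integral>\<^sup>+\<omega>. ennreal ((simple_int n R X \<omega> - (I \<omega> + I2 \<omega>))\<^sup>2) \<partial>M) \<le> 0" by simp
    show "(\<integral>\<^sup>+\<omega>. ennreal ((I \<omega> + I2 \<omega> - (I \<omega> + s \<omega> * N \<omega>))\<^sup>2) \<partial>M) \<le> ennreal (3 * e + 3 * a + 3 * (K\<^sup>2 * b1))"
      using I2N by (simp only: add_diff_cancel_left)
  qed auto
  also have "\<dots> = ennreal (3 * e + 3 * (3 * e + 3 * a + 3 * (K\<^sup>2 * b1)))"
  proof -
    have n: "0 \<le> 3 * e + 3 * a + 3 * (K\<^sup>2 * b1)" using pos by simp
    have three: "(3 :: ennreal) = ennreal 3" by simp
    show ?thesis unfolding three using n pos(1)
      by (simp only: mult_zero_right add_0_right ennreal_mult[symmetric] ennreal_plus[symmetric] zero_le_numeral mult_nonneg_nonneg less_imp_le)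
  qed
  also have "3 * e + 3 * (3 * e + 3 * a + 3 * (K\<^sup>2 * b1)) = 12 * e + 9 * a + 9 * K\<^sup>2 * b1" by simp
  finally show ?thesis using IF unfolding s_def N_def by blast
qed

text \<open>The drift collected before T - \<epsilon> has a past version. The rest is at most
  \<open>K\<close> times an integral over a rectangle of area \<epsilon>; Cauchy-Schwarz with the
  kernel norm of order \<open>sqrt \<epsilon>\<close> bounds its square by order
  \<open>\<epsilon> * sqrt \<epsilon>\<close>, well within the freezing error.\<close>

lemma drift_split:
  assumes x: "x \<in> {0..1}" and \<epsilon>: "0 < \<epsilon>" "\<epsilon> < T" "\<epsilon> \<le> 1"
  shows "\<exists>D\<in>borel_measurable (noise_sigma M W (past \<epsilon>)).
    (\<integral>\<^sup>+\<omega>. ennreal ((drift T x \<omega> - D \<omega>)\<^sup>2) \<partial>M) \<le> ennreal (10 * K\<^sup>2 * \<epsilon> * sqrt \<epsilon>)"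
proof -
  define k where "k p = kap T x p * late \<epsilon> p" for p
  define k' where "k' p = kap T x p * (1 - late \<epsilon> p)" for p
  have [measurable]: "k \<in> borel_measurable borel" "k' \<in> borel_measurable borel" unfolding k_def k'_def by measurable
  have ik: "integrable lborel k" "integrable lborel k'"
    by (rule Bochner_Integration.integrable_bound[OF integrable_kap[OF T, of x]],
        measurable, rule AE_I2, simp add: k_def k'_def late_def indicator_def)+
  have bM: "(\<lambda>z. b (uu z)) \<in> borel_measurable (lborel \<Otimes>\<^sub>M M)" by measurable
  have ad: "(\<lambda>\<omega>. b (uu (p, \<omega>))) \<in> borel_measurable (noise_sigma M W (past \<epsilon>))" if "k' p \<noteq> 0" for p
  proof -
    obtain s y where p: "p = (s, y)" by (cases p)
    have s: "0 < s" "s \<le> T - \<epsilon>" "y \<in> {0..1}"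
      using that by (auto simp: k'_def kap_def late_def indicator_def p split: if_splits)
    have "u s y \<in> borel_measurable (noise_sigma M W ({0..s} \<times> {0..1}))"
      using adapted s unfolding adapted_random_field_def noise_filtration_eq by blast
    moreover have "{0..s} \<times> {0..1 :: real} \<subseteq> past \<epsilon>" using s by (auto simp: past_def)
    ultimately have "u s y \<in> borel_measurable (noise_sigma M W (past \<epsilon>))" by (rule noise_sigma_measurable_mono)
    from measurable_compose[OF this b_measurable] show ?thesis unfolding p uu_eq[OF s(1,3)] .
  qed
  define D where "D \<omega> = (LINT p|lborel. k' p * b (uu (p, \<omega>)))" for \<omega>
  obtain D' where D': "D' \<in> borel_measurable (noise_sigma M W (past \<epsilon>))" "AE \<omega> in M. D \<omega> = D' \<omega>"
    using adapted_integral_version[OF ik(2) bM b_le ad] unfolding D_def by blast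
  have le: "ennreal ((drift T x \<omega> - D \<omega>)\<^sup>2) \<le> ennreal (10 * K\<^sup>2 * \<epsilon> * sqrt \<epsilon>)" if \<omega>: "\<omega> \<in> space M" for \<omega>
  proof -
    have [measurable]: "(\<lambda>p. uu (p, \<omega>)) \<in> borel_measurable borel" using uu_slice[OF \<omega>] by simp
    have ib: "integrable lborel (\<lambda>p. k p * b (uu (p, \<omega>)))" "integrable lborel (\<lambda>p. k' p * b (uu (p, \<omega>)))"
      by (rule Bochner_Integration.integrable_bound[OF integrable_kap_b[OF T \<omega>, of x]],
        measurable, rule AE_I2, simp add: k_def k'_def late_def indicator_def)+
    have "drift T x \<omega> = (LINT p|lborel. k p * b (uu (p, \<omega>)) + k' p * b (uu (p, \<omega>)))"
      unfolding drift_def k_def k'_def by (rule Bochner_Integration.integral_cong[OF refl]) (simp add: algebra_simps)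
    also have "\<dots> = (LINT p|lborel. k p * b (uu (p, \<omega>))) + D \<omega>" unfolding D_def by (rule Bochner_Integration.integral_add[OF ib])
    finally have eq: "drift T x \<omega> - D \<omega> = (LINT p|lborel. k p * b (uu (p, \<omega>)))" by simp
    have "\<bar>drift T x \<omega> - D \<omega>\<bar> \<le> (LINT p|lborel. K * \<bar>k p\<bar>)"
      unfolding eq
    proof (rule abs_integral_le[OF ib(1)])
      show "integrable lborel (\<lambda>p. K * \<bar>k p\<bar>)" using ik(1) by simp
      fix p
      have "\<bar>b (uu (p, \<omega>))\<bar> * \<bar>k p\<bar> \<le> K * \<bar>k p\<bar>" by (rule mult_right_mono[OF b_le]) simp
      then show "\<bar>k p * b (uu (p, \<omega>))\<bar> \<le> K * \<bar>k p\<bar>" by (simp add: abs_mult mult.commute)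
    qed
    then have "\<bar>drift T x \<omega> - D \<omega>\<bar> \<le> K * (LINT p|lborel. \<bar>k p\<bar>)" by simp
    then have "\<bar>drift T x \<omega> - D \<omega>\<bar>\<^sup>2 \<le> (K * (LINT p|lborel. \<bar>k p\<bar>))\<^sup>2" by (rule power_mono) simp
    then have "ennreal ((drift T x \<omega> - D \<omega>)\<^sup>2) \<le> ennreal (K\<^sup>2) * ennreal ((LINT p|lborel. \<bar>k p\<bar>)\<^sup>2)"
      by (simp add: power_mult_distrib ennreal_mult[symmetric] ennreal_leI)
    also have "ennreal ((LINT p|lborel. \<bar>k p\<bar>)\<^sup>2) \<le> ennreal \<epsilon> * (\<integral>\<^sup>+p. ennreal ((k p)\<^sup>2) \<partial>lborel)"
    proof (rule integral_abs_sq_le[OF ik(1), of "{T - \<epsilon><..<T} \<times> {0..1}"])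
      show "k p = 0" if "p \<notin> {T - \<epsilon><..<T} \<times> {0..1}" for p
        using that by (auto simp: k_def kap_def late_def indicator_def)
      have "emeasure lborel ({T - \<epsilon><..<T} \<times> {0..1 :: real}) = ennreal \<epsilon>"
        by (subst lborel_prod[symmetric], subst lborel.emeasure_pair_measure_Times) (use \<epsilon> in auto)
      then show "emeasure lborel ({T - \<epsilon><..<T} \<times> {0..1 :: real}) \<le> ennreal \<epsilon>" by simp
    qed auto
    also have "(\<integral>\<^sup>+p. ennreal ((k p)\<^sup>2) \<partial>lborel) \<le> ennreal (10 * sqrt \<epsilon>)"
      unfolding k_def by (rule late_kap_norm(1)) (use \<epsilon> in auto)
    also have "ennreal (K\<^sup>2) * (ennreal \<epsilon> * ennreal (10 * sqrt \<epsilon>)) = ennreal (10 * K\<^sup>2 * \<epsilon> * sqrt \<epsilon>)"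
    proof -
      have "ennreal (K\<^sup>2) * (ennreal \<epsilon> * ennreal (10 * sqrt \<epsilon>)) = ennreal (K\<^sup>2 * (\<epsilon> * (10 * sqrt \<epsilon>)))"
        using \<epsilon> by (simp only: ennreal_mult[symmetric] zero_le_power2 less_imp_le real_sqrt_ge_zero zero_le_numeral mult_nonneg_nonneg)
      then show ?thesis by (simp only: mult_ac)
    qed
    finally show ?thesis by (simp add: mult_left_mono)
  qed
  have "(\<integral>\<^sup>+\<omega>. ennreal ((drift T x \<omega> - D' \<omega>)\<^sup>2) \<partial>M) \<le> (\<integral>\<^sup>+\<omega>. ennreal (10 * K\<^sup>2 * \<epsilon> * sqrt \<epsilon>) \<partial>M)"
  proof (rule nn_integral_mono_AE)
    show "AE \<omega> in M. ennreal ((drift T x \<omega> - D' \<omega>)\<^sup>2) \<le> ennreal (10 * K\<^sup>2 * \<epsilon> * sqrt \<epsilon>)"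
      using D'(2) AE_space
    proof eventually_elim
      case (elim \<omega>)
      show ?case using le[OF elim(2)] unfolding elim(1) .
    qed
  qed
  also have "\<dots> = ennreal (10 * K\<^sup>2 * \<epsilon> * sqrt \<epsilon>)" by (simp add: emeasure_space_1)
  finally show ?thesis using D'(1) by blast
qed

text \<open>A past variable plus a past factor times a Gaussian carried by the strip. An element
  \<open>c\<close> of \<open>J\<close> is at once index and coefficient, since the sets arise as
  level sets of a simple function; one constant \<open>C\<close> serves both the variance and the
  error.\<close>

definition gaussian_approximation ::
    "real \<Rightarrow> real \<Rightarrow> real \<Rightarrow> real \<Rightarrow> real set \<Rightarrow> (real \<Rightarrow> (real \<times> real) set) \<Rightarrow> real \<Rightarrow> ('a \<Rightarrow> real) \<Rightarrow> bool" where
  "gaussian_approximation \<rho> C \<epsilon> x J A v Y \<longleftrightarrow> finite J \<and> (\<forall>c\<in>J. A c \<in> noise_sets \<and> A c \<subseteq> strip \<rho> \<epsilon> x) \<and>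
    Y \<in> borel_measurable (noise_sigma M W (past \<epsilon>)) \<and>
    centered_gaussian M (\<lambda>\<omega>. \<Sum>c\<in>J. c * W (A c) \<omega>) v \<and> sqrt \<epsilon> / C \<le> v \<and>
    integrable M (\<lambda>\<omega>. u T x \<omega> - (Y \<omega> + frozen \<epsilon> x \<omega> * (\<Sum>c\<in>J. c * W (A c) \<omega>))) \<and>
    expectation (\<lambda>\<omega>. \<bar>u T x \<omega> - (Y \<omega> + frozen \<epsilon> x \<omega> * (\<Sum>c\<in>J. c * W (A c) \<omega>))\<bar>) \<le> C * (\<epsilon> powr (1/4) * (- ln \<epsilon>) powr (- (2 + h)))"

lemma coordinate_approximation:
  assumes x: "0 < x" "x < 1" and \<rho>: "\<rho> > 0"
  shows "\<exists>C>0. \<exists>\<epsilon>\<^sub>0>0. \<forall>\<epsilon>. 0 < \<epsilon> \<longrightarrow> \<epsilon> < \<epsilon>\<^sub>0 \<longrightarrow> (\<exists>J A v Y. gaussian_approximation \<rho> C \<epsilon> x J A v Y)"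
proof -
  have x': "x \<in> {0..1}" using x by simp
  obtain Z where Z: "walsh_version (SF T x) Z" and ae: "AE \<omega> in M. u T x \<omega> = init T x + Z \<omega> + drift T x \<omega>"
    using mild_decomposition[OF T x'] by blast
  obtain C1 where C1: "C1 \<ge> 0" "\<And>\<epsilon> x. 0 < \<epsilon> \<Longrightarrow> \<epsilon> < 1 \<Longrightarrow> \<epsilon> \<le> T/2 \<Longrightarrow> \<epsilon> powr (1/16) \<le> lg h \<epsilon> \<Longrightarrow> x \<in> {0..1} \<Longrightarrow>
    (\<integral>\<^sup>+z. ennreal ((SF T x z * late \<epsilon> (fst z) - frozen \<epsilon> x (snd z) * (kap T x (fst z) * late \<epsilon> (fst z)))\<^sup>2) \<partial>(lborel \<Otimes>\<^sub>M M))
      \<le> ennreal (C1 * (sqrt \<epsilon> * lg h \<epsilon>))"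
    using freezing_error by blast
  obtain C2 \<epsilon>2 where C2: "C2 > 0" "\<epsilon>2 > 0" and ker: "\<And>\<epsilon>. 0 < \<epsilon> \<Longrightarrow> \<epsilon> < \<epsilon>2 \<Longrightarrow> (\<exists>J A v g. finite J \<and> (\<forall>c\<in>J. A c \<in> noise_sets \<and> A c \<subseteq> strip \<rho> \<epsilon> x) \<and>
    (\<forall>p. (\<Sum>c\<in>J. c * indicator (A c) p) = g p) \<and> g \<in> borel_measurable borel \<and>
    centered_gaussian M (\<lambda>\<omega>. \<Sum>c\<in>J. c * W (A c) \<omega>) v \<and> sqrt \<epsilon> / C2 \<le> v \<and>
    (\<integral>\<^sup>+p. ennreal ((kap T x p * late \<epsilon> p - g p)\<^sup>2) \<partial>lborel) \<le> ennreal (C2 * (sqrt \<epsilon> * lg h \<epsilon>)))"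
    using noise_of_kernel[OF x \<rho>] by blast
  obtain \<epsilon>1 where \<epsilon>1: "\<epsilon>1 > 0" "\<And>\<epsilon>. 0 < \<epsilon> \<Longrightarrow> \<epsilon> < \<epsilon>1 \<Longrightarrow> \<epsilon> < 1 \<and> \<epsilon> powr (1/16) \<le> lg h \<epsilon>"
    using power_le_lg[OF h] by blast
  \<comment> \<open>Three times the constants of the pieces, with the simple integral taken at
    accuracy \<open>q\<close>: 3 * 12, 3 * 9, 3 * 9 and 3 * 10.\<close>
  define C3 where "C3 = 36 + 27 * C1 + 27 * K\<^sup>2 * C2 + 30 * K\<^sup>2"
  have C3: "C3 > 0" using C1 C2 by (auto simp: C3_def intro!: add_pos_nonneg)
  define C where "C = C2 + sqrt C3"
  have C: "C > 0" using C2 C3 by (simp add: C_def add_pos_pos)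
  define \<epsilon>\<^sub>0 where "\<epsilon>\<^sub>0 = min (min \<epsilon>1 \<epsilon>2) (T/2)"
  have \<epsilon>0: "\<epsilon>\<^sub>0 > 0" using \<epsilon>1 C2 T by (simp add: \<epsilon>\<^sub>0_def)
  have "\<exists>J A v Y. gaussian_approximation \<rho> C \<epsilon> x J A v Y"
    if \<epsilon>: "0 < \<epsilon>" "\<epsilon> < \<epsilon>\<^sub>0" for \<epsilon>
  proof -
    have \<epsilon>': "\<epsilon> < \<epsilon>1" "\<epsilon> < \<epsilon>2" "\<epsilon> \<le> T/2" "\<epsilon> < T" using \<epsilon> T by (auto simp: \<epsilon>\<^sub>0_def)
    have \<epsilon>lt: "\<epsilon> < 1" and plg: "\<epsilon> powr (1/16) \<le> lg h \<epsilon>" using \<epsilon>1(2)[OF \<epsilon>(1) \<epsilon>'(1)] by auto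
    have lgpos: "lg h \<epsilon> > 0" using plg \<epsilon>(1) by (smt (verit) powr_gt_zero)
    have "\<epsilon> = \<epsilon> powr 1" using \<epsilon> by simp
    also have "\<dots> \<le> \<epsilon> powr (1/16)" using \<epsilon> \<epsilon>lt by (intro powr_mono') auto
    finally have \<epsilon>lg: "\<epsilon> \<le> lg h \<epsilon>" using plg by linarith
    have sq: "sqrt \<epsilon> > 0" using \<epsilon> by simp
    define q where "q = sqrt \<epsilon> * lg h \<epsilon>"
    have q: "q > 0" using sq lgpos by (simp add: q_def)
    obtain J A v g where J: "finite J" and A: "\<forall>c\<in>J. A c \<in> noise_sets \<and> A c \<subseteq> strip \<rho> \<epsilon> x"
      and g: "\<forall>p. (\<Sum>c\<in>J. c * indicator (A c) p) = g p" and gm: "g \<in> borel_measurable borel"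
      and cg: "centered_gaussian M (\<lambda>\<omega>. \<Sum>c\<in>J. c * W (A c) \<omega>) v" and v: "sqrt \<epsilon> / C2 \<le> v"
      and kg: "(\<integral>\<^sup>+p. ennreal ((kap T x p * late \<epsilon> p - g p)\<^sup>2) \<partial>lborel) \<le> ennreal (C2 * (sqrt \<epsilon> * lg h \<epsilon>))"
      using ker[OF \<epsilon>(1) \<epsilon>'(2)] by (elim exE conjE) (rule that)
    define N where "N \<omega> = (\<Sum>c\<in>J. c * W (A c) \<omega>)" for \<omega>
    have NM [measurable]: "N \<in> borel_measurable M" using cg unfolding centered_gaussian_def N_def[abs_def] by blast
    have fr: "(\<integral>\<^sup>+z. ennreal ((SF T x z * late \<epsilon> (fst z) - frozen \<epsilon> x (snd z) * (kap T x (fst z) * late \<epsilon> (fst z)))\<^sup>2) \<partial>(lborel \<Otimes>\<^sub>M M)) \<le> ennreal (C1 * q)"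
      unfolding q_def by (rule C1(2)[OF \<epsilon>(1) \<epsilon>lt \<epsilon>'(3) plg x'])
    have kg': "(\<integral>\<^sup>+p. ennreal ((kap T x p * late \<epsilon> p - g p)\<^sup>2) \<partial>lborel) \<le> ennreal (C2 * q)" using kg unfolding q_def .
    have nn: "0 \<le> C1 * q" "0 \<le> C2 * q" using C1 C2 q by auto
    obtain I where IF: "I \<in> borel_measurable (noise_sigma M W (past \<epsilon>))"
      and I: "(\<integral>\<^sup>+\<omega>. ennreal ((Z \<omega> - (I \<omega> + frozen \<epsilon> x \<omega> * N \<omega>))\<^sup>2) \<partial>M) \<le> ennreal (12 * q + 9 * (C1 * q) + 9 * K\<^sup>2 * (C2 * q))"
      using stochastic_part_split[OF Z x' \<epsilon>(1) \<epsilon>'(4) J A[rule_format] g[rule_format] gm q nn fr kg'] unfolding N_def by blast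
    obtain D where DF: "D \<in> borel_measurable (noise_sigma M W (past \<epsilon>))"
      and D: "(\<integral>\<^sup>+\<omega>. ennreal ((drift T x \<omega> - D \<omega>)\<^sup>2) \<partial>M) \<le> ennreal (10 * K\<^sup>2 * \<epsilon> * sqrt \<epsilon>)"
      using drift_split[OF x' \<epsilon>(1) \<epsilon>'(4) less_imp_le[OF \<epsilon>lt]] by blast
    have [measurable]: "I \<in> borel_measurable M" "D \<in> borel_measurable M" using IF DF by (auto intro: noise_sigma_measurable_M)
    have [measurable]: "Z \<in> borel_measurable M" using Z by (simp add: walsh_version_def)
    have [measurable]: "u T x \<in> borel_measurable M" by (rule u_measurable[OF T x'])
    have [measurable]: "drift T x \<in> borel_measurable M" by (rule drift_measurable)
    have [measurable]: "frozen \<epsilon> x \<in> borel_measurable M" by (rule frozen_measurable(2)[OF \<epsilon>'(4) x'])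
    define Y where "Y \<omega> = init T x + I \<omega> + D \<omega>" for \<omega>
    have YF: "Y \<in> borel_measurable (noise_sigma M W (past \<epsilon>))" unfolding Y_def using IF DF by measurable
    have YM [measurable]: "Y \<in> borel_measurable M" by (rule noise_sigma_measurable_M[OF YF])
    define E where "E \<omega> = u T x \<omega> - (Y \<omega> + frozen \<epsilon> x \<omega> * N \<omega>)" for \<omega>
    have EM: "E \<in> borel_measurable M" unfolding E_def by measurable
    \<comment> \<open>The square root of \<open>C3 * q\<close>: the factor
      \<open>sqrt \<epsilon>\<close> of \<open>q\<close> becomes
      \<open>\<epsilon> powr (1/4)\<close>, and the squared modulus \<open>lg h \<epsilon>\<close>
      becomes a single one.\<close>
    define a where "a = sqrt C3 * (\<epsilon> powr (1/4) * (- ln \<epsilon>) powr (- (2 + h)))"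
    have lnp: "- ln \<epsilon> > 0" using \<epsilon> \<epsilon>lt by simp
    have a: "a > 0" unfolding a_def using C3 \<epsilon> lnp by simp
    have a2: "a\<^sup>2 = C3 * q"
    proof -
      have "(\<epsilon> powr (1/4))\<^sup>2 = sqrt \<epsilon>"
        using \<epsilon> by (simp add: power2_eq_square powr_add[symmetric] powr_half_sqrt)
      moreover have "((- ln \<epsilon>) powr (- (2 + h)))\<^sup>2 = lg h \<epsilon>"
        unfolding lg_def power2_eq_square powr_add[symmetric] by (rule arg_cong2[where f = "(powr)"]) auto
      moreover have "(sqrt C3)\<^sup>2 = C3" using C3 by simp
      ultimately show ?thesis unfolding a_def q_def by (simp only: power_mult_distrib)
    qed
    have "(\<integral>\<^sup>+\<omega>. ennreal ((E \<omega>)\<^sup>2) \<partial>M) \<le> 3 * (\<integral>\<^sup>+\<omega>. ennreal ((u T x \<omega> - (init T x + Z \<omega> + drift T x \<omega>))\<^sup>2) \<partial>M)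
      + 3 * (\<integral>\<^sup>+\<omega>. ennreal ((init T x + Z \<omega> + drift T x \<omega> - (init T x + (I \<omega> + frozen \<epsilon> x \<omega> * N \<omega>) + drift T x \<omega>))\<^sup>2) \<partial>M)
      + 3 * (\<integral>\<^sup>+\<omega>. ennreal ((init T x + (I \<omega> + frozen \<epsilon> x \<omega> * N \<omega>) + drift T x \<omega> - (Y \<omega> + frozen \<epsilon> x \<omega> * N \<omega>))\<^sup>2) \<partial>M)"
      unfolding E_def by (rule nn_integral_sq_triangle3) measurable
    also have "\<dots> \<le> 3 * 0 + 3 * ennreal (12 * q + 9 * (C1 * q) + 9 * K\<^sup>2 * (C2 * q)) + 3 * ennreal (10 * K\<^sup>2 * \<epsilon> * sqrt \<epsilon>)"
    proof (intro add_mono mult_left_mono)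
      have "(\<integral>\<^sup>+\<omega>. ennreal ((u T x \<omega> - (init T x + Z \<omega> + drift T x \<omega>))\<^sup>2) \<partial>M) = (\<integral>\<^sup>+\<omega>. 0 \<partial>M)"
        by (rule nn_integral_cong_AE) (use ae in eventually_elim, simp)
      then show "(\<integral>\<^sup>+\<omega>. ennreal ((u T x \<omega> - (init T x + Z \<omega> + drift T x \<omega>))\<^sup>2) \<partial>M) \<le> 0" by simp
      have 1: "init T x + Z \<omega> + drift T x \<omega> - (init T x + (I \<omega> + frozen \<epsilon> x \<omega> * N \<omega>) + drift T x \<omega>) = Z \<omega> - (I \<omega> + frozen \<epsilon> x \<omega> * N \<omega>)" for \<omega> by simp
      show "(\<integral>\<^sup>+\<omega>. ennreal ((init T x + Z \<omega> + drift T x \<omega> - (init T x + (I \<omega> + frozen \<epsilon> x \<omega> * N \<omega>) + drift T x \<omega>))\<^sup>2) \<partial>M)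
        \<le> ennreal (12 * q + 9 * (C1 * q) + 9 * K\<^sup>2 * (C2 * q))" unfolding 1 by (rule I)
      have 2: "init T x + (I \<omega> + frozen \<epsilon> x \<omega> * N \<omega>) + drift T x \<omega> - (Y \<omega> + frozen \<epsilon> x \<omega> * N \<omega>) = drift T x \<omega> - D \<omega>" for \<omega>
        by (simp add: Y_def)
      show "(\<integral>\<^sup>+\<omega>. ennreal ((init T x + (I \<omega> + frozen \<epsilon> x \<omega> * N \<omega>) + drift T x \<omega> - (Y \<omega> + frozen \<epsilon> x \<omega> * N \<omega>))\<^sup>2) \<partial>M)
        \<le> ennreal (10 * K\<^sup>2 * \<epsilon> * sqrt \<epsilon>)" unfolding 2 by (rule D)
    qed auto
    also have "\<dots> = ennreal (3 * (12 * q + 9 * (C1 * q) + 9 * K\<^sup>2 * (C2 * q)) + 3 * (10 * K\<^sup>2 * \<epsilon> * sqrt \<epsilon>))"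
    proof -
      have n: "0 \<le> 12 * q + 9 * (C1 * q) + 9 * K\<^sup>2 * (C2 * q)" "0 \<le> 10 * K\<^sup>2 * \<epsilon> * sqrt \<epsilon>" using q nn \<epsilon> by auto
      have three: "(3 :: ennreal) = ennreal 3" by simp
      show ?thesis unfolding three using n
        by (simp only: mult_zero_right add_0_left ennreal_mult[symmetric] ennreal_plus[symmetric] zero_le_numeral mult_nonneg_nonneg)
    qed
    also have "\<dots> \<le> ennreal (a\<^sup>2)"
    proof (rule ennreal_leI)
      have "\<epsilon> * sqrt \<epsilon> \<le> q" unfolding q_def using \<epsilon>lg sq by (subst mult.commute) (intro mult_left_mono, auto)
      then have "30 * K\<^sup>2 * (\<epsilon> * sqrt \<epsilon>) \<le> 30 * K\<^sup>2 * q" by (intro mult_left_mono) auto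
      then show "3 * (12 * q + 9 * (C1 * q) + 9 * K\<^sup>2 * (C2 * q)) + 3 * (10 * K\<^sup>2 * \<epsilon> * sqrt \<epsilon>) \<le> a\<^sup>2"
        unfolding a2 C3_def by (simp add: algebra_simps)
    qed
    finally have E2: "(\<integral>\<^sup>+\<omega>. ennreal ((E \<omega>)\<^sup>2) \<partial>M) \<le> ennreal (a\<^sup>2)" .
    note E1 = L1_le_L2[OF EM a E2]
    have aC: "a \<le> C * (\<epsilon> powr (1/4) * (- ln \<epsilon>) powr (- (2 + h)))"
      unfolding a_def C_def using C2 by (intro mult_right_mono) auto
    have vC: "sqrt \<epsilon> / C \<le> v"
    proof -
      have "sqrt \<epsilon> / C \<le> sqrt \<epsilon> / C2" using C2 C3 C sq by (intro divide_left_mono) (auto simp: C_def)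
      then show ?thesis using v by linarith
    qed
    show ?thesis
      using J A YF cg vC E1(1) order_trans[OF E1(2) aC] 
      unfolding E_def N_def gaussian_approximation_def by (intro exI[of _ J] exI[of _ A] exI[of _ v] exI[of _ Y] conjI)
  qed
  note main = this
  show ?thesis
    by (rule exI[of _ C], rule conjI[OF C], rule exI[of _ \<epsilon>\<^sub>0], rule conjI[OF \<epsilon>0], intro allI impI, rule main)
qed

end

section \<open>The joint law of all coordinates\<close>

lemma choice4:
  assumes "\<And>i. \<exists>a b c d. R i a b c d"
  shows "\<exists>a b c d. \<forall>i. R i (a i) (b i) (c i) (d i)"
  using assms by metis

lemma vec_lambda_eq_sum_axis: "(\<chi> i. a i) = (\<Sum>i\<in>UNIV. a i *\<^sub>R axis i 1)"
  for a :: "'d::finite \<Rightarrow> real"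
  by (simp add: vec_eq_iff axis_def if_distrib[where f = "\<lambda>z. _ * z"] sum.delta cong: if_cong)

context elliptic_spde_solution
begin

lemma strip_disjoint:
  assumes "\<bar>cs 1 x - cs 1 x'\<bar> \<ge> 2 * \<rho>"
  shows "strip \<rho> \<epsilon> x \<inter> strip \<rho> \<epsilon> x' = {}"
proof (rule equals0I)
  fix p assume "p \<in> strip \<rho> \<epsilon> x \<inter> strip \<rho> \<epsilon> x'"
  then have "\<bar>cs 1 (snd p) - cs 1 x\<bar> < \<rho>" "\<bar>cs 1 (snd p) - cs 1 x'\<bar> < \<rho>" by (auto simp: strip_def)
  then show False using assms by linarith
qed

text \<open>Coordinates are translated one at a time. For coordinate \<open>k\<close> everything
  else, including the Gaussians of the other coordinates, is measurable for the noise on the past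
  and on the other strips, a region disjoint from the strip of \<open>k\<close>. Joint independence
  of the Gaussians thus never has to be stated.\<close>

lemma translation_bound:
  fixes x :: "'d::finite \<Rightarrow> real" and f :: "real ^ 'd \<Rightarrow> real"
  assumes x: "\<And>i. x i \<in> {0..1}" and sep: "\<And>i j. i \<noteq> j \<Longrightarrow> \<bar>cs 1 (x i) - cs 1 (x j)\<bar> \<ge> 2 * \<rho>"
    and \<epsilon>: "0 < \<epsilon>" "\<epsilon> < T" and C: "\<And>i. C i > 0"
    and approx: "\<And>i. gaussian_approximation \<rho> (C i) \<epsilon> (x i) (J i) (A i) (v i) (Y i)"
    and f: "f \<in> borel_measurable borel" "\<And>z. \<bar>f z\<bar> \<le> 1"
  defines "V \<equiv> \<lambda>\<omega>. \<Sum>i\<in>UNIV. (Y i \<omega> + frozen \<epsilon> (x i) \<omega> * (\<Sum>c\<in>J i. c * W (A i c) \<omega>)) *\<^sub>R axis i (1 :: real)"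
  shows "\<bar>expectation (\<lambda>\<omega>. f (V \<omega> + w)) - expectation (\<lambda>\<omega>. f (V \<omega>))\<bar> \<le> (\<Sum>i\<in>UNIV. 2 * \<bar>w $ i\<bar> / (c\<^sub>0 * sqrt (v i)))"
proof -
  define N where "N i \<omega> = (\<Sum>c\<in>J i. c * W (A i c) \<omega>)" for i \<omega>
  have ap: "finite (J i)" "\<And>c. c \<in> J i \<Longrightarrow> A i c \<in> noise_sets \<and> A i c \<subseteq> strip \<rho> \<epsilon> (x i)"
    "Y i \<in> borel_measurable (noise_sigma M W (past \<epsilon>))"
    "centered_gaussian M (\<lambda>\<omega>. \<Sum>c\<in>J i. c * W (A i c) \<omega>) (v i)" "sqrt \<epsilon> / C i \<le> v i" for i
    using approx[of i] unfolding gaussian_approximation_def by blast+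
  have vpos: "v i > 0" for i
  proof -
    have "0 < sqrt \<epsilon> / C i" using \<epsilon> C[of i] by simp
    then show ?thesis using ap(5)[of i] by linarith
  qed
  define e where "e i = (axis i 1 :: real ^ 'd)" for i
  have "\<bar>expectation (\<lambda>\<omega>. f (V \<omega> + (\<Sum>i\<in>I. (w $ i) *\<^sub>R e i))) - expectation (\<lambda>\<omega>. f (V \<omega>))\<bar> \<le> (\<Sum>i\<in>I. 2 * \<bar>w $ i\<bar> / (c\<^sub>0 * sqrt (v i)))"
    if "finite I" for I
    using that
  proof (induction I)
    case (insert k I)
    define S where "S = past \<epsilon> \<union> (\<Union>i\<in>UNIV - {k}. strip \<rho> \<epsilon> (x i))"
    define a where "a = (\<Sum>i\<in>I. (w $ i) *\<^sub>R e i)"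
    \<comment> \<open>\<open>Y'\<close> also carries the translation \<open>a\<close> accumulated
      over the coordinates already treated.\<close>
    define Y' where "Y' \<omega> = (\<Sum>i\<in>UNIV - {k}. (Y i \<omega> + frozen \<epsilon> (x i) \<omega> * N i \<omega>) *\<^sub>R e i) + Y k \<omega> *\<^sub>R e k + a" for \<omega>
    have pastS: "past \<epsilon> \<subseteq> S" by (auto simp: S_def)
    have YS: "Y i \<in> borel_measurable (noise_sigma M W S)" for i by (rule noise_sigma_measurable_mono[OF ap(3) pastS])
    have frS: "frozen \<epsilon> (x i) \<in> borel_measurable (noise_sigma M W S)" for i
      by (rule noise_sigma_measurable_mono[OF _ pastS]) (use frozen_measurable(1)[OF \<epsilon>(2) x[of i]] in \<open>simp add: past_def\<close>)
    have NS: "N i \<in> borel_measurable (noise_sigma M W S)" if "i \<noteq> k" for i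
      unfolding N_def
    proof (intro borel_measurable_sum borel_measurable_times borel_measurable_const)
      fix c assume "c \<in> J i"
      then have "A i c \<in> noise_sets" "A i c \<subseteq> S" using ap(2)[of c i] that by (auto simp: S_def)
      then show "W (A i c) \<in> borel_measurable (noise_sigma M W S)" by (rule W_noise_sigma_measurable)
    qed
    have Y'S: "Y' \<in> borel_measurable (noise_sigma M W S)"
      unfolding Y'_def
      by (intro borel_measurable_add borel_measurable_sum borel_measurable_scaleR borel_measurable_const borel_measurable_times YS frS NS) auto
    have JR: "A k c \<in> noise_sets \<and> A k c \<inter> S = {}" if "c \<in> J k" for c
    proof -
      have "strip \<rho> \<epsilon> (x k) \<inter> past \<epsilon> = {}" by (auto simp: strip_def past_def)
      moreover have "strip \<rho> \<epsilon> (x k) \<inter> strip \<rho> \<epsilon> (x i) = {}" if "i \<noteq> k" for i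
        by (rule strip_disjoint) (rule sep, use that in auto)
      ultimately have "strip \<rho> \<epsilon> (x k) \<inter> S = {}" unfolding S_def by blast
      then show ?thesis using ap(2)[OF that] by blast
    qed
    have V: "V \<omega> + a = Y' \<omega> + (frozen \<epsilon> (x k) \<omega> * (\<Sum>c\<in>J k. c * W (A k c) \<omega>)) *\<^sub>R e k" for \<omega>
      unfolding V_def Y'_def N_def e_def
      by (subst sum.remove[of UNIV k]) (simp_all add: scaleR_left_distrib)
    have Va: "V \<omega> + (\<Sum>i\<in>insert k I. (w $ i) *\<^sub>R e i) = Y' \<omega> + (frozen \<epsilon> (x k) \<omega> * (\<Sum>c\<in>J k. c * W (A k c) \<omega>)) *\<^sub>R e k + (w $ k) *\<^sub>R e k" for \<omega>
    proof -
      have "V \<omega> + (\<Sum>i\<in>insert k I. (w $ i) *\<^sub>R e i) = (V \<omega> + a) + (w $ k) *\<^sub>R e k"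
        using insert.hyps by (simp add: a_def add_ac)
      then show ?thesis unfolding V .
    qed
    have "\<bar>expectation (\<lambda>\<omega>. f (V \<omega> + (\<Sum>i\<in>insert k I. (w $ i) *\<^sub>R e i))) - expectation (\<lambda>\<omega>. f (V \<omega> + a))\<bar> \<le> 2 * \<bar>w $ k\<bar> / (c\<^sub>0 * sqrt (v k))"
      unfolding V Va
      by (rule noise_translation_bound[where R = "A k" and c = "\<lambda>c. c", OF ap(1) JR ap(4) vpos c0 Y'S frS _ f])
         (simp_all add: frozen_def \<sigma>_ge)
    with insert.IH show ?case unfolding sum.insert[OF insert.hyps] a_def by linarith
  qed simp
  from this[of UNIV] show ?thesis
    unfolding e_def vec_lambda_eq_sum_axis[symmetric] by simp
qed

lemma absolutely_continuous_law:
  fixes x :: "'d::finite \<Rightarrow> real"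
  assumes x: "inj x" "\<And>i. 0 < x i \<and> x i < 1"
  shows "absolutely_continuous lborel (distr M borel (\<lambda>\<omega>. \<chi> i. u T (x i) \<omega>))"
proof -
  \<comment> \<open>Inserting 1 keeps the set of distances nonempty when there is a single
    point.\<close>
  define D where "D = insert 1 ((\<lambda>p. \<bar>cs 1 (x (fst p)) - cs 1 (x (snd p))\<bar>) ` {p. fst p \<noteq> snd p})"
  define \<rho> where "\<rho> = Min D / 2"
  have finD: "finite D" "D \<noteq> {}" by (auto simp: D_def)
  have range: "0 \<le> pi * x i" "pi * x i \<le> pi" for i
    using x(2)[of i] mult_left_le[of "x i" pi] by simp_all
  have Dpos: "d > 0" if d: "d \<in> D" for d
    using d[unfolded D_def]
  proof (rule insertE)
    assume "d \<in> (\<lambda>p. \<bar>cs 1 (x (fst p)) - cs 1 (x (snd p))\<bar>) ` {p. fst p \<noteq> snd p}"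
    then obtain p where p: "d = \<bar>cs 1 (x (fst p)) - cs 1 (x (snd p))\<bar>" "p \<in> {p. fst p \<noteq> snd p}"
      by (rule imageE)
    have "cos (pi * x (fst p)) \<noteq> cos (pi * x (snd p))"
    proof
      assume "cos (pi * x (fst p)) = cos (pi * x (snd p))"
      from cos_inj_pi[OF range range this] have "x (fst p) = x (snd p)" by simp
      from injD[OF x(1) this] p(2) show False by simp
    qed
    then show "d > 0" unfolding p(1) cs_def by simp
  qed simp
  have \<rho>: "\<rho> > 0" unfolding \<rho>_def using Dpos[OF Min_in[OF finD]] by simp
  have sep: "\<bar>cs 1 (x i) - cs 1 (x j)\<bar> \<ge> 2 * \<rho>" if "i \<noteq> j" for i j
  proof -
    have "(i, j) \<in> {p. fst p \<noteq> snd p}" using that by simp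
    from imageI[OF this, of "\<lambda>p. \<bar>cs 1 (x (fst p)) - cs 1 (x (snd p))\<bar>"]
    have "\<bar>cs 1 (x i) - cs 1 (x j)\<bar> \<in> D" unfolding D_def by (simp only: fst_conv snd_conv insertI2)
    then show ?thesis unfolding \<rho>_def using Min_le[OF finD(1)] by simp
  qed
  have "\<forall>i. \<exists>C. C > 0 \<and> (\<exists>\<epsilon>\<^sub>0>0. \<forall>\<epsilon>. 0 < \<epsilon> \<longrightarrow> \<epsilon> < \<epsilon>\<^sub>0 \<longrightarrow> (\<exists>J A v Y. gaussian_approximation \<rho> C \<epsilon> (x i) J A v Y))"
    by (intro allI) (rule coordinate_approximation[OF conjunct1[OF x(2)] conjunct2[OF x(2)] \<rho>])
  from choice[OF this] obtain C where C: "\<And>i. C i > 0"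
    and ex: "\<forall>i. \<exists>\<epsilon>\<^sub>0. \<epsilon>\<^sub>0 > 0 \<and> (\<forall>\<epsilon>. 0 < \<epsilon> \<longrightarrow> \<epsilon> < \<epsilon>\<^sub>0 \<longrightarrow> (\<exists>J A v Y. gaussian_approximation \<rho> (C i) \<epsilon> (x i) J A v Y))"
    by blast
  from choice[OF ex] obtain \<epsilon>\<^sub>0 where \<epsilon>\<^sub>0: "\<And>i. \<epsilon>\<^sub>0 i > 0"
    and ap: "\<And>i \<epsilon>. 0 < \<epsilon> \<Longrightarrow> \<epsilon> < \<epsilon>\<^sub>0 i \<Longrightarrow> \<exists>J A v Y. gaussian_approximation \<rho> (C i) \<epsilon> (x i) J A v Y"
    by blast
  \<comment> \<open>One constant for both demands: the first sum for the L1 error, the second for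
    the translation bound, with \<open>sqrt (C i)\<close> coming from the variance bound
    \<open>sqrt \<epsilon> / C i \<le> v i\<close>.\<close>
  define C' where "C' = (\<Sum>i\<in>UNIV. C i) + (\<Sum>i\<in>UNIV. 2 * sqrt (C i) / c\<^sub>0)"
  have C'1: "(\<Sum>i\<in>UNIV. C i) \<le> C'" and C'2: "(\<Sum>i\<in>UNIV. 2 * sqrt (C i) / c\<^sub>0) \<le> C'" and C'0: "0 \<le> C'"
    unfolding C'_def using C c0 by (auto intro!: sum_nonneg add_nonneg_nonneg simp: less_imp_le)
  \<comment> \<open>The bound by 1 gives \<open>\<delta> ^ 4 \<le> \<delta>\<close>, so that
    thresholds meant for \<epsilon> may be imposed on \<delta>.\<close>
  define \<delta>\<^sub>0 where "\<delta>\<^sub>0 = min (min 1 T) (Min (range \<epsilon>\<^sub>0))"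
  have \<delta>\<^sub>0: "\<delta>\<^sub>0 > 0" using \<epsilon>\<^sub>0 T by (simp add: \<delta>\<^sub>0_def)
  define U where "U \<omega> = (\<chi> i. u T (x i) \<omega>)" for \<omega>
  have x01: "x i \<in> {0..1}" for i using x(2)[of i] by simp
  have uM [measurable]: "u T (x i) \<in> borel_measurable M" for i by (rule u_measurable[OF T x01])
  have UM: "U \<in> borel_measurable M" unfolding U_def vec_lambda_eq_sum_axis by measurable
  have "absolutely_continuous lborel (distr M borel U)"
  proof (rule absolutely_continuous_by_scales[OF UM h C'0 \<delta>\<^sub>0])
    fix \<delta> :: real assume \<delta>: "0 < \<delta>" "\<delta> < \<delta>\<^sub>0"
    define \<epsilon> where "\<epsilon> = \<delta> ^ 4"
    have \<delta>1: "\<delta> < 1" "\<delta> < T" using \<delta> by (auto simp: \<delta>\<^sub>0_def)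
    have \<epsilon>pos: "0 < \<epsilon>" using \<delta> by (simp add: \<epsilon>_def)
    have "\<delta> ^ 4 \<le> \<delta> ^ 1" using \<delta> \<delta>1 by (intro power_decreasing) auto
    then have \<epsilon>\<delta>: "\<epsilon> \<le> \<delta>" by (simp add: \<epsilon>_def)
    then have \<epsilon>T: "\<epsilon> < T" using \<delta>1 by simp
    have \<epsilon>i: "\<epsilon> < \<epsilon>\<^sub>0 i" for i
    proof -
      have "\<delta> < Min (range \<epsilon>\<^sub>0)" using \<delta> by (simp add: \<delta>\<^sub>0_def)
      also have "\<dots> \<le> \<epsilon>\<^sub>0 i" by (rule Min_le) auto
      finally show ?thesis using \<epsilon>\<delta> by linarith
    qed
    obtain J A v Y where a: "\<And>i. gaussian_approximation \<rho> (C i) \<epsilon> (x i) (J i) (A i) (v i) (Y i)"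
      using choice4[of "\<lambda>i J A v Y. gaussian_approximation \<rho> (C i) \<epsilon> (x i) J A v Y", OF ap[OF \<epsilon>pos \<epsilon>i]] by blast
    define N where "N i \<omega> = (\<Sum>c\<in>J i. c * W (A i c) \<omega>)" for i \<omega>
    define V where "V \<omega> = (\<Sum>i\<in>UNIV. (Y i \<omega> + frozen \<epsilon> (x i) \<omega> * N i \<omega>) *\<^sub>R axis i (1 :: real))" for \<omega>
    have b: "Y i \<in> borel_measurable (noise_sigma M W (past \<epsilon>))" "centered_gaussian M (\<lambda>\<omega>. \<Sum>c\<in>J i. c * W (A i c) \<omega>) (v i)" "sqrt \<epsilon> / C i \<le> v i"
      "integrable M (\<lambda>\<omega>. u T (x i) \<omega> - (Y i \<omega> + frozen \<epsilon> (x i) \<omega> * N i \<omega>))"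
      "expectation (\<lambda>\<omega>. \<bar>u T (x i) \<omega> - (Y i \<omega> + frozen \<epsilon> (x i) \<omega> * N i \<omega>)\<bar>) \<le> C i * (\<epsilon> powr (1/4) * (- ln \<epsilon>) powr (- (2 + h)))" for i
      using a[of i] unfolding gaussian_approximation_def N_def by blast+
    have [measurable]: "Y i \<in> borel_measurable M" for i by (rule noise_sigma_measurable_M[OF b(1)])
    have [measurable]: "N i \<in> borel_measurable M" for i
      using b(2)[of i] unfolding centered_gaussian_def N_def[abs_def] by blast
    have [measurable]: "frozen \<epsilon> (x i) \<in> borel_measurable M" for i by (rule frozen_measurable(2)[OF \<epsilon>T x01])
    have VM [measurable]: "V \<in> borel_measurable M" unfolding V_def by measurable
    have le: "norm (U \<omega> - V \<omega>) \<le> (\<Sum>i\<in>UNIV. \<bar>u T (x i) \<omega> - (Y i \<omega> + frozen \<epsilon> (x i) \<omega> * N i \<omega>)\<bar>)" for \<omega>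
    proof -
      have "V \<omega> = (\<chi> i. Y i \<omega> + frozen \<epsilon> (x i) \<omega> * N i \<omega>)" unfolding V_def vec_lambda_eq_sum_axis ..
      then show ?thesis using norm_le_l1_cart[of "U \<omega> - V \<omega>"] by (simp add: U_def)
    qed
    have iS: "integrable M (\<lambda>\<omega>. \<Sum>i\<in>UNIV. \<bar>u T (x i) \<omega> - (Y i \<omega> + frozen \<epsilon> (x i) \<omega> * N i \<omega>)\<bar>)"
      by (intro Bochner_Integration.integrable_sum integrable_abs b)
    have iUV: "integrable M (\<lambda>\<omega>. norm (U \<omega> - V \<omega>))"
    proof (rule Bochner_Integration.integrable_bound[OF iS])
      show "(\<lambda>\<omega>. norm (U \<omega> - V \<omega>)) \<in> borel_measurable M" using UM by measurable
      show "AE \<omega> in M. norm (norm (U \<omega> - V \<omega>)) \<le> norm (\<Sum>i\<in>UNIV. \<bar>u T (x i) \<omega> - (Y i \<omega> + frozen \<epsilon> (x i) \<omega> * N i \<omega>)\<bar>)"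
        by (rule AE_I2) (use le in \<open>auto intro: order_trans\<close>)
    qed
    have e14: "\<epsilon> powr (1/4) = \<delta>"
    proof -
      have e: "\<epsilon> = \<delta> powr 4" using \<delta> by (simp add: \<epsilon>_def powr_numeral)
      show ?thesis unfolding e powr_powr using \<delta> by simp
    qed
    \<comment> \<open>The logarithm of \<epsilon> is four times that of \<delta>, and a larger base
      only decreases a negative power.\<close>
    have lnle: "(- ln \<epsilon>) powr (- (2 + h)) \<le> \<bar>ln \<delta>\<bar> powr (- (2 + h))"
    proof -
      have "- ln \<epsilon> = 4 * \<bar>ln \<delta>\<bar>" using \<delta> \<delta>1 by (simp add: \<epsilon>_def ln_realpow)
      moreover have "\<bar>ln \<delta>\<bar> > 0" using \<delta> \<delta>1 by simp
      ultimately show ?thesis using h by (intro powr_mono2') auto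
    qed
    have "expectation (\<lambda>\<omega>. norm (U \<omega> - V \<omega>)) \<le> expectation (\<lambda>\<omega>. \<Sum>i\<in>UNIV. \<bar>u T (x i) \<omega> - (Y i \<omega> + frozen \<epsilon> (x i) \<omega> * N i \<omega>)\<bar>)"
      by (rule integral_mono[OF iUV iS le])
    also have "\<dots> = (\<Sum>i\<in>UNIV. expectation (\<lambda>\<omega>. \<bar>u T (x i) \<omega> - (Y i \<omega> + frozen \<epsilon> (x i) \<omega> * N i \<omega>)\<bar>))"
      by (intro Bochner_Integration.integral_sum integrable_abs b)
    also have "\<dots> \<le> (\<Sum>i\<in>UNIV. C i * (\<delta> * \<bar>ln \<delta>\<bar> powr (- (2 + h))))"
    proof (rule sum_mono)
      fix i
      have "\<delta> * (- ln \<epsilon>) powr (- (2 + h)) \<le> \<delta> * \<bar>ln \<delta>\<bar> powr (- (2 + h))" using lnle \<delta> by (intro mult_left_mono) auto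
      then have "C i * (\<delta> * (- ln \<epsilon>) powr (- (2 + h))) \<le> C i * (\<delta> * \<bar>ln \<delta>\<bar> powr (- (2 + h)))" by (rule mult_left_mono) (simp add: less_imp_le[OF C])
      then show "expectation (\<lambda>\<omega>. \<bar>u T (x i) \<omega> - (Y i \<omega> + frozen \<epsilon> (x i) \<omega> * N i \<omega>)\<bar>) \<le> C i * (\<delta> * \<bar>ln \<delta>\<bar> powr (- (2 + h)))"
        using b(5)[of i] unfolding e14 by (rule order_trans[rotated])
    qed
    also have "\<dots> = (\<Sum>i\<in>UNIV. C i) * (\<delta> * \<bar>ln \<delta>\<bar> powr (- (2 + h)))" by (rule sum_distrib_right[symmetric])
    also have "\<dots> \<le> C' * (\<delta> * \<bar>ln \<delta>\<bar> powr (- (2 + h)))" using \<delta> by (intro mult_right_mono C'1) auto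
    finally have L1: "expectation (\<lambda>\<omega>. norm (U \<omega> - V \<omega>)) \<le> C' * \<delta> * \<bar>ln \<delta>\<bar> powr (- (2 + h))" by (simp only: mult.assoc)
    have tr: "\<bar>expectation (\<lambda>\<omega>. f (V \<omega> + w)) - expectation (\<lambda>\<omega>. f (V \<omega>))\<bar> \<le> C' / \<delta> * norm w"
      if f: "f \<in> borel_measurable borel" "\<And>z. \<bar>f z\<bar> \<le> 1" for f :: "real ^ 'd \<Rightarrow> real" and w
    proof -
      have "\<bar>expectation (\<lambda>\<omega>. f (V \<omega> + w)) - expectation (\<lambda>\<omega>. f (V \<omega>))\<bar> \<le> (\<Sum>i\<in>UNIV. 2 * \<bar>w $ i\<bar> / (c\<^sub>0 * sqrt (v i)))"
        unfolding V_def N_def by (rule translation_bound[OF x01 sep \<epsilon>pos \<epsilon>T C a f])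
      also have "\<dots> \<le> (\<Sum>i\<in>UNIV. 2 * sqrt (C i) / c\<^sub>0 * (norm w / \<delta>))"
      proof (rule sum_mono)
        fix i
        have "sqrt \<epsilon> = \<delta>\<^sup>2" using \<delta> by (simp add: \<epsilon>_def real_sqrt_unique power_mult[symmetric])
        then have "\<delta>\<^sup>2 / C i \<le> v i" using b(3)[of i] by simp
        then have "sqrt (\<delta>\<^sup>2 / C i) \<le> sqrt (v i)" by (rule real_sqrt_le_mono)
        then have sv: "\<delta> / sqrt (C i) \<le> sqrt (v i)" using \<delta> by (simp add: real_sqrt_divide)
        have p: "0 < \<delta> / sqrt (C i)" using \<delta> C[of i] by simp
        have vp: "0 < v i" using less_le_trans[OF p sv] by simp
        have "2 * \<bar>w $ i\<bar> / (c\<^sub>0 * sqrt (v i)) \<le> 2 * \<bar>w $ i\<bar> / (c\<^sub>0 * (\<delta> / sqrt (C i)))"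
          using sv p vp c0 by (intro divide_left_mono mult_left_mono mult_pos_pos) auto
        also have "\<dots> \<le> 2 * norm w / (c\<^sub>0 * (\<delta> / sqrt (C i)))"
          using less_imp_le[OF p] c0 component_le_norm_cart[of w i] by (intro divide_right_mono mult_left_mono mult_nonneg_nonneg) auto
        also have "\<dots> = 2 * sqrt (C i) / c\<^sub>0 * (norm w / \<delta>)" using \<delta> c0 C[of i] by (simp add: field_simps)
        finally show "2 * \<bar>w $ i\<bar> / (c\<^sub>0 * sqrt (v i)) \<le> 2 * sqrt (C i) / c\<^sub>0 * (norm w / \<delta>)" .
      qed
      also have "\<dots> = (\<Sum>i\<in>UNIV. 2 * sqrt (C i) / c\<^sub>0) * (norm w / \<delta>)" by (rule sum_distrib_right[symmetric])
      also have "\<dots> \<le> C' * (norm w / \<delta>)" using \<delta> by (intro mult_right_mono C'2) auto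
      finally show ?thesis by simp
    qed
    show "\<exists>V\<in>borel_measurable M. integrable M (\<lambda>\<omega>. norm (U \<omega> - V \<omega>)) \<and>
        expectation (\<lambda>\<omega>. norm (U \<omega> - V \<omega>)) \<le> C' * \<delta> * \<bar>ln \<delta>\<bar> powr (- (2 + h)) \<and>
        (\<forall>f\<in>borel_measurable borel. (\<forall>z. \<bar>f z\<bar> \<le> 1) \<longrightarrow>
          (\<forall>w. \<bar>expectation (\<lambda>\<omega>. f (V \<omega> + w)) - expectation (\<lambda>\<omega>. f (V \<omega>))\<bar> \<le> C' / \<delta> * norm w))"
    proof (intro bexI[of _ V] conjI ballI impI allI VM iUV L1)
      fix f :: "real ^ 'd \<Rightarrow> real" and w
      assume "f \<in> borel_measurable borel" "\<forall>z. \<bar>f z\<bar> \<le> 1"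
      then show "\<bar>expectation (\<lambda>\<omega>. f (V \<omega> + w)) - expectation (\<lambda>\<omega>. f (V \<omega>))\<bar> \<le> C' / \<delta> * norm w" by (intro tr) auto
    qed
  qed
  then show ?thesis unfolding U_def[abs_def] .
qed

end

theorem proposition3p3:
  fixes M :: "'a measure"
    and W :: "(real \<times> real) set \<Rightarrow> 'a \<Rightarrow> real"
    and G :: "real \<Rightarrow> real \<Rightarrow> real \<Rightarrow> real"
    and \<sigma> b u0 :: "real \<Rightarrow> real"
    and u :: "real \<Rightarrow> real \<Rightarrow> 'a \<Rightarrow> real"
    and c\<^sub>\<sigma> h T :: real
    and x :: "'d::{finite, linorder} \<Rightarrow> real"
  assumes "prob_space M"
    and "white_noise M W"
    and "neumann_heat_kernel G"
    and "\<sigma> \<in> borel_measurable borel" and "bounded (range \<sigma>)"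
    and "b \<in> borel_measurable borel" and "bounded (range b)"
    and "c\<^sub>\<sigma> > 0" and "\<And>z. \<sigma> z \<ge> c\<^sub>\<sigma>"
    and "h > 0"
    and "\<And>y z. 0 < \<bar>y - z\<bar> \<Longrightarrow> \<bar>y - z\<bar> < 1 \<Longrightarrow>
           \<bar>\<sigma> y - \<sigma> z\<bar> \<le> \<bar>ln \<bar>y - z\<bar>\<bar> powr (- (2 + h))"
    and "adapted_random_field M W u"
    and "mild_solution M W G \<sigma> b u0 u"
    and "strict_mono x" and "\<And>i. 0 < x i \<and> x i < 1"
    and "T > 0"
  shows "absolutely_continuous lborel
           (distr M (borel :: (real, 'd::{finite, linorder}) vec measure) (\<lambda>\<omega>. \<chi> i. u T (x i) \<omega>))"
proof -
  obtain K1 where K1: "\<And>v. \<bar>\<sigma> v\<bar> \<le> K1" using assms(5) unfolding bounded_iff by auto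
  obtain K2 where K2: "\<And>v. \<bar>b v\<bar> \<le> K2" using assms(7) unfolding bounded_iff by auto
  interpret prob_space M by (rule assms(1))
  interpret noise_space M W by unfold_locales (rule assms(2))
  interpret elliptic_spde_solution M W G \<sigma> b u0 u "max K1 K2" c\<^sub>\<sigma> h T
  proof (unfold_locales)
    show "\<bar>\<sigma> v\<bar> \<le> max K1 K2" for v using K1[of v] by simp
    show "\<bar>b v\<bar> \<le> max K1 K2" for v using K2[of v] by simp
  qed (fact assms)+
  show ?thesis
    by (rule absolutely_continuous_law[OF strict_mono_imp_inj_on[OF assms(14)] assms(15)])
qed

end
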